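(* Let $\overline{\Omega}_2$ be the monoidal category of pruned trees of height 2 and let $\mathcal{Q}$ be the collection of morphisms $(f_2,f_1)$ of $\overline{\Omega}_2$ with $f_2$ bijective. The category of fractions $\overline{\Omega}_2[\mathcal{Q}^{-1}]$, with the monoidal structure induced from $\overline{\Omega}_2$, is the free braided monoidal category generated by a commutative monoid, the generating commutative monoid being the image of $S([1])=([1]\to[1])$. That is, $\overline{\Omega}_2[\mathcal{Q}^{-1}]$ carries a braiding for which $S([1])$ is a commutative monoid, and for every braided (strict) monoidal category $\mathcal{C}$, evaluation $F\mapsto F(S([1]))$ is an equivalence from the category of braided monoidal functors $\overline{\Omega}_2[\mathcal{Q}^{-1}]\to\mathcal{C}$ (with monoidal natural transformations) to the category of commutative monoids in $\mathcal{C}$.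
   Context: $[n]=\{1,\dots,n\}$ with its usual order. The category $\overline{\Omega}_2$ of pruned trees of height 2: objects are surjections (not necessarily order-preserving) $t:T_2\to T_1$ of finite (totally) ordered sets; a morphism from $s:S_2\to S_1$ to $t:T_2\to T_1$ is a pair of maps $f_2:S_2\to T_2$, $f_1:S_1\to T_1$ with $t f_2=f_1 s$, such that $f_1$ is order-preserving and $f_2$ is order-preserving on fibres, i.e. for every $x\in S_1$ the restriction $f_2:s^{-1}(x)\to t^{-1}(f_1(x))$ is order-preserving. The monoidal structure is the ordered sum (ordered disjoint union) $\otimes$, with unit object $\emptyset\to\emptyset$. The elements of $T_2$ are the tips (leaves) of the tree, so $\mathcal{Q}$ consists of the morphisms bijective on tips. $\mathcal{Q}$ is closed under $\otimes$, so the localisation inherits a monoidal structure. $S([1])$ is the object $[1]\to[1]$; its monoid structure has multiplication $S([1])\otimes S([1])\to S([1])$ and unit $(\emptyset\to\emptyset)\to S([1])$ given by the unique morphisms. Monoidal functors are strong. A monoid $(A,\mu,\iota)$ in a braided monoidal category with braiding $c$ is commutative if $\mu\, c_{A,A}=\mu$; morphisms of commutative monoids are monoid homomorphisms. *)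

theory Defs
  imports "HOL-Library.FuncSet" "HOL-Library.Nat_Bijection"
begin

section \<open>Categories, monoidal categories, braided monoidal categories\<close>

record ('o, 'a) cat =
  Obj :: "'o set"
  Arr :: "'a set"
  Dom :: "'a \<Rightarrow> 'o"
  Cod :: "'a \<Rightarrow> 'o"
  Ident :: "'o \<Rightarrow> 'a"
  Comp :: "'a \<Rightarrow> 'a \<Rightarrow> 'a"  (infixr "\<cdot>\<index>" 55)

text \<open>Composition is written in applicative order: \<open>g \<cdot> f\<close> is \<open>f\<close> followed by \<open>g\<close>.\<close>

record ('o, 'a) moncat = "('o, 'a) cat" +
  TenO :: "'o \<Rightarrow> 'o \<Rightarrow> 'o"  (infixr "\<odot>\<index>" 65)
  TenA :: "'a \<Rightarrow> 'a \<Rightarrow> 'a"  (infixr "\<otimes>\<index>" 65)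
  Munit :: "'o"  ("\<one>\<index>")
  Assoc :: "'o \<Rightarrow> 'o \<Rightarrow> 'o \<Rightarrow> 'a"
  Lunit :: "'o \<Rightarrow> 'a"
  Runit :: "'o \<Rightarrow> 'a"

record ('o, 'a) brcat = "('o, 'a) moncat" +
  Braid :: "'o \<Rightarrow> 'o \<Rightarrow> 'a"

definition Hom :: "('o, 'a, 'z) cat_scheme \<Rightarrow> 'o \<Rightarrow> 'o \<Rightarrow> 'a set" where
  "Hom C a b = {f \<in> Arr C. Dom C f = a \<and> Cod C f = b}"

definition inverse_arrows :: "('o, 'a, 'z) cat_scheme \<Rightarrow> 'a \<Rightarrow> 'a \<Rightarrow> bool" where
  "inverse_arrows C f g \<longleftrightarrow>
     f \<in> Arr C \<and> g \<in> Hom C (Cod C f) (Dom C f) \<and>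
     g \<cdot>\<^bsub>C\<^esub> f = Ident C (Dom C f) \<and> f \<cdot>\<^bsub>C\<^esub> g = Ident C (Cod C f)"

definition isomorphism :: "('o, 'a, 'z) cat_scheme \<Rightarrow> 'a \<Rightarrow> bool" where
  "isomorphism C f \<longleftrightarrow> (\<exists>g. inverse_arrows C f g)"

definition inv_arr :: "('o, 'a, 'z) cat_scheme \<Rightarrow> 'a \<Rightarrow> 'a" where
  "inv_arr C f = (THE g. inverse_arrows C f g)"

locale category =
  fixes C :: "('o, 'a, 'z) cat_scheme" (structure)
  assumes Dom_in: "f \<in> Arr C \<Longrightarrow> Dom C f \<in> Obj C"
    and Cod_in: "f \<in> Arr C \<Longrightarrow> Cod C f \<in> Obj C"
    and Ident_in: "a \<in> Obj C \<Longrightarrow> Ident C a \<in> Hom C a a"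
    and Comp_in: "\<lbrakk>f \<in> Hom C a b; g \<in> Hom C b c\<rbrakk> \<Longrightarrow> g \<cdot> f \<in> Hom C a c"
    and Ident_left: "f \<in> Hom C a b \<Longrightarrow> Ident C b \<cdot> f = f"
    and Ident_right: "f \<in> Hom C a b \<Longrightarrow> f \<cdot> Ident C a = f"
    and Comp_assoc: "\<lbrakk>f \<in> Hom C a b; g \<in> Hom C b c; h \<in> Hom C c d\<rbrakk>
          \<Longrightarrow> (h \<cdot> g) \<cdot> f = h \<cdot> (g \<cdot> f)"

locale monoidal_category = category C
  for C :: "('o, 'a, 'z) moncat_scheme" (structure) +
  assumes Munit_in: "\<one> \<in> Obj C"
    and TenO_in: "\<lbrakk>a \<in> Obj C; b \<in> Obj C\<rbrakk> \<Longrightarrow> a \<odot> b \<in> Obj C"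
    and TenA_in: "\<lbrakk>f \<in> Hom C a b; g \<in> Hom C c d\<rbrakk> \<Longrightarrow> f \<otimes> g \<in> Hom C (a \<odot> c) (b \<odot> d)"
    and TenA_Ident: "\<lbrakk>a \<in> Obj C; b \<in> Obj C\<rbrakk>
          \<Longrightarrow> Ident C a \<otimes> Ident C b = Ident C (a \<odot> b)"
    and TenA_Comp:
      "\<lbrakk>f \<in> Hom C a b; f' \<in> Hom C b c; g \<in> Hom C a' b'; g' \<in> Hom C b' c'\<rbrakk>
          \<Longrightarrow> (f' \<cdot> f) \<otimes> (g' \<cdot> g) = (f' \<otimes> g') \<cdot> (f \<otimes> g)"
    and Assoc_in: "\<lbrakk>a \<in> Obj C; b \<in> Obj C; c \<in> Obj C\<rbrakk>
          \<Longrightarrow> Assoc C a b c \<in> Hom C ((a \<odot> b) \<odot> c) (a \<odot> (b \<odot> c))"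
    and Assoc_iso: "\<lbrakk>a \<in> Obj C; b \<in> Obj C; c \<in> Obj C\<rbrakk> \<Longrightarrow> isomorphism C (Assoc C a b c)"
    and Assoc_nat: "\<lbrakk>f \<in> Hom C a a'; g \<in> Hom C b b'; h \<in> Hom C c c'\<rbrakk>
          \<Longrightarrow> Assoc C a' b' c' \<cdot> ((f \<otimes> g) \<otimes> h) = (f \<otimes> (g \<otimes> h)) \<cdot> Assoc C a b c"
    and Lunit_in: "a \<in> Obj C \<Longrightarrow> Lunit C a \<in> Hom C (\<one> \<odot> a) a"
    and Lunit_iso: "a \<in> Obj C \<Longrightarrow> isomorphism C (Lunit C a)"
    and Lunit_nat: "f \<in> Hom C a b \<Longrightarrow> Lunit C b \<cdot> (Ident C \<one> \<otimes> f) = f \<cdot> Lunit C a"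
    and Runit_in: "a \<in> Obj C \<Longrightarrow> Runit C a \<in> Hom C (a \<odot> \<one>) a"
    and Runit_iso: "a \<in> Obj C \<Longrightarrow> isomorphism C (Runit C a)"
    and Runit_nat: "f \<in> Hom C a b \<Longrightarrow> Runit C b \<cdot> (f \<otimes> Ident C \<one>) = f \<cdot> Runit C a"
    and pentagon: "\<lbrakk>a \<in> Obj C; b \<in> Obj C; c \<in> Obj C; d \<in> Obj C\<rbrakk>
          \<Longrightarrow> Assoc C a b (c \<odot> d) \<cdot> Assoc C (a \<odot> b) c d
            = (Ident C a \<otimes> Assoc C b c d) \<cdot> Assoc C a (b \<odot> c) d
                \<cdot> (Assoc C a b c \<otimes> Ident C d)"
    and triangle: "\<lbrakk>a \<in> Obj C; b \<in> Obj C\<rbrakk>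
          \<Longrightarrow> (Ident C a \<otimes> Lunit C b) \<cdot> Assoc C a \<one> b = Runit C a \<otimes> Ident C b"

locale strict_monoidal_category = monoidal_category C
  for C :: "('o, 'a, 'z) moncat_scheme" (structure) +
  assumes strict_assoc: "\<lbrakk>a \<in> Obj C; b \<in> Obj C; c \<in> Obj C\<rbrakk>
          \<Longrightarrow> (a \<odot> b) \<odot> c = a \<odot> (b \<odot> c)"
    and strict_Assoc: "\<lbrakk>a \<in> Obj C; b \<in> Obj C; c \<in> Obj C\<rbrakk>
          \<Longrightarrow> Assoc C a b c = Ident C (a \<odot> (b \<odot> c))"
    and strict_lunit: "a \<in> Obj C \<Longrightarrow> \<one> \<odot> a = a"
    and strict_Lunit: "a \<in> Obj C \<Longrightarrow> Lunit C a = Ident C a"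
    and strict_runit: "a \<in> Obj C \<Longrightarrow> a \<odot> \<one> = a"
    and strict_Runit: "a \<in> Obj C \<Longrightarrow> Runit C a = Ident C a"

locale braided_monoidal_category = monoidal_category C
  for C :: "('o, 'a, 'z) brcat_scheme" (structure) +
  assumes Braid_in: "\<lbrakk>a \<in> Obj C; b \<in> Obj C\<rbrakk> \<Longrightarrow> Braid C a b \<in> Hom C (a \<odot> b) (b \<odot> a)"
    and Braid_iso: "\<lbrakk>a \<in> Obj C; b \<in> Obj C\<rbrakk> \<Longrightarrow> isomorphism C (Braid C a b)"
    and Braid_nat: "\<lbrakk>f \<in> Hom C a a'; g \<in> Hom C b b'\<rbrakk>
          \<Longrightarrow> Braid C a' b' \<cdot> (f \<otimes> g) = (g \<otimes> f) \<cdot> Braid C a b"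
    and hexagon_left: "\<lbrakk>a \<in> Obj C; b \<in> Obj C; c \<in> Obj C\<rbrakk>
          \<Longrightarrow> Assoc C b c a \<cdot> Braid C a (b \<odot> c) \<cdot> Assoc C a b c
            = (Ident C b \<otimes> Braid C a c) \<cdot> Assoc C b a c \<cdot> (Braid C a b \<otimes> Ident C c)"
    and hexagon_right: "\<lbrakk>a \<in> Obj C; b \<in> Obj C; c \<in> Obj C\<rbrakk>
          \<Longrightarrow> inv_arr C (Assoc C c a b) \<cdot> Braid C (a \<odot> b) c \<cdot> inv_arr C (Assoc C a b c)
            = (Braid C a c \<otimes> Ident C b) \<cdot> inv_arr C (Assoc C a c b)
                \<cdot> (Ident C a \<otimes> Braid C b c)"


section \<open>Functors and equivalences\<close>

record ('o, 'a, 'p, 'b) func =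
  Omap :: "'o \<Rightarrow> 'p"
  Amap :: "'a \<Rightarrow> 'b"

definition is_functor ::
  "('o, 'a, 'y) cat_scheme \<Rightarrow> ('p, 'b, 'z) cat_scheme \<Rightarrow> ('o, 'a, 'p, 'b, 'x) func_scheme \<Rightarrow> bool"
where
  "is_functor C D F \<longleftrightarrow> category C \<and> category D \<and>
     (\<forall>a\<in>Obj C. Omap F a \<in> Obj D) \<and>
     (\<forall>a b. \<forall>f\<in>Hom C a b. Amap F f \<in> Hom D (Omap F a) (Omap F b)) \<and>
     (\<forall>a\<in>Obj C. Amap F (Ident C a) = Ident D (Omap F a)) \<and>
     (\<forall>a b c. \<forall>f\<in>Hom C a b. \<forall>g\<in>Hom C b c.
        Amap F (g \<cdot>\<^bsub>C\<^esub> f) = Amap F g \<cdot>\<^bsub>D\<^esub> Amap F f)"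

definition id_func :: "('o, 'a, 'o, 'a) func" where
  "id_func = \<lparr>Omap = id, Amap = id\<rparr>"

definition comp_func ::
  "('p, 'b, 'q, 'c) func \<Rightarrow> ('o, 'a, 'p, 'b) func \<Rightarrow> ('o, 'a, 'q, 'c) func" where
  "comp_func G F = \<lparr>Omap = Omap G \<circ> Omap F, Amap = Amap G \<circ> Amap F\<rparr>"

definition is_natural ::
  "('o, 'a, 'y) cat_scheme \<Rightarrow> ('p, 'b, 'z) cat_scheme \<Rightarrow>
   ('o, 'a, 'p, 'b, 'x) func_scheme \<Rightarrow> ('o, 'a, 'p, 'b, 'x) func_scheme \<Rightarrow> ('o \<Rightarrow> 'b) \<Rightarrow> bool"
where
  "is_natural C D F G \<theta> \<longleftrightarrow>
     (\<forall>a\<in>Obj C. \<theta> a \<in> Hom D (Omap F a) (Omap G a)) \<and>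
     (\<forall>a b. \<forall>f\<in>Hom C a b. \<theta> b \<cdot>\<^bsub>D\<^esub> Amap F f = Amap G f \<cdot>\<^bsub>D\<^esub> \<theta> a)"

definition is_natural_iso ::
  "('o, 'a, 'y) cat_scheme \<Rightarrow> ('p, 'b, 'z) cat_scheme \<Rightarrow>
   ('o, 'a, 'p, 'b, 'x) func_scheme \<Rightarrow> ('o, 'a, 'p, 'b, 'x) func_scheme \<Rightarrow> ('o \<Rightarrow> 'b) \<Rightarrow> bool"
where
  "is_natural_iso C D F G \<theta> \<longleftrightarrow>
     is_natural C D F G \<theta> \<and> (\<forall>a\<in>Obj C. isomorphism D (\<theta> a))"

definition is_equivalence ::
  "('o, 'a, 'y) cat_scheme \<Rightarrow> ('p, 'b, 'z) cat_scheme \<Rightarrow> ('o, 'a, 'p, 'b) func \<Rightarrow> bool" where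
  "is_equivalence C D F \<longleftrightarrow> is_functor C D F \<and>
     (\<exists>G. is_functor D C G \<and>
        (\<exists>\<eta>. is_natural_iso C C id_func (comp_func G F) \<eta>) \<and>
        (\<exists>\<epsilon>. is_natural_iso D D (comp_func F G) id_func \<epsilon>))"


section \<open>The category of braided monoidal functors\<close>

text \<open>Arrows of the concrete categories below carry their source and target explicitly.\<close>

record ('x, 'm) arrow =
  Source :: 'x
  Target :: 'x
  Body :: 'm

record ('o, 'a, 'p, 'b) mfunc = "('o, 'a, 'p, 'b) func" +
  Mmap :: "'o \<times> 'o \<Rightarrow> 'b"
  Umap :: "'b"

text \<open>
  The components \<open>F a \<odot> F b \<rightarrow> F (a \<odot> b)\<close> and \<open>\<one> \<rightarrow> F \<one>\<close> are \<open>Mmap F (a, b)\<close> and \<open>Umap F\<close>. All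
  data of a functor are required to be \<^const>\<open>extensional\<close>, and so are the components of a
  transformation: otherwise their values off the carriers would give rise to different arrows
  for one and the same natural transformation.
\<close>

definition is_braided_functor ::
  "('o, 'a, 'y) brcat_scheme \<Rightarrow> ('p, 'b, 'z) brcat_scheme \<Rightarrow> ('o, 'a, 'p, 'b) mfunc \<Rightarrow> bool"
where
  "is_braided_functor M N F \<longleftrightarrow>
     is_functor M N F \<and>
     Omap F \<in> extensional (Obj M) \<and>
     Amap F \<in> extensional (Arr M) \<and>
     Mmap F \<in> extensional (Obj M \<times> Obj M) \<and>
     (\<forall>a\<in>Obj M. \<forall>b\<in>Obj M.
        Mmap F (a, b) \<in> Hom N (Omap F a \<odot>\<^bsub>N\<^esub> Omap F b) (Omap F (a \<odot>\<^bsub>M\<^esub> b)) \<and>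
        isomorphism N (Mmap F (a, b))) \<and>
     Umap F \<in> Hom N \<one>\<^bsub>N\<^esub> (Omap F \<one>\<^bsub>M\<^esub>) \<and> isomorphism N (Umap F) \<and>
     (\<forall>a b c d. \<forall>f\<in>Hom M a b. \<forall>g\<in>Hom M c d.
        Mmap F (b, d) \<cdot>\<^bsub>N\<^esub> (Amap F f \<otimes>\<^bsub>N\<^esub> Amap F g)
          = Amap F (f \<otimes>\<^bsub>M\<^esub> g) \<cdot>\<^bsub>N\<^esub> Mmap F (a, c)) \<and>
     (\<forall>a\<in>Obj M. \<forall>b\<in>Obj M. \<forall>c\<in>Obj M.
        Amap F (Assoc M a b c) \<cdot>\<^bsub>N\<^esub> Mmap F (a \<odot>\<^bsub>M\<^esub> b, c)
            \<cdot>\<^bsub>N\<^esub> (Mmap F (a, b) \<otimes>\<^bsub>N\<^esub> Ident N (Omap F c))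
          = Mmap F (a, b \<odot>\<^bsub>M\<^esub> c) \<cdot>\<^bsub>N\<^esub> (Ident N (Omap F a) \<otimes>\<^bsub>N\<^esub> Mmap F (b, c))
            \<cdot>\<^bsub>N\<^esub> Assoc N (Omap F a) (Omap F b) (Omap F c)) \<and>
     (\<forall>a\<in>Obj M.
        Amap F (Lunit M a) \<cdot>\<^bsub>N\<^esub> Mmap F (\<one>\<^bsub>M\<^esub>, a)
            \<cdot>\<^bsub>N\<^esub> (Umap F \<otimes>\<^bsub>N\<^esub> Ident N (Omap F a))
          = Lunit N (Omap F a)) \<and>
     (\<forall>a\<in>Obj M.
        Amap F (Runit M a) \<cdot>\<^bsub>N\<^esub> Mmap F (a, \<one>\<^bsub>M\<^esub>)
            \<cdot>\<^bsub>N\<^esub> (Ident N (Omap F a) \<otimes>\<^bsub>N\<^esub> Umap F)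
          = Runit N (Omap F a)) \<and>
     (\<forall>a\<in>Obj M. \<forall>b\<in>Obj M.
        Amap F (Braid M a b) \<cdot>\<^bsub>N\<^esub> Mmap F (a, b)
          = Mmap F (b, a) \<cdot>\<^bsub>N\<^esub> Braid N (Omap F a) (Omap F b))"

definition is_monoidal_natural ::
  "('o, 'a, 'y) moncat_scheme \<Rightarrow> ('p, 'b, 'z) moncat_scheme \<Rightarrow>
   ('o, 'a, 'p, 'b) mfunc \<Rightarrow> ('o, 'a, 'p, 'b) mfunc \<Rightarrow> ('o \<Rightarrow> 'b) \<Rightarrow> bool"
where
  "is_monoidal_natural M N F G \<theta> \<longleftrightarrow>
     is_natural M N F G \<theta> \<and>
     \<theta> \<in> extensional (Obj M) \<and>
     (\<forall>a\<in>Obj M. \<forall>b\<in>Obj M.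
        \<theta> (a \<odot>\<^bsub>M\<^esub> b) \<cdot>\<^bsub>N\<^esub> Mmap F (a, b) = Mmap G (a, b) \<cdot>\<^bsub>N\<^esub> (\<theta> a \<otimes>\<^bsub>N\<^esub> \<theta> b)) \<and>
     \<theta> \<one>\<^bsub>M\<^esub> \<cdot>\<^bsub>N\<^esub> Umap F = Umap G"

definition braided_functor_category ::
  "('o, 'a, 'y) brcat_scheme \<Rightarrow> ('p, 'b, 'z) brcat_scheme \<Rightarrow>
   (('o, 'a, 'p, 'b) mfunc, (('o, 'a, 'p, 'b) mfunc, 'o \<Rightarrow> 'b) arrow) cat"
where
  "braided_functor_category M N =
     \<lparr>Obj = {F. is_braided_functor M N F},
      Arr = {\<theta>. is_braided_functor M N (Source \<theta>) \<and> is_braided_functor M N (Target \<theta>) \<and>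
                 is_monoidal_natural M N (Source \<theta>) (Target \<theta>) (Body \<theta>)},
      Dom = Source,
      Cod = Target,
      Ident = (\<lambda>F. \<lparr>Source = F, Target = F, Body = (\<lambda>a\<in>Obj M. Ident N (Omap F a))\<rparr>),
      Comp = (\<lambda>\<psi> \<theta>. \<lparr>Source = Source \<theta>, Target = Target \<psi>,
                      Body = (\<lambda>a\<in>Obj M. Body \<psi> a \<cdot>\<^bsub>N\<^esub> Body \<theta> a)\<rparr>)\<rparr>"


section \<open>The category of commutative monoids\<close>

record ('o, 'a) monoid_data =
  Carr :: 'o
  Mult :: 'a
  Unt :: 'a

definition is_commutative_monoid ::
  "('o, 'a, 'z) brcat_scheme \<Rightarrow> ('o, 'a) monoid_data \<Rightarrow> bool" where
  "is_commutative_monoid C A \<longleftrightarrow>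
     Carr A \<in> Obj C \<and>
     Mult A \<in> Hom C (Carr A \<odot>\<^bsub>C\<^esub> Carr A) (Carr A) \<and>
     Unt A \<in> Hom C \<one>\<^bsub>C\<^esub> (Carr A) \<and>
     Mult A \<cdot>\<^bsub>C\<^esub> (Mult A \<otimes>\<^bsub>C\<^esub> Ident C (Carr A))
       = Mult A \<cdot>\<^bsub>C\<^esub> (Ident C (Carr A) \<otimes>\<^bsub>C\<^esub> Mult A)
           \<cdot>\<^bsub>C\<^esub> Assoc C (Carr A) (Carr A) (Carr A) \<and>
     Mult A \<cdot>\<^bsub>C\<^esub> (Unt A \<otimes>\<^bsub>C\<^esub> Ident C (Carr A)) = Lunit C (Carr A) \<and>
     Mult A \<cdot>\<^bsub>C\<^esub> (Ident C (Carr A) \<otimes>\<^bsub>C\<^esub> Unt A) = Runit C (Carr A) \<and>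
     Mult A \<cdot>\<^bsub>C\<^esub> Braid C (Carr A) (Carr A) = Mult A"

definition is_monoid_hom ::
  "('o, 'a, 'z) moncat_scheme \<Rightarrow> ('o, 'a) monoid_data \<Rightarrow> ('o, 'a) monoid_data \<Rightarrow> 'a \<Rightarrow> bool" where
  "is_monoid_hom C A B h \<longleftrightarrow>
     h \<in> Hom C (Carr A) (Carr B) \<and>
     h \<cdot>\<^bsub>C\<^esub> Mult A = Mult B \<cdot>\<^bsub>C\<^esub> (h \<otimes>\<^bsub>C\<^esub> h) \<and>
     h \<cdot>\<^bsub>C\<^esub> Unt A = Unt B"

definition commutative_monoid_category ::
  "('o, 'a, 'z) brcat_scheme \<Rightarrow>
   (('o, 'a) monoid_data, (('o, 'a) monoid_data, 'a) arrow) cat"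
where
  "commutative_monoid_category C =
     \<lparr>Obj = {A. is_commutative_monoid C A},
      Arr = {h. is_commutative_monoid C (Source h) \<and> is_commutative_monoid C (Target h) \<and>
                is_monoid_hom C (Source h) (Target h) (Body h)},
      Dom = Source,
      Cod = Target,
      Ident = (\<lambda>A. \<lparr>Source = A, Target = A, Body = Ident C (Carr A)\<rparr>),
      Comp = (\<lambda>k h. \<lparr>Source = Source h, Target = Target k, Body = Body k \<cdot>\<^bsub>C\<^esub> Body h\<rparr>)\<rparr>"

definition image_monoid ::
  "('p, 'b, 'z) moncat_scheme \<Rightarrow> ('o, 'a) monoid_data \<Rightarrow> ('o, 'a, 'p, 'b) mfunc \<Rightarrow>
   ('p, 'b) monoid_data"
where
  "image_monoid N A F =
     \<lparr>Carr = Omap F (Carr A),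
      Mult = Amap F (Mult A) \<cdot>\<^bsub>N\<^esub> Mmap F (Carr A, Carr A),
      Unt = Amap F (Unt A) \<cdot>\<^bsub>N\<^esub> Umap F\<rparr>"

definition evaluation ::
  "('p, 'b, 'z) moncat_scheme \<Rightarrow> ('o, 'a) monoid_data \<Rightarrow>
   (('o, 'a, 'p, 'b) mfunc, (('o, 'a, 'p, 'b) mfunc, 'o \<Rightarrow> 'b) arrow,
    ('p, 'b) monoid_data, (('p, 'b) monoid_data, 'b) arrow) func"
where
  "evaluation N A =
     \<lparr>Omap = image_monoid N A,
      Amap = (\<lambda>\<theta>. \<lparr>Source = image_monoid N A (Source \<theta>),
                   Target = image_monoid N A (Target \<theta>),
                   Body = Body \<theta> (Carr A)\<rparr>)\<rparr>"


section \<open>Categories of fractions\<close>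

text \<open>
  The category of fractions is constructed as by Gabriel and Zisman: its arrows are classes of
  zigzags, in which the arrows of \<open>W\<close> may also be traversed backwards. Zigzags are lists in
  diagrammatic order (the head is traversed first).
\<close>

datatype 'a step = Fwd 'a | Bwd 'a

inductive zigzag :: "('o, 'a, 'z) cat_scheme \<Rightarrow> 'a set \<Rightarrow> 'o \<Rightarrow> 'a step list \<Rightarrow> 'o \<Rightarrow> bool"
  for C W where
  zigzag_Nil: "a \<in> Obj C \<Longrightarrow> zigzag C W a [] a"
| zigzag_Fwd: "f \<in> Arr C \<Longrightarrow> zigzag C W (Cod C f) p b \<Longrightarrow> zigzag C W (Dom C f) (Fwd f # p) b"
| zigzag_Bwd: "w \<in> W \<Longrightarrow> zigzag C W (Dom C w) p b \<Longrightarrow> zigzag C W (Cod C w) (Bwd w # p) b"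

inductive basic_relation ::
  "('o, 'a, 'z) cat_scheme \<Rightarrow> 'a set \<Rightarrow> 'o \<Rightarrow> 'o \<Rightarrow> 'a step list \<Rightarrow> 'a step list \<Rightarrow> bool"
  for C W where
  rel_Ident: "a \<in> Obj C \<Longrightarrow> basic_relation C W a a [Fwd (Ident C a)] []"
| rel_Comp: "f \<in> Hom C a b \<Longrightarrow> g \<in> Hom C b c
    \<Longrightarrow> basic_relation C W a c [Fwd f, Fwd g] [Fwd (g \<cdot>\<^bsub>C\<^esub> f)]"
| rel_Fwd_Bwd: "w \<in> W \<Longrightarrow> basic_relation C W (Dom C w) (Dom C w) [Fwd w, Bwd w] []"
| rel_Bwd_Fwd: "w \<in> W \<Longrightarrow> basic_relation C W (Cod C w) (Cod C w) [Bwd w, Fwd w] []"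

inductive zz_equiv ::
  "('o, 'a, 'z) cat_scheme \<Rightarrow> 'a set \<Rightarrow> 'o \<Rightarrow> 'o \<Rightarrow> 'a step list \<Rightarrow> 'a step list \<Rightarrow> bool"
  for C W where
  zz_refl: "zigzag C W a p b \<Longrightarrow> zz_equiv C W a b p p"
| zz_sym: "zz_equiv C W a b p q \<Longrightarrow> zz_equiv C W a b q p"
| zz_trans: "zz_equiv C W a b p q \<Longrightarrow> zz_equiv C W a b q r \<Longrightarrow> zz_equiv C W a b p r"
| zz_basic: "zigzag C W a p c \<Longrightarrow> basic_relation C W c d u v \<Longrightarrow> zigzag C W d q b
    \<Longrightarrow> zz_equiv C W a b (p @ u @ q) (p @ v @ q)"

type_synonym ('o, 'a) fraction = "('o, 'a step list set) arrow"

definition fraction ::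
  "('o, 'a, 'z) cat_scheme \<Rightarrow> 'a set \<Rightarrow> 'o \<Rightarrow> 'o \<Rightarrow> 'a step list \<Rightarrow> ('o, 'a) fraction" where
  "fraction C W a b p = \<lparr>Source = a, Target = b, Body = {q. zz_equiv C W a b p q}\<rparr>"

definition localised_arrow ::
  "('o, 'a, 'z) cat_scheme \<Rightarrow> 'a set \<Rightarrow> 'a \<Rightarrow> ('o, 'a) fraction" where
  "localised_arrow C W f = fraction C W (Dom C f) (Cod C f) [Fwd f]"

text \<open>
  When \<open>W\<close> is closed under tensor products, the tensor product of the classes of
  \<open>p : a \<rightarrow> b\<close> and \<open>q : c \<rightarrow> d\<close> is the class of \<open>p \<otimes> c\<close> followed by \<open>b \<otimes> q\<close>. The body of a
  composite or tensor product is written as a union over all representatives; for valid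
  arguments the united sets coincide.
\<close>

definition localisation ::
  "('o, 'a, 'z) moncat_scheme \<Rightarrow> 'a set \<Rightarrow> ('o, ('o, 'a) fraction) moncat" where
  "localisation M W =
     \<lparr>Obj = Obj M,
      Arr = {fraction M W a b p | a b p. zigzag M W a p b},
      Dom = Source,
      Cod = Target,
      Ident = (\<lambda>a. fraction M W a a []),
      Comp = (\<lambda>G F. \<lparr>Source = Source F, Target = Target G,
                Body = (\<Union>p\<in>Body F. \<Union>q\<in>Body G.
                          {r. zz_equiv M W (Source F) (Target G) (p @ q) r})\<rparr>),
      TenO = TenO M,
      TenA = (\<lambda>F G. \<lparr>Source = Source F \<odot>\<^bsub>M\<^esub> Source G, Target = Target F \<odot>\<^bsub>M\<^esub> Target G,
                Body = (\<Union>p\<in>Body F. \<Union>q\<in>Body G.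
                          {r. zz_equiv M W (Source F \<odot>\<^bsub>M\<^esub> Source G) (Target F \<odot>\<^bsub>M\<^esub> Target G)
                               (map (map_step (\<lambda>f. f \<otimes>\<^bsub>M\<^esub> Ident M (Source G))) p @
                                map (map_step (\<lambda>g. Ident M (Target F) \<otimes>\<^bsub>M\<^esub> g)) q) r})\<rparr>),
      Munit = Munit M,
      Assoc = (\<lambda>a b c. localised_arrow M W (Assoc M a b c)),
      Lunit = (\<lambda>a. localised_arrow M W (Lunit M a)),
      Runit = (\<lambda>a. localised_arrow M W (Runit M a))\<rparr>"


section \<open>Ordered sums of finite ordered sets\<close>

text \<open>
  To have a set of objects, the elements of finite totally ordered sets are taken to be natural
  numbers; the order, however, is an arbitrary linear order \<open>r\<close>, whose underlying set is
  \<open>Field r\<close>. Disjoint unions are formed with the coding \<^const>\<open>sum_encode\<close> of \<open>nat + nat\<close>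
  by \<open>nat\<close>.
\<close>

definition finite_linear_order :: "nat rel \<Rightarrow> bool" where
  "finite_linear_order r \<longleftrightarrow> finite r \<and> Linear_order r"

definition inl :: "nat \<Rightarrow> nat" where
  "inl x = sum_encode (Inl x)"

definition inr :: "nat \<Rightarrow> nat" where
  "inr x = sum_encode (Inr x)"

definition cases_sum :: "(nat \<Rightarrow> nat) \<Rightarrow> (nat \<Rightarrow> nat) \<Rightarrow> nat \<Rightarrow> nat" where
  "cases_sum f g x = case_sum f g (sum_decode x)"

definition ordered_sum :: "nat rel \<Rightarrow> nat rel \<Rightarrow> nat rel" where
  "ordered_sum r r' =
     {(inl x, inl y) | x y. (x, y) \<in> r} \<union>
     {(inr x, inr y) | x y. (x, y) \<in> r'} \<union>
     {(inl x, inr y) | x y. x \<in> Field r \<and> y \<in> Field r'}"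

definition sum_map :: "(nat \<Rightarrow> nat) \<Rightarrow> (nat \<Rightarrow> nat) \<Rightarrow> nat \<Rightarrow> nat" where
  "sum_map f g = cases_sum (inl \<circ> f) (inr \<circ> g)"

definition sum_assoc :: "nat \<Rightarrow> nat" where
  "sum_assoc = cases_sum (cases_sum inl (inr \<circ> inl)) (inr \<circ> inr)"

definition sum_swap :: "nat \<Rightarrow> nat" where
  "sum_swap = cases_sum inr inl"


section \<open>Pruned trees of height 2\<close>

record tree =
  Tips :: "nat rel"
  Nodes :: "nat rel"
  Proj :: "nat \<Rightarrow> nat"

abbreviation TipSet :: "tree \<Rightarrow> nat set" where
  "TipSet t \<equiv> Field (Tips t)"

abbreviation NodeSet :: "tree \<Rightarrow> nat set" where
  "NodeSet t \<equiv> Field (Nodes t)"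

definition pruned_tree :: "tree \<Rightarrow> bool" where
  "pruned_tree t \<longleftrightarrow>
     finite_linear_order (Tips t) \<and> finite_linear_order (Nodes t) \<and>
     Proj t \<in> TipSet t \<rightarrow>\<^sub>E NodeSet t \<and> Proj t ` TipSet t = NodeSet t"

type_synonym tree_arrow = "(tree, (nat \<Rightarrow> nat) \<times> (nat \<Rightarrow> nat)) arrow"

definition is_tree_morphism :: "tree \<Rightarrow> tree \<Rightarrow> (nat \<Rightarrow> nat) \<Rightarrow> (nat \<Rightarrow> nat) \<Rightarrow> bool" where
  "is_tree_morphism s t f2 f1 \<longleftrightarrow>
     f2 \<in> TipSet s \<rightarrow>\<^sub>E TipSet t \<and>
     f1 \<in> NodeSet s \<rightarrow>\<^sub>E NodeSet t \<and>
     (\<forall>x\<in>TipSet s. Proj t (f2 x) = f1 (Proj s x)) \<and>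
     (\<forall>(x, y)\<in>Nodes s. (f1 x, f1 y) \<in> Nodes t) \<and>
     (\<forall>(x, y)\<in>Tips s. Proj s x = Proj s y \<longrightarrow> (f2 x, f2 y) \<in> Tips t)"

definition tree_map :: "tree \<Rightarrow> tree \<Rightarrow> (nat \<Rightarrow> nat) \<Rightarrow> (nat \<Rightarrow> nat) \<Rightarrow> tree_arrow" where
  "tree_map s t f2 f1 =
     \<lparr>Source = s, Target = t, Body = (restrict f2 (TipSet s), restrict f1 (NodeSet s))\<rparr>"

definition tree_sum :: "tree \<Rightarrow> tree \<Rightarrow> tree" where
  "tree_sum s t =
     \<lparr>Tips = ordered_sum (Tips s) (Tips t),
      Nodes = ordered_sum (Nodes s) (Nodes t),
      Proj = restrict (sum_map (Proj s) (Proj t)) (Field (ordered_sum (Tips s) (Tips t)))\<rparr>"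

definition empty_tree :: tree where
  "empty_tree = \<lparr>Tips = {}, Nodes = {}, Proj = restrict id {}\<rparr>"

definition Omega2 :: "(tree, tree_arrow) moncat" where
  "Omega2 =
     \<lparr>Obj = {t. pruned_tree t},
      Arr = {f. pruned_tree (Source f) \<and> pruned_tree (Target f) \<and>
                is_tree_morphism (Source f) (Target f) (fst (Body f)) (snd (Body f))},
      Dom = Source,
      Cod = Target,
      Ident = (\<lambda>t. tree_map t t id id),
      Comp = (\<lambda>g f. tree_map (Source f) (Target g)
                (fst (Body g) \<circ> fst (Body f)) (snd (Body g) \<circ> snd (Body f))),
      TenO = tree_sum,
      TenA = (\<lambda>f g. tree_map (tree_sum (Source f) (Source g)) (tree_sum (Target f) (Target g))
                (sum_map (fst (Body f)) (fst (Body g))) (sum_map (snd (Body f)) (snd (Body g)))),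
      Munit = empty_tree,
      Assoc = (\<lambda>s t u. tree_map (tree_sum (tree_sum s t) u) (tree_sum s (tree_sum t u))
                sum_assoc sum_assoc),
      Lunit = (\<lambda>t. tree_map (tree_sum empty_tree t) t (cases_sum id id) (cases_sum id id)),
      Runit = (\<lambda>t. tree_map (tree_sum t empty_tree) t (cases_sum id id) (cases_sum id id))\<rparr>"

definition tip_bijections :: "tree_arrow set" where
  "tip_bijections =
     {f \<in> Arr Omega2. bij_betw (fst (Body f)) (TipSet (Source f)) (TipSet (Target f))}"

text \<open>
  The tree \<open>X \<rightarrow> [1]\<close> on an ordered set \<open>X\<close>; for \<open>X = \<emptyset>\<close> surjectivity forces \<open>\<emptyset> \<rightarrow> \<emptyset>\<close>.
\<close>

definition corolla :: "nat rel \<Rightarrow> tree" where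
  "corolla r = \<lparr>Tips = r, Nodes = (if r = {} then {} else {(1, 1)}), Proj = (\<lambda>x\<in>Field r. 1)\<rparr>"

definition S1 :: tree where
  "S1 = corolla {(1, 1)}"

text \<open>\<open>S1\<close> is terminal in \<^const>\<open>Omega2\<close>: the unique morphism to it has constant components.\<close>

definition to_S1 :: "tree \<Rightarrow> tree_arrow" where
  "to_S1 t = tree_map t S1 (\<lambda>_. 1) (\<lambda>_. 1)"


section \<open>The braided localisation of the category of pruned trees\<close>

text \<open>
  The braiding \<open>s \<otimes> t \<rightarrow> t \<otimes> s\<close> passes through the corolla on the tips of \<open>t \<otimes> s\<close>: to it
  there is a morphism from \<open>s \<otimes> t\<close>, exchanging the two blocks of tips (the blocks need not be
  kept in order, because no fibre of \<open>s \<otimes> t\<close> meets both), and a morphism from \<open>t \<otimes> s\<close> that is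
  the identity on tips, so that the latter can be inverted.
\<close>

definition tree_braid :: "tree \<Rightarrow> tree \<Rightarrow> (tree, tree_arrow) fraction" where
  "tree_braid s t =
     (let c = corolla (Tips (tree_sum t s)) in
      fraction Omega2 tip_bijections (tree_sum s t) (tree_sum t s)
        [Fwd (tree_map (tree_sum s t) c sum_swap (\<lambda>_. 1)),
         Bwd (tree_map (tree_sum t s) c id (\<lambda>_. 1))])"

definition Omega2_frac :: "(tree, (tree, tree_arrow) fraction) brcat" where
  "Omega2_frac =
     moncat.extend (localisation Omega2 tip_bijections) (brcat.fields tree_braid)"

definition S1_monoid :: "(tree, (tree, tree_arrow) fraction) monoid_data" where
  "S1_monoid =
     \<lparr>Carr = S1,
      Mult = localised_arrow Omega2 tip_bijections (to_S1 (tree_sum S1 S1)),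
      Unt = localised_arrow Omega2 tip_bijections (to_S1 empty_tree)\<rparr>"

end

theory Submission
  imports Defs "HOL-Library.Product_Lexorder"
begin

text \<open>
  Put \<open>n\<close> tips in lexicographic order (first by node, then inside the fibre). For a commutative monoid
  \<open>A\<close> in a strict braided category, a morphism \<open>f : S \<rightarrow> T\<close> is sent to the map
  \<open>A\<^sup>m \<rightarrow> A\<^sup>n\<close> which takes the \<open>m\<close> factors one after the other and multiplies the factor of a tip
  \<open>x\<close> into the slot of \<open>f x\<close>, moving it past the later slots with the braiding. Everything about these
  maps follows from three rules for the operators ``multiply into slot \<open>y\<close>'': they commute up to the
  braiding, two factors for the same slot may be multiplied beforehand, and the unit acts trivially.
  For any braided functor \<open>G\<close> on the localisation, the image under \<open>G\<close> of the corolla with \<open>n\<close>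
  tips satisfies the same three rules, and the computation which gives functoriality also gives the
  naturality of the comparison \<open>A\<^sup>n \<rightarrow> G T\<close>, where \<open>A\<close> is the image of the generator.

  The braiding passes through a corolla, that is, a linear order on the tips. The point is that
  every order extending those of the fibres gives the same arrow; then naturality and the
  hexagons can be checked on maps of tips, after composing with an invertible map to a corolla.
\<close>

section \<open>Calculus in categories and monoidal categories\<close>

text \<open>A braiding need not be an involution, so it matters in which order factors are absorbed
  and on which side they pass each other. Multiplication into slots is functorial only if no factor
  passes a slot in the wrong direction. The lexicographic order guarantees this: whenever a factor
  crosses a slot that an earlier factor has reached or passed, the tips concerned lie over one node,
  where the next morphism is monotone.

  A morphism that is bijective on tips becomes a composite of braidings, hence invertible; this is
  why the construction descends to fractions.

  For the braiding of trees the obstacle is that a morphism is monotone on fibres only, so it need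
  not respect the orders of tips by which the braiding is defined. Naturality therefore needs the
  freedom to choose another order on the source, adapted to the morphism.

  Strictness of the target makes the powers of the monoid unambiguous. It also makes evaluation of
  the constructed functor return the monoid itself, so the content of the equivalence lies in the
  comparison with an arbitrary functor.\<close>

lemma Hom_iff: "f \<in> Hom C a b \<longleftrightarrow> f \<in> Arr C \<and> Dom C f = a \<and> Cod C f = b"
  by (auto simp: Hom_def)

context category
begin

lemma arr_Hom: "f \<in> Arr C \<Longrightarrow> f \<in> Hom C (Dom C f) (Cod C f)"
  by (simp add: Hom_def)

lemma Ident_simps [simp]:
  assumes "a \<in> Obj C"
  shows "Ident C a \<in> Arr C" "Dom C (Ident C a) = a" "Cod C (Ident C a) = a"
  using Ident_in[OF assms] by (auto simp: Hom_def)

lemma Comp_simps [simp]: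
  assumes "f \<in> Arr C" "g \<in> Arr C" "Dom C g = Cod C f"
  shows "g \<cdot> f \<in> Arr C" "Dom C (g \<cdot> f) = Dom C f" "Cod C (g \<cdot> f) = Cod C g"
  using Comp_in[of f "Dom C f" "Cod C f" g "Cod C g"] assms by (auto simp: Hom_def)

lemma Ident_Comp [simp]: "f \<in> Arr C \<Longrightarrow> Cod C f = b \<Longrightarrow> Ident C b \<cdot> f = f"
  using Ident_left by (auto simp: Hom_def)

lemma Comp_Ident [simp]: "f \<in> Arr C \<Longrightarrow> Dom C f = a \<Longrightarrow> f \<cdot> Ident C a = f"
  using Ident_right by (auto simp: Hom_def)

lemma assoc [simp]:
  "f \<in> Arr C \<Longrightarrow> g \<in> Arr C \<Longrightarrow> h \<in> Arr C \<Longrightarrow> Dom C g = Cod C f \<Longrightarrow> Dom C h = Cod C g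
    \<Longrightarrow> (h \<cdot> g) \<cdot> f = h \<cdot> (g \<cdot> f)"
  using Comp_assoc[of f "Dom C f" "Cod C f" g "Cod C g" h "Cod C h"] by (auto simp: Hom_def)

declare Dom_in [simp] Cod_in [simp]

lemma inverse_unique:
  assumes "inverse_arrows C f g" "inverse_arrows C f h" shows "g = h"
proof -
  have *: "f \<in> Arr C" "g \<in> Arr C" "h \<in> Arr C" "Dom C g = Cod C f" "Cod C g = Dom C f"
    "Dom C h = Cod C f" "Cod C h = Dom C f" and e: "g \<cdot> f = Ident C (Dom C f)" "f \<cdot> h = Ident C (Cod C f)"
    using assms by (auto simp: inverse_arrows_def Hom_iff)
  have "(g \<cdot> f) \<cdot> h = g \<cdot> (f \<cdot> h)" using * by (intro assoc) auto
  then have "Ident C (Dom C f) \<cdot> h = g \<cdot> Ident C (Cod C f)" unfolding e .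
  then show ?thesis using * by simp
qed

lemma inv_arr_eq: "inverse_arrows C f g \<Longrightarrow> inv_arr C f = g"
  unfolding inv_arr_def by (rule the_equality) (auto intro: inverse_unique)

lemma inverse_arrows_inv: "isomorphism C f \<Longrightarrow> inverse_arrows C f (inv_arr C f)"
  unfolding isomorphism_def using inv_arr_eq by blast

lemma inv_simps [simp]:
  assumes "isomorphism C f"
  shows "inv_arr C f \<in> Arr C" "Dom C (inv_arr C f) = Cod C f" "Cod C (inv_arr C f) = Dom C f"
    "inv_arr C f \<cdot> f = Ident C (Dom C f)" "f \<cdot> inv_arr C f = Ident C (Cod C f)"
  using inverse_arrows_inv[OF assms] by (auto simp: inverse_arrows_def Hom_iff)

lemma iso_arr: "isomorphism C f \<Longrightarrow> f \<in> Arr C"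
  by (auto simp: isomorphism_def inverse_arrows_def)

lemma inverse_arrows_sym: "inverse_arrows C f g \<Longrightarrow> inverse_arrows C g f"
  by (auto simp: inverse_arrows_def Hom_iff)

lemma iso_inv: "isomorphism C f \<Longrightarrow> isomorphism C (inv_arr C f)"
  by (metis inverse_arrows_inv inverse_arrows_sym isomorphism_def)

lemma inv_cancel [simp]:
  assumes "isomorphism C f" "g \<in> Arr C"
  shows "Cod C g = Dom C f \<Longrightarrow> inv_arr C f \<cdot> (f \<cdot> g) = g"
    and "Cod C g = Cod C f \<Longrightarrow> f \<cdot> (inv_arr C f \<cdot> g) = g"
  using assms iso_arr[OF assms(1)]
  by (simp_all add: assoc[symmetric] inv_simps del: assoc)

lemma iso_Ident: "a \<in> Obj C \<Longrightarrow> isomorphism C (Ident C a)"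
  unfolding isomorphism_def inverse_arrows_def Hom_iff by (rule exI[of _ "Ident C a"]) auto

lemma inv_Ident [simp]: "a \<in> Obj C \<Longrightarrow> inv_arr C (Ident C a) = Ident C a"
  by (rule inv_arr_eq) (auto simp: inverse_arrows_def Hom_iff)

lemma inverse_arrows_Comp:
  assumes "inverse_arrows C f f'" "inverse_arrows C g g'" "Dom C g = Cod C f"
  shows "inverse_arrows C (g \<cdot> f) (f' \<cdot> g')"
proof -
  have *: "f \<in> Arr C" "f' \<in> Arr C" "g \<in> Arr C" "g' \<in> Arr C" "Dom C f' = Cod C f" "Cod C f' = Dom C f"
    "Dom C g' = Cod C g" "Cod C g' = Dom C g" "f' \<cdot> f = Ident C (Dom C f)" "f \<cdot> f' = Ident C (Cod C f)"
    "g' \<cdot> g = Ident C (Dom C g)" "g \<cdot> g' = Ident C (Cod C g)"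
    using assms by (auto simp: inverse_arrows_def Hom_iff)
  have "g' \<cdot> (g \<cdot> f) = (g' \<cdot> g) \<cdot> f" using * assms(3) by (intro assoc[symmetric]) auto
  then have 1: "g' \<cdot> (g \<cdot> f) = f" using * assms(3) by simp
  have "f \<cdot> (f' \<cdot> g') = (f \<cdot> f') \<cdot> g'" using * assms(3) by (intro assoc[symmetric]) auto
  then have 2: "f \<cdot> (f' \<cdot> g') = g'" using * assms(3) by simp
  show ?thesis using * assms(3) 1 2 by (simp add: inverse_arrows_def Hom_iff)
qed

lemma iso_Comp:
  "isomorphism C f \<Longrightarrow> isomorphism C g \<Longrightarrow> Dom C g = Cod C f \<Longrightarrow> isomorphism C (g \<cdot> f)"
  unfolding isomorphism_def using inverse_arrows_Comp by blast

lemma iso_cancel_left: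
  assumes "isomorphism C f" "g \<in> Arr C" "h \<in> Arr C" "Cod C g = Dom C f" "Cod C h = Dom C f"
    and "f \<cdot> g = f \<cdot> h"
  shows "g = h"
  using inv_cancel(1)[OF assms(1,2,4)] inv_cancel(1)[OF assms(1,3,5)] assms(6) by metis

end

lemma functor_simps:
  assumes "is_functor C D F"
  shows "a \<in> Obj C \<Longrightarrow> Omap F a \<in> Obj D"
    and "f \<in> Arr C \<Longrightarrow> Amap F f \<in> Arr D"
    and "f \<in> Arr C \<Longrightarrow> Dom D (Amap F f) = Omap F (Dom C f)"
    and "f \<in> Arr C \<Longrightarrow> Cod D (Amap F f) = Omap F (Cod C f)"
    and "a \<in> Obj C \<Longrightarrow> Amap F (Ident C a) = Ident D (Omap F a)"
    and "f \<in> Arr C \<Longrightarrow> g \<in> Arr C \<Longrightarrow> Dom C g = Cod C f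
      \<Longrightarrow> Amap F (g \<cdot>\<^bsub>C\<^esub> f) = Amap F g \<cdot>\<^bsub>D\<^esub> Amap F f"
proof -
  have self: "f \<in> Hom C (Dom C f) (Cod C f)" if "f \<in> Arr C" for f
    using that by (simp add: Hom_def)
  have "Amap F f \<in> Hom D (Omap F (Dom C f)) (Omap F (Cod C f))" if "f \<in> Arr C" for f
    using assms self[OF that] unfolding is_functor_def by blast
  then show "f \<in> Arr C \<Longrightarrow> Amap F f \<in> Arr D" "f \<in> Arr C \<Longrightarrow> Dom D (Amap F f) = Omap F (Dom C f)"
    "f \<in> Arr C \<Longrightarrow> Cod D (Amap F f) = Omap F (Cod C f)"
    by (simp_all add: Hom_iff)
  show "a \<in> Obj C \<Longrightarrow> Omap F a \<in> Obj D" "a \<in> Obj C \<Longrightarrow> Amap F (Ident C a) = Ident D (Omap F a)"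
    using assms unfolding is_functor_def by blast+
  assume f: "f \<in> Arr C" "g \<in> Arr C" "Dom C g = Cod C f"
  then have "g \<in> Hom C (Cod C f) (Cod C g)" by (simp add: Hom_def)
  then show "Amap F (g \<cdot>\<^bsub>C\<^esub> f) = Amap F g \<cdot>\<^bsub>D\<^esub> Amap F f"
    using assms self[OF f(1)] unfolding is_functor_def by blast
qed

lemma functorI:
  assumes "category C" "category D"
    and "\<And>a. a \<in> Obj C \<Longrightarrow> Omap F a \<in> Obj D"
    and "\<And>f. f \<in> Arr C \<Longrightarrow> Amap F f \<in> Hom D (Omap F (Dom C f)) (Omap F (Cod C f))"
    and "\<And>a. a \<in> Obj C \<Longrightarrow> Amap F (Ident C a) = Ident D (Omap F a)"
    and "\<And>f g. f \<in> Arr C \<Longrightarrow> g \<in> Arr C \<Longrightarrow> Dom C g = Cod C f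
      \<Longrightarrow> Amap F (g \<cdot>\<^bsub>C\<^esub> f) = Amap F g \<cdot>\<^bsub>D\<^esub> Amap F f"
  shows "is_functor C D F"
  using assms unfolding is_functor_def by (auto simp: Hom_iff)

lemma functor_inverse:
  assumes "is_functor C D F" "inverse_arrows C f g"
  shows "inverse_arrows D (Amap F f) (Amap F g)"
proof -
  have C: "category C" "category D" using assms(1) by (auto simp: is_functor_def)
  have *: "f \<in> Arr C" "g \<in> Arr C" "Dom C g = Cod C f" "Cod C g = Dom C f"
    "g \<cdot>\<^bsub>C\<^esub> f = Ident C (Dom C f)" "f \<cdot>\<^bsub>C\<^esub> g = Ident C (Cod C f)"
    using assms(2) by (auto simp: inverse_arrows_def Hom_iff)
  show ?thesis
    using * functor_simps(6)[OF assms(1), of f g] functor_simps(6)[OF assms(1), of g f] C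
    by (simp add: inverse_arrows_def Hom_iff functor_simps[OF assms(1)] category.Dom_in category.Cod_in)
qed

lemma functor_iso: "is_functor C D F \<Longrightarrow> isomorphism C f \<Longrightarrow> isomorphism D (Amap F f)"
  unfolding isomorphism_def by (metis functor_inverse)

context monoidal_category
begin

lemma TenA_simps [simp]:
  assumes "f \<in> Arr C" "g \<in> Arr C"
  shows "f \<otimes> g \<in> Arr C" "Dom C (f \<otimes> g) = Dom C f \<odot> Dom C g" "Cod C (f \<otimes> g) = Cod C f \<odot> Cod C g"
  using TenA_in[OF arr_Hom[OF assms(1)] arr_Hom[OF assms(2)]] by (auto simp: Hom_def)

declare Munit_in [simp] TenO_in [simp] TenA_Ident [simp]

lemma interchange:
  "f \<in> Arr C \<Longrightarrow> f' \<in> Arr C \<Longrightarrow> g \<in> Arr C \<Longrightarrow> g' \<in> Arr C \<Longrightarrow> Dom C f' = Cod C f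
    \<Longrightarrow> Dom C g' = Cod C g \<Longrightarrow> (f' \<otimes> g') \<cdot> (f \<otimes> g) = (f' \<cdot> f) \<otimes> (g' \<cdot> g)"
  using TenA_Comp[of f "Dom C f" "Cod C f" f' "Cod C f'" g "Dom C g" "Cod C g" g' "Cod C g'"]
  by (auto simp: Hom_def)

lemma inverse_arrows_TenA:
  assumes "inverse_arrows C f f'" "inverse_arrows C g g'"
  shows "inverse_arrows C (f \<otimes> g) (f' \<otimes> g')"
  using assms by (auto simp: inverse_arrows_def Hom_iff interchange)

lemma iso_TenA: "isomorphism C f \<Longrightarrow> isomorphism C g \<Longrightarrow> isomorphism C (f \<otimes> g)"
  unfolding isomorphism_def using inverse_arrows_TenA by blast

lemma Assoc_simps [simp]:
  assumes "a \<in> Obj C" "b \<in> Obj C" "c \<in> Obj C"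
  shows "Assoc C a b c \<in> Arr C" "Dom C (Assoc C a b c) = (a \<odot> b) \<odot> c"
    "Cod C (Assoc C a b c) = a \<odot> (b \<odot> c)"
  using Assoc_in[OF assms] by (auto simp: Hom_def)

lemma Lunit_simps [simp]:
  assumes "a \<in> Obj C"
  shows "Lunit C a \<in> Arr C" "Dom C (Lunit C a) = \<one> \<odot> a" "Cod C (Lunit C a) = a"
    "Runit C a \<in> Arr C" "Dom C (Runit C a) = a \<odot> \<one>" "Cod C (Runit C a) = a"
  using Lunit_in[OF assms] Runit_in[OF assms] by (auto simp: Hom_def)

end

section \<open>Monoidal categories of fractions\<close>

text \<open>Tensor products of fractions are formed one side at a time, each step of a zigzag being
  tensored with an identity; closure of \<open>W\<close> is stated in that form.\<close>

locale monoidal_fractions = monoidal_category M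
  for M :: "('o, 'a, 'z) moncat_scheme" (structure) +
  fixes W :: "'a set"
  assumes W_arr: "W \<subseteq> Arr M"
    and W_right: "w \<in> W \<Longrightarrow> a \<in> Obj M \<Longrightarrow> w \<otimes> Ident M a \<in> W"
    and W_left: "w \<in> W \<Longrightarrow> a \<in> Obj M \<Longrightarrow> Ident M a \<otimes> w \<in> W"
begin

abbreviation "zz \<equiv> zigzag M W"
abbreviation "eqv \<equiv> zz_equiv M W"
abbreviation "frac \<equiv> fraction M W"
abbreviation "L \<equiv> localisation M W"
abbreviation "lf \<equiv> localised_arrow M W"
abbreviation L_comp (infixr "\<star>" 55) where "G \<star> F \<equiv> G \<cdot>\<^bsub>L\<^esub> F"

lemma W_Arr [simp]: "w \<in> W \<Longrightarrow> w \<in> Arr M" using W_arr by auto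

lemma zz_Obj: "zz a p b \<Longrightarrow> a \<in> Obj M \<and> b \<in> Obj M"
  by (induction rule: zigzag.induct) auto

lemma zz_append: "zz a p b \<Longrightarrow> zz b q c \<Longrightarrow> zz a (p @ q) c"
  by (induction rule: zigzag.induct) (auto intro: zigzag.intros)

lemma zz_FwdI: "f \<in> Arr M \<Longrightarrow> a = Dom M f \<Longrightarrow> zz (Cod M f) p b \<Longrightarrow> zz a (Fwd f # p) b"
  by (auto intro: zigzag.intros)

lemma zz_BwdI: "w \<in> W \<Longrightarrow> a = Cod M w \<Longrightarrow> zz (Dom M w) p b \<Longrightarrow> zz a (Bwd w # p) b"
  by (auto intro: zigzag.intros)

lemma zz_Fwd1: "f \<in> Arr M \<Longrightarrow> zz (Dom M f) [Fwd f] (Cod M f)"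
  by (intro zz_FwdI zigzag_Nil) auto

lemma zz_Bwd1: "w \<in> W \<Longrightarrow> zz (Cod M w) [Bwd w] (Dom M w)"
  by (intro zz_BwdI zigzag_Nil) auto

lemma basic_zz: "basic_relation M W c d u v \<Longrightarrow> zz c u d \<and> zz c v d"
  by (induction rule: basic_relation.induct)
     (auto simp: Hom_iff intro!: zz_FwdI zz_BwdI zigzag_Nil)

lemma eqv_zz: "eqv a b p q \<Longrightarrow> zz a p b \<and> zz a q b"
  by (induction rule: zz_equiv.induct) (auto intro!: zz_append dest: basic_zz)

lemma eqv_append_right: "eqv a b p q \<Longrightarrow> zz b r c \<Longrightarrow> eqv a c (p @ r) (q @ r)"
proof (induction rule: zz_equiv.induct)
  case (zz_basic a p c d u v q b)
  then show ?case using zz_equiv.zz_basic[of M W a p c d u v "q @ r"] zz_append by simp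
qed (auto intro: zz_equiv.intros zz_append)

lemma eqv_append_left: "eqv b c p q \<Longrightarrow> zz a r b \<Longrightarrow> eqv a c (r @ p) (r @ q)"
proof (induction rule: zz_equiv.induct)
  case (zz_basic b p c d u v q e)
  then show ?case using zz_equiv.zz_basic[of M W a "r @ p" c d u v q] zz_append by simp
qed (auto intro: zz_equiv.intros zz_append)

lemma eqv_append: "eqv a b p q \<Longrightarrow> eqv b c r s \<Longrightarrow> eqv a c (p @ r) (q @ s)"
  by (meson eqv_append_left eqv_append_right eqv_zz zz_trans)

lemma basic_eqv: "basic_relation M W a b u v \<Longrightarrow> eqv a b u v"
  using zz_basic[of M W a "[]" a b u v "[]"] basic_zz zz_Obj zigzag_Nil by fastforce

lemma frac_simps [simp]: "Source (frac a b p) = a" "Target (frac a b p) = b"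
  "Body (frac a b p) = {q. eqv a b p q}"
  by (auto simp: fraction_def)

lemma frac_eqI: "eqv a b p q \<Longrightarrow> frac a b p = frac a b q"
  unfolding fraction_def by (auto intro: zz_trans zz_sym)

lemma L_simps [simp]: "Obj L = Obj M" "Dom L = Source" "Cod L = Target" "TenO L = TenO M"
  "Munit L = Munit M" "Ident L a = frac a a []" "Assoc L a b c = lf (Assoc M a b c)"
  "Lunit L a = lf (Lunit M a)" "Runit L a = lf (Runit M a)"
  by (auto simp: localisation_def)

lemma frac_Arr [simp]: "zz a p b \<Longrightarrow> frac a b p \<in> Arr L"
  by (auto simp: localisation_def)

lemma frac_cases:
  assumes "X \<in> Arr L" obtains a b p where "X = frac a b p" "zz a p b"
  using assms by (auto simp: localisation_def)

text \<open>Concatenation respects the equivalence of zigzags, so every pair of representatives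
  contributes the same class and the union in the definition of composition collapses. From here on
  composites are computed on representatives.\<close>

lemma L_Comp:
  assumes "zz a p b" "zz b q c"
  shows "Comp L (frac b c q) (frac a b p) = frac a c (p @ q)"
proof -
  have "(\<Union>p'\<in>{q. eqv a b p q}. \<Union>q'\<in>{r. eqv b c q r}. {r. eqv a c (p' @ q') r}) = {r. eqv a c (p @ q) r}"
  proof safe
    fix p' q' r assume "eqv a b p p'" "eqv b c q q'" "eqv a c (p' @ q') r"
    then show "eqv a c (p @ q) r" by (meson eqv_append zz_trans)
  next
    fix r assume "eqv a c (p @ q) r"
    then show "r \<in> (\<Union>p'\<in>{q. eqv a b p q}. \<Union>q'\<in>{r. eqv b c q r}. {r. eqv a c (p' @ q') r})"
      using zz_refl[OF assms(1)] zz_refl[OF assms(2)] by blast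
  qed
  then show ?thesis by (simp add: localisation_def fraction_def)
qed

lemma category_L: "category L"
proof
  fix f a b g c h d
  show "f \<in> Arr L \<Longrightarrow> Dom L f \<in> Obj L" "f \<in> Arr L \<Longrightarrow> Cod L f \<in> Obj L"
    by (auto elim!: frac_cases dest: zz_Obj)
  show "a \<in> Obj L \<Longrightarrow> Ident L a \<in> Hom L a a"
    by (auto simp: Hom_iff intro!: frac_Arr zigzag_Nil)
  show "f \<in> Hom L a b \<Longrightarrow> g \<in> Hom L b c \<Longrightarrow> g \<star> f \<in> Hom L a c"
    by (auto simp: Hom_iff L_Comp zz_append elim!: frac_cases)
  show "f \<in> Hom L a b \<Longrightarrow> Ident L b \<star> f = f"
    by (auto simp: Hom_iff elim!: frac_cases) (metis L_Comp append_Nil2 zigzag_Nil zz_Obj)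
  show "f \<in> Hom L a b \<Longrightarrow> f \<star> Ident L a = f"
    by (auto simp: Hom_iff elim!: frac_cases) (metis L_Comp append_Nil zigzag_Nil zz_Obj)
  show "f \<in> Hom L a b \<Longrightarrow> g \<in> Hom L b c \<Longrightarrow> h \<in> Hom L c d
    \<Longrightarrow> (h \<star> g) \<star> f = h \<star> (g \<star> f)"
    by (auto simp: Hom_iff L_Comp zz_append elim!: frac_cases)
qed

sublocale LC: category L by (rule category_L)

lemma lf_simps [simp]:
  assumes "f \<in> Arr M"
  shows "lf f \<in> Arr L" "Source (lf f) = Dom M f" "Target (lf f) = Cod M f"
  using zz_Fwd1[OF assms] by (auto simp: localised_arrow_def)

lemma lf_Ident [simp]: "a \<in> Obj M \<Longrightarrow> lf (Ident M a) = frac a a []"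
  unfolding localised_arrow_def using basic_eqv[OF rel_Ident] by (auto intro: frac_eqI)

lemma lf_Comp:
  assumes "f \<in> Arr M" "g \<in> Arr M" "Dom M g = Cod M f"
  shows "lf (g \<cdot> f) = lf g \<star> lf f"
proof -
  have "lf g \<star> lf f = frac (Dom M f) (Cod M g) ([Fwd f] @ [Fwd g])"
    unfolding localised_arrow_def using assms L_Comp zz_Fwd1 by metis
  also have "\<dots> = lf (g \<cdot> f)" unfolding localised_arrow_def
    using assms basic_eqv[OF rel_Comp[OF arr_Hom[OF assms(1)], of g "Cod M g"]]
    by (auto intro!: frac_eqI simp: Hom_iff)
  finally show ?thesis by simp
qed

lemma lf_inverse:
  assumes "w \<in> W"
  shows "inverse_arrows L (lf w) (frac (Cod M w) (Dom M w) [Bwd w])"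
proof -
  have z: "zz (Dom M w) [Fwd w] (Cod M w)" "zz (Cod M w) [Bwd w] (Dom M w)"
    using assms by (auto intro: zz_Fwd1 zz_Bwd1)
  have l: "lf w = frac (Dom M w) (Cod M w) [Fwd w]" by (simp add: localised_arrow_def)
  have "frac (Cod M w) (Dom M w) [Bwd w] \<star> lf w = frac (Dom M w) (Dom M w) []"
    unfolding l L_Comp[OF z] using basic_eqv[OF rel_Fwd_Bwd[OF assms]] by (simp add: frac_eqI)
  moreover have "lf w \<star> frac (Cod M w) (Dom M w) [Bwd w] = frac (Cod M w) (Cod M w) []"
    unfolding l L_Comp[OF z(2,1)] using basic_eqv[OF rel_Bwd_Fwd[OF assms]] by (simp add: frac_eqI)
  ultimately show ?thesis using z assms by (simp add: inverse_arrows_def Hom_iff)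
qed

lemma lf_iso: "w \<in> W \<Longrightarrow> isomorphism L (lf w)"
  unfolding isomorphism_def using lf_inverse by blast

lemma inv_lf: "w \<in> W \<Longrightarrow> inv_arr L (lf w) = frac (Cod M w) (Dom M w) [Bwd w]"
  using LC.inv_arr_eq[OF lf_inverse] .

lemma lf_functor: "is_functor M L \<lparr>Omap = id, Amap = lf\<rparr>"
  by (rule functorI) (auto simp: Hom_iff category_L category_axioms lf_Comp)

lemma lf_iso': "isomorphism M f \<Longrightarrow> isomorphism L (lf f)"
  using functor_iso[OF lf_functor] by simp

text \<open>Peeling off the head of a zigzag exhibits its class as a composite whose first factor is
  some \<open>lf f\<close> or the inverse of some \<open>lf w\<close>.\<close>

lemma frac_induct:
  assumes "zz a p b"
    and I: "\<And>a. a \<in> Obj M \<Longrightarrow> P (Ident L a)"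
    and F: "\<And>f. f \<in> Arr M \<Longrightarrow> P (lf f)"
    and B: "\<And>w. w \<in> W \<Longrightarrow> P (inv_arr L (lf w))"
    and C: "\<And>X Y. X \<in> Arr L \<Longrightarrow> Y \<in> Arr L \<Longrightarrow> Source Y = Target X \<Longrightarrow> P X \<Longrightarrow> P Y \<Longrightarrow> P (Y \<star> X)"
  shows "P (frac a b p)"
  using assms(1)
proof (induction rule: zigzag.induct)
  case (zigzag_Nil a) then show ?case using I by simp
next
  case (zigzag_Fwd f p b)
  have "P (frac (Cod M f) b p \<star> lf f)" using zigzag_Fwd F by (intro C) auto
  then show ?case using zigzag_Fwd L_Comp[OF zz_Fwd1, of f] by (simp add: localised_arrow_def)
next
  case (zigzag_Bwd w p b)
  have "P (frac (Dom M w) b p \<star> inv_arr L (lf w))"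
    using zigzag_Bwd B by (intro C) (auto simp: inv_lf zz_Bwd1)
  then show ?case using zigzag_Bwd L_Comp[OF zz_Bwd1, of w] by (simp add: inv_lf)
qed

text \<open>A square at an invertible arrow yields the square at its inverse, and squares compose;
  so only the images of arrows of \<open>M\<close> have to be tested. Later naturality statements
  about fractions, and equations that can be read as such, are reduced to arrows of \<open>M\<close>
  in this way.\<close>

lemma natural_from_lf:
  assumes F: "is_functor L D F" and G: "is_functor L D G"
    and T: "\<And>a. a \<in> Obj M \<Longrightarrow> \<theta> a \<in> Hom D (Omap F a) (Omap G a)"
    and N: "\<And>f. f \<in> Arr M \<Longrightarrow> \<theta> (Cod M f) \<cdot>\<^bsub>D\<^esub> Amap F (lf f) = Amap G (lf f) \<cdot>\<^bsub>D\<^esub> \<theta> (Dom M f)"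
    and X: "X \<in> Arr L"
  shows "\<theta> (Target X) \<cdot>\<^bsub>D\<^esub> Amap F X = Amap G X \<cdot>\<^bsub>D\<^esub> \<theta> (Source X)"
proof -
  interpret D: category D using F by (simp add: is_functor_def)
  have T': "\<theta> a \<in> Arr D" "Dom D (\<theta> a) = Omap F a" "Cod D (\<theta> a) = Omap G a" if "a \<in> Obj M" for a
    using T[OF that] by (auto simp: Hom_iff)
  note [simp] = functor_simps(1-5)[OF F, simplified] functor_simps(1-5)[OF G, simplified]
  obtain a b p where "X = frac a b p" "zz a p b" using X frac_cases by blast
  moreover have "zz a p b \<Longrightarrow> \<theta> (Target (frac a b p)) \<cdot>\<^bsub>D\<^esub> Amap F (frac a b p) = Amap G (frac a b p) \<cdot>\<^bsub>D\<^esub> \<theta> (Source (frac a b p))"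
  proof (rule frac_induct[of a p b "\<lambda>X. \<theta> (Target X) \<cdot>\<^bsub>D\<^esub> Amap F X = Amap G X \<cdot>\<^bsub>D\<^esub> \<theta> (Source X)"])
    fix w assume w: "w \<in> W"
    let ?i = "inv_arr L (lf w)"
    have iF: "inverse_arrows D (Amap F (lf w)) (Amap F ?i)" "inverse_arrows D (Amap G (lf w)) (Amap G ?i)"
      using F G LC.inverse_arrows_inv[OF lf_iso[OF w]] by (auto intro: functor_inverse)
    then have i: "Amap F (lf w) \<cdot>\<^bsub>D\<^esub> Amap F ?i = Ident D (Omap F (Cod M w))"
       "Amap G ?i \<cdot>\<^bsub>D\<^esub> Amap G (lf w) = Ident D (Omap G (Dom M w))"
      using w by (auto simp: inverse_arrows_def)
    have wA: "?i \<in> Arr L" "Source ?i = Cod M w" "Target ?i = Dom M w"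
      using LC.inv_simps[OF lf_iso[OF w]] w by auto
    \<comment> \<open>The identity \<open>Amap G ?i \<cdot> Amap G (lf w)\<close> is inserted on the
      left; the square at \<open>w\<close> then produces \<open>Amap F (lf w)\<close>, which cancels
      against \<open>Amap F ?i\<close>.\<close>
    have "\<theta> (Dom M w) \<cdot>\<^bsub>D\<^esub> Amap F ?i = Amap G ?i \<cdot>\<^bsub>D\<^esub> Amap G (lf w) \<cdot>\<^bsub>D\<^esub> \<theta> (Dom M w) \<cdot>\<^bsub>D\<^esub> Amap F ?i"
      using i(2) wA w T' by (subst D.assoc[symmetric]) auto
    also have "\<dots> = Amap G ?i \<cdot>\<^bsub>D\<^esub> (\<theta> (Cod M w) \<cdot>\<^bsub>D\<^esub> Amap F (lf w)) \<cdot>\<^bsub>D\<^esub> Amap F ?i"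
      using N[of w] wA w T' by (subst N) auto
    also have "\<dots> = Amap G ?i \<cdot>\<^bsub>D\<^esub> \<theta> (Cod M w)"
      using i(1) wA w T' by simp
    finally show "\<theta> (Target ?i) \<cdot>\<^bsub>D\<^esub> Amap F ?i = Amap G ?i \<cdot>\<^bsub>D\<^esub> \<theta> (Source ?i)" using wA by simp
  next
    fix X Y assume X: "X \<in> Arr L" and Y: "Y \<in> Arr L" and XY: "Source Y = Target X"
      and e: "\<theta> (Target X) \<cdot>\<^bsub>D\<^esub> Amap F X = Amap G X \<cdot>\<^bsub>D\<^esub> \<theta> (Source X)"
         "\<theta> (Target Y) \<cdot>\<^bsub>D\<^esub> Amap F Y = Amap G Y \<cdot>\<^bsub>D\<^esub> \<theta> (Source Y)"
    have o: "Source X \<in> Obj M" "Target X \<in> Obj M" "Target Y \<in> Obj M"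
      using LC.Dom_in LC.Cod_in X Y by auto
    have "\<theta> (Target Y) \<cdot>\<^bsub>D\<^esub> Amap F Y \<cdot>\<^bsub>D\<^esub> Amap F X = (\<theta> (Target Y) \<cdot>\<^bsub>D\<^esub> Amap F Y) \<cdot>\<^bsub>D\<^esub> Amap F X"
      using X Y XY o T' by simp
    also have "\<dots> = Amap G Y \<cdot>\<^bsub>D\<^esub> \<theta> (Target X) \<cdot>\<^bsub>D\<^esub> Amap F X"
      unfolding e(2) using X Y XY o T' by simp
    also have "\<dots> = Amap G Y \<cdot>\<^bsub>D\<^esub> Amap G X \<cdot>\<^bsub>D\<^esub> \<theta> (Source X)" unfolding e(1) ..
    finally show "\<theta> (Target (Y \<star> X)) \<cdot>\<^bsub>D\<^esub> Amap F (Y \<star> X) = Amap G (Y \<star> X) \<cdot>\<^bsub>D\<^esub> \<theta> (Source (Y \<star> X))"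
      using X Y XY o T' LC.Comp_simps[OF X Y] functor_simps(6)[OF F X Y] functor_simps(6)[OF G X Y] by simp
  next
    fix a assume a: "a \<in> Obj M"
    then have "Amap F (Ident L a) = Ident D (Omap F a)" "Amap G (Ident L a) = Ident D (Omap G a)"
      using functor_simps(5)[OF F, of a] functor_simps(5)[OF G, of a] by simp_all
    then show "\<theta> (Target (Ident L a)) \<cdot>\<^bsub>D\<^esub> Amap F (Ident L a) = Amap G (Ident L a) \<cdot>\<^bsub>D\<^esub> \<theta> (Source (Ident L a))"
      using T'[OF a] by simp
  next
    fix f assume "f \<in> Arr M"
    then show "\<theta> (Target (lf f)) \<cdot>\<^bsub>D\<^esub> Amap F (lf f) = Amap G (lf f) \<cdot>\<^bsub>D\<^esub> \<theta> (Source (lf f))"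
      using N[of f] by simp
  qed
  ultimately show ?thesis by simp
qed

end

section \<open>The tensor product of fractions\<close>

context monoidal_fractions
begin

text \<open>An assignment that preserves sources, targets, identities, composites and
  \<open>W\<close> carries each basic relation to a basic relation, up to an identity. It is applied
  to tensoring with a fixed object on either side.\<close>

lemma map_steps:
  assumes a: "\<And>f. f \<in> Arr M \<Longrightarrow> \<phi> f \<in> Arr M \<and> Dom M (\<phi> f) = h (Dom M f) \<and> Cod M (\<phi> f) = h (Cod M f)"
    and o: "\<And>a. a \<in> Obj M \<Longrightarrow> h a \<in> Obj M \<and> \<phi> (Ident M a) = Ident M (h a)"
    and c: "\<And>f g. f \<in> Arr M \<Longrightarrow> g \<in> Arr M \<Longrightarrow> Dom M g = Cod M f \<Longrightarrow> \<phi> (g \<cdot> f) = \<phi> g \<cdot> \<phi> f"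
    and w: "\<And>w. w \<in> W \<Longrightarrow> \<phi> w \<in> W"
  shows zz_map: "zz a p b \<Longrightarrow> zz (h a) (map (map_step \<phi>) p) (h b)"
    and eqv_map: "eqv a b p q \<Longrightarrow> eqv (h a) (h b) (map (map_step \<phi>) p) (map (map_step \<phi>) q)"
proof -
  show Z: "zz (h a) (map (map_step \<phi>) p) (h b)" if "zz a p b" for a p b
    using that by induction (auto simp: o a w intro: zigzag.zigzag_Nil intro!: zz_FwdI zz_BwdI)
  have B: "eqv (h a) (h b) (map (map_step \<phi>) u) (map (map_step \<phi>) v)"
    if "basic_relation M W a b u v" for a b u v
    using that
  proof induction
    case (rel_Ident a)
    then show ?case using o basic_eqv[OF basic_relation.rel_Ident] by simp
  next
    case (rel_Comp f a b g c)
    then have "\<phi> f \<in> Hom M (h a) (h b)" "\<phi> g \<in> Hom M (h b) (h c)" "\<phi> (g \<cdot> f) = \<phi> g \<cdot> \<phi> f"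
      using a[of f] a[of g] c[of f g] by (auto simp: Hom_iff)
    then show ?case using basic_eqv[OF basic_relation.rel_Comp] by simp
  next
    case (rel_Fwd_Bwd w)
    then show ?case using basic_eqv[OF basic_relation.rel_Fwd_Bwd[OF w[OF rel_Fwd_Bwd]]] a[of w] by simp
  next
    case (rel_Bwd_Fwd w)
    then show ?case using basic_eqv[OF basic_relation.rel_Bwd_Fwd[OF w[OF rel_Bwd_Fwd]]] a[of w] by simp
  qed
  assume "eqv a b p q"
  then show "eqv (h a) (h b) (map (map_step \<phi>) p) (map (map_step \<phi>) q)"
  proof induction
    case (zz_basic a p c d u v q b)
    then show ?case
      using eqv_append_left[OF eqv_append_right[OF B[OF zz_basic(2)] Z[OF zz_basic(3)]] Z[OF zz_basic(1)]] by simp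
  qed (auto intro: zz_equiv.intros Z)
qed

abbreviation "mr c \<equiv> map (map_step (\<lambda>f. f \<otimes> Ident M c))"
abbreviation "ml a \<equiv> map (map_step (\<lambda>g. Ident M a \<otimes> g))"

lemma mr: assumes "c \<in> Obj M"
  shows "zz a p b \<Longrightarrow> zz (a \<odot> c) (mr c p) (b \<odot> c)"
    and "eqv a b p q \<Longrightarrow> eqv (a \<odot> c) (b \<odot> c) (mr c p) (mr c q)"
  using map_steps[of "\<lambda>f. f \<otimes> Ident M c" "\<lambda>a. a \<odot> c"] assms by (auto simp: interchange W_right)

lemma ml: assumes "c \<in> Obj M"
  shows "zz a p b \<Longrightarrow> zz (c \<odot> a) (ml c p) (c \<odot> b)"
    and "eqv a b p q \<Longrightarrow> eqv (c \<odot> a) (c \<odot> b) (ml c p) (ml c q)"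
  using map_steps[of "\<lambda>f. Ident M c \<otimes> f" "\<lambda>a. c \<odot> a"] assms by (auto simp: interchange W_left)

lemma L_TenA:
  assumes "zz a p b" "zz c q d"
  shows "TenA L (frac a b p) (frac c d q) = frac (a \<odot> c) (b \<odot> d) (mr c p @ ml b q)"
proof -
  have o: "b \<in> Obj M" "c \<in> Obj M" using assms zz_Obj by auto
  have "(\<Union>p'\<in>{r. eqv a b p r}. \<Union>q'\<in>{r. eqv c d q r}. {r. eqv (a \<odot> c) (b \<odot> d) (mr c p' @ ml b q') r})
      = {r. eqv (a \<odot> c) (b \<odot> d) (mr c p @ ml b q) r}"
  proof safe
    fix p' q' r assume "eqv a b p p'" "eqv c d q q'" "eqv (a \<odot> c) (b \<odot> d) (mr c p' @ ml b q') r"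
    then show "eqv (a \<odot> c) (b \<odot> d) (mr c p @ ml b q) r"
      using mr(2)[OF o(2)] ml(2)[OF o(1)] eqv_append zz_trans by meson
  next
    fix r assume "eqv (a \<odot> c) (b \<odot> d) (mr c p @ ml b q) r"
    then show "r \<in> (\<Union>p'\<in>{r. eqv a b p r}. \<Union>q'\<in>{r. eqv c d q r}. {r. eqv (a \<odot> c) (b \<odot> d) (mr c p' @ ml b q') r})"
      using zz_refl[OF assms(1)] zz_refl[OF assms(2)] by blast
  qed
  then show ?thesis by (simp add: localisation_def fraction_def)
qed

abbreviation RT where "RT X c \<equiv> TenA L X (frac c c [])"
abbreviation LT where "LT c X \<equiv> TenA L (frac c c []) X"

lemma RT_frac: "zz a p b \<Longrightarrow> c \<in> Obj M \<Longrightarrow> RT (frac a b p) c = frac (a \<odot> c) (b \<odot> c) (mr c p)"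
  using L_TenA[of a p b c "[]" c] by (simp add: zigzag_Nil)

lemma LT_frac: "zz a p b \<Longrightarrow> c \<in> Obj M \<Longrightarrow> LT c (frac a b p) = frac (c \<odot> a) (c \<odot> b) (ml c p)"
  using L_TenA[of c "[]" c a p b] by (simp add: zigzag_Nil)

lemma L_TenA_Arr [simp]:
  assumes "X \<in> Arr L" "Y \<in> Arr L"
  shows "TenA L X Y \<in> Arr L" "Source (TenA L X Y) = Source X \<odot> Source Y"
    "Target (TenA L X Y) = Target X \<odot> Target Y"
proof -
  from assms obtain a b p c d q where *: "X = frac a b p" "zz a p b" "Y = frac c d q" "zz c q d"
    by (auto elim!: frac_cases)
  then have "zz (a \<odot> c) (mr c p @ ml b q) (b \<odot> d)"
    using mr(1) ml(1) zz_Obj by (metis zz_append)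
  then show "TenA L X Y \<in> Arr L" "Source (TenA L X Y) = Source X \<odot> Source Y"
    "Target (TenA L X Y) = Target X \<odot> Target Y"
    using * by (simp_all add: L_TenA)
qed

text \<open>This factorisation into two one-sided products reduces bifunctoriality to functoriality
  on each side together with \<open>L_interchange\<close>.\<close>

lemma L_TenA_split:
  assumes "X \<in> Arr L" "Y \<in> Arr L"
  shows "TenA L X Y = LT (Target X) Y \<star> RT X (Source Y)"
proof -
  from assms obtain a b p c d q where *: "X = frac a b p" "zz a p b" "Y = frac c d q" "zz c q d"
    by (auto elim!: frac_cases)
  then have o: "a \<in> Obj M" "b \<in> Obj M" "c \<in> Obj M" "d \<in> Obj M" using zz_Obj by auto
  show ?thesis using * o L_Comp[OF mr(1)[OF o(3) *(2)] ml(1)[OF o(2) *(4)]]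
    by (simp add: RT_frac LT_frac L_TenA)
qed

lemma RT_lf: "f \<in> Arr M \<Longrightarrow> c \<in> Obj M \<Longrightarrow> RT (lf f) c = lf (f \<otimes> Ident M c)"
  using RT_frac[OF zz_Fwd1, of f c] by (simp add: localised_arrow_def)

lemma LT_lf: "f \<in> Arr M \<Longrightarrow> c \<in> Obj M \<Longrightarrow> LT c (lf f) = lf (Ident M c \<otimes> f)"
  using LT_frac[OF zz_Fwd1, of f c] by (simp add: localised_arrow_def)

lemma RT_Comp:
  assumes "X \<in> Arr L" "Y \<in> Arr L" "Source Y = Target X" "c \<in> Obj M"
  shows "RT (Y \<star> X) c = RT Y c \<star> RT X c"
proof -
  from assms obtain a b p d q where *: "X = frac a b p" "zz a p b" "Y = frac b d q" "zz b q d"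
    by (auto elim!: frac_cases)
  show ?thesis using * assms(4) L_Comp[OF *(2,4)] L_Comp[OF mr(1)[OF assms(4) *(2)] mr(1)[OF assms(4) *(4)]]
    by (simp add: RT_frac zz_append)
qed

lemma LT_Comp:
  assumes "X \<in> Arr L" "Y \<in> Arr L" "Source Y = Target X" "c \<in> Obj M"
  shows "LT c (Y \<star> X) = LT c Y \<star> LT c X"
proof -
  from assms obtain a b p d q where *: "X = frac a b p" "zz a p b" "Y = frac b d q" "zz b q d"
    by (auto elim!: frac_cases)
  show ?thesis using * assms(4) L_Comp[OF *(2,4)] L_Comp[OF ml(1)[OF assms(4) *(2)] ml(1)[OF assms(4) *(4)]]
    by (simp add: LT_frac zz_append)
qed

lemma id_Arr [simp]: "a \<in> Obj M \<Longrightarrow> frac a a [] \<in> Arr L"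
  by (simp add: zigzag_Nil)

lemma TenA_id [simp]: "a \<in> Obj M \<Longrightarrow> b \<in> Obj M \<Longrightarrow> RT (frac a a []) b = frac (a \<odot> b) (a \<odot> b) []"
  using RT_frac[of a "[]" a b] by (simp add: zigzag_Nil)

lemma RT_functor:
  assumes "c \<in> Obj M" shows "is_functor L L \<lparr>Omap = (\<lambda>a. a \<odot> c), Amap = (\<lambda>X. RT X c)\<rparr>"
  using assms LC.Dom_in LC.Cod_in
  by (intro functorI) (auto simp: Hom_iff category_L RT_Comp)

lemma LT_functor:
  assumes "c \<in> Obj M" shows "is_functor L L \<lparr>Omap = (\<lambda>a. c \<odot> a), Amap = (\<lambda>X. LT c X)\<rparr>"
  using assms LC.Dom_in LC.Cod_in
  by (intro functorI) (auto simp: Hom_iff category_L LT_Comp)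

lemma natural_L:
  assumes "is_functor L D \<lparr>Omap = f, Amap = A\<rparr>" "is_functor L D \<lparr>Omap = g, Amap = B\<rparr>"
    and "\<And>a. a \<in> Obj M \<Longrightarrow> \<theta> a \<in> Hom D (f a) (g a)"
    and "\<And>f. f \<in> Arr M \<Longrightarrow> \<theta> (Cod M f) \<cdot>\<^bsub>D\<^esub> A (lf f) = B (lf f) \<cdot>\<^bsub>D\<^esub> \<theta> (Dom M f)"
    and "X \<in> Arr L"
  shows "\<theta> (Target X) \<cdot>\<^bsub>D\<^esub> A X = B X \<cdot>\<^bsub>D\<^esub> \<theta> (Source X)"
  using natural_from_lf[OF assms(1,2), of \<theta> X] assms(3-5) by simp

text \<open>For arrows of \<open>M\<close> this is the interchange law there. It is extended to
  fractions by reading it as naturality twice: in \<open>Y\<close> with a fixed arrow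
  \<open>f\<close> of \<open>M\<close> in place of \<open>X\<close>, and then in \<open>X\<close>
  with \<open>Y\<close> fixed.\<close>

lemma L_interchange:
  assumes X: "X \<in> Arr L" and Y: "Y \<in> Arr L"
  shows "LT (Target X) Y \<star> RT X (Source Y) = RT X (Target Y) \<star> LT (Source X) Y"
proof -
  have o: "Source Y \<in> Obj M" "Target Y \<in> Obj M" using LC.Dom_in LC.Cod_in Y by auto
  have 1: "LT (Cod M f) Y \<star> RT (lf f) (Source Y) = RT (lf f) (Target Y) \<star> LT (Dom M f) Y"
    if f: "f \<in> Arr M" for f
  proof -
    have 2: "LT (Cod M f) (lf g) \<star> RT (lf f) (Dom M g) = RT (lf f) (Cod M g) \<star> LT (Dom M f) (lf g)"
      if g: "g \<in> Arr M" for g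
      using f g by (simp add: RT_lf LT_lf lf_Comp[symmetric] interchange)
    have "RT (lf f) (Target Y) \<star> LT (Dom M f) Y = LT (Cod M f) Y \<star> RT (lf f) (Source Y)"
      by (rule natural_L[OF LT_functor LT_functor]) (use f Y 2 in \<open>simp_all add: Hom_iff\<close>)
    then show ?thesis by simp
  qed
  have 3: "LT a Y \<in> Hom L (a \<odot> Source Y) (a \<odot> Target Y)" if "a \<in> Obj M" for a
    using Y that by (simp add: Hom_iff)
  have 4: "is_functor L L \<lparr>Omap = (\<lambda>a. a \<odot> Source Y), Amap = (\<lambda>X. RT X (Source Y))\<rparr>"
    "is_functor L L \<lparr>Omap = (\<lambda>a. a \<odot> Target Y), Amap = (\<lambda>X. RT X (Target Y))\<rparr>"
    using o by (simp_all add: RT_functor)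
  show ?thesis
    using natural_L[OF 4, of "\<lambda>a. LT a Y" X, OF 3 1 X] .
qed

lemma L_TenA_Comp:
  assumes X: "X \<in> Arr L" "X' \<in> Arr L" "Source X' = Target X" and Y: "Y \<in> Arr L" "Y' \<in> Arr L" "Source Y' = Target Y"
  shows "TenA L (X' \<star> X) (Y' \<star> Y) = TenA L X' Y' \<star> TenA L X Y"
proof -
  note [simp] = LC.Comp_simps[simplified] LC.Dom_in[simplified] LC.Cod_in[simplified]
  have "TenA L (X' \<star> X) (Y' \<star> Y)
      = (LT (Target X') Y' \<star> LT (Target X') Y) \<star> (RT X' (Source Y) \<star> RT X (Source Y))"
    using X Y by (subst L_TenA_split) (auto simp: LT_Comp RT_Comp)
  also have "\<dots> = LT (Target X') Y' \<star> (LT (Target X') Y \<star> RT X' (Source Y)) \<star> RT X (Source Y)"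
    using X Y by (simp add: LC.assoc[simplified])
  also have "\<dots> = LT (Target X') Y' \<star> (RT X' (Target Y) \<star> LT (Source X') Y) \<star> RT X (Source Y)"
    using L_interchange[OF X(2) Y(1)] by simp
  also have "\<dots> = (LT (Target X') Y' \<star> RT X' (Source Y')) \<star> (LT (Target X) Y \<star> RT X (Source Y))"
    using X Y by (simp add: LC.assoc[simplified])
  also have "\<dots> = TenA L X' Y' \<star> TenA L X Y"
    using L_TenA_split[OF X(2) Y(2)] L_TenA_split[OF X(1) Y(1)] by simp
  finally show ?thesis .
qed

lemma lf_TenA:
  assumes "f \<in> Arr M" "g \<in> Arr M" shows "lf (f \<otimes> g) = TenA L (lf f) (lf g)"
  using assms by (subst L_TenA_split) (simp_all add: RT_lf LT_lf lf_Comp[symmetric] interchange)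

text \<open>The predicate \<open>N\<close> is closed under composition in all three variables at
  once (\<open>C\<close>), so it suffices to vary one variable while the other two are identities
  (\<open>N1\<close>, \<open>N2\<close>, \<open>N3\<close>), where \<open>natural_L\<close>
  applies.\<close>

lemma L_Assoc_nat:
  assumes X: "X \<in> Arr L" and Y: "Y \<in> Arr L" and Z: "Z \<in> Arr L"
  shows "Assoc L (Target X) (Target Y) (Target Z) \<star> TenA L (TenA L X Y) Z
    = TenA L X (TenA L Y Z) \<star> Assoc L (Source X) (Source Y) (Source Z)"
proof -
  note [simp] = LC.Comp_simps[simplified] LC.Dom_in[simplified] LC.Cod_in[simplified]
    LC.assoc[simplified] LC.Ident_Comp[simplified] LC.Comp_Ident[simplified]
  define N where "N X Y Z \<longleftrightarrow> Assoc L (Target X) (Target Y) (Target Z) \<star> TenA L (TenA L X Y) Z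
    = TenA L X (TenA L Y Z) \<star> Assoc L (Source X) (Source Y) (Source Z)" for X Y Z
  have lf: "N (lf f) (lf g) (lf h)" if "f \<in> Arr M" "g \<in> Arr M" "h \<in> Arr M" for f g h
    using Assoc_nat[OF arr_Hom[OF that(1)] arr_Hom[OF that(2)] arr_Hom[OF that(3)]] that
    by (simp add: N_def lf_TenA[symmetric] lf_Comp[symmetric])
  have C: "N (X' \<star> X) (Y' \<star> Y) (Z' \<star> Z)" if "N X Y Z" "N X' Y' Z'"
    "X \<in> Arr L" "X' \<in> Arr L" "Source X' = Target X" "Y \<in> Arr L" "Y' \<in> Arr L" "Source Y' = Target Y"
    "Z \<in> Arr L" "Z' \<in> Arr L" "Source Z' = Target Z" for X Y Z X' Y' Z'
  proof -
    let ?a = "lf (Assoc M (Target X) (Target Y) (Target Z))"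
    let ?b = "lf (Assoc M (Target X') (Target Y') (Target Z'))"
    have b: "?b \<star> TenA L (TenA L X' Y') Z' = TenA L X' (TenA L Y' Z') \<star> ?a"
      and a: "?a \<star> TenA L (TenA L X Y) Z = TenA L X (TenA L Y Z) \<star> lf (Assoc M (Source X) (Source Y) (Source Z))"
      using that unfolding N_def by auto
    have "?b \<star> (TenA L (TenA L X' Y') Z' \<star> TenA L (TenA L X Y) Z)
      = (?b \<star> TenA L (TenA L X' Y') Z') \<star> TenA L (TenA L X Y) Z" using that by simp
    also have "\<dots> = TenA L X' (TenA L Y' Z') \<star> (?a \<star> TenA L (TenA L X Y) Z)"
      unfolding b using that by simp
    finally show ?thesis unfolding N_def using that a by (simp add: L_TenA_Comp)
  qed
  have N1: "N V (frac b b []) (frac c c [])" if V: "V \<in> Arr L" and o: "b \<in> Obj M" "c \<in> Obj M" for V b c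
    unfolding N_def L_simps frac_simps
  proof (rule natural_L[where \<theta> = "\<lambda>a. lf (Assoc M a b c)" and f = "\<lambda>a. (a \<odot> b) \<odot> c" and g = "\<lambda>a. a \<odot> b \<odot> c"])
    show "is_functor L L \<lparr>Omap = \<lambda>a. (a \<odot> b) \<odot> c, Amap = \<lambda>V. RT (RT V b) c\<rparr>"
      using o by (intro functorI) (auto simp: Hom_iff category_L RT_Comp)
    show "is_functor L L \<lparr>Omap = \<lambda>a. a \<odot> b \<odot> c, Amap = \<lambda>V. TenA L V (RT (frac b b []) c)\<rparr>"
      using o by (intro functorI) (auto simp: Hom_iff category_L RT_Comp)
  qed (use o V lf[of _ "Ident M b" "Ident M c"] in \<open>auto simp: Hom_iff N_def\<close>)
  have N2: "N (frac b b []) V (frac c c [])" if V: "V \<in> Arr L" and o: "b \<in> Obj M" "c \<in> Obj M" for V b c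
    unfolding N_def L_simps frac_simps
  proof (rule natural_L[where \<theta> = "\<lambda>a. lf (Assoc M b a c)" and f = "\<lambda>a. (b \<odot> a) \<odot> c" and g = "\<lambda>a. b \<odot> a \<odot> c"])
    show "is_functor L L \<lparr>Omap = \<lambda>a. (b \<odot> a) \<odot> c, Amap = \<lambda>V. RT (LT b V) c\<rparr>"
      using o by (intro functorI) (auto simp: Hom_iff category_L RT_Comp LT_Comp)
    show "is_functor L L \<lparr>Omap = \<lambda>a. b \<odot> a \<odot> c, Amap = \<lambda>V. LT b (RT V c)\<rparr>"
      using o by (intro functorI) (auto simp: Hom_iff category_L RT_Comp LT_Comp)
  qed (use o V lf[of "Ident M b" _ "Ident M c"] in \<open>auto simp: Hom_iff N_def\<close>)
  have N3: "N (frac b b []) (frac c c []) V" if V: "V \<in> Arr L" and o: "b \<in> Obj M" "c \<in> Obj M" for V b c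
    unfolding N_def L_simps frac_simps
  proof (rule natural_L[where \<theta> = "\<lambda>a. lf (Assoc M b c a)" and f = "\<lambda>a. (b \<odot> c) \<odot> a" and g = "\<lambda>a. b \<odot> c \<odot> a"])
    show "is_functor L L \<lparr>Omap = \<lambda>a. (b \<odot> c) \<odot> a, Amap = \<lambda>V. TenA L (RT (frac b b []) c) V\<rparr>"
      using o by (intro functorI) (auto simp: Hom_iff category_L LT_Comp)
    show "is_functor L L \<lparr>Omap = \<lambda>a. b \<odot> c \<odot> a, Amap = \<lambda>V. LT b (LT c V)\<rparr>"
      using o by (intro functorI) (auto simp: Hom_iff category_L LT_Comp)
  qed (use o V lf[of "Ident M b" "Ident M c"] in \<open>auto simp: Hom_iff N_def\<close>)
  let ?i = "\<lambda>a. frac a a []"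
  have o: "Source X \<in> Obj M" "Target X \<in> Obj M" "Source Y \<in> Obj M" "Target Y \<in> Obj M"
    "Source Z \<in> Obj M" "Target Z \<in> Obj M" using X Y Z by auto
  \<comment> \<open>\<open>X\<close> is carried out first, then \<open>Y\<close>, then
    \<open>Z\<close>; the variables already treated stay at their targets, the remaining ones at
    their sources.\<close>
  have "N (?i (Target X) \<star> X) (?i (Target Y) \<star> Y) (Z \<star> ?i (Source Z))"
    using C[OF C[OF N1[OF X o(3,5)] N2[OF Y o(2,5)]] N3[OF Z o(2,4)]] X Y Z o by simp
  then show ?thesis using X Y Z unfolding N_def by simp
qed

lemma monoidal_L: "monoidal_category L"
proof -
  note [simp] = LC.Comp_simps[simplified] LC.Dom_in[simplified] LC.Cod_in[simplified]
    LC.assoc[simplified] LC.Ident_Comp[simplified] LC.Comp_Ident[simplified]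
  show ?thesis
  proof
    fix f a b g c d h f' g' a' b' c'
    show "\<one>\<^bsub>L\<^esub> \<in> Obj L" by simp
    show "a \<in> Obj L \<Longrightarrow> b \<in> Obj L \<Longrightarrow> a \<odot>\<^bsub>L\<^esub> b \<in> Obj L" by simp
    show "f \<in> Hom L a b \<Longrightarrow> g \<in> Hom L c d \<Longrightarrow> f \<otimes>\<^bsub>L\<^esub> g \<in> Hom L (a \<odot>\<^bsub>L\<^esub> c) (b \<odot>\<^bsub>L\<^esub> d)"
      by (auto simp: Hom_iff)
    show "a \<in> Obj L \<Longrightarrow> b \<in> Obj L \<Longrightarrow> Ident L a \<otimes>\<^bsub>L\<^esub> Ident L b = Ident L (a \<odot>\<^bsub>L\<^esub> b)" by simp
    show "f \<in> Hom L a b \<Longrightarrow> f' \<in> Hom L b c \<Longrightarrow> g \<in> Hom L a' b' \<Longrightarrow> g' \<in> Hom L b' c'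
      \<Longrightarrow> (f' \<star> f) \<otimes>\<^bsub>L\<^esub> (g' \<star> g) = (f' \<otimes>\<^bsub>L\<^esub> g') \<star> (f \<otimes>\<^bsub>L\<^esub> g)"
      by (rule L_TenA_Comp) (auto simp: Hom_iff)
    show "a \<in> Obj L \<Longrightarrow> b \<in> Obj L \<Longrightarrow> c \<in> Obj L
      \<Longrightarrow> Assoc L a b c \<in> Hom L ((a \<odot>\<^bsub>L\<^esub> b) \<odot>\<^bsub>L\<^esub> c) (a \<odot>\<^bsub>L\<^esub> (b \<odot>\<^bsub>L\<^esub> c))"
      by (simp add: Hom_iff)
    show "a \<in> Obj L \<Longrightarrow> b \<in> Obj L \<Longrightarrow> c \<in> Obj L \<Longrightarrow> isomorphism L (Assoc L a b c)"
      by (simp add: lf_iso' Assoc_iso)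
    show "f \<in> Hom L a a' \<Longrightarrow> g \<in> Hom L b b' \<Longrightarrow> h \<in> Hom L c c'
      \<Longrightarrow> Assoc L a' b' c' \<star> ((f \<otimes>\<^bsub>L\<^esub> g) \<otimes>\<^bsub>L\<^esub> h) = (f \<otimes>\<^bsub>L\<^esub> (g \<otimes>\<^bsub>L\<^esub> h)) \<star> Assoc L a b c"
      using L_Assoc_nat[of f g h] by (auto simp: Hom_iff)
    show "a \<in> Obj L \<Longrightarrow> Lunit L a \<in> Hom L (\<one>\<^bsub>L\<^esub> \<odot>\<^bsub>L\<^esub> a) a" "a \<in> Obj L \<Longrightarrow> isomorphism L (Lunit L a)"
      "a \<in> Obj L \<Longrightarrow> Runit L a \<in> Hom L (a \<odot>\<^bsub>L\<^esub> \<one>\<^bsub>L\<^esub>) a" "a \<in> Obj L \<Longrightarrow> isomorphism L (Runit L a)"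
      by (simp_all add: Hom_iff lf_iso' Lunit_iso Runit_iso)
    have I: "is_functor L L \<lparr>Omap = \<lambda>a. a, Amap = \<lambda>X. X\<rparr>"
      by (intro functorI) (auto simp: Hom_iff category_L)
    have "Lunit L (Target X) \<star> LT \<one> X = X \<star> Lunit L (Source X)" if "X \<in> Arr L" for X
      unfolding L_simps
      by (rule natural_L[OF LT_functor[OF Munit_in] I, where \<theta> = "\<lambda>a. lf (Lunit M a)"])
         (use that Lunit_nat[OF arr_Hom] in \<open>simp_all add: Hom_iff LT_lf lf_Comp[symmetric]\<close>)
    then show "f \<in> Hom L a b \<Longrightarrow> Lunit L b \<star> (Ident L \<one>\<^bsub>L\<^esub> \<otimes>\<^bsub>L\<^esub> f) = f \<star> Lunit L a"
      by (auto simp: Hom_iff)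
    have "Runit L (Target X) \<star> RT X \<one> = X \<star> Runit L (Source X)" if "X \<in> Arr L" for X
      unfolding L_simps
      by (rule natural_L[OF RT_functor[OF Munit_in] I, where \<theta> = "\<lambda>a. lf (Runit M a)"])
         (use that Runit_nat[OF arr_Hom] in \<open>simp_all add: Hom_iff RT_lf lf_Comp[symmetric]\<close>)
    then show "f \<in> Hom L a b \<Longrightarrow> Runit L b \<star> (f \<otimes>\<^bsub>L\<^esub> Ident L \<one>\<^bsub>L\<^esub>) = f \<star> Runit L a"
      by (auto simp: Hom_iff)
    show "a \<in> Obj L \<Longrightarrow> b \<in> Obj L \<Longrightarrow> c \<in> Obj L \<Longrightarrow> d \<in> Obj L
          \<Longrightarrow> Assoc L a b (c \<odot>\<^bsub>L\<^esub> d) \<star> Assoc L (a \<odot>\<^bsub>L\<^esub> b) c d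
            = (Ident L a \<otimes>\<^bsub>L\<^esub> Assoc L b c d) \<star> Assoc L a (b \<odot>\<^bsub>L\<^esub> c) d
                \<star> (Assoc L a b c \<otimes>\<^bsub>L\<^esub> Ident L d)"
      using pentagon[of a b c d] by (simp add: LT_lf RT_lf lf_Comp[symmetric])
    show "a \<in> Obj L \<Longrightarrow> b \<in> Obj L
          \<Longrightarrow> (Ident L a \<otimes>\<^bsub>L\<^esub> Lunit L b) \<star> Assoc L a \<one>\<^bsub>L\<^esub> b = Runit L a \<otimes>\<^bsub>L\<^esub> Ident L b"
      using triangle[of a b] by (simp add: LT_lf RT_lf lf_Comp[symmetric])
  qed
qed

section \<open>The universal property of the category of fractions\<close>

primrec zz_eval ::
  "('p, 'b, 'y) cat_scheme \<Rightarrow> ('o, 'a, 'p, 'b) func \<Rightarrow> 'o \<Rightarrow> 'a step list \<Rightarrow> 'b" where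
  "zz_eval D F a [] = Ident D (Omap F a)"
| "zz_eval D F a (s # p) = (case s of
      Fwd f \<Rightarrow> zz_eval D F (Cod M f) p \<cdot>\<^bsub>D\<^esub> Amap F f
    | Bwd w \<Rightarrow> zz_eval D F (Dom M w) p \<cdot>\<^bsub>D\<^esub> inv_arr D (Amap F w))"

definition extend_func ::
  "('p, 'b, 'y) cat_scheme \<Rightarrow> ('o, 'a, 'p, 'b) func \<Rightarrow> ('o, ('o, 'a) fraction, 'p, 'b) func" where
  "extend_func D F = \<lparr>Omap = Omap F, Amap = (\<lambda>X. zz_eval D F (Source X) (SOME p. p \<in> Body X))\<rparr>"

text \<open>A backward step can be evaluated as soon as the image of the arrow is invertible. Each
  basic relation then becomes an equation in \<open>D\<close>, so evaluation is constant on classes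
  and the representative picked in \<open>extend_func\<close> does not influence the value.\<close>

lemma
  assumes F: "is_functor M D F" and I: "\<And>w. w \<in> W \<Longrightarrow> isomorphism D (Amap F w)"
  shows extend_functor: "is_functor L D (extend_func D F)"
    and extend_lf: "f \<in> Arr M \<Longrightarrow> Amap (extend_func D F) (lf f) = Amap F f"
proof -
  interpret D: category D using F by (simp add: is_functor_def)
  note [simp] = functor_simps[OF F] I
  have H: "zz_eval D F a p \<in> Arr D \<and> Dom D (zz_eval D F a p) = Omap F a \<and> Cod D (zz_eval D F a p) = Omap F b"
    if "zz a p b" for a p b
    using that by induction auto
  have A: "zz_eval D F a (p @ q) = zz_eval D F b q \<cdot>\<^bsub>D\<^esub> zz_eval D F a p" if "zz a p b" "zz b q c" for a p b q c
    using that
  proof induction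
    case (zigzag_Nil a) then show ?case using H[of a q c] by simp
  next
    case (zigzag_Fwd f p b) then show ?case using H[of b q c] H[of "Cod M f" p b] by simp
  next
    case (zigzag_Bwd w p b) then show ?case using H[of b q c] H[of "Dom M w" p b] by simp
  qed
  have B: "zz_eval D F a u = zz_eval D F a v" if "basic_relation M W a b u v" for a b u v
    using that by induction (auto simp: Hom_iff)
  have E: "zz_eval D F a p = zz_eval D F a q" if "eqv a b p q" for a b p q
    using that
  proof induction
    case (zz_basic a p c d u v q b)
    have uv: "zz c u d" "zz c v d" using basic_zz[OF zz_basic(2)] by auto
    show ?case using zz_basic uv A[OF zz_basic(1) zz_append[OF uv(1) zz_basic(3)]]
        A[OF zz_basic(1) zz_append[OF uv(2) zz_basic(3)]] A[OF uv(1) zz_basic(3)] A[OF uv(2) zz_basic(3)]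
        B[OF zz_basic(2)] by simp
  qed simp_all
  have fr: "Amap (extend_func D F) (frac a b p) = zz_eval D F a p" if "zz a p b" for a b p
  proof -
    have "eqv a b p (SOME q. eqv a b p q)" using zz_refl[OF that] by (rule someI)
    then show ?thesis using E unfolding extend_func_def by simp
  qed
  show "is_functor L D (extend_func D F)"
  proof (rule functorI)
    fix X assume "X \<in> Arr L"
    then show "Amap (extend_func D F) X \<in> Hom D (Omap (extend_func D F) (Dom L X)) (Omap (extend_func D F) (Cod L X))"
      using H by (auto elim!: frac_cases simp: fr Hom_iff) (simp_all add: extend_func_def)
  next
    fix X Y assume *: "X \<in> Arr L" "Y \<in> Arr L" "Dom L Y = Cod L X"
    then obtain a b p c q where "X = frac a b p" "zz a p b" "Y = frac b c q" "zz b q c"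
      by (auto elim!: frac_cases)
    then show "Amap (extend_func D F) (Y \<star> X) = Amap (extend_func D F) Y \<cdot>\<^bsub>D\<^esub> Amap (extend_func D F) X"
      using A by (simp add: L_Comp fr zz_append)
  next
    fix a assume "a \<in> Obj L"
    then show "Amap (extend_func D F) (Ident L a) = Ident D (Omap (extend_func D F) a)"
      using fr[OF zigzag_Nil[of a]] by (simp add: extend_func_def)
  qed (auto simp: category_L D.category_axioms extend_func_def)
  show "f \<in> Arr M \<Longrightarrow> Amap (extend_func D F) (lf f) = Amap F f"
    using fr[OF zz_Fwd1] by (simp add: localised_arrow_def)
qed

end

section \<open>Commutative monoids in strict braided monoidal categories\<close>

text \<open>Composites are normalised to the right; this form applies an equation between the two
  leading factors in front of a further factor.\<close>

lemma (in category) push: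
  assumes "g \<cdot> f = r" "f \<in> Arr C" "g \<in> Arr C" "h \<in> Arr C" "Dom C g = Cod C f" "Cod C h = Dom C f"
  shows "g \<cdot> f \<cdot> h = r \<cdot> h"
  using assms(2-6) assoc[of h f g] unfolding assms(1)[symmetric] by (metis)

locale strict_braided = braided_monoidal_category C + strict_monoidal_category C
  for C :: "('o, 'a, 'z) brcat_scheme" (structure)
begin

abbreviation I where "I a \<equiv> Ident C a"

declare strict_assoc [simp] strict_lunit [simp] strict_runit [simp]
  strict_Assoc [simp] strict_Lunit [simp] strict_Runit [simp]

lemma TenA_assoc [simp]:
  "f \<in> Arr C \<Longrightarrow> g \<in> Arr C \<Longrightarrow> h \<in> Arr C \<Longrightarrow> (f \<otimes> g) \<otimes> h = f \<otimes> (g \<otimes> h)"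
  using Assoc_nat[OF arr_Hom arr_Hom arr_Hom, of f g h] by simp

lemma unit_TenA [simp]: "f \<in> Arr C \<Longrightarrow> I \<one> \<otimes> f = f" "f \<in> Arr C \<Longrightarrow> f \<otimes> I \<one> = f"
  using Lunit_nat[OF arr_Hom, of f] Runit_nat[OF arr_Hom, of f] by simp_all

lemma TenA_Ident_left [simp]:
  "a \<in> Obj C \<Longrightarrow> b \<in> Obj C \<Longrightarrow> f \<in> Arr C \<Longrightarrow> I a \<otimes> (I b \<otimes> f) = I (a \<odot> b) \<otimes> f"
  by (simp flip: TenA_assoc)

lemma wr: "f \<in> Arr C \<Longrightarrow> g \<in> Arr C \<Longrightarrow> Dom C g = Cod C f \<Longrightarrow> a \<in> Obj C
    \<Longrightarrow> (g \<cdot> f) \<otimes> I a = (g \<otimes> I a) \<cdot> (f \<otimes> I a)"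
  by (simp add: interchange)

lemma wl: "f \<in> Arr C \<Longrightarrow> g \<in> Arr C \<Longrightarrow> Dom C g = Cod C f \<Longrightarrow> a \<in> Obj C
    \<Longrightarrow> I a \<otimes> (g \<cdot> f) = (I a \<otimes> g) \<cdot> (I a \<otimes> f)"
  by (simp add: interchange)

lemma slide: "f \<in> Arr C \<Longrightarrow> g \<in> Arr C \<Longrightarrow> Cod C f = a \<Longrightarrow> Dom C g = b \<Longrightarrow> Cod C g = b' \<Longrightarrow> Dom C f = a'
    \<Longrightarrow> (I a \<otimes> g) \<cdot> (f \<otimes> I b) = (f \<otimes> I b') \<cdot> (I a' \<otimes> g)"
  by (auto simp add: interchange)

lemma Braid_simps [simp]:
  assumes "a \<in> Obj C" "b \<in> Obj C"
  shows "Braid C a b \<in> Arr C" "Dom C (Braid C a b) = a \<odot> b" "Cod C (Braid C a b) = b \<odot> a"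
  using Braid_in[OF assms] by (auto simp: Hom_iff)

lemma Braid_natural: "f \<in> Arr C \<Longrightarrow> g \<in> Arr C
    \<Longrightarrow> Braid C (Cod C f) (Cod C g) \<cdot> (f \<otimes> g) = (g \<otimes> f) \<cdot> Braid C (Dom C f) (Dom C g)"
  using Braid_nat[OF arr_Hom arr_Hom] .

lemma Braid_right: "a \<in> Obj C \<Longrightarrow> b \<in> Obj C \<Longrightarrow> c \<in> Obj C
    \<Longrightarrow> Braid C a (b \<odot> c) = (I b \<otimes> Braid C a c) \<cdot> (Braid C a b \<otimes> I c)"
  using hexagon_left[of a b c] by simp

lemma Braid_left: "a \<in> Obj C \<Longrightarrow> b \<in> Obj C \<Longrightarrow> c \<in> Obj C
    \<Longrightarrow> Braid C (a \<odot> b) c = (Braid C a c \<otimes> I b) \<cdot> (I a \<otimes> Braid C b c)"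
  using hexagon_right[of a b c] by simp

lemma idempotent_iso:
  assumes "isomorphism C f" "Cod C f = Dom C f" "f = f \<cdot> f" shows "f = I (Dom C f)"
  using iso_cancel_left[OF assms(1), of f "I (Dom C f)"] assms iso_arr[OF assms(1)] by simp

text \<open>In the strict case the hexagons with two unit arguments say that these braidings are
  idempotent, and an idempotent isomorphism is an identity.\<close>

lemma Braid_unit [simp]:
  assumes "a \<in> Obj C" shows "Braid C a \<one> = I a" "Braid C \<one> a = I a"
proof -
  show "Braid C a \<one> = I a"
    using idempotent_iso[OF Braid_iso[of a \<one>]] Braid_right[of a \<one> \<one>] assms by simp
  show "Braid C \<one> a = I a"
    using idempotent_iso[OF Braid_iso[of \<one> a]] Braid_left[of \<one> \<one> a] assms by simp
qed

end

locale commutative_monoid_object = strict_braided C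
  for C :: "('o, 'a, 'z) brcat_scheme" (structure) +
  fixes A :: 'o and \<mu> \<iota> :: 'a
  assumes A_in [simp]: "A \<in> Obj C"
    and mu_in [simp]: "\<mu> \<in> Arr C" "Dom C \<mu> = A \<odot> A" "Cod C \<mu> = A"
    and iota_in [simp]: "\<iota> \<in> Arr C" "Dom C \<iota> = \<one>" "Cod C \<iota> = A"
    and mu_assoc: "\<mu> \<cdot> (\<mu> \<otimes> Ident C A) = \<mu> \<cdot> (Ident C A \<otimes> \<mu>)"
    and mu_left: "\<mu> \<cdot> (\<iota> \<otimes> Ident C A) = Ident C A"
    and mu_right: "\<mu> \<cdot> (Ident C A \<otimes> \<iota>) = Ident C A"
    and mu_comm: "\<mu> \<cdot> Braid C A A = \<mu>"
begin

abbreviation "c \<equiv> Braid C A A"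

text \<open>
  The structure by which the powers of \<open>A\<close> and the images of corollas are compared:
  the object \<open>E\<close> has \<open>k\<close> slots, and \<open>m y\<close> multiplies a further factor \<open>A\<close> into slot \<open>y\<close>.
\<close>

definition slot_object :: "'o \<Rightarrow> nat \<Rightarrow> (nat \<Rightarrow> 'a) \<Rightarrow> bool" where
  "slot_object E k m \<longleftrightarrow> E \<in> Obj C \<and>
     (\<forall>y<k. m y \<in> Arr C \<and> Dom C (m y) = E \<odot> A \<and> Cod C (m y) = E) \<and>
     (\<forall>y z. y \<le> z \<longrightarrow> z < k \<longrightarrow> m y \<cdot> (m z \<otimes> I A) = m z \<cdot> (m y \<otimes> I A) \<cdot> (I E \<otimes> c)) \<and>
     (\<forall>y<k. m y \<cdot> (m y \<otimes> I A) = m y \<cdot> (I E \<otimes> \<mu>)) \<and>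
     (\<forall>y<k. m y \<cdot> (I E \<otimes> \<iota>) = I E)"

lemma slot_objectD:
  assumes "slot_object E k m"
  shows "E \<in> Obj C" "y < k \<Longrightarrow> m y \<in> Arr C" "y < k \<Longrightarrow> Dom C (m y) = E \<odot> A" "y < k \<Longrightarrow> Cod C (m y) = E"
    and "y \<le> z \<Longrightarrow> z < k \<Longrightarrow> m y \<cdot> (m z \<otimes> I A) = m z \<cdot> (m y \<otimes> I A) \<cdot> (I E \<otimes> c)"
    and "y < k \<Longrightarrow> m y \<cdot> (m y \<otimes> I A) = m y \<cdot> (I E \<otimes> \<mu>)"
    and "y < k \<Longrightarrow> m y \<cdot> (I E \<otimes> \<iota>) = I E"
  using assms unfolding slot_object_def by blast+

text \<open>A map with source \<open>Dom C u \<odot> pw (length xs)\<close>: the factors are taken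
  from left to right, and factor \<open>j\<close> is multiplied into slot
  \<open>xs ! j\<close>.\<close>

definition Phi :: "(nat \<Rightarrow> 'a) \<Rightarrow> 'a \<Rightarrow> nat list \<Rightarrow> 'a" where
  "Phi m = foldl (\<lambda>v y. m y \<cdot> (v \<otimes> I A))"

primrec pw :: "nat \<Rightarrow> 'o" where
  "pw 0 = \<one>"
| "pw (Suc n) = pw n \<odot> A"

lemma pw_Obj [simp]: "pw n \<in> Obj C"
  by (induction n) auto

lemma pw_add: "pw (m + n) = pw m \<odot> pw n"
  by (induction n) auto

lemma pw_comm: "A \<odot> pw n = pw n \<odot> A"
  using pw_add[of 1 n] by simp

lemma pw_comm': "b \<in> Obj C \<Longrightarrow> A \<odot> pw n \<odot> b = pw n \<odot> A \<odot> b"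
  by (metis A_in pw_Obj pw_comm strict_assoc)

lemma Phi_Nil [simp]: "Phi m u [] = u"
  and Phi_snoc [simp]: "Phi m u (xs @ [y]) = m y \<cdot> (Phi m u xs \<otimes> I A)"
  and Phi_Cons: "Phi m u (y # xs) = Phi m (m y \<cdot> (u \<otimes> I A)) xs"
  and Phi_append: "Phi m u (xs @ ys) = Phi m (Phi m u xs) ys"
  by (auto simp: Phi_def)

lemma Phi_arr:
  assumes "slot_object E k m" "u \<in> Arr C" "Cod C u = E" "set xs \<subseteq> {..<k}"
  shows "Phi m u xs \<in> Arr C" "Dom C (Phi m u xs) = Dom C u \<odot> pw (length xs)" "Cod C (Phi m u xs) = E"
proof -
  have "Phi m u xs \<in> Arr C \<and> Dom C (Phi m u xs) = Dom C u \<odot> pw (length xs) \<and> Cod C (Phi m u xs) = E"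
    using assms(4) by (induction xs rule: rev_induct) (auto simp: assms slot_objectD[OF assms(1)])
  then show "Phi m u xs \<in> Arr C" "Dom C (Phi m u xs) = Dom C u \<odot> pw (length xs)" "Cod C (Phi m u xs) = E"
    by auto
qed

text \<open>This is naturality of the braiding in its second argument, applied to the arrow
  \<open>c\<close> itself and expanded by a hexagon.\<close>

lemma yang_baxter: "(c \<otimes> I A) \<cdot> (I A \<otimes> c) \<cdot> (c \<otimes> I A) = (I A \<otimes> c) \<cdot> (c \<otimes> I A) \<cdot> (I A \<otimes> c)"
  using Braid_natural[of "I A" c] by (simp add: Braid_right)

lemma braid_mu: "c \<cdot> (\<mu> \<otimes> I A) = (I A \<otimes> \<mu>) \<cdot> (c \<otimes> I A) \<cdot> (I A \<otimes> c)"
  using Braid_natural[of \<mu> "I A"] by (simp add: Braid_left)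

lemma braid_mu': "c \<cdot> (I A \<otimes> \<mu>) = (\<mu> \<otimes> I A) \<cdot> (I A \<otimes> c) \<cdot> (c \<otimes> I A)"
  using Braid_natural[of "I A" \<mu>] by (simp add: Braid_right)

lemma braid_iota: "c \<cdot> (I A \<otimes> \<iota>) = \<iota> \<otimes> I A" "c \<cdot> (\<iota> \<otimes> I A) = I A \<otimes> \<iota>"
  using Braid_natural[of "I A" \<iota>] Braid_natural[of \<iota> "I A"] by simp_all

text \<open>A new last slot is appended; on its way to an older slot a factor first crosses it by
  \<open>c\<close>. The commutation rule for two older slots is the Yang-Baxter equation, for an
  older and the new slot it is naturality of the braiding with respect to \<open>\<mu>\<close>, and
  for the new slot with itself it is associativity together with commutativity of
  \<open>\<mu>\<close>. The other two rules follow from naturality with respect to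
  \<open>\<mu>\<close> and \<open>\<iota>\<close> and from the monoid laws.\<close>

lemma slot_object_Suc:
  assumes m: "slot_object E k m"
  shows "slot_object (E \<odot> A) (Suc k) (\<lambda>y. if y < k then (m y \<otimes> I A) \<cdot> (I E \<otimes> c) else I E \<otimes> \<mu>)"
    (is "slot_object _ _ ?m")
proof -
  note [simp] = slot_objectD(1-4)[OF m]
  have w: "I E \<otimes> (g \<cdot> f) = (I E \<otimes> g) \<cdot> (I E \<otimes> f)" if "f \<in> Arr C" "g \<in> Arr C" "Dom C g = Cod C f" for f g
    using that by (simp add: wl)
  have slide': "(I E \<otimes> c) \<cdot> (m z \<otimes> I (A \<odot> A)) \<cdot> h = (m z \<otimes> I (A \<odot> A)) \<cdot> (I (E \<odot> A) \<otimes> c) \<cdot> h"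
    if "z < k" "h \<in> Arr C" "Cod C h = E \<odot> A \<odot> A \<odot> A" for z h
    using that push[OF slide[of "m z" c E "A \<odot> A" "A \<odot> A" "E \<odot> A"], of h] by simp
  have R1: "?m y \<cdot> (?m z \<otimes> I A) = ?m z \<cdot> (?m y \<otimes> I A) \<cdot> (I (E \<odot> A) \<otimes> c)"
    if "y \<le> z" "z < Suc k" for y z
  proof -
    consider "z < k" | "y < k" "z = k" | "y = k" "z = k" using \<open>y \<le> z\<close> \<open>z < Suc k\<close> by linarith
    then show ?thesis
    proof cases
      case 1
      then have yk: "y < k" using \<open>y \<le> z\<close> by simp
      have 2: "(m y \<otimes> I A) \<cdot> (m z \<otimes> I (A \<odot> A)) \<cdot> h = (m z \<otimes> I A) \<cdot> (m y \<otimes> I (A \<odot> A)) \<cdot> (I E \<otimes> c \<otimes> I A) \<cdot> h"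
        if "h \<in> Arr C" "Cod C h = E \<odot> A \<odot> A \<odot> A" for h
      proof -
        have "(m y \<otimes> I A) \<cdot> (m z \<otimes> I (A \<odot> A)) = (m y \<cdot> (m z \<otimes> I A)) \<otimes> I A"
          using 1 yk by (simp add: wr)
        also have "\<dots> = (m z \<otimes> I A) \<cdot> (m y \<otimes> I (A \<odot> A)) \<cdot> (I E \<otimes> c \<otimes> I A)"
          unfolding slot_objectD(5)[OF m \<open>y \<le> z\<close> 1] using 1 yk by (simp add: wr)
        finally show ?thesis using push[of "m y \<otimes> I A" "m z \<otimes> I (A \<odot> A)" _ h] that 1 yk by simp
      qed
      have 3: "(I E \<otimes> c \<otimes> I A) \<cdot> (I (E \<odot> A) \<otimes> c) \<cdot> (I E \<otimes> c \<otimes> I A)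
          = (I (E \<odot> A) \<otimes> c) \<cdot> (I E \<otimes> c \<otimes> I A) \<cdot> (I (E \<odot> A) \<otimes> c)"
        using arg_cong[OF yang_baxter, of "\<lambda>f. I E \<otimes> f"] by (simp add: w)
      have "?m y \<cdot> (?m z \<otimes> I A) = (m y \<otimes> I A) \<cdot> (I E \<otimes> c) \<cdot> (m z \<otimes> I (A \<odot> A)) \<cdot> (I E \<otimes> c \<otimes> I A)"
        using 1 yk by (simp add: wr)
      also have "\<dots> = (m z \<otimes> I A) \<cdot> (m y \<otimes> I (A \<odot> A)) \<cdot> (I (E \<odot> A) \<otimes> c) \<cdot> (I E \<otimes> c \<otimes> I A) \<cdot> (I (E \<odot> A) \<otimes> c)"
        using 1 yk by (simp add: slide' 2 3)
      also have "\<dots> = (m z \<otimes> I A) \<cdot> (I E \<otimes> c) \<cdot> (m y \<otimes> I (A \<odot> A)) \<cdot> (I E \<otimes> c \<otimes> I A) \<cdot> (I (E \<odot> A) \<otimes> c)"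
        using 1 yk by (simp add: slide')
      also have "\<dots> = ?m z \<cdot> (?m y \<otimes> I A) \<cdot> (I (E \<odot> A) \<otimes> c)"
        using 1 yk by (simp add: wr)
      finally show ?thesis .
    next
      case 2
      have "?m y \<cdot> (?m z \<otimes> I A) = (m y \<otimes> I A) \<cdot> (I E \<otimes> (c \<cdot> (\<mu> \<otimes> I A)))"
        using 2 by (simp add: w)
      also have "\<dots> = ((m y \<otimes> I A) \<cdot> (I (E \<odot> A) \<otimes> \<mu>)) \<cdot> (I E \<otimes> c \<otimes> I A) \<cdot> (I (E \<odot> A) \<otimes> c)"
        unfolding braid_mu using 2 by (simp add: w)
      also have "(m y \<otimes> I A) \<cdot> (I (E \<odot> A) \<otimes> \<mu>) = (I E \<otimes> \<mu>) \<cdot> (m y \<otimes> I (A \<odot> A))"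
        using 2 by (simp add: slide)
      finally show ?thesis using 2 by (simp add: wr)
    next
      case 3
      have "\<mu> \<cdot> (\<mu> \<otimes> I A) = \<mu> \<cdot> (I A \<otimes> (\<mu> \<cdot> c))" by (simp add: mu_comm mu_assoc)
      also have "\<dots> = (\<mu> \<cdot> (I A \<otimes> \<mu>)) \<cdot> (I A \<otimes> c)" by (simp add: wl)
      also have "\<dots> = \<mu> \<cdot> (\<mu> \<otimes> I A) \<cdot> (I A \<otimes> c)" unfolding mu_assoc[symmetric] by simp
      finally have "I E \<otimes> (\<mu> \<cdot> (\<mu> \<otimes> I A)) = I E \<otimes> (\<mu> \<cdot> (\<mu> \<otimes> I A) \<cdot> (I A \<otimes> c))" by simp
      then show ?thesis using 3 by (simp add: w)
    qed
  qed
  have R2: "?m y \<cdot> (?m y \<otimes> I A) = ?m y \<cdot> (I (E \<odot> A) \<otimes> \<mu>)" if "y < Suc k" for y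
  proof (cases "y < k")
    case True
    have "?m y \<cdot> (?m y \<otimes> I A) = (m y \<otimes> I A) \<cdot> (I E \<otimes> c) \<cdot> (m y \<otimes> I (A \<odot> A)) \<cdot> (I E \<otimes> c \<otimes> I A)"
      using True by (simp add: wr)
    also have "\<dots> = ((m y \<cdot> (m y \<otimes> I A)) \<otimes> I A) \<cdot> (I (E \<odot> A) \<otimes> c) \<cdot> (I E \<otimes> c \<otimes> I A)"
      using True by (simp add: slide' wr)
    also have "\<dots> = (m y \<otimes> I A) \<cdot> (I E \<otimes> ((\<mu> \<otimes> I A) \<cdot> (I A \<otimes> c) \<cdot> (c \<otimes> I A)))"
      unfolding slot_objectD(6)[OF m True] using True by (simp add: wr w)
    also have "\<dots> = ?m y \<cdot> (I (E \<odot> A) \<otimes> \<mu>)"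
      unfolding braid_mu'[symmetric] using True by (simp add: w)
    finally show ?thesis .
  next
    case False
    then show ?thesis using arg_cong[OF mu_assoc, of "\<lambda>f. I E \<otimes> f"] by (simp add: w)
  qed
  have R3: "?m y \<cdot> (I (E \<odot> A) \<otimes> \<iota>) = I (E \<odot> A)" if "y < Suc k" for y
  proof (cases "y < k")
    case True
    have "?m y \<cdot> (I (E \<odot> A) \<otimes> \<iota>) = (m y \<otimes> I A) \<cdot> (I E \<otimes> (c \<cdot> (I A \<otimes> \<iota>)))"
      using True by (simp add: w)
    also have "\<dots> = (m y \<cdot> (I E \<otimes> \<iota>)) \<otimes> I A" using True by (simp add: braid_iota wr)
    also have "\<dots> = I (E \<odot> A)" using True by (simp add: slot_objectD(7)[OF m])
    finally show ?thesis .
  next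
    case False
    then show ?thesis using arg_cong[OF mu_right, of "\<lambda>f. I E \<otimes> f"] by (simp add: w)
  qed
  show ?thesis unfolding slot_object_def using R1 R2 R3 by auto
qed

text \<open>Unfolding the recursion, the added factor on the right travels leftwards across slots
  \<open>n - 1\<close> down to \<open>y + 1\<close>, always by the same \<open>c\<close>, and is
  then multiplied into slot \<open>y\<close>.\<close>

primrec slot :: "nat \<Rightarrow> nat \<Rightarrow> 'a" where
  "slot 0 = (\<lambda>y. I \<one>)"
| "slot (Suc n) = (\<lambda>y. if y < n then (slot n y \<otimes> I A) \<cdot> (I (pw n) \<otimes> c) else I (pw n) \<otimes> \<mu>)"

primrec eps :: "nat \<Rightarrow> 'a" where
  "eps 0 = I \<one>"
| "eps (Suc n) = eps n \<otimes> \<iota>"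

lemma slot_object_pw: "slot_object (pw n) n (slot n)"
proof (induction n)
  case 0 then show ?case by (simp add: slot_object_def)
next
  case (Suc n) then show ?case using slot_object_Suc by simp
qed

lemmas slot_simps [simp] = slot_objectD(2-4)[OF slot_object_pw]

lemma eps_simps [simp]: "eps n \<in> Arr C" "Dom C (eps n) = \<one>" "Cod C (eps n) = pw n"
  by (induction n) auto

text \<open>All slots start with the unit, so slots missed by \<open>xs\<close> end up carrying
  \<open>\<iota>\<close>. This is the map from \<open>pw (length xs)\<close> to \<open>pw n\<close>
  attached to a map of finite sets written as a list.\<close>

definition Phin :: "nat \<Rightarrow> nat list \<Rightarrow> 'a" where
  "Phin n xs = Phi (slot n) (eps n) xs"

lemma Phin_simps [simp]:
  assumes "set xs \<subseteq> {..<n}"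
  shows "Phin n xs \<in> Arr C" "Dom C (Phin n xs) = pw (length xs)" "Cod C (Phin n xs) = pw n"
  using Phi_arr[OF slot_object_pw, of "eps n" n xs] assms unfolding Phin_def by simp_all

lemma Phin_Nil [simp]: "Phin n [] = eps n"
  and Phin_snoc [simp]: "Phin n (xs @ [y]) = slot n y \<cdot> (Phin n xs \<otimes> I A)"
  by (simp_all add: Phin_def)

text \<open>On the left the added factor crosses the slots \<open>j > y\<close>. Each crossing is
  absorbed in \<open>E\<close> by the commutation rule of a slot object, which demands
  \<open>ys ! y \<le> ys ! j\<close>; once the factor has arrived, two factors for the same slot are
  multiplied.\<close>

lemma Phi_slot:
  assumes m: "slot_object E k m" "u \<in> Arr C" "Cod C u = E" "Dom C u = \<one>"
    and "set ys \<subseteq> {..<k}" "y < length ys" "\<And>j. y < j \<Longrightarrow> j < length ys \<Longrightarrow> ys ! y \<le> ys ! j"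
  shows "Phi m u ys \<cdot> slot (length ys) y = m (ys ! y) \<cdot> (Phi m u ys \<otimes> I A)"
  using assms(5-7)
proof (induction ys rule: rev_induct)
  case (snoc w ys)
  note [simp] = slot_objectD(1-4)[OF m(1)]
  let ?n = "length ys" let ?P = "Phi m u ys"
  have P [simp]: "?P \<in> Arr C" "Dom C ?P = pw ?n" "Cod C ?P = E"
    using Phi_arr[OF m(1-3), of ys] snoc m(4) by auto
  have wk: "w < k" using snoc by simp
  show ?case
  proof (cases "y < ?n")
    case True
    let ?z = "ys ! y"
    have zk: "?z < k" using True snoc.prems(1) by (simp add: subset_iff)
    have zw: "?z \<le> w" using snoc.prems(3)[of ?n] True by (simp add: nth_append)
    have IH: "?P \<cdot> slot ?n y = m ?z \<cdot> (?P \<otimes> I A)"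
    proof (rule snoc.IH)
      fix j assume "y < j" "j < ?n"
      then show "ys ! y \<le> ys ! j" using snoc.prems(3)[of j] True by (simp add: nth_append)
    qed (use snoc True in auto)
    have "Phi m u (ys @ [w]) \<cdot> slot (length (ys @ [w])) y
       = m w \<cdot> ((?P \<cdot> slot ?n y) \<otimes> I A) \<cdot> (I (pw ?n) \<otimes> c)"
      using True wk by (simp add: wr)
    also have "\<dots> = m w \<cdot> (m ?z \<otimes> I A) \<cdot> (?P \<otimes> I (A \<odot> A)) \<cdot> (I (pw ?n) \<otimes> c)"
      unfolding IH using zk wk by (simp add: wr)
    also have "(?P \<otimes> I (A \<odot> A)) \<cdot> (I (pw ?n) \<otimes> c) = (I E \<otimes> c) \<cdot> (?P \<otimes> I (A \<odot> A))"
      using slide[of ?P c E "A \<odot> A" "A \<odot> A" "pw ?n"] by simp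
    also have "m w \<cdot> (m ?z \<otimes> I A) \<cdot> (I E \<otimes> c) \<cdot> (?P \<otimes> I (A \<odot> A))
        = (m w \<cdot> (m ?z \<otimes> I A) \<cdot> (I E \<otimes> c)) \<cdot> (?P \<otimes> I (A \<odot> A))"
      using zk wk by simp
    also have "m w \<cdot> (m ?z \<otimes> I A) \<cdot> (I E \<otimes> c) = m ?z \<cdot> (m w \<otimes> I A)"
      using slot_objectD(5)[OF m(1) zw wk] by simp
    finally show ?thesis using True zk wk by (simp add: wr nth_append)
  next
    case False
    then have y: "y = ?n" using snoc by simp
    have "Phi m u (ys @ [w]) \<cdot> slot (length (ys @ [w])) y = m w \<cdot> (?P \<otimes> I A) \<cdot> (I (pw ?n) \<otimes> \<mu>)"
      using wk y by simp
    also have "(?P \<otimes> I A) \<cdot> (I (pw ?n) \<otimes> \<mu>) = (I E \<otimes> \<mu>) \<cdot> (?P \<otimes> I (A \<odot> A))"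
      using slide[of ?P \<mu> E "A \<odot> A" "A" "pw ?n"] by simp
    also have "m w \<cdot> (I E \<otimes> \<mu>) \<cdot> (?P \<otimes> I (A \<odot> A)) = (m w \<cdot> (I E \<otimes> \<mu>)) \<cdot> (?P \<otimes> I (A \<odot> A))"
      using wk by simp
    also have "\<dots> = m w \<cdot> (m w \<otimes> I A) \<cdot> (?P \<otimes> I (A \<odot> A))"
      unfolding slot_objectD(6)[OF m(1) wk, symmetric] using wk by simp
    finally show ?thesis using y wk by (simp add: wr)
  qed
qed simp

lemma Phin_Suc:
  "set xs \<subseteq> {..<n} \<Longrightarrow> Phin (Suc n) xs = Phin n xs \<otimes> \<iota>"
proof (induction xs rule: rev_induct)
  case (snoc y xs)
  then have y: "y < n" and xs: "set xs \<subseteq> {..<n}" "set xs \<subseteq> {..<Suc n}" by auto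
  have "Phin (Suc n) (xs @ [y]) = (slot n y \<otimes> I A) \<cdot> (I (pw n) \<otimes> c) \<cdot> (Phin n xs \<otimes> \<iota> \<otimes> I A)"
    using snoc y xs by simp
  also have "(I (pw n) \<otimes> c) \<cdot> (Phin n xs \<otimes> \<iota> \<otimes> I A) = Phin n xs \<otimes> (c \<cdot> (\<iota> \<otimes> I A))"
    using xs by (simp add: interchange)
  also have "(slot n y \<otimes> I A) \<cdot> (Phin n xs \<otimes> (c \<cdot> (\<iota> \<otimes> I A))) = (slot n y \<cdot> (Phin n xs \<otimes> I A)) \<otimes> \<iota>"
    using xs y interchange[of "Phin n xs \<otimes> I A" "slot n y" \<iota> "I A"] by (simp add: braid_iota)
  finally show ?case by simp
qed simp

lemma Phi_snoc_iota:
  assumes m: "slot_object E k m" "u \<in> Arr C" "Cod C u = E" "Dom C u = \<one>"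
    and "set ys \<subseteq> {..<k}" "w < k"
  shows "Phi m u (ys @ [w]) \<cdot> (I (pw (length ys)) \<otimes> \<iota>) = Phi m u ys"
proof -
  note [simp] = slot_objectD(1-4)[OF m(1)]
  let ?P = "Phi m u ys"
  have P [simp]: "?P \<in> Arr C" "Dom C ?P = pw (length ys)" "Cod C ?P = E"
    using Phi_arr[OF m(1-3), of ys] assms by auto
  have "(?P \<otimes> I A) \<cdot> (I (pw (length ys)) \<otimes> \<iota>) = (I E \<otimes> \<iota>) \<cdot> (?P \<otimes> I \<one>)"
    using slide[of ?P \<iota> E \<one> A "pw (length ys)"] by simp
  then have "Phi m u (ys @ [w]) \<cdot> (I (pw (length ys)) \<otimes> \<iota>) = (m w \<cdot> (I E \<otimes> \<iota>)) \<cdot> ?P"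
    using assms(6) by simp
  then show ?thesis using slot_objectD(7)[OF m(1) assms(6)] by simp
qed

text \<open>Slots from \<open>n\<close> on still hold the unit, which is absorbed when it is
  multiplied in. Discarding them matters because \<open>Phi_slot\<close> imposes a condition on
  every slot that follows, including those not reached yet.\<close>

lemma Phi_Phin_take:
  assumes m: "slot_object E k m" "u \<in> Arr C" "Cod C u = E" "Dom C u = \<one>"
    and "set ys \<subseteq> {..<k}" "n \<le> length ys" "set xs \<subseteq> {..<n}"
  shows "Phi m u ys \<cdot> Phin (length ys) xs = Phi m u (take n ys) \<cdot> Phin n xs"
  using assms(5,6)
proof (induction ys rule: rev_induct)
  case (snoc w ys)
  show ?case
  proof (cases "n \<le> length ys")
    case True
    have xs: "set xs \<subseteq> {..<length ys}" using assms(7) True by auto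
    note P = Phi_arr[OF m(1-3), of "ys @ [w]"] Phi_arr[OF m(1-3), of ys]
    have "Phin (Suc (length ys)) xs = (I (pw (length ys)) \<otimes> \<iota>) \<cdot> Phin (length ys) xs"
      using Phin_Suc[OF xs] xs interchange[of "Phin (length ys) xs" "I (pw (length ys))" "I \<one>" \<iota>] by simp
    then have "Phi m u (ys @ [w]) \<cdot> Phin (Suc (length ys)) xs
        = (Phi m u (ys @ [w]) \<cdot> (I (pw (length ys)) \<otimes> \<iota>)) \<cdot> Phin (length ys) xs"
      using xs P snoc.prems m(4) by (simp del: Phi_snoc)
    then show ?thesis
      using snoc True Phi_snoc_iota[OF m, of ys w] by (simp del: Phi_snoc)
  next
    case False
    then have "n = Suc (length ys)" using snoc.prems by simp
    then show ?thesis by simp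
  qed
qed simp

lemma Phi_eps:
  assumes m: "slot_object E k m" "u \<in> Arr C" "Cod C u = E" "Dom C u = \<one>" and ys: "set ys \<subseteq> {..<k}"
  shows "Phi m u ys \<cdot> eps (length ys) = u"
  using Phi_Phin_take[OF m ys, of 0 "[]"] m by simp

text \<open>
  The hypothesis says that a factor inserted into slot \<open>xs ! j\<close> only has to pass slots that
  it would also pass on the other side.
\<close>

lemma Phi_functorial:
  assumes m: "slot_object E k m" "u \<in> Arr C" "Cod C u = E" "Dom C u = \<one>"
    and ys: "set ys \<subseteq> {..<k}" and "set xs \<subseteq> {..<length ys}"
    and "\<And>i j z. i < j \<Longrightarrow> j < length xs \<Longrightarrow> xs ! j < z \<Longrightarrow> z \<le> xs ! i \<Longrightarrow> ys ! (xs ! j) \<le> ys ! z"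
  shows "Phi m u ys \<cdot> Phin (length ys) xs = Phi m u (map (\<lambda>x. ys ! x) xs)"
  using assms(6,7)
proof (induction xs rule: rev_induct)
  case Nil then show ?case using Phi_eps[OF m ys] by simp
next
  case (snoc y xs)
  note [simp] = slot_objectD(1-4)[OF m(1)]
  let ?n = "length ys"
  \<comment> \<open>After truncation at \<open>c\<close>, a slot \<open>z\<close> beyond
    \<open>y\<close> is bounded by some earlier entry \<open>xs ! i\<close>; these are exactly the
    slots covered by the hypothesis. Including \<open>y\<close> keeps the maximum meaningful when
    \<open>xs\<close> is empty.\<close>
  define c where "c = Suc (Max (set (y # xs)))"
  have c: "set (xs @ [y]) \<subseteq> {..<c}" by (auto simp: c_def less_Suc_eq_le)
  have "Max (set (y # xs)) < ?n" using snoc.prems(1) by (subst Max_less_iff) auto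
  then have cn: "c \<le> ?n" unfolding c_def by (rule Suc_leI)
  have good: "ys ! y \<le> ys ! z" if yz: "y < z" and "z < c" for z
  proof -
    have "Max (set (y # xs)) \<in> set (y # xs)" by (intro Max_in) auto
    moreover have "z \<le> Max (set (y # xs))" using that by (simp add: c_def)
    ultimately obtain x where "x \<in> set xs" "z \<le> x" using yz by auto
    then obtain i where "i < length xs" "z \<le> xs ! i" by (metis in_set_conv_nth)
    then show ?thesis using snoc.prems(2)[of i "length xs" z] yz by (simp add: nth_append)
  qed
  have IH: "Phi m u ys \<cdot> Phin ?n xs = Phi m u (map (\<lambda>x. ys ! x) xs)"
  proof (rule snoc.IH)
    fix i j z assume "i < j" "j < length xs" "xs ! j < z" "z \<le> xs ! i"
    then show "ys ! (xs ! j) \<le> ys ! z" using snoc.prems(2)[of i j z] by (simp add: nth_append)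
  qed (use snoc in auto)
  let ?t = "take c ys"
  have t: "set ?t \<subseteq> {..<k}" "length ?t = c" using ys cn by (auto dest: in_set_takeD)
  have T [simp]: "Phi m u ?t \<in> Arr C" "Dom C (Phi m u ?t) = pw c" "Cod C (Phi m u ?t) = E"
    using Phi_arr[OF m(1-3) t(1)] t(2) m(4) cn by auto
  have cx: "set xs \<subseteq> {..<c}" "y < c" using c by auto
  have yk: "ys ! y < k" using ys snoc.prems(1) by (simp add: subset_iff)
  have "Phi m u ys \<cdot> Phin ?n (xs @ [y]) = Phi m u ?t \<cdot> Phin c (xs @ [y])"
    using Phi_Phin_take[OF m ys cn c] .
  also have "\<dots> = (Phi m u ?t \<cdot> slot c y) \<cdot> (Phin c xs \<otimes> I A)"
    using cx by simp
  also have "Phi m u ?t \<cdot> slot c y = m (ys ! y) \<cdot> (Phi m u ?t \<otimes> I A)"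
    using Phi_slot[OF m t(1), of y] t(2) cx good by simp
  also have "(m (ys ! y) \<cdot> (Phi m u ?t \<otimes> I A)) \<cdot> (Phin c xs \<otimes> I A)
      = m (ys ! y) \<cdot> ((Phi m u ?t \<cdot> Phin c xs) \<otimes> I A)"
    using cx yk by (simp add: wr)
  also have "Phi m u ?t \<cdot> Phin c xs = Phi m u ys \<cdot> Phin ?n xs"
    using Phi_Phin_take[OF m ys cn cx(1)] by simp
  finally show ?case using IH by simp
qed


section \<open>Exchanging and juxtaposing blocks of factors\<close>

lemma Phi_swap1:
  assumes m: "slot_object E k m" "u \<in> Arr C" "Cod C u = E"
    and "set xs \<subseteq> {..<k}" "\<And>x. x \<in> set xs \<Longrightarrow> v \<le> x" "v < k"
  shows "Phi m u (xs @ [v]) = Phi m u (v # xs) \<cdot> (I (Dom C u) \<otimes> Braid C (pw (length xs)) A)"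
  using assms(4,5)
proof (induction xs rule: rev_induct)
  case Nil
  note [simp] = slot_objectD(1-4)[OF m(1)]
  show ?case using m(2,3) assms(6) by (simp add: Phi_Cons)
next
  case (snoc x xs)
  note [simp] = slot_objectD(1-4)[OF m(1)] m(2,3)
  let ?n = "length xs" let ?X = "Dom C u"
  have P [simp]: "Phi m u xs \<in> Arr C" "Dom C (Phi m u xs) = ?X \<odot> pw ?n" "Cod C (Phi m u xs) = E"
    "Phi m u (v # xs) \<in> Arr C" "Dom C (Phi m u (v # xs)) = ?X \<odot> pw ?n \<odot> A" "Cod C (Phi m u (v # xs)) = E"
    using Phi_arr[OF m(1-3), of xs] Phi_arr[OF m(1-3), of "v # xs"] snoc assms(6) by (auto simp: pw_comm)
  have vx: "v \<le> x" "x < k" "v < k" using snoc assms(6) by auto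
  have IH: "m v \<cdot> (Phi m u xs \<otimes> I A) = Phi m u (v # xs) \<cdot> (I ?X \<otimes> Braid C (pw ?n) A)"
    using snoc by simp
  have "Phi m u ((xs @ [x]) @ [v]) = (m v \<cdot> (m x \<otimes> I A)) \<cdot> (Phi m u xs \<otimes> I (A \<odot> A))"
    using vx by (simp add: wr del: append_assoc)
  also have "m v \<cdot> (m x \<otimes> I A) = m x \<cdot> (m v \<otimes> I A) \<cdot> (I E \<otimes> c)"
    using slot_objectD(5)[OF m(1)] vx by simp
  also have "(m x \<cdot> (m v \<otimes> I A) \<cdot> (I E \<otimes> c)) \<cdot> (Phi m u xs \<otimes> I (A \<odot> A))
      = m x \<cdot> (m v \<otimes> I A) \<cdot> ((I E \<otimes> c) \<cdot> (Phi m u xs \<otimes> I (A \<odot> A)))"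
    using vx by simp
  also have "(I E \<otimes> c) \<cdot> (Phi m u xs \<otimes> I (A \<odot> A)) = (Phi m u xs \<otimes> I (A \<odot> A)) \<cdot> (I (?X \<odot> pw ?n) \<otimes> c)"
    by (simp add: slide)
  also have "m x \<cdot> (m v \<otimes> I A) \<cdot> (Phi m u xs \<otimes> I (A \<odot> A)) \<cdot> (I (?X \<odot> pw ?n) \<otimes> c)
      = m x \<cdot> ((m v \<cdot> (Phi m u xs \<otimes> I A)) \<otimes> I A) \<cdot> (I (?X \<odot> pw ?n) \<otimes> c)"
    using vx by (simp add: wr)
  also have "\<dots> = m x \<cdot> (Phi m u (v # xs) \<otimes> I A) \<cdot> (I ?X \<otimes> Braid C (pw ?n \<odot> A) A)"
    unfolding IH using vx by (simp add: wr wl Braid_left pw_comm)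
  finally show ?case using vx Phi_snoc[of m u "v # xs" x] by (simp del: Phi_snoc add: pw_comm pw_comm')
qed

text \<open>Every entry of \<open>ys\<close> is at most every entry of \<open>xs\<close>, so the
  factors for \<open>ys\<close> may be moved in front of the block \<open>xs\<close> one at a time
  by \<open>Phi_swap1\<close>; the crossings assemble to a single braiding of blocks by a hexagon.
  It serves to invert permutations and to compute the image of the braiding of trees.\<close>

lemma Phi_swap:
  assumes m: "slot_object E k m" "u \<in> Arr C" "Cod C u = E"
    and "set xs \<subseteq> {..<k}" "set ys \<subseteq> {..<k}" "\<And>x y. x \<in> set xs \<Longrightarrow> y \<in> set ys \<Longrightarrow> y \<le> x"
  shows "Phi m u (xs @ ys) = Phi m u (ys @ xs) \<cdot> (I (Dom C u) \<otimes> Braid C (pw (length xs)) (pw (length ys)))"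
  using assms(5,6)
proof (induction ys rule: rev_induct)
  case Nil then show ?case using Phi_arr[OF m(1-3) assms(4)] m(2) by simp
next
  case (snoc v ys)
  note [simp] = slot_objectD(1-4)[OF m(1)] m(2,3)
  let ?n = "length xs" let ?l = "length ys" let ?X = "Dom C u"
  have v: "v < k" "set ys \<subseteq> {..<k}" using snoc by auto
  note [simp] = assms(4) v
  let ?P = "Phi m u ys"
  have P [simp]: "?P \<in> Arr C" "Dom C ?P = ?X \<odot> pw ?l" "Cod C ?P = E"
    using Phi_arr[OF m(1-3), of ys] by auto
  have Q: "Phi m ?P xs \<in> Arr C" "Dom C (Phi m ?P xs) = (?X \<odot> pw ?l) \<odot> pw ?n" "Cod C (Phi m ?P xs) = E"
    "Phi m ?P (v # xs) \<in> Arr C" "Dom C (Phi m ?P (v # xs)) = ((?X \<odot> pw ?l) \<odot> pw ?n) \<odot> A" "Cod C (Phi m ?P (v # xs)) = E"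
    using Phi_arr[OF m(1) P(1,3), of xs] Phi_arr[OF m(1) P(1,3), of "v # xs"] by (auto simp: pw_comm)
  have "Phi m u (xs @ ys @ [v]) = m v \<cdot> ((Phi m u (xs @ ys)) \<otimes> I A)"
    using Phi_snoc[of m u "xs @ ys" v] by simp
  also have "\<dots> = m v \<cdot> (Phi m ?P xs \<otimes> I A) \<cdot> (I ?X \<otimes> Braid C (pw ?n) (pw ?l) \<otimes> I A)"
    using snoc Q by (simp add: wr Phi_append)
  also have "\<dots> = (m v \<cdot> (Phi m ?P xs \<otimes> I A)) \<cdot> (I ?X \<otimes> Braid C (pw ?n) (pw ?l) \<otimes> I A)"
    using Q by simp
  also have "m v \<cdot> (Phi m ?P xs \<otimes> I A) = Phi m ?P (v # xs) \<cdot> (I (?X \<odot> pw ?l) \<otimes> Braid C (pw ?n) A)"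
    using Phi_swap1[OF m(1) P(1,3) assms(4), of v] snoc by simp
  also have "(Phi m ?P (v # xs) \<cdot> (I (?X \<odot> pw ?l) \<otimes> Braid C (pw ?n) A)) \<cdot> (I ?X \<otimes> Braid C (pw ?n) (pw ?l) \<otimes> I A)
     = Phi m ?P (v # xs) \<cdot> (I ?X \<otimes> Braid C (pw ?n) (pw ?l \<odot> A))"
    using Q by (simp add: Braid_right wl pw_comm)
  also have "Phi m ?P (v # xs) = Phi m u ((ys @ [v]) @ xs)" by (simp add: Phi_append)
  finally show ?case by simp
qed

lemma slot_add: "slot (m + n) (m + y) = I (pw m) \<otimes> slot n y" if "y < n"
  using that by (induction n) (auto simp: wl pw_add)

lemma Phin_add_left: "set xs \<subseteq> {..<m} \<Longrightarrow> Phin (m + n) xs = Phin m xs \<otimes> eps n"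
proof (induction n)
  case (Suc n)
  have "set xs \<subseteq> {..<m + n}" using Suc by auto
  then show ?case using Suc Phin_Suc[of xs "m + n"] by simp
qed simp

text \<open>The second list is shifted past the first \<open>m\<close> slots, so its factors only
  travel among the last \<open>n\<close> slots and never cross the first block. This yields
  compatibility with tensor products.\<close>

lemma Phin_add:
  assumes "set xs \<subseteq> {..<m}" "set ys \<subseteq> {..<n}"
  shows "Phin (m + n) (xs @ map (\<lambda>y. m + y) ys) = Phin m xs \<otimes> Phin n ys"
  using assms(2)
proof (induction ys rule: rev_induct)
  case Nil then show ?case using Phin_add_left assms by simp
next
  case (snoc y ys)
  have "Phin (m + n) (xs @ map (\<lambda>y. m + y) (ys @ [y])) = slot (m + n) (m + y) \<cdot> (Phin (m + n) (xs @ map (\<lambda>y. m + y) ys) \<otimes> I A)"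
    using Phin_snoc[of "m + n" "xs @ map (\<lambda>y. m + y) ys" "m + y"] by simp
  then show ?case using snoc assms interchange[of "Phin m xs" "I (pw m)" "Phin n ys \<otimes> I A" "slot n y"]
    by (simp add: slot_add)
qed

text \<open>Moving the factor for the top slot to the end costs one invertible braiding, and what
  remains is the map of a permutation of \<open>n\<close> slots tensored with \<open>A\<close>.
  Hence a permutation becomes a composite of braidings, which is what makes the arrows bijective on
  tips invertible.\<close>

lemma iso_Phin:
  "distinct xs \<Longrightarrow> set xs = {..<n} \<Longrightarrow> isomorphism C (Phin n xs)"
proof (induction n arbitrary: xs)
  case 0 then show ?case by (simp add: iso_Ident)
next
  case (Suc n)
  then have "n \<in> set xs" by simp
  then obtain us vs where xs: "xs = us @ n # vs" by (metis split_list)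
  have uv: "distinct (us @ vs)" "set (us @ vs) = {..<n}"
    using Suc.prems unfolding xs by (auto simp: lessThan_Suc)
  then have s: "set us \<subseteq> {..<n}" "set vs \<subseteq> {..<n}" by auto
  then have s: "set us \<subseteq> {..<n}" "set vs \<subseteq> {..<n}" "set us \<subseteq> {..<Suc n}" "set vs \<subseteq> {..<Suc n}" by force+
  let ?u = "Phi (slot (Suc n)) (eps (Suc n)) us"
  note so = slot_object_pw[of "Suc n"]
  note u = Phi_arr[OF so eps_simps(1,3) s(3)]
  have vn: "y \<le> n" if "y \<in> set vs" for y using that s by auto
  \<comment> \<open>The single factor for slot \<open>n\<close> plays the part of the upper block,
    and \<open>vs\<close>, whose entries are smaller, that of the lower one.\<close>
  have "Phi (slot (Suc n)) ?u ([n] @ vs) = Phi (slot (Suc n)) ?u (vs @ [n]) \<cdot> (I (Dom C ?u) \<otimes> Braid C (pw (length [n])) (pw (length vs)))"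
    by (rule Phi_swap[OF so u(1,3)]) (use s vn in auto)
  then have "Phin (Suc n) xs = Phin (Suc n) ((us @ vs) @ [n]) \<cdot> (I (pw (length us)) \<otimes> Braid C A (pw (length vs)))"
    using u(2) unfolding Phin_def xs by (simp add: Phi_append[of _ _ us] del: Phi_snoc eps.simps slot.simps)
  also have "Phin (Suc n) ((us @ vs) @ [n]) = (I (pw n) \<otimes> \<mu>) \<cdot> (Phin n (us @ vs) \<otimes> \<iota> \<otimes> I A)"
    using Phin_Suc[of "us @ vs" n] Phin_simps[of "us @ vs" n] s unfolding Phin_snoc by simp
  also have "\<dots> = Phin n (us @ vs) \<otimes> I A"
    using Phin_simps[of "us @ vs" n] uv(2) interchange[of "Phin n (us @ vs)" "I (pw n)" "\<iota> \<otimes> I A" \<mu>]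
    by (simp add: mu_left)
  finally have "Phin (Suc n) xs = (Phin n (us @ vs) \<otimes> I A) \<cdot> (I (pw (length us)) \<otimes> Braid C A (pw (length vs)))" .
  moreover have "isomorphism C (Phin n (us @ vs) \<otimes> I A)"
    using Suc.IH[OF uv] by (simp add: iso_TenA iso_Ident)
  moreover have "isomorphism C (I (pw (length us)) \<otimes> Braid C A (pw (length vs)))"
    by (simp add: iso_TenA iso_Ident Braid_iso)
  ultimately show ?case
    using Phin_simps[of "us @ vs" n] uv(2) by (simp add: iso_Comp pw_add pw_comm)
qed

end

section \<open>The monoidal category of pruned trees\<close>

lemma inl_inr [simp]:
  "inl x = inl y \<longleftrightarrow> x = y" "inr x = inr y \<longleftrightarrow> x = y" "inl x \<noteq> inr z" "inr z \<noteq> inl x"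
  by (auto simp: inl_def inr_def sum_encode_eq)

lemma cases_sum_simps [simp]: "cases_sum f g (inl x) = f x" "cases_sum f g (inr x) = g x"
  by (auto simp: cases_sum_def inl_def inr_def)

lemma sum_map_simps [simp]: "sum_map f g (inl x) = inl (f x)" "sum_map f g (inr x) = inr (g x)"
  by (auto simp: sum_map_def)

lemma sum_assoc_simps [simp]: "sum_assoc (inl (inl x)) = inl x" "sum_assoc (inl (inr x)) = inr (inl x)"
  "sum_assoc (inr x) = inr (inr x)"
  by (auto simp: sum_assoc_def)

lemma sum_swap_simps [simp]: "sum_swap (inl x) = inr x" "sum_swap (inr x) = inl x"
  by (auto simp: sum_swap_def)

lemma Field_ordered_sum [simp]: "Field (ordered_sum r s) = inl ` Field r \<union> inr ` Field s"
proof
  show "Field (ordered_sum r s) \<subseteq> inl ` Field r \<union> inr ` Field s"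
    by (auto simp: ordered_sum_def Field_def)
  have "inl x \<in> Field (ordered_sum r s)" if x: "x \<in> Field r" for x
  proof -
    obtain y where "(x, y) \<in> r \<or> (y, x) \<in> r" using x unfolding Field_def by blast
    then have "(inl x, inl y) \<in> ordered_sum r s \<or> (inl y, inl x) \<in> ordered_sum r s"
      by (auto simp: ordered_sum_def)
    then show ?thesis by (auto intro: FieldI1 FieldI2)
  qed
  moreover have "inr x \<in> Field (ordered_sum r s)" if x: "x \<in> Field s" for x
  proof -
    obtain y where "(x, y) \<in> s \<or> (y, x) \<in> s" using x unfolding Field_def by blast
    then have "(inr x, inr y) \<in> ordered_sum r s \<or> (inr y, inr x) \<in> ordered_sum r s"
      by (auto simp: ordered_sum_def)
    then show ?thesis by (auto intro: FieldI1 FieldI2)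
  qed
  ultimately show "inl ` Field r \<union> inr ` Field s \<subseteq> Field (ordered_sum r s)" by auto
qed

lemma ordered_sum_iff [simp]:
  "(inl x, inl y) \<in> ordered_sum r s \<longleftrightarrow> (x, y) \<in> r" "(inr x, inr y) \<in> ordered_sum r s \<longleftrightarrow> (x, y) \<in> s"
  "(inl x, inr y) \<in> ordered_sum r s \<longleftrightarrow> x \<in> Field r \<and> y \<in> Field s" "(inr y, inl x) \<notin> ordered_sum r s"
  by (auto simp: ordered_sum_def)

lemma flo_iff: "finite_linear_order r \<longleftrightarrow> finite r \<and> (\<forall>x\<in>Field r. (x, x) \<in> r) \<and>
   (\<forall>x y z. (x, y) \<in> r \<longrightarrow> (y, z) \<in> r \<longrightarrow> (x, z) \<in> r) \<and> (\<forall>x y. (x, y) \<in> r \<longrightarrow> (y, x) \<in> r \<longrightarrow> x = y) \<and>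
   (\<forall>x\<in>Field r. \<forall>y\<in>Field r. (x, y) \<in> r \<or> (y, x) \<in> r)" (is "_ \<longleftrightarrow> ?R")
proof
  assume r: "finite_linear_order r"
  then have "finite r" "refl_on (Field r) r" "trans r" "antisym r" "total_on (Field r) r"
    by (simp_all add: finite_linear_order_def order_on_defs)
  note D = this
  show ?R
  proof (intro conjI)
    show "\<forall>x y z. (x, y) \<in> r \<longrightarrow> (y, z) \<in> r \<longrightarrow> (x, z) \<in> r" using D(3) by (blast dest: transD)
    show "\<forall>x y. (x, y) \<in> r \<longrightarrow> (y, x) \<in> r \<longrightarrow> x = y" using D(4) by (blast dest: antisymD)
    show *: "\<forall>x\<in>Field r. (x, x) \<in> r" using D(2) unfolding refl_on_def .
    show "\<forall>x\<in>Field r. \<forall>y\<in>Field r. (x, y) \<in> r \<or> (y, x) \<in> r"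
      using D(5) * unfolding total_on_def by metis
  qed (rule D(1))
next
  assume R: ?R
  have "finite r" "refl_on (Field r) r" using R unfolding refl_on_def by blast+
  moreover have "trans r" "antisym r" "total_on (Field r) r"
    using R unfolding trans_def antisym_def total_on_def by blast+
  moreover have "r \<subseteq> Field r \<times> Field r" by (auto intro: FieldI1 FieldI2)
  ultimately show "finite_linear_order r" by (simp add: finite_linear_order_def order_on_defs)
qed

lemma floD:
  assumes "finite_linear_order r"
  shows flo_finite: "finite r" "finite (Field r)" and flo_refl: "x \<in> Field r \<Longrightarrow> (x, x) \<in> r"
    and flo_trans: "(x, y) \<in> r \<Longrightarrow> (y, z) \<in> r \<Longrightarrow> (x, z) \<in> r"
    and flo_antisym: "(x, y) \<in> r \<Longrightarrow> (y, x) \<in> r \<Longrightarrow> x = y"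
    and flo_total: "x \<in> Field r \<Longrightarrow> y \<in> Field r \<Longrightarrow> (x, y) \<in> r \<or> (y, x) \<in> r"
  using assms unfolding flo_iff by (blast intro: finite_Field)+

lemma flo_ordered_sum:
  assumes r: "finite_linear_order r" and s: "finite_linear_order s"
  shows "finite_linear_order (ordered_sum r s)"
proof -
  let ?X = "inl ` Field r \<union> inr ` Field s"
  have sub: "ordered_sum r s \<subseteq> ?X \<times> ?X"
    by (auto simp: ordered_sum_def intro: FieldI1 FieldI2)
  then have "finite (ordered_sum r s)"
    using flo_finite(2)[OF r] flo_finite(2)[OF s] by (meson finite_SigmaI finite_UnI finite_imageI finite_subset)
  moreover have "x \<in> ?X \<Longrightarrow> (x, x) \<in> ordered_sum r s" for x
    using flo_refl[OF r] flo_refl[OF s] by auto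
  moreover have "(x, z) \<in> ordered_sum r s" if xy: "(x, y) \<in> ordered_sum r s" and yz: "(y, z) \<in> ordered_sum r s" for x y z
  proof -
    have "x \<in> ?X" "y \<in> ?X" "z \<in> ?X" using sub xy yz by auto
    then show ?thesis using xy yz
      by (elim UnE imageE; simp) (blast intro: flo_trans[OF r] flo_trans[OF s])+
  qed
  moreover have "x = y" if xy: "(x, y) \<in> ordered_sum r s" and yx: "(y, x) \<in> ordered_sum r s" for x y
  proof -
    have "x \<in> ?X" "y \<in> ?X" using sub xy by auto
    then show ?thesis using xy yx flo_antisym[OF r] flo_antisym[OF s] by auto
  qed
  moreover have "(x, y) \<in> ordered_sum r s \<or> (y, x) \<in> ordered_sum r s" if "x \<in> ?X" "y \<in> ?X" for x y
    using that by (elim UnE imageE; simp) (use flo_total[OF r] flo_total[OF s] in blast)+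
  ultimately show ?thesis unfolding flo_iff by (simp add: Field_ordered_sum)
qed

lemma flo_empty: "finite_linear_order {}"
  by (simp add: flo_iff)

text \<open>
  A tree is determined by its set of tips, the preorder of the nodes below them, and their order;
  in these terms a morphism is just a map of tips.
\<close>

definition nle :: "tree \<Rightarrow> nat \<Rightarrow> nat \<Rightarrow> bool" where
  "nle S x y \<longleftrightarrow> (Proj S x, Proj S y) \<in> Nodes S"

abbreviation tle :: "tree \<Rightarrow> nat \<Rightarrow> nat \<Rightarrow> bool" where
  "tle S x y \<equiv> (x, y) \<in> Tips S"

definition tmor :: "tree \<Rightarrow> tree \<Rightarrow> (nat \<Rightarrow> nat) \<Rightarrow> bool" where
  "tmor S T f \<longleftrightarrow> pruned_tree S \<and> pruned_tree T \<and> (\<forall>x\<in>TipSet S. f x \<in> TipSet T) \<and>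
     (\<forall>x\<in>TipSet S. \<forall>y\<in>TipSet S. nle S x y \<longrightarrow> nle T (f x) (f y)) \<and>
     (\<forall>x y. tle S x y \<longrightarrow> nle S x y \<longrightarrow> nle S y x \<longrightarrow> tle T (f x) (f y))"

text \<open>The projection is onto, so the map of nodes can be read off from the map of tips: its
  value at \<open>n\<close> is taken at some tip over \<open>n\<close>, and \<open>tmor_proj\<close>
  shows that the chosen tip is irrelevant.\<close>

definition tarr :: "tree \<Rightarrow> tree \<Rightarrow> (nat \<Rightarrow> nat) \<Rightarrow> tree_arrow" where
  "tarr S T f = tree_map S T f (\<lambda>n. Proj T (f (SOME x. x \<in> TipSet S \<and> Proj S x = n)))"

lemma prunedD:
  assumes "pruned_tree S"
  shows "finite_linear_order (Tips S)" "finite_linear_order (Nodes S)" "Proj S \<in> extensional (TipSet S)"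
    "x \<in> TipSet S \<Longrightarrow> Proj S x \<in> NodeSet S" "Proj S ` TipSet S = NodeSet S"
  using assms unfolding pruned_tree_def PiE_def by auto

lemma nleD:
  assumes "pruned_tree S"
  shows nle_refl: "x \<in> TipSet S \<Longrightarrow> nle S x x"
    and nle_trans: "nle S x y \<Longrightarrow> nle S y z \<Longrightarrow> nle S x z"
    and nle_antisym: "nle S x y \<Longrightarrow> nle S y x \<Longrightarrow> Proj S x = Proj S y"
    and nle_total: "x \<in> TipSet S \<Longrightarrow> y \<in> TipSet S \<Longrightarrow> nle S x y \<or> nle S y x"
  unfolding nle_def
  using flo_refl[OF prunedD(2)[OF assms] prunedD(4)[OF assms]] flo_trans[OF prunedD(2)[OF assms]]
    flo_antisym[OF prunedD(2)[OF assms]]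
    flo_total[OF prunedD(2)[OF assms] prunedD(4)[OF assms] prunedD(4)[OF assms]]
  by blast+

lemma nle_eq:
  assumes "pruned_tree S" "x \<in> TipSet S" "y \<in> TipSet S"
  shows "Proj S x = Proj S y \<longleftrightarrow> nle S x y \<and> nle S y x"
  using nleD[OF assms(1)] assms(2,3) unfolding nle_def by metis

lemma tmorD:
  assumes "tmor S T f"
  shows "pruned_tree S" "pruned_tree T" "x \<in> TipSet S \<Longrightarrow> f x \<in> TipSet T"
    "x \<in> TipSet S \<Longrightarrow> y \<in> TipSet S \<Longrightarrow> nle S x y \<Longrightarrow> nle T (f x) (f y)"
    "tle S x y \<Longrightarrow> nle S x y \<Longrightarrow> nle S y x \<Longrightarrow> tle T (f x) (f y)"
  using assms unfolding tmor_def by blast+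

lemma tmorI:
  assumes "pruned_tree S" "pruned_tree T" "\<And>x. x \<in> TipSet S \<Longrightarrow> f x \<in> TipSet T"
    "\<And>x y. x \<in> TipSet S \<Longrightarrow> y \<in> TipSet S \<Longrightarrow> nle S x y \<Longrightarrow> nle T (f x) (f y)"
    "\<And>x y. x \<in> TipSet S \<Longrightarrow> y \<in> TipSet S \<Longrightarrow> tle S x y \<Longrightarrow> nle S x y \<Longrightarrow> nle S y x \<Longrightarrow> tle T (f x) (f y)"
  shows "tmor S T f"
  unfolding tmor_def using assms by (blast intro: FieldI1 FieldI2)

lemma tarr_ext: "(\<And>x. x \<in> TipSet S \<Longrightarrow> f x = g x) \<Longrightarrow> pruned_tree S \<Longrightarrow> tarr S T f = tarr S T g"
proof -
  assume e: "\<And>x. x \<in> TipSet S \<Longrightarrow> f x = g x" and S: "pruned_tree S"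
  have "f (SOME x. x \<in> TipSet S \<and> Proj S x = n) = g (SOME x. x \<in> TipSet S \<and> Proj S x = n)"
    if "n \<in> NodeSet S" for n
  proof -
    have "\<exists>x. x \<in> TipSet S \<and> Proj S x = n" using that unfolding prunedD(5)[OF S, symmetric] by auto
    then show ?thesis using e by (metis (mono_tags, lifting) someI_ex)
  qed
  then show ?thesis unfolding tarr_def tree_map_def using e by (auto intro!: restrict_ext)
qed

text \<open>Every node lies under a tip, so a node map compatible with \<open>f\<close> on
  projections is the one that \<open>tarr\<close> computes. This brings the arrows given by explicit
  node maps into the normal form.\<close>

lemma tree_map_tarr:
  assumes "tmor S T f" "\<And>x. x \<in> TipSet S \<Longrightarrow> g (Proj S x) = Proj T (f x)"
  shows "tree_map S T f g = tarr S T f"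
proof -
  have "g n = Proj T (f (SOME x. x \<in> TipSet S \<and> Proj S x = n))" if "n \<in> NodeSet S" for n
  proof -
    have "\<exists>x. x \<in> TipSet S \<and> Proj S x = n"
      using that unfolding prunedD(5)[OF tmorD(1)[OF assms(1)], symmetric] by auto
    then show ?thesis using assms(2) by (metis (mono_tags, lifting) someI_ex)
  qed
  then show ?thesis unfolding tarr_def tree_map_def by (auto intro!: restrict_ext)
qed

lemma tmor_proj:
  assumes "tmor S T f" "x \<in> TipSet S"
  shows "Proj T (f (SOME y. y \<in> TipSet S \<and> Proj S y = Proj S x)) = Proj T (f x)"
proof -
  define y where "y = (SOME y. y \<in> TipSet S \<and> Proj S y = Proj S x)"
  have "y \<in> TipSet S \<and> Proj S y = Proj S x" unfolding y_def by (rule someI[of _ x]) (simp add: assms)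
  then have "nle S x y" "nle S y x" "y \<in> TipSet S" using nle_eq[OF tmorD(1)[OF assms(1)]] assms(2) by metis+
  then show ?thesis using nle_antisym tmorD[OF assms(1)] assms(2) unfolding y_def[symmetric] by metis
qed

lemma tarr_tmor:
  assumes f: "tmor S T f" shows "tarr S T f \<in> Arr Omega2"
proof -
  define g where "g n = Proj T (f (SOME x. x \<in> TipSet S \<and> Proj S x = n))" for n
  have g: "g (Proj S x) = Proj T (f x)" if "x \<in> TipSet S" for x
    unfolding g_def using tmor_proj[OF f that] .
  have N: "NodeSet S = Proj S ` TipSet S" using prunedD(5)[OF tmorD(1)[OF f]] by simp
  have "(g a, g b) \<in> Nodes T" if "(a, b) \<in> Nodes S" for a b
  proof -
    have "a \<in> NodeSet S" "b \<in> NodeSet S" using that by (auto intro: FieldI1 FieldI2)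
    then obtain x y where "x \<in> TipSet S" "y \<in> TipSet S" "a = Proj S x" "b = Proj S y" unfolding N by auto
    then show ?thesis using that g tmorD(4)[OF f, of x y] by (simp add: nle_def)
  qed
  moreover have "tle T (f x) (f y)" if "tle S x y" "Proj S x = Proj S y" for x y
    using that tmorD(5)[OF f that(1)] nle_eq[OF tmorD(1)[OF f], of x y] by (metis FieldI1 FieldI2)
  moreover have "g n \<in> NodeSet T" if "n \<in> NodeSet S" for n
    using that tmorD(3)[OF f] prunedD(4)[OF tmorD(2)[OF f]] g unfolding N by auto
  ultimately have "is_tree_morphism S T (restrict f (TipSet S)) (restrict g (NodeSet S))"
    using tmorD(3)[OF f] g prunedD(4)[OF tmorD(1)[OF f]]
    unfolding is_tree_morphism_def by (auto simp: FieldI1 FieldI2)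
  then show ?thesis
    using tmorD(1,2)[OF f] unfolding Omega2_def tarr_def tree_map_def g_def by simp
qed

lemma Arr_tarr:
  assumes "h \<in> Arr Omega2"
  shows "h = tarr (Source h) (Target h) (fst (Body h))" "tmor (Source h) (Target h) (fst (Body h))"
proof -
  obtain S T f g where h: "h = \<lparr>Source = S, Target = T, Body = (f, g)\<rparr>" by (cases h) auto
  have p: "pruned_tree S" "pruned_tree T" and m: "is_tree_morphism S T f g"
    using assms unfolding h by (auto simp: Omega2_def)
  have F: "f \<in> TipSet S \<rightarrow>\<^sub>E TipSet T" "g \<in> NodeSet S \<rightarrow>\<^sub>E NodeSet T"
    and P: "\<And>x. x \<in> TipSet S \<Longrightarrow> Proj T (f x) = g (Proj S x)"
    and N: "\<And>a b. (a, b) \<in> Nodes S \<Longrightarrow> (g a, g b) \<in> Nodes T"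
    and O: "\<And>x y. tle S x y \<Longrightarrow> Proj S x = Proj S y \<Longrightarrow> tle T (f x) (f y)"
    using m unfolding is_tree_morphism_def by blast+
  have t': "tmor S T f"
  proof (rule tmorI)
    fix x y assume "x \<in> TipSet S" "y \<in> TipSet S" "nle S x y"
    then show "nle T (f x) (f y)" using P N unfolding nle_def by simp
  next
    fix x y assume "tle S x y" "nle S x y" "nle S y x"
    then show "tle T (f x) (f y)" using O nle_antisym[OF p(1)] by blast
  qed (use p F in auto)
  then show t: "tmor (Source h) (Target h) (fst (Body h))" unfolding h by simp
  have "h = tree_map S T f g"
    using F unfolding h tree_map_def by (simp add: PiE_def extensional_restrict)
  also have "\<dots> = tarr S T f"
    by (rule tree_map_tarr[OF t']) (simp add: P)
  finally have "h = tarr S T f" .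
  moreover have "Source h = S" "Target h = T" "fst (Body h) = f" by (simp_all add: h)
  ultimately show "h = tarr (Source h) (Target h) (fst (Body h))" by metis
qed

lemma tarr_sel [simp]: "Source (tarr S T f) = S" "Target (tarr S T f) = T"
  "fst (Body (tarr S T f)) = restrict f (TipSet S)"
  by (auto simp: tarr_def tree_map_def)

lemma Omega2_sel [simp]: "Obj Omega2 = {t. pruned_tree t}" "Dom Omega2 = Source" "Cod Omega2 = Target"
  "TenO Omega2 = tree_sum" "Munit Omega2 = empty_tree"
  by (auto simp: Omega2_def)

lemma tarr_Comp:
  assumes f: "tmor S T f" and g: "tmor T U g"
  shows "tmor S U (g \<circ> f)" "Comp Omega2 (tarr T U g) (tarr S T f) = tarr S U (g \<circ> f)"
proof -
  show gf: "tmor S U (g \<circ> f)"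
    by (rule tmorI) (use tmorD[OF f] tmorD[OF g] in auto)
  have r: "f x \<in> TipSet T" "Proj S x \<in> NodeSet S" "Proj T (f x) \<in> NodeSet T" if "x \<in> TipSet S" for x
    using that tmorD[OF f] prunedD(4) by auto
  have "Comp Omega2 (tarr T U g) (tarr S T f) = tree_map S U (g \<circ> f)
     ((\<lambda>n\<in>NodeSet T. Proj U (g (SOME x. x \<in> TipSet T \<and> Proj T x = n)))
      \<circ> (\<lambda>n\<in>NodeSet S. Proj T (f (SOME x. x \<in> TipSet S \<and> Proj S x = n))))"
    unfolding Omega2_def tarr_def tree_map_def using r by (auto intro!: restrict_ext)
  also have "\<dots> = tarr S U (g \<circ> f)"
    by (rule tree_map_tarr[OF gf]) (use r tmor_proj[OF f] tmor_proj[OF g] in simp)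
  finally show "Comp Omega2 (tarr T U g) (tarr S T f) = tarr S U (g \<circ> f)" .
qed

lemma tmor_id: "pruned_tree S \<Longrightarrow> tmor S S (\<lambda>x. x)"
  by (rule tmorI) auto

lemma Ident_tarr: "pruned_tree S \<Longrightarrow> Ident Omega2 S = tarr S S (\<lambda>x. x)"
  unfolding Omega2_def id_def by (simp add: tree_map_tarr tmor_id)

lemma category_Omega2: "category Omega2"
proof
  fix f a b g c h d
  show "f \<in> Arr Omega2 \<Longrightarrow> Dom Omega2 f \<in> Obj Omega2" "f \<in> Arr Omega2 \<Longrightarrow> Cod Omega2 f \<in> Obj Omega2"
    by (auto simp: Omega2_def)
  show "a \<in> Obj Omega2 \<Longrightarrow> Ident Omega2 a \<in> Hom Omega2 a a"
    by (simp add: Ident_tarr Hom_iff tarr_tmor tmor_id)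
  assume "f \<in> Hom Omega2 a b"
  then obtain f' where f: "f = tarr a b f'" "tmor a b f'" using Arr_tarr[of f] by (auto simp: Hom_iff)
  show "Ident Omega2 b \<cdot>\<^bsub>Omega2\<^esub> f = f" "f \<cdot>\<^bsub>Omega2\<^esub> Ident Omega2 a = f"
    using f tmorD(1,2)[OF f(2)] by (simp_all add: Ident_tarr tarr_Comp(2)[OF f(2) tmor_id] tarr_Comp(2)[OF tmor_id f(2)] comp_def)
  assume "g \<in> Hom Omega2 b c"
  then obtain g' where g: "g = tarr b c g'" "tmor b c g'" using Arr_tarr[of g] by (auto simp: Hom_iff)
  show "g \<cdot>\<^bsub>Omega2\<^esub> f \<in> Hom Omega2 a c"
    using f g tarr_Comp[OF f(2) g(2)] by (simp add: Hom_iff tarr_tmor)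
  assume "h \<in> Hom Omega2 c d"
  then obtain h' where h: "h = tarr c d h'" "tmor c d h'" using Arr_tarr[of h] by (auto simp: Hom_iff)
  show "(h \<cdot>\<^bsub>Omega2\<^esub> g) \<cdot>\<^bsub>Omega2\<^esub> f = h \<cdot>\<^bsub>Omega2\<^esub> (g \<cdot>\<^bsub>Omega2\<^esub> f)"
    unfolding f(1) g(1) h(1) tarr_Comp(2)[OF f(2) g(2)] tarr_Comp(2)[OF g(2) h(2)]
      tarr_Comp(2)[OF tarr_Comp(1)[OF f(2) g(2)] h(2)] tarr_Comp(2)[OF f(2) tarr_Comp(1)[OF g(2) h(2)]]
    by (simp add: comp_assoc)
qed

section \<open>The ordered sum in terms of tips\<close>

lemma TipSet_sum [simp]: "TipSet (tree_sum S T) = inl ` TipSet S \<union> inr ` TipSet T"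
  and NodeSet_sum [simp]: "NodeSet (tree_sum S T) = inl ` NodeSet S \<union> inr ` NodeSet T"
  and Tips_sum: "Tips (tree_sum S T) = ordered_sum (Tips S) (Tips T)"
  by (simp_all add: tree_sum_def)

lemma tle_sum [simp]:
  "tle (tree_sum S T) (inl x) (inl y) \<longleftrightarrow> tle S x y" "tle (tree_sum S T) (inr x) (inr y) \<longleftrightarrow> tle T x y"
  "tle (tree_sum S T) (inl x) (inr y) \<longleftrightarrow> x \<in> TipSet S \<and> y \<in> TipSet T" "\<not> tle (tree_sum S T) (inr y) (inl x)"
  by (simp_all add: Tips_sum)

lemma nle_sum [simp]:
  "x \<in> TipSet S \<Longrightarrow> y \<in> TipSet S \<Longrightarrow> nle (tree_sum S T) (inl x) (inl y) \<longleftrightarrow> nle S x y"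
  "x \<in> TipSet T \<Longrightarrow> y \<in> TipSet T \<Longrightarrow> nle (tree_sum S T) (inr x) (inr y) \<longleftrightarrow> nle T x y"
  "x \<in> TipSet S \<Longrightarrow> y \<in> TipSet T \<Longrightarrow> pruned_tree S \<Longrightarrow> pruned_tree T \<Longrightarrow> nle (tree_sum S T) (inl x) (inr y)"
  "x \<in> TipSet S \<Longrightarrow> y \<in> TipSet T \<Longrightarrow> \<not> nle (tree_sum S T) (inr y) (inl x)"
  using prunedD(4) by (auto simp: nle_def tree_sum_def)

lemma pruned_sum [simp]:
  assumes S: "pruned_tree S" and T: "pruned_tree T" shows "pruned_tree (tree_sum S T)"
proof -
  have "Proj (tree_sum S T) \<in> TipSet (tree_sum S T) \<rightarrow>\<^sub>E NodeSet (tree_sum S T)"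
    using prunedD(4)[OF S] prunedD(4)[OF T] by (auto simp: tree_sum_def)
  moreover have "Proj (tree_sum S T) ` TipSet (tree_sum S T) = NodeSet (tree_sum S T)"
  proof -
    have "Proj (tree_sum S T) ` TipSet (tree_sum S T) = inl ` Proj S ` TipSet S \<union> inr ` Proj T ` TipSet T"
      by (simp add: tree_sum_def image_Un image_image)
    then show ?thesis using prunedD(5)[OF S] prunedD(5)[OF T] by simp
  qed
  ultimately show ?thesis
    using prunedD(1,2)[OF S] prunedD(1,2)[OF T]
    by (auto simp: pruned_tree_def flo_ordered_sum tree_sum_def)
qed

lemma pruned_empty [simp]: "pruned_tree empty_tree" "TipSet empty_tree = {}" "Tips empty_tree = {}"
  by (auto simp: pruned_tree_def empty_tree_def flo_empty)

lemma Proj_sum: "x \<in> TipSet S \<Longrightarrow> Proj (tree_sum S T) (inl x) = inl (Proj S x)"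
  "y \<in> TipSet T \<Longrightarrow> Proj (tree_sum S T) (inr y) = inr (Proj T y)"
  by (auto simp: tree_sum_def)

lemma tmor_sum:
  assumes f: "tmor S T f" and g: "tmor S' T' g"
  shows "tmor (tree_sum S S') (tree_sum T T') (sum_map f g)"
  by (rule tmorI) (use tmorD[OF f] tmorD[OF g] in \<open>auto\<close>)

lemma tarr_TenA:
  assumes f: "tmor S T f" and g: "tmor S' T' g"
  shows "TenA Omega2 (tarr S T f) (tarr S' T' g) = tarr (tree_sum S S') (tree_sum T T') (sum_map f g)"
proof -
  have r: "Proj S x \<in> NodeSet S" if "x \<in> TipSet S" for x using that prunedD(4)[OF tmorD(1)[OF f]] by simp
  have r': "Proj S' x \<in> NodeSet S'" if "x \<in> TipSet S'" for x using that prunedD(4)[OF tmorD(1)[OF g]] by simp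
  let ?F = "\<lambda>n\<in>NodeSet S. Proj T (f (SOME x. x \<in> TipSet S \<and> Proj S x = n))"
  let ?G = "\<lambda>n\<in>NodeSet S'. Proj T' (g (SOME x. x \<in> TipSet S' \<and> Proj S' x = n))"
  have "TenA Omega2 (tarr S T f) (tarr S' T' g) = tree_map (tree_sum S S') (tree_sum T T')
     (sum_map (restrict f (TipSet S)) (restrict g (TipSet S'))) (sum_map ?F ?G)"
    unfolding Omega2_def tarr_def by (simp add: tree_map_def)
  also have "\<dots> = tree_map (tree_sum S S') (tree_sum T T') (sum_map f g) (sum_map ?F ?G)"
    unfolding tree_map_def by (auto intro!: restrict_ext)
  also have "\<dots> = tarr (tree_sum S S') (tree_sum T T') (sum_map f g)"
    by (rule tree_map_tarr[OF tmor_sum[OF f g]])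
       (use r r' tmor_proj[OF f] tmor_proj[OF g] tmorD(3)[OF f] tmorD(3)[OF g] in \<open>auto simp: Proj_sum\<close>)
  finally show ?thesis .
qed

lemma tmor_assoc:
  assumes "pruned_tree S" "pruned_tree T" "pruned_tree U"
  shows "tmor (tree_sum (tree_sum S T) U) (tree_sum S (tree_sum T U)) sum_assoc"
  by (rule tmorI) (use assms in \<open>auto\<close>)

lemma tarr_Assoc:
  assumes "pruned_tree S" "pruned_tree T" "pruned_tree U"
  shows "Assoc Omega2 S T U = tarr (tree_sum (tree_sum S T) U) (tree_sum S (tree_sum T U)) sum_assoc"
proof -
  have "Assoc Omega2 S T U = tree_map (tree_sum (tree_sum S T) U) (tree_sum S (tree_sum T U)) sum_assoc sum_assoc"
    by (simp add: Omega2_def)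
  also have "\<dots> = tarr (tree_sum (tree_sum S T) U) (tree_sum S (tree_sum T U)) sum_assoc"
    by (rule tree_map_tarr[OF tmor_assoc[OF assms]]) (auto simp: Proj_sum)
  finally show ?thesis .
qed

lemma tarr_Lunit:
  assumes "pruned_tree S"
  shows "tmor (tree_sum empty_tree S) S (cases_sum id id)" "tmor (tree_sum S empty_tree) S (cases_sum id id)"
    "Lunit Omega2 S = tarr (tree_sum empty_tree S) S (cases_sum id id)"
    "Runit Omega2 S = tarr (tree_sum S empty_tree) S (cases_sum id id)"
proof -
  show l: "tmor (tree_sum empty_tree S) S (cases_sum id id)" by (rule tmorI) (use assms in \<open>auto\<close>)
  show r: "tmor (tree_sum S empty_tree) S (cases_sum id id)" by (rule tmorI) (use assms in \<open>auto\<close>)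
  show "Lunit Omega2 S = tarr (tree_sum empty_tree S) S (cases_sum id id)"
    unfolding Omega2_def by simp (rule tree_map_tarr[OF l], auto simp: Proj_sum)
  show "Runit Omega2 S = tarr (tree_sum S empty_tree) S (cases_sum id id)"
    unfolding Omega2_def by simp (rule tree_map_tarr[OF r], auto simp: Proj_sum)
qed

lemma tarr_iso:
  assumes "tmor S T f" "tmor T S g" "\<And>x. x \<in> TipSet S \<Longrightarrow> g (f x) = x" "\<And>x. x \<in> TipSet T \<Longrightarrow> f (g x) = x"
  shows "isomorphism Omega2 (tarr S T f)"
proof -
  have "tarr S S (g \<circ> f) = tarr S S (\<lambda>x. x)" "tarr T T (f \<circ> g) = tarr T T (\<lambda>x. x)"
    using assms(3,4) tmorD[OF assms(1)] by (auto intro!: tarr_ext)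
  then have "inverse_arrows Omega2 (tarr S T f) (tarr T S g)"
    using tmorD(1,2)[OF assms(1)]
    by (simp add: inverse_arrows_def Hom_iff tarr_tmor assms(1,2) Ident_tarr
        tarr_Comp(2)[OF assms(1,2)] tarr_Comp(2)[OF assms(2,1)])
  then show ?thesis unfolding isomorphism_def by blast
qed

abbreviation tip :: "tree_arrow \<Rightarrow> nat \<Rightarrow> nat" where
  "tip h \<equiv> fst (Body h)"

text \<open>Both arrows are in the normal form \<open>tarr\<close>, where the node map is computed
  from the tip map. Equations between arrows thereby become equations between maps on
  elements.\<close>

lemma arr_ext:
  assumes "g \<in> Arr Omega2" "h \<in> Arr Omega2" "Source g = Source h" "Target g = Target h"
    and "\<And>x. x \<in> TipSet (Source h) \<Longrightarrow> tip g x = tip h x"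
  shows "g = h"
proof -
  have "tarr (Source h) (Target h) (tip g) = tarr (Source h) (Target h) (tip h)"
    using assms(5) tmorD(1)[OF Arr_tarr(2)[OF assms(2)]] by (rule tarr_ext)
  then show ?thesis using Arr_tarr(1)[OF assms(1)] Arr_tarr(1)[OF assms(2)] assms(3,4) by simp
qed

lemma tip_in: "h \<in> Arr Omega2 \<Longrightarrow> x \<in> TipSet (Source h) \<Longrightarrow> tip h x \<in> TipSet (Target h)"
  using tmorD(3)[OF Arr_tarr(2)] .

lemma tip_Comp:
  assumes "g \<in> Arr Omega2" "h \<in> Arr Omega2" "Source h = Target g" "x \<in> TipSet (Source g)"
  shows "tip (h \<cdot>\<^bsub>Omega2\<^esub> g) x = tip h (tip g x)"
proof -
  have "h \<cdot>\<^bsub>Omega2\<^esub> g = tarr (Source g) (Target h) (tip h \<circ> tip g)"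
    using tarr_Comp(2)[OF Arr_tarr(2)[OF assms(1)], of "Target h" "tip h"]
      Arr_tarr[OF assms(1)] Arr_tarr[OF assms(2)] assms(3) by simp
  then show ?thesis using assms(4) by simp
qed

lemma tip_TenA:
  assumes "g \<in> Arr Omega2" "h \<in> Arr Omega2"
  shows "Source (g \<otimes>\<^bsub>Omega2\<^esub> h) = tree_sum (Source g) (Source h)"
    "Target (g \<otimes>\<^bsub>Omega2\<^esub> h) = tree_sum (Target g) (Target h)"
    "g \<otimes>\<^bsub>Omega2\<^esub> h \<in> Arr Omega2"
    "x \<in> TipSet (Source g) \<Longrightarrow> tip (g \<otimes>\<^bsub>Omega2\<^esub> h) (inl x) = inl (tip g x)"
    "x \<in> TipSet (Source h) \<Longrightarrow> tip (g \<otimes>\<^bsub>Omega2\<^esub> h) (inr x) = inr (tip h x)"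
proof -
  have *: "g \<otimes>\<^bsub>Omega2\<^esub> h = tarr (tree_sum (Source g) (Source h)) (tree_sum (Target g) (Target h)) (sum_map (tip g) (tip h))"
    using tarr_TenA[OF Arr_tarr(2)[OF assms(1)] Arr_tarr(2)[OF assms(2)]] Arr_tarr(1)[OF assms(1)]
      Arr_tarr(1)[OF assms(2)] by simp
  then show "Source (g \<otimes>\<^bsub>Omega2\<^esub> h) = tree_sum (Source g) (Source h)"
    "Target (g \<otimes>\<^bsub>Omega2\<^esub> h) = tree_sum (Target g) (Target h)"
    "x \<in> TipSet (Source g) \<Longrightarrow> tip (g \<otimes>\<^bsub>Omega2\<^esub> h) (inl x) = inl (tip g x)"
    "x \<in> TipSet (Source h) \<Longrightarrow> tip (g \<otimes>\<^bsub>Omega2\<^esub> h) (inr x) = inr (tip h x)" by simp_all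
  show "g \<otimes>\<^bsub>Omega2\<^esub> h \<in> Arr Omega2" unfolding *
    by (rule tarr_tmor[OF tmor_sum[OF Arr_tarr(2)[OF assms(1)] Arr_tarr(2)[OF assms(2)]]])
qed

text \<open>Each coherence equation is tested on tips by \<open>arr_ext\<close>, where it is a case
  distinction between \<open>inl\<close> and \<open>inr\<close>; the structure maps are invertible
  because the evident inverse tip maps are morphisms as well.\<close>

lemma monoidal_Omega2: "monoidal_category Omega2"
proof -
  interpret category Omega2 by (rule category_Omega2)
  have pr: "pruned_tree (Source h)" "pruned_tree (Target h)" if "h \<in> Arr Omega2" for h
    using tmorD[OF Arr_tarr(2)[OF that]] by auto
  have C: "h \<cdot>\<^bsub>Omega2\<^esub> g \<in> Arr Omega2" "Source (h \<cdot>\<^bsub>Omega2\<^esub> g) = Source g" "Target (h \<cdot>\<^bsub>Omega2\<^esub> g) = Target h"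
    if "g \<in> Arr Omega2" "h \<in> Arr Omega2" "Source h = Target g" for g h
    using Comp_simps[of g h] that by auto
  have Id: "Ident Omega2 a \<in> Arr Omega2" "Source (Ident Omega2 a) = a" "Target (Ident Omega2 a) = a"
     "x \<in> TipSet a \<Longrightarrow> tip (Ident Omega2 a) x = x" if "pruned_tree a" for a x
    using that Ident_simps[of a] by (auto simp: Ident_tarr)
  have As: "Assoc Omega2 a b c \<in> Arr Omega2" "Source (Assoc Omega2 a b c) = tree_sum (tree_sum a b) c"
    "Target (Assoc Omega2 a b c) = tree_sum a (tree_sum b c)"
    "x \<in> TipSet (tree_sum (tree_sum a b) c) \<Longrightarrow> tip (Assoc Omega2 a b c) x = sum_assoc x"
    if "pruned_tree a" "pruned_tree b" "pruned_tree c" for a b c x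
    using that tmor_assoc[OF that] by (auto simp: tarr_Assoc tarr_tmor)
  have Un: "Lunit Omega2 a \<in> Arr Omega2" "Source (Lunit Omega2 a) = tree_sum empty_tree a" "Target (Lunit Omega2 a) = a"
    "x \<in> TipSet (tree_sum empty_tree a) \<Longrightarrow> tip (Lunit Omega2 a) x = cases_sum id id x"
    "Runit Omega2 a \<in> Arr Omega2" "Source (Runit Omega2 a) = tree_sum a empty_tree" "Target (Runit Omega2 a) = a"
    "y \<in> TipSet (tree_sum a empty_tree) \<Longrightarrow> tip (Runit Omega2 a) y = cases_sum id id y"
    if "pruned_tree a" for a x y
    using that tarr_Lunit[OF that] by (auto simp: tarr_tmor)
  note [simp] = pr C Id As Un tip_Comp tip_TenA tip_in
  note [simp del] = assoc Comp_Ident Ident_Comp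
  show ?thesis
  proof
    fix f a a' b g b' c d h c' f' g'
    show "\<one>\<^bsub>Omega2\<^esub> \<in> Obj Omega2" by simp
    show "a \<in> Obj Omega2 \<Longrightarrow> b \<in> Obj Omega2 \<Longrightarrow> a \<odot>\<^bsub>Omega2\<^esub> b \<in> Obj Omega2" by simp
    show "f \<in> Hom Omega2 a b \<Longrightarrow> g \<in> Hom Omega2 c d \<Longrightarrow> f \<otimes>\<^bsub>Omega2\<^esub> g \<in> Hom Omega2 (a \<odot>\<^bsub>Omega2\<^esub> c) (b \<odot>\<^bsub>Omega2\<^esub> d)"
      by (auto simp: Hom_iff)
    show "a \<in> Obj Omega2 \<Longrightarrow> b \<in> Obj Omega2 \<Longrightarrow> Ident Omega2 a \<otimes>\<^bsub>Omega2\<^esub> Ident Omega2 b = Ident Omega2 (a \<odot>\<^bsub>Omega2\<^esub> b)"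
      by (rule arr_ext) auto
    show "f \<in> Hom Omega2 a b \<Longrightarrow> f' \<in> Hom Omega2 b c \<Longrightarrow> g \<in> Hom Omega2 a' b' \<Longrightarrow> g' \<in> Hom Omega2 b' c'
      \<Longrightarrow> (f' \<cdot>\<^bsub>Omega2\<^esub> f) \<otimes>\<^bsub>Omega2\<^esub> (g' \<cdot>\<^bsub>Omega2\<^esub> g) = (f' \<otimes>\<^bsub>Omega2\<^esub> g') \<cdot>\<^bsub>Omega2\<^esub> (f \<otimes>\<^bsub>Omega2\<^esub> g)"
      by (rule arr_ext) (auto simp: Hom_iff)
    show "a \<in> Obj Omega2 \<Longrightarrow> b \<in> Obj Omega2 \<Longrightarrow> c \<in> Obj Omega2
      \<Longrightarrow> Assoc Omega2 a b c \<in> Hom Omega2 ((a \<odot>\<^bsub>Omega2\<^esub> b) \<odot>\<^bsub>Omega2\<^esub> c) (a \<odot>\<^bsub>Omega2\<^esub> (b \<odot>\<^bsub>Omega2\<^esub> c))"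
      by (simp add: Hom_iff)
    show "isomorphism Omega2 (Assoc Omega2 a b c)" if "a \<in> Obj Omega2" "b \<in> Obj Omega2" "c \<in> Obj Omega2"
    proof -
      have p: "pruned_tree a" "pruned_tree b" "pruned_tree c" using that by auto
      have "tmor (tree_sum a (tree_sum b c)) (tree_sum (tree_sum a b) c) (cases_sum (inl \<circ> inl) (cases_sum (inl \<circ> inr) inr))"
        by (rule tmorI) (use p in \<open>auto\<close>)
      then show ?thesis unfolding tarr_Assoc[OF p] by (rule tarr_iso[OF tmor_assoc[OF p]]) auto
    qed
    show "f \<in> Hom Omega2 a a' \<Longrightarrow> g \<in> Hom Omega2 b b' \<Longrightarrow> h \<in> Hom Omega2 c c'
      \<Longrightarrow> Assoc Omega2 a' b' c' \<cdot>\<^bsub>Omega2\<^esub> ((f \<otimes>\<^bsub>Omega2\<^esub> g) \<otimes>\<^bsub>Omega2\<^esub> h) = (f \<otimes>\<^bsub>Omega2\<^esub> (g \<otimes>\<^bsub>Omega2\<^esub> h)) \<cdot>\<^bsub>Omega2\<^esub> Assoc Omega2 a b c"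
      by (rule arr_ext) (auto simp: Hom_iff)
    show "a \<in> Obj Omega2 \<Longrightarrow> Lunit Omega2 a \<in> Hom Omega2 (\<one>\<^bsub>Omega2\<^esub> \<odot>\<^bsub>Omega2\<^esub> a) a"
      "a \<in> Obj Omega2 \<Longrightarrow> Runit Omega2 a \<in> Hom Omega2 (a \<odot>\<^bsub>Omega2\<^esub> \<one>\<^bsub>Omega2\<^esub>) a"
      by (simp_all add: Hom_iff)
    show "isomorphism Omega2 (Lunit Omega2 a)" "isomorphism Omega2 (Runit Omega2 a)" if "a \<in> Obj Omega2"
    proof -
      have p: "pruned_tree a" using that by simp
      have "tmor a (tree_sum empty_tree a) inr" by (rule tmorI) (use p in \<open>auto\<close>)
      then show "isomorphism Omega2 (Lunit Omega2 a)" unfolding tarr_Lunit[OF p]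
        by (rule tarr_iso[OF tarr_Lunit(1)[OF p]]) auto
      have "tmor a (tree_sum a empty_tree) inl" by (rule tmorI) (use p in \<open>auto\<close>)
      then show "isomorphism Omega2 (Runit Omega2 a)" unfolding tarr_Lunit[OF p]
        by (rule tarr_iso[OF tarr_Lunit(2)[OF p]]) auto
    qed
    show "f \<in> Hom Omega2 a b \<Longrightarrow> Lunit Omega2 b \<cdot>\<^bsub>Omega2\<^esub> (Ident Omega2 \<one>\<^bsub>Omega2\<^esub> \<otimes>\<^bsub>Omega2\<^esub> f) = f \<cdot>\<^bsub>Omega2\<^esub> Lunit Omega2 a"
      by (rule arr_ext) (auto simp: Hom_iff)
    show "f \<in> Hom Omega2 a b \<Longrightarrow> Runit Omega2 b \<cdot>\<^bsub>Omega2\<^esub> (f \<otimes>\<^bsub>Omega2\<^esub> Ident Omega2 \<one>\<^bsub>Omega2\<^esub>) = f \<cdot>\<^bsub>Omega2\<^esub> Runit Omega2 a"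
      by (rule arr_ext) (auto simp: Hom_iff)
    show "a \<in> Obj Omega2 \<Longrightarrow> b \<in> Obj Omega2 \<Longrightarrow> c \<in> Obj Omega2 \<Longrightarrow> d \<in> Obj Omega2
          \<Longrightarrow> Assoc Omega2 a b (c \<odot>\<^bsub>Omega2\<^esub> d) \<cdot>\<^bsub>Omega2\<^esub> Assoc Omega2 (a \<odot>\<^bsub>Omega2\<^esub> b) c d
            = (Ident Omega2 a \<otimes>\<^bsub>Omega2\<^esub> Assoc Omega2 b c d) \<cdot>\<^bsub>Omega2\<^esub> Assoc Omega2 a (b \<odot>\<^bsub>Omega2\<^esub> c) d
                \<cdot>\<^bsub>Omega2\<^esub> (Assoc Omega2 a b c \<otimes>\<^bsub>Omega2\<^esub> Ident Omega2 d)"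
      by (rule arr_ext) auto
    show "a \<in> Obj Omega2 \<Longrightarrow> b \<in> Obj Omega2
          \<Longrightarrow> (Ident Omega2 a \<otimes>\<^bsub>Omega2\<^esub> Lunit Omega2 b) \<cdot>\<^bsub>Omega2\<^esub> Assoc Omega2 a \<one>\<^bsub>Omega2\<^esub> b = Runit Omega2 a \<otimes>\<^bsub>Omega2\<^esub> Ident Omega2 b"
      by (rule arr_ext) auto
  qed
qed

lemma tip_bij_iff: "tmor S T f \<Longrightarrow> tarr S T f \<in> tip_bijections \<longleftrightarrow> bij_betw f (TipSet S) (TipSet T)"
  using bij_betw_cong[of "TipSet S" "restrict f (TipSet S)" f "TipSet T"]
  by (simp add: tip_bijections_def tarr_tmor)

lemma bij_betw_sum_map:
  assumes "bij_betw f A A'" "bij_betw g B B'"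
  shows "bij_betw (sum_map f g) (inl ` A \<union> inr ` B) (inl ` A' \<union> inr ` B')"
proof -
  have "sum_map f g ` (inl ` A \<union> inr ` B) = inl ` f ` A \<union> inr ` g ` B"
    by (simp add: image_Un image_image)
  moreover have "inj_on (sum_map f g) (inl ` A \<union> inr ` B)"
  proof (rule inj_onI)
    fix u v assume "u \<in> inl ` A \<union> inr ` B" "v \<in> inl ` A \<union> inr ` B" "sum_map f g u = sum_map f g v"
    then show "u = v"
      by (elim UnE imageE)
         (auto dest: inj_onD[OF bij_betw_imp_inj_on[OF assms(1)]] inj_onD[OF bij_betw_imp_inj_on[OF assms(2)]])
  qed
  ultimately show ?thesis
    using bij_betw_imp_surj_on[OF assms(1)] bij_betw_imp_surj_on[OF assms(2)] by (simp add: bij_betw_def)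
qed

interpretation Om: monoidal_fractions Omega2 tip_bijections
proof -
  interpret monoidal_category Omega2 by (rule monoidal_Omega2)
  show "monoidal_fractions Omega2 tip_bijections"
  proof
    show "tip_bijections \<subseteq> Arr Omega2" by (auto simp: tip_bijections_def)
    fix w a assume w: "w \<in> tip_bijections" and a: "a \<in> Obj Omega2"
    then have "w \<in> Arr Omega2" by (auto simp: tip_bijections_def)
    then obtain S T f where f: "w = tarr S T f" "tmor S T f" using Arr_tarr by metis
    then have b: "bij_betw f (TipSet S) (TipSet T)" using w tip_bij_iff by simp
    have i: "bij_betw (\<lambda>x. x) (TipSet a) (TipSet a)" by (simp add: bij_betw_def inj_on_def)
    show "w \<otimes>\<^bsub>Omega2\<^esub> Ident Omega2 a \<in> tip_bijections" "Ident Omega2 a \<otimes>\<^bsub>Omega2\<^esub> w \<in> tip_bijections"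
      using a f b i by (simp_all add: Ident_tarr tarr_TenA tip_bij_iff tmor_sum tmor_id bij_betw_sum_map)
  qed
qed

section \<open>Independence of the braiding of the chosen orders\<close>

text \<open>For a total preorder this counts the elements strictly below \<open>x\<close>. It turns
  an abstract preorder into a comparison of natural numbers, which can serve as nodes of a tree or
  as positions of tips.\<close>

definition rk :: "'x set \<Rightarrow> ('x \<Rightarrow> 'x \<Rightarrow> bool) \<Rightarrow> 'x \<Rightarrow> nat" where
  "rk X le x = card {y \<in> X. \<not> le x y}"

lemma rk_iff:
  assumes "finite X" and t: "\<And>x y. x \<in> X \<Longrightarrow> y \<in> X \<Longrightarrow> le x y \<or> le y x"
    and tr: "\<And>x y z. x \<in> X \<Longrightarrow> y \<in> X \<Longrightarrow> z \<in> X \<Longrightarrow> le x y \<Longrightarrow> le y z \<Longrightarrow> le x z"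
    and x: "x \<in> X" and y: "y \<in> X"
  shows "rk X le x \<le> rk X le y \<longleftrightarrow> le x y"
proof
  assume "le x y"
  then have "{z \<in> X. \<not> le x z} \<subseteq> {z \<in> X. \<not> le y z}" using tr[OF x y] by blast
  then show "rk X le x \<le> rk X le y" unfolding rk_def using assms(1) by (intro card_mono) auto
next
  assume r: "rk X le x \<le> rk X le y"
  show "le x y"
  proof (rule ccontr)
    assume n: "\<not> le x y"
    then have yx: "le y x" using t x y by blast
    then have "{z \<in> X. \<not> le y z} \<subseteq> {z \<in> X. \<not> le x z}" using tr[OF y x] by blast
    moreover have "y \<in> {z \<in> X. \<not> le x z}" "y \<notin> {z \<in> X. \<not> le y z}" using n y t[OF y y] by auto
    ultimately have "{z \<in> X. \<not> le y z} \<subset> {z \<in> X. \<not> le x z}" by blast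
    then have "rk X le y < rk X le x" unfolding rk_def using assms(1) by (intro psubset_card_mono) auto
    then show False using r by simp
  qed
qed

lemma rk_less:
  assumes "finite X" "x \<in> X" "le x x" shows "rk X le x < card X"
  unfolding rk_def by (rule psubset_card_mono[OF assms(1)]) (use assms in auto)

lemma corolla_simps [simp]:
  assumes "finite_linear_order r"
  shows "pruned_tree (corolla r)" "Tips (corolla r) = r"
    "x \<in> Field r \<Longrightarrow> y \<in> Field r \<Longrightarrow> nle (corolla r) x y"
proof -
  have "Field r = {} \<longleftrightarrow> r = {}" by (auto simp: Field_def)
  then show "pruned_tree (corolla r)"
    using assms by (auto simp: pruned_tree_def corolla_def flo_empty flo_iff)
  show "x \<in> Field r \<Longrightarrow> y \<in> Field r \<Longrightarrow> nle (corolla r) x y" "Tips (corolla r) = r"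
    by (auto simp: nle_def corolla_def)
qed

abbreviation "\<L> \<equiv> Om.L"

abbreviation frac_comp :: "(tree, tree_arrow) fraction \<Rightarrow> (tree, tree_arrow) fraction \<Rightarrow> (tree, tree_arrow) fraction"
    (infixr "\<bullet>" 55) where
  "G \<bullet> F \<equiv> G \<cdot>\<^bsub>Om.L\<^esub> F"

abbreviation lt :: "tree \<Rightarrow> tree \<Rightarrow> (nat \<Rightarrow> nat) \<Rightarrow> (tree, tree_arrow) fraction" where
  "lt S T f \<equiv> Om.lf (tarr S T f)"

lemma lt_simps [simp]:
  assumes "tmor S T f"
  shows "lt S T f \<in> Arr \<L>" "Source (lt S T f) = S" "Target (lt S T f) = T"
  using tarr_tmor[OF assms] Om.lf_simps[of "tarr S T f"] by auto

lemma lt_Comp: "tmor S T f \<Longrightarrow> tmor T U g \<Longrightarrow> lt T U g \<bullet> lt S T f = lt S U (g \<circ> f)"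
  by (simp add: tarr_Comp(2)[symmetric] Om.lf_Comp tarr_tmor)

lemma lt_cong: "(\<And>x. x \<in> TipSet S \<Longrightarrow> f x = g x) \<Longrightarrow> pruned_tree S \<Longrightarrow> lt S T f = lt S T g"
  using tarr_ext by metis

lemma lt_Comp_eq:
  assumes "tmor S T f" "tmor T U g" "\<And>x. x \<in> TipSet S \<Longrightarrow> g (f x) = h x"
  shows "lt T U g \<bullet> lt S T f = lt S U h"
  unfolding lt_Comp[OF assms(1,2)] by (rule lt_cong) (use assms(3) tmorD(1)[OF assms(1)] in auto)

lemma lt_iso: "tmor S T f \<Longrightarrow> bij_betw f (TipSet S) (TipSet T) \<Longrightarrow> isomorphism \<L> (lt S T f)"
  by (simp add: Om.lf_iso tip_bij_iff)

lemma bij_betw_id: "(\<And>x. x \<in> A \<Longrightarrow> f x = x) \<Longrightarrow> A = B \<Longrightarrow> bij_betw f A B"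
  by (auto simp: bij_betw_def inj_on_def)

lemma bij_betw_swap: "bij_betw sum_swap (inl ` A \<union> inr ` B) (inl ` B \<union> inr ` A)"
  by (rule bij_betwI[of _ _ _ sum_swap]) auto

text \<open>Tips with equal keys form a fibre, and the nodes are ordered like the keys. Ranks
  replace the keys because nodes have to be natural numbers, whereas keys may be pairs in
  lexicographic order.\<close>

definition key_tree :: "(nat \<Rightarrow> 'k::linorder) \<Rightarrow> nat rel \<Rightarrow> tree" where
  "key_tree key r = (let v = rk (Field r) (\<lambda>x y. key x \<le> key y) in
     \<lparr>Tips = r, Nodes = {(a, b). a \<in> v ` Field r \<and> b \<in> v ` Field r \<and> a \<le> b}, Proj = restrict v (Field r)\<rparr>)"

lemma key_tree_simps [simp]:
  assumes "finite_linear_order r"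
  shows "pruned_tree (key_tree key r)" "Tips (key_tree key r) = r"
    "x \<in> Field r \<Longrightarrow> y \<in> Field r \<Longrightarrow> nle (key_tree key r) x y \<longleftrightarrow> key x \<le> key y"
proof -
  have f: "finite (Field r)" using flo_finite[OF assms] by simp
  define v where "v = rk (Field r) (\<lambda>x y. key x \<le> key y)"
  have t: "key_tree key r = \<lparr>Tips = r, Nodes = {(a, b). a \<in> v ` Field r \<and> b \<in> v ` Field r \<and> a \<le> b}, Proj = restrict v (Field r)\<rparr>"
    by (simp add: key_tree_def v_def Let_def)
  have F: "Field {(a, b). a \<in> v ` Field r \<and> b \<in> v ` Field r \<and> a \<le> b} = v ` Field r"
    by (auto simp: Field_def)
  have "finite {(a, b). a \<in> v ` Field r \<and> b \<in> v ` Field r \<and> a \<le> b}"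
    by (rule finite_subset[of _ "v ` Field r \<times> v ` Field r"]) (use f in auto)
  then have "finite_linear_order {(a, b). a \<in> v ` Field r \<and> b \<in> v ` Field r \<and> a \<le> b}"
    unfolding flo_iff F by auto
  then show "pruned_tree (key_tree key r)" unfolding pruned_tree_def t using assms F by auto
  show "Tips (key_tree key r) = r" by (simp add: t)
  assume xy: "x \<in> Field r" "y \<in> Field r"
  have "v x \<le> v y \<longleftrightarrow> key x \<le> key y"
    unfolding v_def by (rule rk_iff[OF f]) (use xy in auto)
  then show "nle (key_tree key r) x y \<longleftrightarrow> key x \<le> key y" using xy by (simp add: nle_def t)
qed

text \<open>
  The tips outside \<open>U\<close> carry a block of nodes, which is moved past the \<open>U\<close>-nodes one at a time:
  \<open>shuffled k\<close> has the block in front of the \<open>k\<close>-th \<open>U\<close>-node, and \<open>merged k\<close> is obtained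
  by collapsing the block and the \<open>k\<close>-th \<open>U\<close>-node into a single node. All of them map to the corolla
  on an order \<open>Q\<close> as soon as \<open>Q\<close> extends \<open>r\<close> except between different \<open>U\<close>-nodes, so the resulting
  comparison does not depend on \<open>Q\<close>.
\<close>

locale block_move =
  fixes r :: "nat rel" and U :: "nat set" and p q :: "nat \<Rightarrow> nat"
  assumes r: "finite_linear_order r"
begin

text \<open>Nodes of \<open>U\<close> have odd first key and the block has the even key
  \<open>2 * k\<close>, so the block lies strictly after the \<open>U\<close>-nodes with
  \<open>p < k\<close> and strictly before those with \<open>p \<ge> k\<close>. The second key keeps
  the nodes inside the block apart.\<close>

definition shuffled :: "nat \<Rightarrow> tree" where
  "shuffled k = key_tree (\<lambda>x. if x \<in> U then (2 * p x + 1, 0) else (2 * k, q x)) r"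

text \<open>The block shares the key \<open>2 * k + 1\<close> of the \<open>U\<close>-nodes with
  \<open>p = k\<close>. Raising \<open>2 * k\<close> or lowering \<open>2 * k + 2\<close> to this
  value is monotone, so both neighbouring shuffled trees map here by the identity on tips.\<close>

definition merged :: "nat \<Rightarrow> tree" where
  "merged k = key_tree (\<lambda>x. if x \<in> U then 2 * p x + 1 else 2 * k + 1) r"

definition admissible :: "nat rel \<Rightarrow> bool" where
  "admissible Q \<longleftrightarrow> finite_linear_order Q \<and> Field Q = Field r \<and>
     (\<forall>x y. (x, y) \<in> r \<longrightarrow> \<not> (x \<in> U \<and> y \<in> U \<and> p x \<noteq> p y) \<longrightarrow> (x, y) \<in> Q)"

lemma tmor_shuffled:
  shows "tmor (shuffled k) (merged k) (\<lambda>x. x)" "tmor (shuffled (Suc k)) (merged k) (\<lambda>x. x)"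
    "admissible Q \<Longrightarrow> tmor (merged k) (corolla Q) (\<lambda>x. x)"
    "admissible Q \<Longrightarrow> tmor (shuffled k) (corolla Q) (\<lambda>x. x)"
proof -
  show 1: "tmor (shuffled k) (merged k) (\<lambda>x. x)" "tmor (shuffled (Suc k)) (merged k) (\<lambda>x. x)" for k
    using r unfolding shuffled_def merged_def by (auto intro!: tmorI split: if_splits)
  show 2: "tmor (merged k) (corolla Q) (\<lambda>x. x)" if "admissible Q" for k
    using r that unfolding merged_def admissible_def by (auto intro!: tmorI split: if_splits)
  show "tmor (shuffled k) (corolla Q) (\<lambda>x. x)" if "admissible Q"
    using tarr_Comp(1)[OF 1(1) 2[OF that]] by (simp add: comp_def)
qed

text \<open>One arrow \<open>z\<close> serves all admissible \<open>Q\<close> at once. It is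
  composed of the roofs \<open>shuffled (Suc k)\<close> to \<open>merged k\<close> from
  \<open>shuffled k\<close>, whose legs are identities on tips and thus invertible; compatibility
  with \<open>Q\<close> holds because \<open>merged k\<close> itself maps to the corolla on
  \<open>Q\<close>.\<close>

lemma block_move:
  "\<exists>z\<in>Hom \<L> (shuffled k) (shuffled 0). isomorphism \<L> z \<and>
     (\<forall>Q. admissible Q \<longrightarrow> lt (shuffled 0) (corolla Q) (\<lambda>x. x) \<bullet> z = lt (shuffled k) (corolla Q) (\<lambda>x. x))"
proof (induction k)
  case 0
  have p: "pruned_tree (shuffled 0)" using tmorD(1)[OF tmor_shuffled(1)] .
  show ?case
  proof (intro bexI conjI allI impI)
    show "isomorphism \<L> (lt (shuffled 0) (shuffled 0) (\<lambda>x. x))"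
      by (intro lt_iso tmor_id bij_betw_id) (use p in auto)
    show "lt (shuffled 0) (shuffled 0) (\<lambda>x. x) \<in> Hom \<L> (shuffled 0) (shuffled 0)"
      using tmor_id[OF p] by (simp add: Hom_iff)
    fix Q assume "admissible Q"
    then show "lt (shuffled 0) (corolla Q) (\<lambda>x. x) \<bullet> lt (shuffled 0) (shuffled 0) (\<lambda>x. x) = lt (shuffled 0) (corolla Q) (\<lambda>x. x)"
      by (intro lt_Comp_eq tmor_id p tmor_shuffled) auto
  qed
next
  case (Suc k)
  then obtain z where z: "z \<in> Arr \<L>" "Source z = shuffled k" "Target z = shuffled 0" "isomorphism \<L> z"
    "\<And>Q. admissible Q \<Longrightarrow> lt (shuffled 0) (corolla Q) (\<lambda>x. x) \<bullet> z = lt (shuffled k) (corolla Q) (\<lambda>x. x)"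
    by (auto simp: Hom_iff)
  let ?a = "lt (shuffled k) (merged k) (\<lambda>x. x)" and ?b = "lt (shuffled (Suc k)) (merged k) (\<lambda>x. x)"
  have T: "TipSet (shuffled k) = Field r" "TipSet (merged k) = Field r" for k
    using r by (simp_all add: shuffled_def merged_def)
  have i: "isomorphism \<L> ?a" "isomorphism \<L> ?b"
    by (intro lt_iso tmor_shuffled bij_betw_id; simp add: T)+
  note [simp] = tmor_shuffled Om.LC.iso_arr Om.LC.inv_simps[simplified] Om.LC.Comp_simps[simplified]
  let ?z = "z \<bullet> inv_arr \<L> ?a \<bullet> ?b"
  show ?case
  proof (intro bexI conjI allI impI)
    show "?z \<in> Hom \<L> (shuffled (Suc k)) (shuffled 0)" using z i by (simp add: Hom_iff)
    show "isomorphism \<L> ?z"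
      using z i Om.LC.iso_inv[OF i(1)] by (intro Om.LC.iso_Comp) simp_all
    fix Q assume Q: "admissible Q"
    let ?c = "lt (merged k) (corolla Q) (\<lambda>x. x)"
    have "lt (shuffled 0) (corolla Q) (\<lambda>x. x) \<bullet> ?z
        = (lt (shuffled 0) (corolla Q) (\<lambda>x. x) \<bullet> z) \<bullet> inv_arr \<L> ?a \<bullet> ?b"
      using z i Q by (subst Om.LC.assoc) simp_all
    also have "\<dots> = (?c \<bullet> ?a) \<bullet> inv_arr \<L> ?a \<bullet> ?b"
      unfolding z(5)[OF Q] using lt_Comp[OF tmor_shuffled(1) tmor_shuffled(3)[OF Q], of k] by (simp add: comp_def)
    also have "\<dots> = ?c \<bullet> ?b"
      using i Q by (subst Om.LC.assoc) (simp_all add: Om.LC.inv_cancel[simplified])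
    also have "\<dots> = lt (shuffled (Suc k)) (corolla Q) (\<lambda>x. x)"
      using lt_Comp[OF tmor_shuffled(2) tmor_shuffled(3)[OF Q], of k] by (simp add: comp_def)
    finally show "lt (shuffled 0) (corolla Q) (\<lambda>x. x) \<bullet> ?z = lt (shuffled (Suc k)) (corolla Q) (\<lambda>x. x)" .
  qed
qed

text \<open>The result of \<open>block_move\<close> is transported along the tip bijections
  \<open>f\<close> and \<open>g\<close>, so that it can be used for the two ordered sums rather than
  for trees presented by keys.\<close>

lemma block_move_between:
  assumes i: "tmor S (shuffled k) f" "bij_betw f (TipSet S) (Field r)"
    and j: "tmor T (shuffled 0) g" "bij_betw g (TipSet T) (Field r)"
  shows "\<exists>z\<in>Hom \<L> S T. isomorphism \<L> z \<and>
     (\<forall>Q. admissible Q \<longrightarrow> lt T (corolla Q) g \<bullet> z = lt S (corolla Q) f)"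
proof -
  obtain z where z: "z \<in> Arr \<L>" "Source z = shuffled k" "Target z = shuffled 0" "isomorphism \<L> z"
    "\<And>Q. admissible Q \<Longrightarrow> lt (shuffled 0) (corolla Q) (\<lambda>x. x) \<bullet> z = lt (shuffled k) (corolla Q) (\<lambda>x. x)"
    using block_move[of k] by (auto simp: Hom_iff)
  let ?I = "lt S (shuffled k) f" and ?J = "lt T (shuffled 0) g"
  have iso: "isomorphism \<L> ?I" "isomorphism \<L> ?J"
    using lt_iso[OF i(1)] lt_iso[OF j(1)] i(2) j(2) r by (simp_all add: shuffled_def)
  note [simp] = i(1) j(1) iso z(1-3) Om.LC.inv_simps[simplified] Om.LC.Comp_simps[simplified]
  show ?thesis
  proof (intro bexI conjI allI impI)
    show "inv_arr \<L> ?J \<bullet> z \<bullet> ?I \<in> Hom \<L> S T" by (simp add: Hom_iff)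
    show "isomorphism \<L> (inv_arr \<L> ?J \<bullet> z \<bullet> ?I)"
      using z(4) iso Om.LC.iso_inv[OF iso(2)] by (intro Om.LC.iso_Comp) simp_all
    fix Q assume Q: "admissible Q"
    have [simp]: "tmor (shuffled k) (corolla Q) (\<lambda>x. x)" for k using tmor_shuffled(4)[OF Q] .
    have "lt T (corolla Q) g = lt (shuffled 0) (corolla Q) (\<lambda>x. x) \<bullet> ?J"
      by (rule lt_Comp_eq[symmetric]) simp_all
    then have "lt T (corolla Q) g \<bullet> (inv_arr \<L> ?J \<bullet> z \<bullet> ?I) = (lt (shuffled 0) (corolla Q) (\<lambda>x. x) \<bullet> z) \<bullet> ?I"
      by (simp add: Om.LC.assoc[simplified] Om.LC.inv_cancel[simplified])
    also have "\<dots> = lt S (corolla Q) f"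
      unfolding z(5)[OF Q] by (rule lt_Comp_eq) simp_all
    finally show "lt T (corolla Q) g \<bullet> (inv_arr \<L> ?J \<bullet> z \<bullet> ?I) = lt S (corolla Q) f" .
  qed
qed

end

section \<open>Orders on tips extending the orders of the fibres\<close>

lemma rk_nle:
  assumes S: "pruned_tree S" and x: "x \<in> TipSet S"
  shows "y \<in> TipSet S \<Longrightarrow> rk (TipSet S) (nle S) x \<le> rk (TipSet S) (nle S) y \<longleftrightarrow> nle S x y"
    and "Suc (2 * rk (TipSet S) (nle S) x) \<le> 2 * card (TipSet S)"
proof -
  have f: "finite (TipSet S)" using flo_finite(2)[OF prunedD(1)[OF S]] .
  show "y \<in> TipSet S \<Longrightarrow> rk (TipSet S) (nle S) x \<le> rk (TipSet S) (nle S) y \<longleftrightarrow> nle S x y"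
    by (rule rk_iff[OF f _ _ x]) (use nle_total[OF S] nle_trans[OF S] in blast)+
  show "Suc (2 * rk (TipSet S) (nle S) x) \<le> 2 * card (TipSet S)"
    using rk_less[where le = "nle S", OF f x nle_refl[OF S x]] by simp
qed

text \<open>This is what the identity on tips requires in order to be a morphism to
  \<open>corolla Q\<close>; see \<open>tmor_corolla_id\<close>.\<close>

definition fibre_order :: "tree \<Rightarrow> nat rel \<Rightarrow> bool" where
  "fibre_order S Q \<longleftrightarrow> finite_linear_order Q \<and> Field Q = TipSet S \<and>
     (\<forall>x y. tle S x y \<longrightarrow> nle S x y \<longrightarrow> nle S y x \<longrightarrow> (x, y) \<in> Q)"

lemma fibre_orderD:
  assumes "fibre_order S Q"
  shows "finite_linear_order Q" "Field Q = TipSet S" "tle S x y \<Longrightarrow> nle S x y \<Longrightarrow> nle S y x \<Longrightarrow> (x, y) \<in> Q"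
  using assms by (auto simp: fibre_order_def)

text \<open>On a fibre both orders contain the linear order of the tips, and a linear order
  containing another one on the same set equals it.\<close>

lemma fibre_order_unique:
  assumes "pruned_tree S" "fibre_order S Q" "fibre_order S Q'" "(x, y) \<in> Q" "nle S x y" "nle S y x"
  shows "(x, y) \<in> Q'"
proof -
  have xy: "x \<in> TipSet S" "y \<in> TipSet S" using fibre_orderD(2)[OF assms(2)] assms(4) by (auto intro: FieldI1 FieldI2)
  then consider "tle S x y" | "tle S y x" using flo_total[OF prunedD(1)[OF assms(1)]] by blast
  then show ?thesis
  proof cases
    case 2
    then have "(y, x) \<in> Q" using fibre_orderD(3)[OF assms(2)] assms by blast
    then have "x = y" using flo_antisym[OF fibre_orderD(1)[OF assms(2)]] assms(4) by blast
    then show ?thesis using flo_refl[OF fibre_orderD(1)[OF assms(3)]] fibre_orderD(2)[OF assms(3)] xy by simp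
  qed (use fibre_orderD(3)[OF assms(3)] assms in blast)
qed

lemma fibre_order_Tips: "pruned_tree S \<Longrightarrow> fibre_order S (Tips S)"
  by (simp add: fibre_order_def prunedD(1))

lemma tmor_corolla_id: "pruned_tree S \<Longrightarrow> fibre_order S Q \<Longrightarrow> tmor S (corolla Q) (\<lambda>x. x)"
  by (rule tmorI) (auto simp: fibre_order_def)

lemma fibre_order_sum:
  assumes "pruned_tree S" "pruned_tree T" "fibre_order S Q" "fibre_order T Q'"
  shows "fibre_order (tree_sum S T) (ordered_sum Q Q')"
proof -
  note a = fibre_orderD[OF assms(3)] and b = fibre_orderD[OF assms(4)]
  have "(x, y) \<in> ordered_sum Q Q'"
    if "tle (tree_sum S T) x y" "nle (tree_sum S T) x y" "nle (tree_sum S T) y x" for x y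
  proof -
    have "x \<in> TipSet (tree_sum S T)" "y \<in> TipSet (tree_sum S T)"
      using FieldI1[OF that(1)] FieldI2[OF that(1)] by auto
    then show ?thesis using that assms(1,2) a b by auto
  qed
  then show ?thesis using a b by (auto simp: fibre_order_def flo_ordered_sum)
qed

lemma tmor_swap_corolla:
  assumes "pruned_tree S" "pruned_tree T" "fibre_order S Y" "fibre_order T Z"
  shows "tmor (tree_sum S T) (corolla (ordered_sum Z Y)) sum_swap"
  by (rule tmorI) (use assms fibre_orderD[OF assms(3)] fibre_orderD[OF assms(4)] in \<open>auto simp: flo_ordered_sum\<close>)

lemma tree_braid_alt:
  assumes "pruned_tree S" "pruned_tree T"
  shows "tree_braid S T = inv_arr \<L> (lt (tree_sum T S) (corolla (Tips (tree_sum T S))) (\<lambda>x. x))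
      \<bullet> lt (tree_sum S T) (corolla (Tips (tree_sum T S))) sum_swap" (is "_ = inv_arr _ (Om.lf ?q) \<bullet> Om.lf ?s")
proof -
  let ?c = "corolla (Tips (tree_sum T S))"
  have p: "pruned_tree (tree_sum T S)" using assms by simp
  have q: "tmor (tree_sum T S) ?c (\<lambda>x. x)"
    using tmor_corolla_id[OF p fibre_order_Tips[OF p]] .
  have s: "tmor (tree_sum S T) ?c sum_swap"
    using tmor_swap_corolla[OF assms fibre_order_Tips[OF assms(1)] fibre_order_Tips[OF assms(2)]] by (simp add: Tips_sum)
  have "Proj ?c y = 1" if "y \<in> TipSet (tree_sum T S)" for y using that by (simp add: corolla_def)
  then have m: "tree_map (tree_sum S T) ?c sum_swap (\<lambda>_. 1) = ?s" "tree_map (tree_sum T S) ?c id (\<lambda>_. 1) = ?q"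
    unfolding id_def by (intro tree_map_tarr[OF s] tree_map_tarr[OF q]; force)+
  have W: "?q \<in> tip_bijections" using tip_bij_iff[OF q] by (auto intro: bij_betw_id simp: prunedD(1)[OF p])
  have "Om.lf ?s = Om.frac (tree_sum S T) ?c [Fwd ?s]" by (simp add: localised_arrow_def)
  moreover have "Om.zz (tree_sum S T) [Fwd ?s] ?c" "Om.zz ?c [Bwd ?q] (tree_sum T S)"
    using Om.zz_Fwd1[OF tarr_tmor[OF s]] Om.zz_Bwd1[OF W] by simp_all
  ultimately show ?thesis
    unfolding tree_braid_def Let_def m using Om.L_Comp[of "tree_sum S T" "[Fwd ?s]" ?c "[Bwd ?q]" "tree_sum T S"]
    by (simp add: Om.inv_lf[OF W])
qed

lemma tree_braid_simps [simp]:
  assumes "pruned_tree S" "pruned_tree T"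
  shows "tree_braid S T \<in> Arr \<L>" "Source (tree_braid S T) = tree_sum S T" "Target (tree_braid S T) = tree_sum T S"
    and tree_braid_iso: "isomorphism \<L> (tree_braid S T)"
    and tree_braid_Tips: "lt (tree_sum T S) (corolla (ordered_sum (Tips T) (Tips S))) (\<lambda>x. x) \<bullet> tree_braid S T
       = lt (tree_sum S T) (corolla (ordered_sum (Tips T) (Tips S))) sum_swap"
proof -
  note f = fibre_order_Tips[OF assms(1)] fibre_order_Tips[OF assms(2)]
  let ?Q = "ordered_sum (Tips T) (Tips S)"
  have Q: "finite_linear_order ?Q" using fibre_orderD(1) f flo_ordered_sum by blast
  have q: "tmor (tree_sum T S) (corolla ?Q) (\<lambda>x. x)"
    using tmor_corolla_id[OF _ fibre_order_sum[OF assms(2,1) f(2,1)]] assms by simp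
  have s: "tmor (tree_sum S T) (corolla ?Q) sum_swap" using tmor_swap_corolla[OF assms f] .
  have i: "isomorphism \<L> (lt (tree_sum T S) (corolla ?Q) (\<lambda>x. x))"
    by (rule lt_iso[OF q]) (auto intro: bij_betw_id simp: Q)
  have j: "isomorphism \<L> (lt (tree_sum S T) (corolla ?Q) sum_swap)"
    by (rule lt_iso[OF s]) (use bij_betw_swap Q in simp)
  note [simp] = q s i j Om.LC.inv_simps[simplified] Om.LC.Comp_simps[simplified]
  show "tree_braid S T \<in> Arr \<L>" "Source (tree_braid S T) = tree_sum S T" "Target (tree_braid S T) = tree_sum T S"
    unfolding tree_braid_alt[OF assms] Tips_sum by simp_all
  show "isomorphism \<L> (tree_braid S T)"
    unfolding tree_braid_alt[OF assms] Tips_sum by (intro Om.LC.iso_Comp Om.LC.iso_inv) simp_all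
  show "lt (tree_sum T S) (corolla ?Q) (\<lambda>x. x) \<bullet> tree_braid S T = lt (tree_sum S T) (corolla ?Q) sum_swap"
    unfolding tree_braid_alt[OF assms] Tips_sum by (simp add: Om.LC.inv_cancel[simplified])
qed

text \<open>Here \<open>U\<close> consists of the tips of \<open>S\<close> and the moving block of
  those of \<open>T\<close>. Changing \<open>Y\<close> alters the order only between tips over
  different nodes of \<open>S\<close>, which is just the freedom that \<open>admissible\<close>
  leaves, so a single \<open>z\<close> works for all \<open>Y\<close>.\<close>

lemma braid_order_left:
  assumes S: "pruned_tree S" and T: "pruned_tree T" and Z: "fibre_order T Z"
  shows "\<exists>z\<in>Hom \<L> (tree_sum S T) (tree_sum T S). \<forall>Y. fibre_order S Y \<longrightarrow>
     lt (tree_sum T S) (corolla (ordered_sum Z Y)) (\<lambda>x. x) \<bullet> z = lt (tree_sum S T) (corolla (ordered_sum Z Y)) sum_swap"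
proof -
  let ?Y = "Tips S"
  note FS = fibre_order_Tips[OF S]
  define p where "p = cases_sum (\<lambda>_. 0) (rk (TipSet S) (nle S))"
  define q where "q = cases_sum (rk (TipSet T) (nle T)) (\<lambda>_. 0)"
  have pq: "p (inr x) = rk (TipSet S) (nle S) x" "q (inl x) = rk (TipSet T) (nle T) x" for x
    by (simp_all add: p_def q_def)
  have Q: "finite_linear_order (ordered_sum Z ?Y)"
    using flo_ordered_sum fibre_orderD(1)[OF Z] prunedD(1)[OF S] by blast
  interpret block_move "ordered_sum Z ?Y" "inr ` TipSet S" p q by unfold_locales (rule Q)
  note ZD = fibre_orderD[OF Z]
  \<comment> \<open>All ranks are below \<open>?K\<close>, so at \<open>?K\<close> the block stands
    behind every node of \<open>S\<close>, as in \<open>tree_sum S T\<close>; at \<open>0\<close> it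
    stands in front, as in \<open>tree_sum T S\<close>.\<close>
  let ?K = "card (TipSet S)"
  have i: "tmor (tree_sum S T) (shuffled ?K) sum_swap"
    by (rule tmorI) (use S T Q ZD rk_nle in \<open>auto simp: shuffled_def pq less_imp_le\<close>)
  have j: "tmor (tree_sum T S) (shuffled 0) (\<lambda>x. x)"
    by (rule tmorI) (use S T Q ZD rk_nle in \<open>auto simp: shuffled_def pq less_imp_le\<close>)
  have fi: "bij_betw sum_swap (TipSet (tree_sum S T)) (Field (ordered_sum Z ?Y))"
    and fj: "bij_betw (\<lambda>x. x) (TipSet (tree_sum T S)) (Field (ordered_sum Z ?Y))"
    using bij_betw_swap by (auto simp: ZD intro!: bij_betw_id)
  have adm: "admissible (ordered_sum Z Y)" if Y: "fibre_order S Y" for Y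
  proof -
    note YD = fibre_orderD[OF Y]
    have "(x, y) \<in> ordered_sum Z Y" if xy: "(x, y) \<in> ordered_sum Z ?Y"
      and n: "\<not> (x \<in> inr ` TipSet S \<and> y \<in> inr ` TipSet S \<and> p x \<noteq> p y)" for x y
    proof -
      have F: "x \<in> inl ` TipSet T \<union> inr ` TipSet S" "y \<in> inl ` TipSet T \<union> inr ` TipSet S"
        using FieldI1[OF xy] FieldI2[OF xy] ZD by auto
      show ?thesis
      proof (cases "x \<in> inr ` TipSet S \<and> y \<in> inr ` TipSet S")
        case True
        then obtain a b where ab: "x = inr a" "y = inr b" "a \<in> TipSet S" "b \<in> TipSet S" by auto
        then have "nle S a b" "nle S b a" using n rk_nle(1)[OF S, of a b] rk_nle(1)[OF S, of b a] by (auto simp: pq)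
        then show ?thesis using fibre_order_unique[OF S FS Y] xy ab by simp
      next
        case False
        then show ?thesis using F xy ZD YD by auto
      qed
    qed
    then show ?thesis using ZD YD by (auto simp: admissible_def flo_ordered_sum)
  qed
  show ?thesis using block_move_between[OF i fi j fj] adm by blast
qed

text \<open>The roles are exchanged: \<open>U\<close> consists of the tips of \<open>T\<close>, and
  the block comes from \<open>S\<close>. The block is now in front in \<open>tree_sum S T\<close>
  and behind in \<open>tree_sum T S\<close>, so the moving arrow runs the other way and its inverse
  is taken.\<close>

lemma braid_order_right:
  assumes S: "pruned_tree S" and T: "pruned_tree T" and Y: "fibre_order S Y"
  shows "\<exists>z\<in>Hom \<L> (tree_sum S T) (tree_sum T S). \<forall>Z. fibre_order T Z \<longrightarrow>
     lt (tree_sum T S) (corolla (ordered_sum Z Y)) (\<lambda>x. x) \<bullet> z = lt (tree_sum S T) (corolla (ordered_sum Z Y)) sum_swap"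
proof -
  let ?Z = "Tips T"
  note FT = fibre_order_Tips[OF T]
  define p where "p = cases_sum (rk (TipSet T) (nle T)) (\<lambda>_. 0)"
  define q where "q = cases_sum (\<lambda>_. 0) (rk (TipSet S) (nle S))"
  have pq: "p (inl x) = rk (TipSet T) (nle T) x" "q (inr x) = rk (TipSet S) (nle S) x" for x
    by (simp_all add: p_def q_def)
  have Q: "finite_linear_order (ordered_sum ?Z Y)"
    using flo_ordered_sum fibre_orderD(1)[OF Y] prunedD(1)[OF T] by blast
  interpret block_move "ordered_sum ?Z Y" "inl ` TipSet T" p q by unfold_locales (rule Q)
  note YD = fibre_orderD[OF Y]
  let ?K = "card (TipSet T)"
  have i: "tmor (tree_sum S T) (shuffled 0) sum_swap"
    by (rule tmorI) (use S T Q YD rk_nle in \<open>auto simp: shuffled_def pq less_imp_le\<close>)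
  have j: "tmor (tree_sum T S) (shuffled ?K) (\<lambda>x. x)"
    by (rule tmorI) (use S T Q YD rk_nle in \<open>auto simp: shuffled_def pq less_imp_le\<close>)
  have fi: "bij_betw sum_swap (TipSet (tree_sum S T)) (Field (ordered_sum ?Z Y))"
    and fj: "bij_betw (\<lambda>x. x) (TipSet (tree_sum T S)) (Field (ordered_sum ?Z Y))"
    using bij_betw_swap by (auto simp: YD intro!: bij_betw_id)
  have adm: "admissible (ordered_sum Z Y)" if Z: "fibre_order T Z" for Z
  proof -
    note ZD = fibre_orderD[OF Z]
    have "(x, y) \<in> ordered_sum Z Y" if xy: "(x, y) \<in> ordered_sum ?Z Y"
      and n: "\<not> (x \<in> inl ` TipSet T \<and> y \<in> inl ` TipSet T \<and> p x \<noteq> p y)" for x y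
    proof -
      have F: "x \<in> inl ` TipSet T \<union> inr ` TipSet S" "y \<in> inl ` TipSet T \<union> inr ` TipSet S"
        using FieldI1[OF xy] FieldI2[OF xy] YD by auto
      show ?thesis
      proof (cases "x \<in> inl ` TipSet T \<and> y \<in> inl ` TipSet T")
        case True
        then obtain a b where ab: "x = inl a" "y = inl b" "a \<in> TipSet T" "b \<in> TipSet T" by auto
        then have "nle T a b" "nle T b a" using n rk_nle(1)[OF T, of a b] rk_nle(1)[OF T, of b a] by (auto simp: pq)
        then show ?thesis using fibre_order_unique[OF T FT Z] xy ab by simp
      next
        case False
        then show ?thesis using F xy ZD YD by auto
      qed
    qed
    then show ?thesis using ZD YD by (auto simp: admissible_def flo_ordered_sum)
  qed
  obtain z where z: "z \<in> Hom \<L> (tree_sum T S) (tree_sum S T)" "isomorphism \<L> z"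
    "\<And>Q. admissible Q \<Longrightarrow> lt (tree_sum S T) (corolla Q) sum_swap \<bullet> z = lt (tree_sum T S) (corolla Q) (\<lambda>x. x)"
    using block_move_between[OF j fj i fi] by blast
  note [simp] = z(2) Om.LC.inv_simps[simplified] Om.LC.Comp_simps[simplified]
  have zA: "z \<in> Arr \<L>" "Source z = tree_sum T S" "Target z = tree_sum S T" using z(1) by (auto simp: Hom_iff)
  show ?thesis
  proof (intro bexI allI impI)
    show "inv_arr \<L> z \<in> Hom \<L> (tree_sum S T) (tree_sum T S)" using zA by (simp add: Hom_iff)
    fix Z assume Z: "fibre_order T Z"
    note a = adm[OF Z]
    have "tmor (tree_sum S T) (corolla (ordered_sum Z Y)) sum_swap" using tmor_swap_corolla[OF S T Y Z] .
    then show "lt (tree_sum T S) (corolla (ordered_sum Z Y)) (\<lambda>x. x) \<bullet> inv_arr \<L> z = lt (tree_sum S T) (corolla (ordered_sum Z Y)) sum_swap"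
      unfolding z(3)[OF a, symmetric] using zA by (simp add: Om.LC.Comp_Ident[simplified])
  qed
qed

text \<open>The orders are changed one summand at a time, from \<open>Tips S\<close> to
  \<open>Y\<close> and afterwards from \<open>Tips T\<close> to \<open>Z\<close>. At either stage
  the arrow \<open>z\<close>, which does not depend on the varying order, must be the braiding: they
  agree after composition with an invertible map to a corolla for the order already treated.\<close>

lemma tree_braid_order:
  assumes S: "pruned_tree S" and T: "pruned_tree T" and Y: "fibre_order S Y" and Z: "fibre_order T Z"
  shows "lt (tree_sum T S) (corolla (ordered_sum Z Y)) (\<lambda>x. x) \<bullet> tree_braid S T
    = lt (tree_sum S T) (corolla (ordered_sum Z Y)) sum_swap"
proof -
  have uniq: "z = tree_braid S T"
    if "z \<in> Hom \<L> (tree_sum S T) (tree_sum T S)" "fibre_order S Y" "fibre_order T Z"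
      "lt (tree_sum T S) (corolla (ordered_sum Z Y)) (\<lambda>x. x) \<bullet> z = lt (tree_sum S T) (corolla (ordered_sum Z Y)) sum_swap"
      "lt (tree_sum T S) (corolla (ordered_sum Z Y)) (\<lambda>x. x) \<bullet> tree_braid S T = lt (tree_sum S T) (corolla (ordered_sum Z Y)) sum_swap"
    for z Y Z
  proof (rule Om.LC.iso_cancel_left)
    have Q: "fibre_order (tree_sum T S) (ordered_sum Z Y)" using fibre_order_sum that S T by blast
    then have m: "tmor (tree_sum T S) (corolla (ordered_sum Z Y)) (\<lambda>x. x)" using tmor_corolla_id S T by simp
    show "isomorphism \<L> (lt (tree_sum T S) (corolla (ordered_sum Z Y)) (\<lambda>x. x))"
      by (rule lt_iso[OF m], rule bij_betw_id) (use fibre_orderD[OF Q] in auto)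
    show "lt (tree_sum T S) (corolla (ordered_sum Z Y)) (\<lambda>x. x) \<bullet> z = lt (tree_sum T S) (corolla (ordered_sum Z Y)) (\<lambda>x. x) \<bullet> tree_braid S T"
      using that by simp
  qed (use that S T tmor_corolla_id[OF _ fibre_order_sum[OF T S that(3,2)]] in \<open>auto simp: Hom_iff\<close>)
  have 1: "lt (tree_sum T S) (corolla (ordered_sum (Tips T) Y)) (\<lambda>x. x) \<bullet> tree_braid S T
    = lt (tree_sum S T) (corolla (ordered_sum (Tips T) Y)) sum_swap"
    using braid_order_left[OF S T fibre_order_Tips[OF T]] uniq[OF _ fibre_order_Tips[OF S] fibre_order_Tips[OF T]]
      tree_braid_Tips[OF S T] fibre_order_Tips[OF S] Y by metis
  show ?thesis
    using braid_order_right[OF S T Y] uniq[OF _ Y fibre_order_Tips[OF T] _ 1] fibre_order_Tips[OF T] Z by metis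
qed

section \<open>The braided structure\<close>

lemmas L_Comp_simps [simp] = Om.LC.Comp_simps[simplified]
lemmas L_inv_simps [simp] = Om.LC.inv_simps[simplified]

text \<open>If \<open>f\<close> is a morphism already on the corolla, it factors through the arrow
  by which the braiding is characterised. The braiding then turns into a swap of tips, and an
  equation of fractions into one of maps; any compatible pair of orders may be used.\<close>

lemma tree_braid_absorb:
  assumes S: "pruned_tree S" and T: "pruned_tree T" and Y: "fibre_order S Y" and Z: "fibre_order T Z"
    and f: "tmor (corolla (ordered_sum Z Y)) X f"
  shows "lt (tree_sum T S) X f \<bullet> tree_braid S T = lt (tree_sum S T) X (f \<circ> sum_swap)"
proof -
  have q: "tmor (tree_sum T S) (corolla (ordered_sum Z Y)) (\<lambda>x. x)"
    using tmor_corolla_id[OF _ fibre_order_sum[OF T S Z Y]] S T by simp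
  have s: "tmor (tree_sum S T) (corolla (ordered_sum Z Y)) sum_swap" using tmor_swap_corolla[OF S T Y Z] .
  have "lt (tree_sum T S) X f \<bullet> tree_braid S T
      = lt (corolla (ordered_sum Z Y)) X f \<bullet> (lt (tree_sum T S) (corolla (ordered_sum Z Y)) (\<lambda>x. x) \<bullet> tree_braid S T)"
    using lt_Comp[OF q f] q f S T by (simp add: comp_def flip: Om.LC.assoc)
  also have "\<dots> = lt (tree_sum S T) X (f \<circ> sum_swap)"
    unfolding tree_braid_order[OF S T Y Z] by (rule lt_Comp[OF s f])
  finally show ?thesis .
qed

lemma lt_TenA: "tmor S T f \<Longrightarrow> tmor S' T' g
    \<Longrightarrow> TenA \<L> (lt S T f) (lt S' T' g) = lt (tree_sum S S') (tree_sum T T') (sum_map f g)"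
  by (simp add: Om.lf_TenA[symmetric] tarr_tmor tarr_TenA)

lemma lt_id: "pruned_tree S \<Longrightarrow> lt S S (\<lambda>x. x) = Om.frac S S []"
  using Om.lf_Ident[of S] by (simp add: Ident_tarr)

text \<open>The same absorption beside an inert tensor factor, as it occurs in the hexagons; only
  the braided part has to factor through a corolla.\<close>

lemma tree_braid_absorb_left:
  assumes S: "pruned_tree S" and T: "pruned_tree T" and U: "pruned_tree U"
    and f: "tmor (tree_sum U (corolla (ordered_sum (Tips T) (Tips S)))) X f"
  shows "lt (tree_sum U (tree_sum T S)) X f \<bullet> Om.LT U (tree_braid S T)
    = lt (tree_sum U (tree_sum S T)) X (f \<circ> sum_map (\<lambda>x. x) sum_swap)"
proof -
  let ?c = "corolla (ordered_sum (Tips T) (Tips S))"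
  let ?X = "lt (tree_sum U ?c) X f"
  let ?q = "lt (tree_sum T S) ?c (\<lambda>x. x)"
  let ?s = "lt (tree_sum S T) ?c sum_swap"
  note F = fibre_order_Tips[OF S] fibre_order_Tips[OF T]
  have q: "tmor (tree_sum T S) ?c (\<lambda>x. x)"
    using tmor_corolla_id[OF _ fibre_order_sum[OF T S F(2,1)]] S T by simp
  have s: "tmor (tree_sum S T) ?c sum_swap" using tmor_swap_corolla[OF S T F] .
  note i = tmor_id[OF U]
  have e: "?X \<bullet> Om.LT U (?q) = lt (tree_sum U (tree_sum T S)) X f"
    unfolding lt_id[OF U, symmetric] lt_TenA[OF i q] by (rule lt_Comp_eq[OF tmor_sum[OF i q] f]) auto
  have "lt (tree_sum U (tree_sum T S)) X f \<bullet> Om.LT U (tree_braid S T)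
      = ?X \<bullet> (Om.LT U (?q) \<bullet> Om.LT U (tree_braid S T))"
    unfolding e[symmetric] using q f S T U by (subst Om.LC.assoc) simp_all
  also have "Om.LT U (?q) \<bullet> Om.LT U (tree_braid S T)
     = Om.LT U (?s)"
    using tree_braid_Tips[OF S T] q S T U by (subst Om.LT_Comp[symmetric]) simp_all
  also have "?X \<bullet> Om.LT U (?s)
     = lt (tree_sum U (tree_sum S T)) X (f \<circ> sum_map (\<lambda>x. x) sum_swap)"
    unfolding lt_id[OF U, symmetric] lt_TenA[OF i s] by (rule lt_Comp[OF tmor_sum[OF i s] f])
  finally show ?thesis .
qed

lemma tree_braid_absorb_right:
  assumes S: "pruned_tree S" and T: "pruned_tree T" and U: "pruned_tree U"
    and f: "tmor (tree_sum (corolla (ordered_sum (Tips T) (Tips S))) U) X f"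
  shows "lt (tree_sum (tree_sum T S) U) X f \<bullet> Om.RT (tree_braid S T) U
    = lt (tree_sum (tree_sum S T) U) X (f \<circ> sum_map sum_swap (\<lambda>x. x))"
proof -
  let ?c = "corolla (ordered_sum (Tips T) (Tips S))"
  let ?X = "lt (tree_sum ?c U) X f"
  let ?q = "lt (tree_sum T S) ?c (\<lambda>x. x)"
  let ?s = "lt (tree_sum S T) ?c sum_swap"
  note F = fibre_order_Tips[OF S] fibre_order_Tips[OF T]
  have q: "tmor (tree_sum T S) ?c (\<lambda>x. x)"
    using tmor_corolla_id[OF _ fibre_order_sum[OF T S F(2,1)]] S T by simp
  have s: "tmor (tree_sum S T) ?c sum_swap" using tmor_swap_corolla[OF S T F] .
  note i = tmor_id[OF U]
  have e: "?X \<bullet> Om.RT (?q) U = lt (tree_sum (tree_sum T S) U) X f"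
    unfolding lt_id[OF U, symmetric] lt_TenA[OF q i] by (rule lt_Comp_eq[OF tmor_sum[OF q i] f]) auto
  have "lt (tree_sum (tree_sum T S) U) X f \<bullet> Om.RT (tree_braid S T) U
      = ?X \<bullet> (Om.RT (?q) U \<bullet> Om.RT (tree_braid S T) U)"
    unfolding e[symmetric] using q f S T U by (subst Om.LC.assoc) simp_all
  also have "Om.RT (?q) U \<bullet> Om.RT (tree_braid S T) U
     = Om.RT (?s) U"
    using tree_braid_Tips[OF S T] q S T U by (subst Om.RT_Comp[symmetric]) simp_all
  also have "?X \<bullet> Om.RT (?s) U
     = lt (tree_sum (tree_sum S T) U) X (f \<circ> sum_map sum_swap (\<lambda>x. x))"
    unfolding lt_id[OF U, symmetric] lt_TenA[OF s i] by (rule lt_Comp[OF tmor_sum[OF s i] f])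
  finally show ?thesis .
qed

text \<open>Ties are broken by the order of \<open>S\<close>, so that the orders of the fibres are respected.\<close>

definition pull_order :: "tree \<Rightarrow> tree \<Rightarrow> (nat \<Rightarrow> nat) \<Rightarrow> nat rel" where
  "pull_order S T f = {(x, y). x \<in> TipSet S \<and> y \<in> TipSet S \<and> tle T (f x) (f y) \<and> (f x = f y \<longrightarrow> tle S x y)}"

lemma fibre_order_pull:
  assumes f: "tmor S T f" shows "fibre_order S (pull_order S T f)"
proof -
  note s = floD[OF prunedD(1)[OF tmorD(1)[OF f]]] and t = floD[OF prunedD(1)[OF tmorD(2)[OF f]]]
  note fx = tmorD(3)[OF f]
  have F: "Field (pull_order S T f) = TipSet S"
  proof
    show "Field (pull_order S T f) \<subseteq> TipSet S" by (auto simp: Field_def pull_order_def)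
    show "TipSet S \<subseteq> Field (pull_order S T f)"
    proof
      fix x assume "x \<in> TipSet S"
      then have "(x, x) \<in> pull_order S T f" using s(3) t(3) fx by (simp add: pull_order_def)
      then show "x \<in> Field (pull_order S T f)" by (rule FieldI1)
    qed
  qed
  have "finite (pull_order S T f)"
    by (rule finite_subset[of _ "TipSet S \<times> TipSet S"]) (use s(2) in \<open>auto simp: pull_order_def\<close>)
  moreover have "(x, x) \<in> pull_order S T f" if "x \<in> TipSet S" for x
    using that s(3) t(3) fx by (simp add: pull_order_def)
  moreover have "(x, z) \<in> pull_order S T f" if "(x, y) \<in> pull_order S T f" "(y, z) \<in> pull_order S T f" for x y z
  proof -
    from that have *: "tle T (f x) (f y)" "tle T (f y) (f z)" "x \<in> TipSet S" "z \<in> TipSet S"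
      "f x = f y \<longrightarrow> tle S x y" "f y = f z \<longrightarrow> tle S y z" by (auto simp: pull_order_def)
    moreover have "tle S x z" if e: "f x = f z"
    proof -
      have "f x = f y" "f y = f z" using t(5) *(1,2) e by metis+
      then show ?thesis using * s(4) by blast
    qed
    ultimately show ?thesis using t(4) unfolding pull_order_def by blast
  qed
  moreover have "x = y" if "(x, y) \<in> pull_order S T f" "(y, x) \<in> pull_order S T f" for x y
  proof -
    have "f x = f y" using that t(5) by (auto simp: pull_order_def)
    then show ?thesis using that s(5) by (auto simp: pull_order_def)
  qed
  moreover have "(x, y) \<in> pull_order S T f \<or> (y, x) \<in> pull_order S T f" if "x \<in> TipSet S" "y \<in> TipSet S" for x y
  proof (cases "f x = f y")
    case True then show ?thesis using that s(6)[of x y] t(3)[OF fx] by (auto simp: pull_order_def)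
  next
    case False then show ?thesis using that t(6)[OF fx fx, of x y] by (auto simp: pull_order_def)
  qed
  ultimately have "finite_linear_order (pull_order S T f)" unfolding flo_iff F by blast
  moreover have "(x, y) \<in> pull_order S T f" if "tle S x y" "nle S x y" "nle S y x" for x y
    using that tmorD(5)[OF f] FieldI1[OF that(1)] FieldI2[OF that(1)] by (auto simp: pull_order_def)
  ultimately show ?thesis using F by (auto simp: fibre_order_def)
qed

text \<open>Both sides are followed by the invertible map to the corolla on the target. The braiding
  of the target is absorbed with the given orders of tips, that of the source with the pulled-back
  orders, and the same map of tips remains.\<close>

lemma tree_braid_nat_lt:
  assumes f: "tmor S S' f" and g: "tmor T T' g"
  shows "tree_braid S' T' \<bullet> TenA \<L> (lt S S' f) (lt T T' g) = TenA \<L> (lt T T' g) (lt S S' f) \<bullet> tree_braid S T"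
proof -
  note p = tmorD(1,2)[OF f] tmorD(1,2)[OF g]
  note Y = fibre_order_pull[OF f] and Z = fibre_order_pull[OF g]
  note YD = fibre_orderD[OF Y] and ZD = fibre_orderD[OF Z]
  note F = fibre_order_Tips[OF p(2)] fibre_order_Tips[OF p(4)]
  let ?c = "corolla (ordered_sum (Tips T') (Tips S'))"
  let ?K = "lt (tree_sum T' S') ?c (\<lambda>x. x)"
  let ?FG = "lt (tree_sum S T) (tree_sum S' T') (sum_map f g)"
  let ?GF = "lt (tree_sum T S) (tree_sum T' S') (sum_map g f)"
  have O: "finite_linear_order (ordered_sum (Tips T') (Tips S'))"
    using flo_ordered_sum prunedD(1) p by blast
  have q: "tmor (tree_sum T' S') ?c (\<lambda>x. x)"
    using tmor_corolla_id[OF _ fibre_order_sum[OF p(4,2) F(2,1)]] p by simp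
  have s: "tmor (tree_sum S' T') ?c sum_swap" using tmor_swap_corolla[OF p(2,4) F] .
  have i: "isomorphism \<L> (?K)"
    by (rule lt_iso[OF q]) (auto intro: bij_betw_id simp: O)
  note fg = tmor_sum[OF f g] and gf = tmor_sum[OF g f]
  \<comment> \<open>With the pulled-back orders the tip map is monotone between the corollas. For
    the orders \<open>Tips S\<close> and \<open>Tips T\<close> this may fail, since \<open>f\<close>
    and \<open>g\<close> are monotone on fibres only.\<close>
  have k: "tmor (corolla (ordered_sum (pull_order T T' g) (pull_order S S' f))) ?c (sum_map g f)"
    by (rule tmorI)
       (use O YD(1,2) ZD(1,2) tmorD(3)[OF f] tmorD(3)[OF g] in \<open>auto simp: flo_ordered_sum pull_order_def\<close>)
  show ?thesis unfolding lt_TenA[OF f g] lt_TenA[OF g f]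
  proof (rule Om.LC.iso_cancel_left[OF i])
    have "?K \<bullet> tree_braid S' T' \<bullet> ?FG
        = lt (tree_sum S' T') ?c sum_swap \<bullet> ?FG"
      using tree_braid_Tips[OF p(2,4)] p q fg by (subst Om.LC.assoc[symmetric]) simp_all
    also have "\<dots> = lt (tree_sum S T) ?c (sum_map g f \<circ> sum_swap)"
      by (rule lt_Comp_eq[OF fg s]) auto
    also have "\<dots> = lt (tree_sum T S) ?c (sum_map g f) \<bullet> tree_braid S T"
      using tree_braid_absorb[OF p(1,3) Y Z k] by simp
    also have "lt (tree_sum T S) ?c (sum_map g f) = ?K \<bullet> ?GF"
      by (rule lt_Comp_eq[OF gf q, symmetric]) auto
    finally show "?K \<bullet> tree_braid S' T' \<bullet> ?FG
       = ?K \<bullet> ?GF \<bullet> tree_braid S T"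
      using p q gf by simp
  qed (use p fg gf q in simp_all)
qed

text \<open>Passing from tree morphisms to fractions is done separately in each variable by
  \<open>natural_L\<close>; the two halves are joined by splitting the tensor product.\<close>

lemma tree_braid_nat:
  assumes X: "X \<in> Arr \<L>" and Y: "Y \<in> Arr \<L>"
  shows "tree_braid (Target X) (Target Y) \<bullet> TenA \<L> X Y = TenA \<L> Y X \<bullet> tree_braid (Source X) (Source Y)"
proof -
  note LA = Om.LC.Dom_in[simplified] Om.LC.Cod_in[simplified]
  have lf: "\<exists>S S' f. h = tarr S S' f \<and> tmor S S' f" if "h \<in> Arr Omega2" for h
    using Arr_tarr[OF that] by blast
  have right: "tree_braid (Target X) c \<bullet> Om.RT X c = Om.LT c X \<bullet> tree_braid (Source X) c"
    if X: "X \<in> Arr \<L>" and c: "pruned_tree c" for X c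
  proof (rule Om.natural_L[OF Om.RT_functor Om.LT_functor _ _ X, where \<theta> = "\<lambda>a. tree_braid a c"])
    fix h assume "h \<in> Arr Omega2"
    then obtain S S' f where "h = tarr S S' f" "tmor S S' f" using lf by blast
    then show "tree_braid (Cod Omega2 h) c \<bullet> Om.RT (Om.lf h) c = Om.LT c (Om.lf h) \<bullet> tree_braid (Dom Omega2 h) c"
      using tree_braid_nat_lt[OF _ tmor_id[OF c], of S S' f] by (simp add: lt_id c)
  qed (use c in \<open>simp_all add: Hom_iff\<close>)
  have left: "tree_braid c (Target X) \<bullet> Om.LT c X = Om.RT X c \<bullet> tree_braid c (Source X)"
    if X: "X \<in> Arr \<L>" and c: "pruned_tree c" for X c
  proof (rule Om.natural_L[OF Om.LT_functor Om.RT_functor _ _ X, where \<theta> = "\<lambda>a. tree_braid c a"])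
    fix h assume "h \<in> Arr Omega2"
    then obtain S S' f where "h = tarr S S' f" "tmor S S' f" using lf by blast
    then show "tree_braid c (Cod Omega2 h) \<bullet> Om.LT c (Om.lf h) = Om.RT (Om.lf h) c \<bullet> tree_braid c (Dom Omega2 h)"
      using tree_braid_nat_lt[OF tmor_id[OF c], of S S' f] by (simp add: lt_id c)
  qed (use c in \<open>simp_all add: Hom_iff\<close>)
  have o: "pruned_tree (Source X)" "pruned_tree (Target X)" "pruned_tree (Source Y)" "pruned_tree (Target Y)"
    using LA X Y by auto
  have "tree_braid (Target X) (Target Y) \<bullet> TenA \<L> X Y
     = (tree_braid (Target X) (Target Y) \<bullet> Om.LT (Target X) Y) \<bullet> Om.RT X (Source Y)"
    unfolding Om.L_TenA_split[OF X Y] using X Y o by (subst Om.LC.assoc) simp_all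
  also have "\<dots> = Om.RT Y (Target X) \<bullet> (tree_braid (Target X) (Source Y) \<bullet> Om.RT X (Source Y))"
    unfolding left[OF Y o(2)] using X Y o by (subst Om.LC.assoc) simp_all
  also have "\<dots> = (Om.RT Y (Target X) \<bullet> Om.LT (Source Y) X) \<bullet> tree_braid (Source X) (Source Y)"
    unfolding right[OF X o(3)] using X Y o by (subst Om.LC.assoc) simp_all
  also have "Om.RT Y (Target X) \<bullet> Om.LT (Source Y) X = TenA \<L> Y X"
    using Om.L_TenA_split[OF Y X] Om.L_interchange[OF Y X] by simp
  finally show ?thesis .
qed

section \<open>The hexagons\<close>

lemma lf_Assoc: "pruned_tree a \<Longrightarrow> pruned_tree b \<Longrightarrow> pruned_tree c
   \<Longrightarrow> Om.lf (Assoc Omega2 a b c) = lt (tree_sum (tree_sum a b) c) (tree_sum a (tree_sum b c)) sum_assoc"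
  by (simp add: tarr_Assoc)

definition sum_assoc_inv :: "nat \<Rightarrow> nat" where
  "sum_assoc_inv = cases_sum (inl \<circ> inl) (cases_sum (inl \<circ> inr) inr)"

lemma sum_assoc_inv_simps [simp]: "sum_assoc_inv (inl x) = inl (inl x)" "sum_assoc_inv (inr (inl x)) = inl (inr x)"
  "sum_assoc_inv (inr (inr x)) = inr x"
  by (auto simp: sum_assoc_inv_def)

lemma tmor_assoc_inv: "pruned_tree a \<Longrightarrow> pruned_tree b \<Longrightarrow> pruned_tree c
   \<Longrightarrow> tmor (tree_sum a (tree_sum b c)) (tree_sum (tree_sum a b) c) sum_assoc_inv"
  by (rule tmorI) auto

lemma inv_lf_Assoc:
  assumes "pruned_tree a" "pruned_tree b" "pruned_tree c"
  shows "inv_arr \<L> (Om.lf (Assoc Omega2 a b c)) = lt (tree_sum a (tree_sum b c)) (tree_sum (tree_sum a b) c) sum_assoc_inv"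
proof -
  note t = tmor_assoc[OF assms] tmor_assoc_inv[OF assms]
  have "lt (tree_sum a (tree_sum b c)) (tree_sum (tree_sum a b) c) sum_assoc_inv \<bullet>
      lt (tree_sum (tree_sum a b) c) (tree_sum a (tree_sum b c)) sum_assoc = Om.frac (tree_sum (tree_sum a b) c) (tree_sum (tree_sum a b) c) []"
    unfolding lt_id[OF pruned_sum[OF pruned_sum[OF assms(1,2)] assms(3)], symmetric] by (rule lt_Comp_eq[OF t]) auto
  moreover have "lt (tree_sum (tree_sum a b) c) (tree_sum a (tree_sum b c)) sum_assoc \<bullet>
      lt (tree_sum a (tree_sum b c)) (tree_sum (tree_sum a b) c) sum_assoc_inv = Om.frac (tree_sum a (tree_sum b c)) (tree_sum a (tree_sum b c)) []"
    unfolding lt_id[OF pruned_sum[OF assms(1) pruned_sum[OF assms(2,3)]], symmetric] by (rule lt_Comp_eq[OF t(2,1)]) auto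
  ultimately show ?thesis
    using t assms by (intro Om.LC.inv_arr_eq) (simp add: inverse_arrows_def Hom_iff lf_Assoc)
qed

text \<open>After composition with the invertible \<open>?K\<close> to the corolla on
  \<open>?r\<close>, every braiding is absorbed, the tip maps being monotone for the concatenated
  orders. Both sides become the image of one map that brings the tips of \<open>a\<close> behind
  those of \<open>b\<close> and \<open>c\<close>.\<close>

lemma hexagon_left_trees:
  assumes a: "pruned_tree a" and b: "pruned_tree b" and c: "pruned_tree c"
  shows "Om.lf (Assoc Omega2 b c a) \<bullet> tree_braid a (tree_sum b c) \<bullet> Om.lf (Assoc Omega2 a b c)
     = Om.LT b (tree_braid a c) \<bullet> Om.lf (Assoc Omega2 b a c) \<bullet> Om.RT (tree_braid a b) c"
proof -
  note p = a b c
  let ?r = "ordered_sum (Tips b) (ordered_sum (Tips c) (Tips a))" let ?k = "corolla ?r"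
  let ?K = "lt (tree_sum b (tree_sum c a)) ?k (\<lambda>x. x)"
  let ?a1 = "Om.lf (Assoc Omega2 b c a)"
  let ?a2 = "Om.lf (Assoc Omega2 a b c)"
  let ?a3 = "Om.lf (Assoc Omega2 b a c)"
  let ?abc = "tree_sum (tree_sum a b) c"
  have O: "finite_linear_order ?r" "finite_linear_order (ordered_sum (Tips c) (Tips a))"
    "finite_linear_order (ordered_sum (Tips b) (Tips a))"
    "finite_linear_order (ordered_sum (ordered_sum (Tips b) (Tips c)) (Tips a))"
    using p by (auto intro!: flo_ordered_sum prunedD(1))
  have pc: "pruned_tree (tree_sum b c)" using p by simp
  have k: "tmor (tree_sum b (tree_sum c a)) ?k (\<lambda>x. x)"
    by (rule tmorI) (use p O in auto)
  have ki: "isomorphism \<L> (?K)"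
    by (rule lt_iso[OF k]) (auto intro!: bij_betw_id simp: O)
  let ?f = "sum_map (\<lambda>x. x) sum_swap" let ?g = "?f \<circ> sum_assoc"
  have 1: "?K \<bullet> Om.LT b (tree_braid a c) = lt (tree_sum b (tree_sum a c)) ?k ?f"
  proof -
    have "tmor (tree_sum b (corolla (ordered_sum (Tips c) (Tips a)))) ?k (\<lambda>x. x)"
      by (rule tmorI) (use p O in auto)
    then show ?thesis using tree_braid_absorb_left[OF a c b] by (simp add: comp_def)
  qed
  have f: "tmor (tree_sum b (tree_sum a c)) ?k ?f" by (rule tmorI) (use p O in auto)
  have 2: "lt (tree_sum b (tree_sum a c)) ?k ?f \<bullet> ?a3 = lt (tree_sum (tree_sum b a) c) ?k ?g"
    unfolding lf_Assoc[OF b a c] by (rule lt_Comp[OF tmor_assoc[OF b a c] f])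
  have 3: "lt (tree_sum (tree_sum b a) c) ?k ?g \<bullet> Om.RT (tree_braid a b) c
     = lt (?abc) ?k (?g \<circ> sum_map sum_swap (\<lambda>x. x))"
  proof (rule tree_braid_absorb_right[OF a b c])
    show "tmor (tree_sum (corolla (ordered_sum (Tips b) (Tips a))) c) ?k ?g"
      by (rule tmorI) (use p O in auto)
  qed
  have 4: "?K \<bullet> ?a1
     = lt (tree_sum (tree_sum b c) a) ?k sum_assoc"
    unfolding lf_Assoc[OF b c a] by (rule lt_Comp_eq[OF tmor_assoc[OF b c a] k]) auto
  have 5: "lt (tree_sum (tree_sum b c) a) ?k sum_assoc \<bullet> tree_braid a (tree_sum b c)
     = lt (tree_sum a (tree_sum b c)) ?k (sum_assoc \<circ> sum_swap)"
  proof (rule tree_braid_absorb[OF a pc fibre_order_Tips[OF a] fibre_order_Tips[OF pc]])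
    show "tmor (corolla (ordered_sum (Tips (tree_sum b c)) (Tips a))) ?k sum_assoc"
      unfolding Tips_sum by (rule tmorI) (use p O in auto)
  qed
  have s: "tmor (tree_sum a (tree_sum b c)) ?k (sum_assoc \<circ> sum_swap)"
    by (rule tmorI) (use p O in auto)
  have g: "tmor (tree_sum (tree_sum b a) c) ?k ?g" using tarr_Comp(1)[OF tmor_assoc[OF b a c] f] .
  note [simp] = p k s f g tmor_assoc lf_Assoc
  show ?thesis
  proof (rule Om.LC.iso_cancel_left[OF ki])
    have "?K \<bullet> ?a1 \<bullet> tree_braid a (tree_sum b c) \<bullet> ?a2
      = ((?K \<bullet> ?a1) \<bullet> tree_braid a (tree_sum b c)) \<bullet> ?a2"
      by simp
    also have "\<dots> = lt (?abc) ?k (?g \<circ> sum_map sum_swap (\<lambda>x. x))"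
      unfolding 4 5 unfolding lf_Assoc[OF p] by (rule lt_Comp_eq[OF tmor_assoc[OF p] s]) auto
    also have "\<dots> = ((?K \<bullet> Om.LT b (tree_braid a c)) \<bullet> ?a3) \<bullet> Om.RT (tree_braid a b) c"
      unfolding 1 2 3 ..
    finally show "?K \<bullet> ?a1 \<bullet> tree_braid a (tree_sum b c) \<bullet> ?a2
      = ?K \<bullet> Om.LT b (tree_braid a c) \<bullet> ?a3 \<bullet> Om.RT (tree_braid a b) c"
      by simp
  qed simp_all
qed

text \<open>The mirror image: the concatenated order is bracketed to the left, and the inverse
  associators are morphisms of trees given by \<open>sum_assoc_inv\<close>.\<close>

lemma hexagon_right_trees:
  assumes a: "pruned_tree a" and b: "pruned_tree b" and c: "pruned_tree c"
  shows "inv_arr \<L> (Om.lf (Assoc Omega2 c a b)) \<bullet> tree_braid (tree_sum a b) c \<bullet> inv_arr \<L> (Om.lf (Assoc Omega2 a b c))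
     = Om.RT (tree_braid a c) b \<bullet> inv_arr \<L> (Om.lf (Assoc Omega2 a c b)) \<bullet> Om.LT a (tree_braid b c)"
proof -
  note p = a b c
  let ?r = "ordered_sum (ordered_sum (Tips c) (Tips a)) (Tips b)" let ?k = "corolla ?r"
  let ?K = "lt (tree_sum (tree_sum c a) b) ?k (\<lambda>x. x)"
  let ?a1 = "inv_arr \<L> (Om.lf (Assoc Omega2 c a b))"
  let ?a2 = "inv_arr \<L> (Om.lf (Assoc Omega2 a b c))"
  let ?a3 = "inv_arr \<L> (Om.lf (Assoc Omega2 a c b))"
  let ?abc = "tree_sum a (tree_sum b c)"
  have O: "finite_linear_order ?r" "finite_linear_order (ordered_sum (Tips c) (Tips a))"
    "finite_linear_order (ordered_sum (Tips c) (Tips b))"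
    "finite_linear_order (ordered_sum (Tips c) (ordered_sum (Tips a) (Tips b)))"
    using p by (auto intro!: flo_ordered_sum prunedD(1))
  have pc: "pruned_tree (tree_sum a b)" using p by simp
  have k: "tmor (tree_sum (tree_sum c a) b) ?k (\<lambda>x. x)"
    by (rule tmorI) (use p O in auto)
  have ki: "isomorphism \<L> (?K)"
    by (rule lt_iso[OF k]) (auto intro!: bij_betw_id simp: O)
  let ?f = "sum_map sum_swap (\<lambda>x. x)" let ?g = "?f \<circ> sum_assoc_inv"
  have 1: "?K \<bullet> Om.RT (tree_braid a c) b = lt (tree_sum (tree_sum a c) b) ?k ?f"
  proof -
    have "tmor (tree_sum (corolla (ordered_sum (Tips c) (Tips a))) b) ?k (\<lambda>x. x)"
      by (rule tmorI) (use p O in auto)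
    then show ?thesis using tree_braid_absorb_right[OF a c b] by (simp add: comp_def)
  qed
  have f: "tmor (tree_sum (tree_sum a c) b) ?k ?f" by (rule tmorI) (use p O in auto)
  have 2: "lt (tree_sum (tree_sum a c) b) ?k ?f \<bullet> ?a3 = lt (tree_sum a (tree_sum c b)) ?k ?g"
    unfolding inv_lf_Assoc[OF a c b] by (rule lt_Comp[OF tmor_assoc_inv[OF a c b] f])
  have 3: "lt (tree_sum a (tree_sum c b)) ?k ?g \<bullet> Om.LT a (tree_braid b c)
     = lt (?abc) ?k (?g \<circ> sum_map (\<lambda>x. x) sum_swap)"
  proof (rule tree_braid_absorb_left[OF b c a])
    show "tmor (tree_sum a (corolla (ordered_sum (Tips c) (Tips b)))) ?k ?g"
      by (rule tmorI) (use p O in auto)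
  qed
  have 4: "?K \<bullet> ?a1
     = lt (tree_sum c (tree_sum a b)) ?k sum_assoc_inv"
    unfolding inv_lf_Assoc[OF c a b] by (rule lt_Comp_eq[OF tmor_assoc_inv[OF c a b] k]) auto
  have 5: "lt (tree_sum c (tree_sum a b)) ?k sum_assoc_inv \<bullet> tree_braid (tree_sum a b) c
     = lt (tree_sum (tree_sum a b) c) ?k (sum_assoc_inv \<circ> sum_swap)"
  proof (rule tree_braid_absorb[OF pc c fibre_order_Tips[OF pc] fibre_order_Tips[OF c]])
    show "tmor (corolla (ordered_sum (Tips c) (Tips (tree_sum a b)))) ?k sum_assoc_inv"
      unfolding Tips_sum by (rule tmorI) (use p O in auto)
  qed
  have s: "tmor (tree_sum (tree_sum a b) c) ?k (sum_assoc_inv \<circ> sum_swap)"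
    by (rule tmorI) (use p O in auto)
  have g: "tmor (tree_sum a (tree_sum c b)) ?k ?g" using tarr_Comp(1)[OF tmor_assoc_inv[OF a c b] f] .
  note [simp] = p k s f g tmor_assoc_inv inv_lf_Assoc
  show ?thesis
  proof (rule Om.LC.iso_cancel_left[OF ki])
    have "?K \<bullet> ?a1 \<bullet> tree_braid (tree_sum a b) c \<bullet> ?a2
      = ((?K \<bullet> ?a1) \<bullet> tree_braid (tree_sum a b) c) \<bullet> ?a2"
      by simp
    also have "\<dots> = lt (?abc) ?k (?g \<circ> sum_map (\<lambda>x. x) sum_swap)"
      unfolding 4 5 unfolding inv_lf_Assoc[OF p] by (rule lt_Comp_eq[OF tmor_assoc_inv[OF p] s]) auto
    also have "\<dots> = ((?K \<bullet> Om.RT (tree_braid a c) b) \<bullet> ?a3) \<bullet> Om.LT a (tree_braid b c)"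
      unfolding 1 2 3 ..
    finally show "?K \<bullet> ?a1 \<bullet> tree_braid (tree_sum a b) c \<bullet> ?a2
      = ?K \<bullet> Om.RT (tree_braid a c) b \<bullet> ?a3 \<bullet> Om.LT a (tree_braid b c)"
      by simp
  qed simp_all
qed

section \<open>Assembling the braided monoidal category\<close>

lemma Omega2_frac_sel [simp]:
  "Obj Omega2_frac = {t. pruned_tree t}" "Arr Omega2_frac = Arr \<L>" "Dom Omega2_frac = Source" "Cod Omega2_frac = Target"
  "Ident Omega2_frac = Ident \<L>" "Comp Omega2_frac = Comp \<L>" "TenO Omega2_frac = tree_sum" "TenA Omega2_frac = TenA \<L>"
  "Munit Omega2_frac = empty_tree" "Assoc Omega2_frac = Assoc \<L>" "Lunit Omega2_frac = Lunit \<L>"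
  "Runit Omega2_frac = Runit \<L>" "Braid Omega2_frac = tree_braid"
  by (simp_all add: Omega2_frac_def moncat.defs brcat.defs localisation_def)

lemma Omega2_frac_cat: "Hom Omega2_frac = Hom \<L>" "isomorphism Omega2_frac = isomorphism \<L>" "inv_arr Omega2_frac = inv_arr \<L>"
proof -
  show H: "Hom Omega2_frac = Hom \<L>" by (intro ext) (simp add: Hom_def)
  have "inverse_arrows Omega2_frac = inverse_arrows \<L>" by (intro ext) (simp add: inverse_arrows_def H)
  then show "isomorphism Omega2_frac = isomorphism \<L>" "inv_arr Omega2_frac = inv_arr \<L>"
    by (auto simp: isomorphism_def inv_arr_def fun_eq_iff)
qed

lemma category_Omega2_frac: "category Omega2_frac"
  using Om.category_L unfolding category_def Omega2_frac_cat by simp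

lemma monoidal_Omega2_frac: "monoidal_category Omega2_frac"
proof -
  have "monoidal_category_axioms \<L>" using Om.monoidal_L by (simp add: monoidal_category_def)
  then have "monoidal_category_axioms Omega2_frac"
    unfolding monoidal_category_axioms_def Omega2_frac_cat by simp
  then show ?thesis using category_Omega2_frac by (simp add: monoidal_category_def)
qed

lemma braided_Omega2_frac: "braided_monoidal_category Omega2_frac"
proof -
  interpret monoidal_category Omega2_frac by (rule monoidal_Omega2_frac)
  show ?thesis
  proof
    fix a b c f g a' b'
    show "a \<in> Obj Omega2_frac \<Longrightarrow> b \<in> Obj Omega2_frac \<Longrightarrow>
      Braid Omega2_frac a b \<in> Hom Omega2_frac (a \<odot>\<^bsub>Omega2_frac\<^esub> b) (b \<odot>\<^bsub>Omega2_frac\<^esub> a)"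
      by (simp add: Omega2_frac_cat Hom_iff)
    show "a \<in> Obj Omega2_frac \<Longrightarrow> b \<in> Obj Omega2_frac \<Longrightarrow> isomorphism Omega2_frac (Braid Omega2_frac a b)"
      by (simp add: Omega2_frac_cat tree_braid_iso)
    show "f \<in> Hom Omega2_frac a a' \<Longrightarrow> g \<in> Hom Omega2_frac b b' \<Longrightarrow>
      Braid Omega2_frac a' b' \<cdot>\<^bsub>Omega2_frac\<^esub> (f \<otimes>\<^bsub>Omega2_frac\<^esub> g) = (g \<otimes>\<^bsub>Omega2_frac\<^esub> f) \<cdot>\<^bsub>Omega2_frac\<^esub> Braid Omega2_frac a b"
      using tree_braid_nat[of f g] by (auto simp: Omega2_frac_cat Hom_iff)
    assume o: "a \<in> Obj Omega2_frac" "b \<in> Obj Omega2_frac" "c \<in> Obj Omega2_frac"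
    show "Assoc Omega2_frac b c a \<cdot>\<^bsub>Omega2_frac\<^esub> Braid Omega2_frac a (b \<odot>\<^bsub>Omega2_frac\<^esub> c) \<cdot>\<^bsub>Omega2_frac\<^esub> Assoc Omega2_frac a b c
       = (Ident Omega2_frac b \<otimes>\<^bsub>Omega2_frac\<^esub> Braid Omega2_frac a c) \<cdot>\<^bsub>Omega2_frac\<^esub> Assoc Omega2_frac b a c
         \<cdot>\<^bsub>Omega2_frac\<^esub> (Braid Omega2_frac a b \<otimes>\<^bsub>Omega2_frac\<^esub> Ident Omega2_frac c)"
      using o hexagon_left_trees[of a b c] by simp
    show "inv_arr Omega2_frac (Assoc Omega2_frac c a b) \<cdot>\<^bsub>Omega2_frac\<^esub> Braid Omega2_frac (a \<odot>\<^bsub>Omega2_frac\<^esub> b) c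
        \<cdot>\<^bsub>Omega2_frac\<^esub> inv_arr Omega2_frac (Assoc Omega2_frac a b c)
       = (Braid Omega2_frac a c \<otimes>\<^bsub>Omega2_frac\<^esub> Ident Omega2_frac b) \<cdot>\<^bsub>Omega2_frac\<^esub> inv_arr Omega2_frac (Assoc Omega2_frac a c b)
         \<cdot>\<^bsub>Omega2_frac\<^esub> (Ident Omega2_frac a \<otimes>\<^bsub>Omega2_frac\<^esub> Braid Omega2_frac b c)"
      using o hexagon_right_trees[of a b c] by (simp add: Omega2_frac_cat)
  qed
qed

section \<open>Lexicographic order of the tips\<close>

lemma flo_singleton: "finite_linear_order {(1, 1)}"
  by (auto simp: flo_iff)

lemma S1_simps [simp]: "pruned_tree S1" "TipSet S1 = {1}" "tle S1 x y \<longleftrightarrow> x = 1 \<and> y = 1" "nle S1 1 1" "nle S1 (Suc 0) (Suc 0)"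
  unfolding S1_def using flo_singleton by auto

lemma tmor_S1: "pruned_tree T \<Longrightarrow> (\<And>x. x \<in> TipSet T \<Longrightarrow> f x = 1) \<Longrightarrow> tmor T S1 f"
  by (rule tmorI) auto

lemma lt_S1: "pruned_tree T \<Longrightarrow> (\<And>x. x \<in> TipSet T \<Longrightarrow> f x = 1) \<Longrightarrow> lt T S1 f = lt T S1 (\<lambda>_. 1)"
  by (rule lt_cong) auto

lemma to_S1_tarr: "pruned_tree T \<Longrightarrow> to_S1 T = tarr T S1 (\<lambda>_. 1)"
  unfolding to_S1_def by (rule tree_map_tarr[OF tmor_S1]) (auto simp: S1_def corolla_def)

lemma S1_monoid_simps [simp]: "Carr S1_monoid = S1" "Mult S1_monoid = lt (tree_sum S1 S1) S1 (\<lambda>_. 1)"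
  "Unt S1_monoid = lt empty_tree S1 (\<lambda>_. 1)"
  by (simp_all add: S1_monoid_def to_S1_tarr)

text \<open>All tip maps to \<open>S1\<close> are constant, which settles the monoid laws. For
  commutativity, the constant map is a morphism on the corolla as well, so it absorbs the
  braiding.\<close>

lemma commutative_S1_monoid: "is_commutative_monoid Omega2_frac S1_monoid"
proof -
  let ?D = "tree_sum S1 S1"
  have m: "tmor ?D S1 (\<lambda>_. 1)" "tmor empty_tree S1 (\<lambda>_. 1)" "tmor S1 S1 (\<lambda>x. x)"
    by (auto intro!: tmor_S1)
  note i = lt_id[OF S1_simps(1), symmetric]
  note t = m tmor_sum[OF m(1,3)] tmor_sum[OF m(3,1)] tmor_sum[OF m(2,3)] tmor_sum[OF m(3,2)]
    tmor_assoc[of S1 S1 S1] tarr_Lunit[of S1]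
  have "lt ?D S1 (\<lambda>_. 1) \<bullet> (lt ?D S1 (\<lambda>_. 1) \<otimes>\<^bsub>\<L>\<^esub> lt S1 S1 (\<lambda>x. x)) = lt (tree_sum ?D S1) S1 (\<lambda>_. 1)"
    unfolding lt_TenA[OF m(1,3)] by (rule lt_Comp_eq[OF t(4) m(1)]) auto
  moreover have "lt ?D S1 (\<lambda>_. 1) \<bullet> (lt S1 S1 (\<lambda>x. x) \<otimes>\<^bsub>\<L>\<^esub> lt ?D S1 (\<lambda>_. 1)) \<bullet> Om.lf (Assoc Omega2 S1 S1 S1) = lt (tree_sum ?D S1) S1 (\<lambda>_. 1)"
  proof -
    have "(lt S1 S1 (\<lambda>x. x) \<otimes>\<^bsub>\<L>\<^esub> lt ?D S1 (\<lambda>_. 1)) \<bullet> Om.lf (Assoc Omega2 S1 S1 S1) = lt (tree_sum ?D S1) ?D (sum_map (\<lambda>x. x) (\<lambda>_. 1) \<circ> sum_assoc)"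
      unfolding lt_TenA[OF m(3,1)] lf_Assoc[OF S1_simps(1,1,1)] by (rule lt_Comp[OF t(8,5)]) simp_all
    moreover have "tmor (tree_sum ?D S1) ?D (sum_map (\<lambda>x. x) (\<lambda>_. 1) \<circ> sum_assoc)"
      by (rule tarr_Comp(1)[OF t(8,5)]) simp_all
    ultimately show ?thesis using lt_Comp_eq[OF _ m(1), of "tree_sum ?D S1" "sum_map (\<lambda>x. x) (\<lambda>_. 1) \<circ> sum_assoc" "\<lambda>_. 1"] by simp
  qed
  moreover have "lt ?D S1 (\<lambda>_. 1) \<bullet> (lt empty_tree S1 (\<lambda>_. 1) \<otimes>\<^bsub>\<L>\<^esub> lt S1 S1 (\<lambda>x. x)) = Om.lf (Lunit Omega2 S1)"
    unfolding lt_TenA[OF m(2,3)] t(11)[OF S1_simps(1)] by (rule lt_Comp_eq[OF t(6) m(1)]) auto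
  moreover have "lt ?D S1 (\<lambda>_. 1) \<bullet> (lt S1 S1 (\<lambda>x. x) \<otimes>\<^bsub>\<L>\<^esub> lt empty_tree S1 (\<lambda>_. 1)) = Om.lf (Runit Omega2 S1)"
    unfolding lt_TenA[OF m(3,2)] t(12)[OF S1_simps(1)] by (rule lt_Comp_eq[OF t(7) m(1)]) auto
  moreover have "lt ?D S1 (\<lambda>_. 1) \<bullet> tree_braid S1 S1 = lt ?D S1 (\<lambda>_. 1)"
  proof -
    have "tmor (corolla (ordered_sum (Tips S1) (Tips S1))) S1 (\<lambda>_. 1)"
      by (rule tmor_S1) (auto intro!: corolla_simps flo_ordered_sum prunedD(1))
    then show ?thesis
      using tree_braid_absorb[OF S1_simps(1,1) fibre_order_Tips[OF S1_simps(1)] fibre_order_Tips[OF S1_simps(1)]]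
      by (simp add: comp_def)
  qed
  ultimately show ?thesis
    unfolding is_commutative_monoid_def using m by (simp add: Hom_iff i)
qed

section \<open>Positions of the tips\<close>

definition lexle :: "tree \<Rightarrow> nat \<Rightarrow> nat \<Rightarrow> bool" where
  "lexle T x y \<longleftrightarrow> nle T x y \<and> (nle T y x \<longrightarrow> tle T x y)"

text \<open>The number of tips strictly before a given one, so positions run from \<open>0\<close>
  to \<open>nt T - 1\<close>.\<close>

definition pos :: "tree \<Rightarrow> nat \<Rightarrow> nat" where
  "pos T = rk (TipSet T) (lexle T)"

abbreviation nt :: "tree \<Rightarrow> nat" where
  "nt T \<equiv> card (TipSet T)"

definition tips :: "tree \<Rightarrow> nat list" where
  "tips T = map (inv_into (TipSet T) (pos T)) [0..<nt T]"

lemma finite_tips: "pruned_tree T \<Longrightarrow> finite (TipSet T)"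
  using flo_finite(2)[OF prunedD(1)] .

lemma pos_le:
  assumes T: "pruned_tree T" and "x \<in> TipSet T" "y \<in> TipSet T"
  shows "pos T x \<le> pos T y \<longleftrightarrow> lexle T x y"
  unfolding pos_def
proof (rule rk_iff[OF finite_tips[OF T] _ _ assms(2,3)])
  fix x y assume "x \<in> TipSet T" "y \<in> TipSet T"
  then show "lexle T x y \<or> lexle T y x"
    using nle_total[OF T] flo_total[OF prunedD(1)[OF T]] unfolding lexle_def by blast
next
  fix x y z assume *: "lexle T x y" "lexle T y z"
  have n: "nle T x z" using * nle_trans[OF T] unfolding lexle_def by blast
  moreover have "tle T x z" if zx: "nle T z x"
  proof -
    have "nle T z y" "nle T y x" using * zx nle_trans[OF T] unfolding lexle_def by blast+
    then show ?thesis using * flo_trans[OF prunedD(1)[OF T]] unfolding lexle_def by blast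
  qed
  ultimately show "lexle T x z" unfolding lexle_def by blast
qed

lemma pos_bij:
  assumes T: "pruned_tree T" shows "bij_betw (pos T) (TipSet T) {..<nt T}"
proof -
  have "x = y" if "x \<in> TipSet T" "y \<in> TipSet T" "pos T x = pos T y" for x y
  proof -
    have "lexle T x y" "lexle T y x" using pos_le[OF T that(1,2)] pos_le[OF T that(2,1)] that(3) by auto
    then show ?thesis using flo_antisym[OF prunedD(1)[OF T]] unfolding lexle_def by blast
  qed
  then have i: "inj_on (pos T) (TipSet T)" by (rule inj_onI)
  have "pos T x < nt T" if "x \<in> TipSet T" for x
    unfolding pos_def by (rule rk_less[OF finite_tips[OF T] that])
      (use that nle_refl[OF T] flo_refl[OF prunedD(1)[OF T]] in \<open>simp add: lexle_def\<close>)
  then have "pos T ` TipSet T \<subseteq> {..<nt T}" by auto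
  then have "pos T ` TipSet T = {..<nt T}"
    by (rule card_subset_eq[rotated]) (simp_all add: card_image[OF i])
  then show ?thesis using i by (simp add: bij_betw_def)
qed

lemma pos_less: "pruned_tree T \<Longrightarrow> x \<in> TipSet T \<Longrightarrow> pos T x < nt T"
  using bij_betwE[OF pos_bij] by blast

lemma length_tips [simp]: "length (tips T) = nt T"
  by (simp add: tips_def)

lemma tips_nth:
  assumes "pruned_tree T" "i < nt T"
  shows "tips T ! i \<in> TipSet T" "pos T (tips T ! i) = i"
  using assms bij_betwE[OF bij_betw_inv_into[OF pos_bij[OF assms(1)]]] bij_betw_inv_into_right[OF pos_bij[OF assms(1)]]
  by (auto simp: tips_def)

lemma tips_pos: "pruned_tree T \<Longrightarrow> x \<in> TipSet T \<Longrightarrow> tips T ! pos T x = x"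
  using bij_betw_inv_into_left[OF pos_bij] pos_less by (simp add: tips_def)

lemma set_tips: "pruned_tree T \<Longrightarrow> set (tips T) = TipSet T"
  using bij_betw_imp_surj_on[OF bij_betw_inv_into[OF pos_bij]] by (simp add: tips_def atLeast0LessThan)

lemma distinct_tips: "pruned_tree T \<Longrightarrow> distinct (tips T)"
  unfolding distinct_conv_nth using tips_nth by (metis length_tips)

lemma tipsI:
  assumes T: "pruned_tree T" "length xs = nt T" and "\<And>i. i < nt T \<Longrightarrow> xs ! i \<in> TipSet T \<and> pos T (xs ! i) = i"
  shows "xs = tips T"
proof (rule nth_equalityI)
  fix i assume i: "i < length xs"
  then have "xs ! i = tips T ! pos T (xs ! i)" using assms tips_pos[OF T(1), of "xs ! i"] by simp
  then show "xs ! i = tips T ! i" using assms i by simp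
qed (use T in simp)

lemma card_sum: "finite A \<Longrightarrow> finite B \<Longrightarrow> card (inl ` A \<union> inr ` B) = card A + card B"
  by (subst card_Un_disjoint) (auto simp: card_image inj_on_def)

lemma nt_sum: "pruned_tree S \<Longrightarrow> pruned_tree T \<Longrightarrow> nt (tree_sum S T) = nt S + nt T"
  by (simp add: card_sum finite_tips)

lemma nt_simps [simp]: "nt empty_tree = 0" "nt S1 = 1"
  by simp_all

lemma lexle_sum:
  assumes "pruned_tree S" "pruned_tree T"
  shows "x \<in> TipSet S \<Longrightarrow> y \<in> TipSet S \<Longrightarrow> lexle (tree_sum S T) (inl x) (inl y) \<longleftrightarrow> lexle S x y"
    "x \<in> TipSet T \<Longrightarrow> y \<in> TipSet T \<Longrightarrow> lexle (tree_sum S T) (inr x) (inr y) \<longleftrightarrow> lexle T x y"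
    "x \<in> TipSet S \<Longrightarrow> y \<in> TipSet T \<Longrightarrow> lexle (tree_sum S T) (inl x) (inr y)"
    "x \<in> TipSet S \<Longrightarrow> y \<in> TipSet T \<Longrightarrow> \<not> lexle (tree_sum S T) (inr y) (inl x)"
  using assms by (simp_all add: lexle_def)

lemma pos_sum:
  assumes S: "pruned_tree S" and T: "pruned_tree T"
  shows "x \<in> TipSet S \<Longrightarrow> pos (tree_sum S T) (inl x) = pos S x"
    and "y \<in> TipSet T \<Longrightarrow> pos (tree_sum S T) (inr y) = nt S + pos T y"
proof -
  assume x: "x \<in> TipSet S"
  have "{z \<in> TipSet (tree_sum S T). \<not> lexle (tree_sum S T) (inl x) z} = inl ` {z \<in> TipSet S. \<not> lexle S x z}"
    using x lexle_sum[OF S T] by auto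
  then show "pos (tree_sum S T) (inl x) = pos S x"
    unfolding pos_def rk_def by (simp add: card_image inj_on_def)
next
  assume y: "y \<in> TipSet T"
  have "{z \<in> TipSet (tree_sum S T). \<not> lexle (tree_sum S T) (inr y) z} = inl ` TipSet S \<union> inr ` {z \<in> TipSet T. \<not> lexle T y z}"
    using y lexle_sum[OF S T] by auto
  then show "pos (tree_sum S T) (inr y) = nt S + pos T y"
    unfolding pos_def rk_def by (simp add: card_sum finite_tips S T)
qed

lemma tips_sum:
  assumes S: "pruned_tree S" and T: "pruned_tree T"
  shows "tips (tree_sum S T) = map inl (tips S) @ map inr (tips T)"
proof (rule tipsI[symmetric])
  fix i assume "i < nt (tree_sum S T)"
  then have i: "i < nt S + nt T" by (simp only: nt_sum S T)
  show "(map inl (tips S) @ map inr (tips T)) ! i \<in> TipSet (tree_sum S T) \<and>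
      pos (tree_sum S T) ((map inl (tips S) @ map inr (tips T)) ! i) = i"
    using i tips_nth[OF S, of i] tips_nth[OF T, of "i - nt S"] pos_sum[OF S T]
    by (auto simp: nth_append)
qed (use S T in \<open>simp_all add: nt_sum del: TipSet_sum\<close>)

lemma tips_empty [simp]: "tips empty_tree = []" and tips_S1 [simp]: "tips S1 = [1]"
proof -
  show "tips empty_tree = []" by (simp add: tips_def)
  have "tips S1 ! 0 \<in> TipSet S1" by (rule tips_nth) simp_all
  then have "tips S1 ! 0 = 1" by simp
  moreover have "length (tips S1) = 1" by simp
  ultimately show "tips S1 = [1]" by (metis One_nat_def length_0_conv length_Suc_conv nth_Cons_0)
qed

section \<open>Morphisms of trees as lists of positions\<close>

definition plist :: "tree_arrow \<Rightarrow> nat list" where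
  "plist h = map (\<lambda>x. pos (Target h) (tip h x)) (tips (Source h))"

lemma plist_tarr: "tmor S T f \<Longrightarrow> plist (tarr S T f) = map (\<lambda>x. pos T (f x)) (tips S)"
  using set_tips[OF tmorD(1)] by (simp add: plist_def)

lemma pos_tips: "pruned_tree T \<Longrightarrow> map (pos T) (tips T) = [0..<nt T]"
  by (rule nth_equalityI) (simp_all add: tips_nth)

lemma plist_simps:
  assumes "h \<in> Arr Omega2"
  shows "length (plist h) = nt (Source h)" "set (plist h) \<subseteq> {..<nt (Target h)}"
  using tmorD(1,2)[OF Arr_tarr(2)[OF assms]] pos_less tip_in[OF assms] by (auto simp: plist_def set_tips)

lemma plist_Comp:
  assumes g: "g \<in> Arr Omega2" and h: "h \<in> Arr Omega2" and gh: "Source h = Target g"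
  shows "plist (h \<cdot>\<^bsub>Omega2\<^esub> g) = map (\<lambda>i. plist h ! i) (plist g)"
proof -
  note p = tmorD(1,2)[OF Arr_tarr(2)[OF g]] tmorD(1,2)[OF Arr_tarr(2)[OF h]]
  have s: "Source (h \<cdot>\<^bsub>Omega2\<^esub> g) = Source g" "Target (h \<cdot>\<^bsub>Omega2\<^esub> g) = Target h"
    using Om.Comp_simps[OF g h] gh by simp_all
  have "pos (Target h) (tip (h \<cdot>\<^bsub>Omega2\<^esub> g) x) = plist h ! pos (Target g) (tip g x)" if "x \<in> TipSet (Source g)" for x
    using that tip_Comp[OF g h gh] tip_in[OF g that] pos_less[OF p(2)] tips_pos[OF p(2)] gh
    by (simp add: plist_def)
  then show ?thesis unfolding plist_def[of "h \<cdot>\<^bsub>Omega2\<^esub> g"] plist_def[of g] s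
    using p by (simp add: set_tips)
qed

text \<open>The tips passed on the way lie over the same node, and there \<open>h\<close> preserves the order.\<close>

lemma plist_passing:
  assumes g: "g \<in> Arr Omega2" and h: "h \<in> Arr Omega2" and gh: "Source h = Target g"
    and ij: "i < j" "j < length (plist g)" and z: "plist g ! j < z" "z \<le> plist g ! i"
  shows "plist h ! (plist g ! j) \<le> plist h ! z"
proof -
  let ?S = "Source g" and ?T = "Target g" and ?U = "Target h"
  note mg = Arr_tarr(2)[OF g] and mh = Arr_tarr(2)[OF h]
  note p = tmorD(1,2)[OF mg] tmorD(2)[OF mh]
  define si sj where "si = tips ?S ! i" and "sj = tips ?S ! j"
  have l: "length (plist g) = nt ?S" using plist_simps[OF g] by simp
  have s: "si \<in> TipSet ?S" "sj \<in> TipSet ?S" "pos ?S si = i" "pos ?S sj = j"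
    unfolding si_def sj_def using tips_nth[OF p(1)] ij l by auto
  have P: "plist g ! i = pos ?T (tip g si)" "plist g ! j = pos ?T (tip g sj)"
    unfolding plist_def si_def sj_def using ij l by simp_all
  note gi = tip_in[OF g s(1)] and gj = tip_in[OF g s(2)]
  have zT: "z < nt ?T" using z P pos_less[OF p(2) gi] by simp
  define t where "t = tips ?T ! z"
  have t: "t \<in> TipSet ?T" "pos ?T t = z" unfolding t_def using tips_nth[OF p(2) zT] by auto
  \<comment> \<open>Since \<open>i < j\<close>, the node below the image of \<open>si\<close> is at
    most that below the image of \<open>sj\<close>, whereas the positions put \<open>t\<close>
    between them in the opposite order. All three tips therefore lie over one node, and there
    \<open>t\<close> comes after the image of \<open>sj\<close>.\<close>
  have "lexle ?S si sj" using pos_le[OF p(1) s(1,2)] s ij by simp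
  then have "nle ?T (tip g si) (tip g sj)" using tmorD(4)[OF mg s(1,2)] by (simp add: lexle_def)
  moreover have 1: "lexle ?T (tip g sj) t" using pos_le[OF p(2) gj t(1)] z P t by simp
  moreover have "lexle ?T t (tip g si)" using pos_le[OF p(2) t(1) gi] z P t by simp
  ultimately have n: "nle ?T t (tip g sj)" "nle ?T (tip g sj) t" using nle_trans[OF p(2)] unfolding lexle_def by blast+
  then have "tle ?T (tip g sj) t" using 1 by (simp add: lexle_def)
  then have "tle ?U (tip h (tip g sj)) (tip h t)" "nle ?U (tip h (tip g sj)) (tip h t)"
    using tmorD(4,5)[OF mh] n gh gj t(1) by auto
  then have "lexle ?U (tip h (tip g sj)) (tip h t)" by (simp add: lexle_def)
  then have "pos ?U (tip h (tip g sj)) \<le> pos ?U (tip h t)"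
    using pos_le[OF p(3)] tip_in[OF h] gh gj t(1) by simp
  moreover have "plist h ! pos ?T x = pos ?U (tip h x)" if "x \<in> TipSet ?T" for x
    using that pos_less[OF p(2) that] tips_pos[OF p(2) that] gh by (simp add: plist_def)
  ultimately show ?thesis using P(2) t gj by metis
qed

lemma plist_bij:
  assumes h: "h \<in> tip_bijections"
  shows "distinct (plist h)" "set (plist h) = {..<nt (Target h)}" "nt (Source h) = nt (Target h)"
proof -
  have hA: "h \<in> Arr Omega2" and b: "bij_betw (tip h) (TipSet (Source h)) (TipSet (Target h))"
    using h unfolding tip_bijections_def by blast+
  note p = tmorD(1,2)[OF Arr_tarr(2)[OF hA]]
  have c: "bij_betw (\<lambda>x. pos (Target h) (tip h x)) (TipSet (Source h)) {..<nt (Target h)}"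
    using bij_betw_trans[OF b pos_bij[OF p(2)]] by (simp add: comp_def)
  show "distinct (plist h)" "set (plist h) = {..<nt (Target h)}"
    unfolding plist_def using c distinct_tips[OF p(1)] set_tips[OF p(1)]
    by (auto simp: distinct_map bij_betw_def)
  show "nt (Source h) = nt (Target h)" using bij_betw_same_card[OF b] .
qed

section \<open>Standard corollas and linear trees\<close>

definition Cn :: "nat \<Rightarrow> tree" where
  "Cn n = corolla {(i, j). i \<le> j \<and> j < n}"

lemma flo_Cn: "finite_linear_order {(i, j). i \<le> j \<and> j < n}" and Field_Cn: "Field {(i, j). i \<le> j \<and> j < n} = {..<n}"
proof -
  show F: "Field {(i, j). i \<le> j \<and> j < n} = {..<n}"
  proof
    show "{..<n} \<subseteq> Field {(i, j). i \<le> j \<and> j < n}"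
    proof
      fix x assume "x \<in> {..<n}"
      then have "(x, x) \<in> {(i, j). i \<le> j \<and> j < n}" by simp
      then show "x \<in> Field {(i, j). i \<le> j \<and> j < n}" by (rule FieldI1)
    qed
  qed (auto simp: Field_def)
  have "finite {(i, j). i \<le> j \<and> j < n}"
    by (rule finite_subset[of _ "{..<n} \<times> {..<n}"]) auto
  then show "finite_linear_order {(i, j). i \<le> j \<and> j < n}" unfolding flo_iff F by auto
qed

lemma Cn_simps [simp]: "pruned_tree (Cn n)" "TipSet (Cn n) = {..<n}" "tle (Cn n) i j \<longleftrightarrow> i \<le> j \<and> j < n"
  "i < n \<Longrightarrow> j < n \<Longrightarrow> nle (Cn n) i j"
  unfolding Cn_def using flo_Cn Field_Cn by auto

text \<open>The tensor power of the generator, with exactly one tip over each node. A tree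
  \<open>T\<close> lies between \<open>Pn (nt T)\<close> and \<open>Cn (nt T)\<close> by the
  position-preserving maps \<open>pt T\<close> and \<open>pos T\<close>; both are bijective on tips,
  so all three become isomorphic among the fractions.\<close>

primrec Pn :: "nat \<Rightarrow> tree" where
  "Pn 0 = empty_tree"
| "Pn (Suc n) = tree_sum (Pn n) S1"

lemma pruned_Pn [simp]: "pruned_tree (Pn n)" by (induction n) auto

lemma nt_Pn [simp]: "nt (Pn n) = n"
  by (induction n) (simp_all add: nt_sum del: TipSet_sum)

lemma linear_Pn: "x \<in> TipSet (Pn n) \<Longrightarrow> y \<in> TipSet (Pn n) \<Longrightarrow> nle (Pn n) x y \<Longrightarrow> nle (Pn n) y x \<Longrightarrow> x = y"
  by (induction n arbitrary: x y) auto

lemma tmor_Pn: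
  assumes "pruned_tree T" "\<And>x. x \<in> TipSet (Pn n) \<Longrightarrow> f x \<in> TipSet T"
    "\<And>x y. x \<in> TipSet (Pn n) \<Longrightarrow> y \<in> TipSet (Pn n) \<Longrightarrow> pos (Pn n) x \<le> pos (Pn n) y \<Longrightarrow> nle T (f x) (f y)"
  shows "tmor (Pn n) T f"
proof (rule tmorI)
  fix x y assume xy: "x \<in> TipSet (Pn n)" "y \<in> TipSet (Pn n)" "nle (Pn n) x y"
  then have "lexle (Pn n) x y"
    using linear_Pn[OF xy] flo_refl[OF prunedD(1)[OF pruned_Pn]] by (auto simp: lexle_def)
  then show "nle T (f x) (f y)" using assms(3) pos_le[OF pruned_Pn] xy by simp
next
  fix x y assume xy: "x \<in> TipSet (Pn n)" "y \<in> TipSet (Pn n)" "nle (Pn n) x y" "nle (Pn n) y x"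
  then show "tle T (f x) (f y)" using linear_Pn[OF xy] flo_refl[OF prunedD(1)[OF assms(1)]] assms(2) by simp
qed (use assms in simp_all)

lemma tmor_Cn: "pruned_tree T \<Longrightarrow> tmor T (Cn (nt T)) (pos T)"
  by (rule tmorI) (auto simp: pos_less pos_le lexle_def)

definition pt :: "tree \<Rightarrow> nat \<Rightarrow> nat" where
  "pt T x = tips T ! pos (Pn (nt T)) x"

lemma pt_simps:
  assumes "pruned_tree T" "x \<in> TipSet (Pn (nt T))"
  shows "pt T x \<in> TipSet T" "pos T (pt T x) = pos (Pn (nt T)) x"
  using tips_nth[OF assms(1)] pos_less[OF pruned_Pn assms(2)] by (auto simp: pt_def)

lemma tmor_pt: assumes T: "pruned_tree T" shows "tmor (Pn (nt T)) T (pt T)"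
proof (rule tmor_Pn[OF T])
  fix x y assume xy: "x \<in> TipSet (Pn (nt T))" "y \<in> TipSet (Pn (nt T))" "pos (Pn (nt T)) x \<le> pos (Pn (nt T)) y"
  then have "lexle T (pt T x) (pt T y)" using pos_le[OF T] pt_simps[OF T] by metis
  then show "nle T (pt T x) (pt T y)" by (simp add: lexle_def)
qed (use pt_simps[OF T] in simp)

lemma pt_unique:
  assumes "pruned_tree T" "x \<in> TipSet (Pn (nt T))" "y \<in> TipSet T" "pos T y = pos (Pn (nt T)) x"
  shows "pt T x = y"
  using pt_simps[OF assms(1,2)] assms pos_bij[OF assms(1)] by (metis bij_betw_inv_into_left)

lemma bij_pt: assumes T: "pruned_tree T" shows "bij_betw (pt T) (TipSet (Pn (nt T))) (TipSet T)"
proof -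
  have "bij_betw (\<lambda>x. inv_into (TipSet T) (pos T) (pos (Pn (nt T)) x)) (TipSet (Pn (nt T))) (TipSet T)"
    using bij_betw_trans[OF pos_bij[OF pruned_Pn, of "nt T", unfolded nt_Pn] bij_betw_inv_into[OF pos_bij[OF T]]] by (simp add: comp_def)
  moreover have "pt T x = inv_into (TipSet T) (pos T) (pos (Pn (nt T)) x)" if "x \<in> TipSet (Pn (nt T))" for x
    using pos_less[OF pruned_Pn that] by (simp add: pt_def tips_def)
  ultimately show ?thesis by (simp cong: bij_betw_cong)
qed

lemma map_pt: assumes T: "pruned_tree T" shows "map (pt T) (tips (Pn (nt T))) = tips T"
  by (rule nth_equalityI) (use T tips_nth[OF pruned_Pn[of "nt T"]] in \<open>simp_all add: pt_def\<close>)

section \<open>The functor defined by a commutative monoid\<close>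

context commutative_monoid_object
begin

lemma Phin_id: "Phin n [0..<n] = I (pw n)"
proof (induction n)
  case (Suc n)
  have "Phin (Suc n) [0..<Suc n] = (I (pw n) \<otimes> \<mu>) \<cdot> (Phin n [0..<n] \<otimes> \<iota> \<otimes> I A)"
    using Phin_Suc[of "[0..<n]" n] by (simp add: atLeast0LessThan)
  then show ?case using Suc interchange[of "I (pw n)" "I (pw n)" "\<iota> \<otimes> I A" \<mu>] by (simp add: mu_left)
qed simp

definition tree_func :: "(tree, tree_arrow, 'o, 'a) func" where
  "tree_func = \<lparr>Omap = (\<lambda>T. pw (nt T)), Amap = (\<lambda>h. Phin (nt (Target h)) (plist h))\<rparr>"

text \<open>Composites are preserved by \<open>Phi_functorial\<close>, whose hypothesis on the slots
  passed is \<open>plist_passing\<close>.\<close>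

lemma tree_functor: "is_functor Omega2 C tree_func"
proof (rule functorI)
  show "category Omega2" by (rule category_Omega2)
  show "category C" by (rule category_axioms)
  fix h assume h: "h \<in> Arr Omega2"
  then show "Amap tree_func h \<in> Hom C (Omap tree_func (Dom Omega2 h)) (Omap tree_func (Cod Omega2 h))"
    using plist_simps[OF h] by (simp add: tree_func_def Hom_iff)
next
  fix T assume "T \<in> Obj Omega2"
  then have T: "pruned_tree T" by simp
  show "Amap tree_func (Ident Omega2 T) = Ident C (Omap tree_func T)"
    using plist_tarr[OF tmor_id[OF T]] pos_tips[OF T]
    by (simp add: Ident_tarr[OF T] tree_func_def Phin_id)
next
  fix g h assume g: "g \<in> Arr Omega2" and h: "h \<in> Arr Omega2" and "Dom Omega2 h = Cod Omega2 g"
  then have gh: "Source h = Target g" by simp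
  have l: "length (plist h) = nt (Target g)" using plist_simps(1)[OF h] gh by simp
  have s: "Target (h \<cdot>\<^bsub>Omega2\<^esub> g) = Target h" using Om.Comp_simps[OF g h] gh by simp
  have "Phi (slot (nt (Target h))) (eps (nt (Target h))) (plist h) \<cdot> Phin (length (plist h)) (plist g)
     = Phi (slot (nt (Target h))) (eps (nt (Target h))) (map (\<lambda>x. plist h ! x) (plist g))"
    by (rule Phi_functorial[OF slot_object_pw])
       (use plist_simps[OF g] plist_simps[OF h] plist_passing[OF g h gh] l in auto)
  then show "Amap tree_func (h \<cdot>\<^bsub>Omega2\<^esub> g) = Amap tree_func h \<cdot> Amap tree_func g"
    by (simp add: tree_func_def plist_Comp[OF g h gh] s l flip: Phin_def)
qed (simp add: tree_func_def)

lemma tree_func_iso: "w \<in> tip_bijections \<Longrightarrow> isomorphism C (Amap tree_func w)"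
  using plist_bij[of w] by (simp add: tree_func_def iso_Phin)

section \<open>Extension to fractions and compatibility with the braided structure\<close>

definition ext_func :: "(tree, (tree, tree_arrow) fraction, 'o, 'a) func" where
  "ext_func = Om.extend_func C tree_func"

abbreviation F :: "(tree, tree_arrow) fraction \<Rightarrow> 'a" where
  "F X \<equiv> Amap ext_func X"

lemma ext_functor: "is_functor \<L> C ext_func"
  unfolding ext_func_def by (rule Om.extend_functor[OF tree_functor tree_func_iso])

lemma ext_Omap [simp]: "Omap ext_func T = pw (nt T)"
  by (simp add: ext_func_def Om.extend_func_def tree_func_def)

lemmas F_simps [simp] = functor_simps(2-4)[OF ext_functor, simplified]
lemmas F_Comp = functor_simps(6)[OF ext_functor, simplified]

lemma F_Ident: "pruned_tree T \<Longrightarrow> F (Om.frac T T []) = I (pw (nt T))"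
  using functor_simps(5)[OF ext_functor, of T] by simp

lemma F_iso: "isomorphism \<L> X \<Longrightarrow> isomorphism C (F X)"
  using functor_iso[OF ext_functor] .

lemma F_lt: "tmor S T f \<Longrightarrow> F (lt S T f) = Phin (nt T) (map (\<lambda>x. pos T (f x)) (tips S))"
  unfolding ext_func_def using Om.extend_lf[OF tree_functor tree_func_iso tarr_tmor]
  by (simp add: tree_func_def plist_tarr)

text \<open>The list of such a morphism is \<open>[0..<nt S]\<close>. In particular associators and
  unitors go to identities, as a strict target demands.\<close>

lemma F_pos:
  assumes f: "tmor S T f" and n: "nt S = nt T" and p: "\<And>x. x \<in> TipSet S \<Longrightarrow> pos T (f x) = pos S x"
  shows "F (lt S T f) = I (pw (nt S))"
proof -
  note S = tmorD(1)[OF f]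
  have "map (\<lambda>x. pos T (f x)) (tips S) = map (pos S) (tips S)" using p set_tips[OF S] by simp
  then show ?thesis unfolding F_lt[OF f] using pos_tips[OF S] n by (simp add: Phin_id)
qed

lemma F_TenA_lt:
  assumes f: "tmor S T f" and g: "tmor S' T' g"
  shows "F (TenA \<L> (lt S T f) (lt S' T' g)) = F (lt S T f) \<otimes> F (lt S' T' g)"
proof -
  note p = tmorD(1,2)[OF f] tmorD(1,2)[OF g]
  let ?xs = "map (\<lambda>x. pos T (f x)) (tips S)" and ?ys = "map (\<lambda>x. pos T' (g x)) (tips S')"
  have e: "map (\<lambda>x. pos (tree_sum T T') (sum_map f g x)) (tips (tree_sum S S')) = ?xs @ map (\<lambda>i. nt T + i) ?ys"
    using tmorD(3)[OF f] tmorD(3)[OF g] p by (simp add: tips_sum set_tips pos_sum)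
  have "Phin (nt T + nt T') (?xs @ map (\<lambda>i. nt T + i) ?ys) = Phin (nt T) ?xs \<otimes> Phin (nt T') ?ys"
    by (rule Phin_add) (use tmorD(3)[OF f] tmorD(3)[OF g] p pos_less in \<open>auto simp: set_tips\<close>)
  then show ?thesis
    unfolding lt_TenA[OF f g] F_lt[OF tmor_sum[OF f g]] F_lt[OF f] F_lt[OF g] e nt_sum[OF p(2,4)] .
qed

text \<open>For tree morphisms the positions in a sum are those of the summands, the second shifted.
  Fractions are reached one side at a time, and both sides are combined by splitting the tensor
  product.\<close>

lemma F_TenA:
  assumes X: "X \<in> Arr \<L>" and Y: "Y \<in> Arr \<L>"
  shows "F (TenA \<L> X Y) = F X \<otimes> F Y"
proof -
  have lf: "\<exists>S S' f. h = tarr S S' f \<and> tmor S S' f" if "h \<in> Arr Omega2" for h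
    using Arr_tarr[OF that] by blast
  have R: "F (Om.RT X c) = F X \<otimes> I (pw (nt c))" if X: "X \<in> Arr \<L>" and c: "pruned_tree c" for X c
  proof -
    have o: "pruned_tree (Source X)" "pruned_tree (Target X)" using Om.LC.Dom_in Om.LC.Cod_in X by auto
    \<comment> \<open>The desired equation is read as naturality of an identity transformation
      between two functors in \<open>X\<close>, which makes \<open>natural_L\<close>
      available.\<close>
    have "I (pw (nt (Target X) + nt c)) \<cdot> F (Om.RT X c) = (F X \<otimes> I (pw (nt c))) \<cdot> I (pw (nt (Source X) + nt c))"
    proof (rule Om.natural_L[OF _ _ _ _ X, where \<theta> = "\<lambda>a. I (pw (nt a + nt c))"])
      show "is_functor \<L> C \<lparr>Omap = \<lambda>a. pw (nt (tree_sum a c)), Amap = \<lambda>X. F (Om.RT X c)\<rparr>"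
        using c category_axioms
        by (intro functorI) (auto simp: Hom_iff Om.category_L Om.RT_Comp F_Comp F_Ident simp del: TipSet_sum)
      show "is_functor \<L> C \<lparr>Omap = \<lambda>a. pw (nt a) \<odot> pw (nt c), Amap = \<lambda>X. F X \<otimes> I (pw (nt c))\<rparr>"
        using c category_axioms
        by (intro functorI) (auto simp: Hom_iff Om.category_L F_Comp F_Ident wr)
      fix h assume "h \<in> Arr Omega2"
      then obtain S S' f where h: "h = tarr S S' f" "tmor S S' f" using lf by blast
      then show "I (pw (nt (Cod Omega2 h) + nt c)) \<cdot> F (Om.RT (Om.lf h) c) = (F (Om.lf h) \<otimes> I (pw (nt c))) \<cdot> I (pw (nt (Dom Omega2 h) + nt c))"
        using F_TenA_lt[OF h(2) tmor_id[OF c]] c by (simp add: lt_id F_Ident pw_add)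
    qed (use c in \<open>simp add: Hom_iff nt_sum pw_add del: TipSet_sum\<close>)
    then show ?thesis using X c o by (simp add: nt_sum pw_add del: TipSet_sum)
  qed
  have L: "F (Om.LT c X) = I (pw (nt c)) \<otimes> F X" if X: "X \<in> Arr \<L>" and c: "pruned_tree c" for X c
  proof -
    have o: "pruned_tree (Source X)" "pruned_tree (Target X)" using Om.LC.Dom_in Om.LC.Cod_in X by auto
    have "I (pw (nt c + nt (Target X))) \<cdot> F (Om.LT c X) = (I (pw (nt c)) \<otimes> F X) \<cdot> I (pw (nt c + nt (Source X)))"
    proof (rule Om.natural_L[OF _ _ _ _ X, where \<theta> = "\<lambda>a. I (pw (nt c + nt a))"])
      show "is_functor \<L> C \<lparr>Omap = \<lambda>a. pw (nt (tree_sum c a)), Amap = \<lambda>X. F (Om.LT c X)\<rparr>"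
        using c category_axioms
        by (intro functorI) (auto simp: Hom_iff Om.category_L Om.LT_Comp F_Comp F_Ident simp del: TipSet_sum)
      show "is_functor \<L> C \<lparr>Omap = \<lambda>a. pw (nt c) \<odot> pw (nt a), Amap = \<lambda>X. I (pw (nt c)) \<otimes> F X\<rparr>"
        using c category_axioms
        by (intro functorI) (auto simp: Hom_iff Om.category_L F_Comp F_Ident wl)
      fix h assume "h \<in> Arr Omega2"
      then obtain S S' f where h: "h = tarr S S' f" "tmor S S' f" using lf by blast
      then show "I (pw (nt c + nt (Cod Omega2 h))) \<cdot> F (Om.LT c (Om.lf h)) = (I (pw (nt c)) \<otimes> F (Om.lf h)) \<cdot> I (pw (nt c + nt (Dom Omega2 h)))"
        using F_TenA_lt[OF tmor_id[OF c] h(2)] c by (simp add: lt_id F_Ident pw_add)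
    qed (use c in \<open>simp add: Hom_iff nt_sum pw_add del: TipSet_sum\<close>)
    then show ?thesis using X c o by (simp add: nt_sum pw_add del: TipSet_sum)
  qed
  have o: "pruned_tree (Source X)" "pruned_tree (Target X)" "pruned_tree (Source Y)" "pruned_tree (Target Y)"
    using Om.LC.Dom_in Om.LC.Cod_in X Y by auto
  show ?thesis
    unfolding Om.L_TenA_split[OF X Y] using X Y o by (simp add: F_Comp L R interchange)
qed

text \<open>Both ordered sums map to the same corolla, with the lists \<open>?xS @ ?xT\<close> and
  \<open>?xT @ ?xS\<close>, and there the tips of \<open>T\<close> precede those of
  \<open>S\<close>. So \<open>Phi_swap\<close> yields the braiding of \<open>C\<close>, and the map
  from \<open>tree_sum T S\<close>, which goes to an isomorphism, is cancelled.\<close>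

lemma F_braid:
  assumes S: "pruned_tree S" and T: "pruned_tree T"
  shows "F (tree_braid S T) = Braid C (pw (nt S)) (pw (nt T))"
proof -
  let ?r = "ordered_sum (Tips T) (Tips S)" let ?k = "corolla ?r" and ?n = "nt T + nt S"
  note FO = fibre_order_Tips[OF S] fibre_order_Tips[OF T]
  have O: "finite_linear_order ?r" using flo_ordered_sum prunedD(1) S T by blast
  have q: "tmor (tree_sum T S) ?k (\<lambda>x. x)"
    using tmor_corolla_id[OF _ fibre_order_sum[OF T S FO(2,1)]] S T by simp
  have s: "tmor (tree_sum S T) ?k sum_swap" using tmor_swap_corolla[OF S T FO] .
  have i: "isomorphism C (F (lt (tree_sum T S) ?k (\<lambda>x. x)))"
    by (rule F_iso[OF lt_iso[OF q]]) (auto intro: bij_betw_id simp: O)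
  have n: "nt ?k = ?n" using O S T by (simp add: card_sum finite_tips)
  let ?xS = "map (\<lambda>x. pos ?k (inr x)) (tips S)" and ?xT = "map (\<lambda>x. pos ?k (inl x)) (tips T)"
  have 1: "F (lt (tree_sum T S) ?k (\<lambda>x. x)) = Phin ?n (?xT @ ?xS)"
    unfolding F_lt[OF q] n by (simp add: tips_sum S T comp_def)
  have 2: "F (lt (tree_sum S T) ?k sum_swap) = Phin ?n (?xS @ ?xT)"
    unfolding F_lt[OF s] n by (simp add: tips_sum S T comp_def)
  have pk: "pruned_tree ?k" using O by simp
  have l: "pos ?k x < ?n" if "x \<in> inl ` TipSet T \<union> inr ` TipSet S" for x
    using pos_less[OF pk, of x] that O n by simp
  have "Phin ?n (?xS @ ?xT) = Phin ?n (?xT @ ?xS) \<cdot> (I (Dom C (eps ?n)) \<otimes> Braid C (pw (length ?xS)) (pw (length ?xT)))"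
    unfolding Phin_def
  proof (rule Phi_swap[OF slot_object_pw])
    show "set ?xS \<subseteq> {..<?n}" "set ?xT \<subseteq> {..<?n}" using l by (auto simp: set_tips S T)
    fix x y assume "x \<in> set ?xS" "y \<in> set ?xT"
    then obtain a b where "x = pos ?k (inr a)" "a \<in> TipSet S" "y = pos ?k (inl b)" "b \<in> TipSet T"
      by (auto simp: set_tips S T)
    then show "y \<le> x" using pos_le[OF pk, of "inl b" "inr a"] O by (simp add: lexle_def)
  qed simp_all
  then have "F (lt (tree_sum S T) ?k sum_swap) = F (lt (tree_sum T S) ?k (\<lambda>x. x)) \<cdot> Braid C (pw (nt S)) (pw (nt T))"
    unfolding 1 2 by simp
  moreover have "F (lt (tree_sum S T) ?k sum_swap) = F (lt (tree_sum T S) ?k (\<lambda>x. x)) \<cdot> F (tree_braid S T)"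
    using F_Comp[of "tree_braid S T" "lt (tree_sum T S) ?k (\<lambda>x. x)"] S T q
    unfolding tree_braid_Tips[OF S T] by simp
  ultimately have e: "F (lt (tree_sum T S) ?k (\<lambda>x. x)) \<cdot> F (tree_braid S T)
      = F (lt (tree_sum T S) ?k (\<lambda>x. x)) \<cdot> Braid C (pw (nt S)) (pw (nt T))" by metis
  show ?thesis
    by (rule iso_cancel_left[OF i _ _ _ _ e]) (use S T q in \<open>simp_all add: nt_sum pw_add del: TipSet_sum\<close>)
qed

lemma F_Assoc:
  assumes "pruned_tree a" "pruned_tree b" "pruned_tree d"
  shows "F (Om.lf (Assoc Omega2 a b d)) = I (pw (nt a + nt b + nt d))"
proof -
  have "F (lt (tree_sum (tree_sum a b) d) (tree_sum a (tree_sum b d)) sum_assoc) = I (pw (nt (tree_sum (tree_sum a b) d)))"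
    by (rule F_pos[OF tmor_assoc[OF assms]]) (use assms in \<open>auto simp: card_sum finite_tips pos_sum\<close>)
  then show ?thesis unfolding lf_Assoc[OF assms] by (simp add: card_sum finite_tips assms add.assoc)
qed

lemma F_unit:
  assumes "pruned_tree a"
  shows "F (Om.lf (Lunit Omega2 a)) = I (pw (nt a))" "F (Om.lf (Runit Omega2 a)) = I (pw (nt a))"
proof -
  have l: "x \<in> TipSet (tree_sum empty_tree a) \<Longrightarrow> pos a (cases_sum id id x) = pos (tree_sum empty_tree a) x" for x
    using assms pos_sum(2)[of empty_tree a] by auto
  have r: "x \<in> TipSet (tree_sum a empty_tree) \<Longrightarrow> pos a (cases_sum id id x) = pos (tree_sum a empty_tree) x" for x
    using assms pos_sum(1)[of a empty_tree] by auto
  have n: "nt (tree_sum empty_tree a) = nt a" "nt (tree_sum a empty_tree) = nt a"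
    by (simp_all add: nt_sum assms del: TipSet_sum)
  show "F (Om.lf (Lunit Omega2 a)) = I (pw (nt a))"
    using F_pos[OF tarr_Lunit(1)[OF assms] n(1) l] unfolding tarr_Lunit(3)[OF assms] n .
  show "F (Om.lf (Runit Omega2 a)) = I (pw (nt a))"
    using F_pos[OF tarr_Lunit(2)[OF assms] n(2) r] unfolding tarr_Lunit(4)[OF assms] n .
qed

text \<open>The structure maps are identities because positions in an ordered sum are concatenated
  and \<open>pw (m + n) = pw m \<odot> pw n\<close> in a strict category. The restrictions supply
  the extensionality required of a braided functor.\<close>

definition free_func :: "(tree, (tree, tree_arrow) fraction, 'o, 'a) mfunc" where
  "free_func = \<lparr>Omap = (\<lambda>T\<in>Obj Omega2_frac. pw (nt T)), Amap = (\<lambda>X\<in>Arr Omega2_frac. F X),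
     Mmap = (\<lambda>(a, b)\<in>Obj Omega2_frac \<times> Obj Omega2_frac. I (pw (nt a + nt b))), Umap = I \<one>\<rparr>"

lemma free_func_sel:
  "pruned_tree T \<Longrightarrow> Omap free_func T = pw (nt T)" "X \<in> Arr \<L> \<Longrightarrow> Amap free_func X = F X"
  "pruned_tree T \<Longrightarrow> pruned_tree U \<Longrightarrow> Mmap free_func (T, U) = I (pw (nt T + nt U))" "Umap free_func = I \<one>"
  by (simp_all add: free_func_def)

lemma free_func_braided: "is_braided_functor Omega2_frac C free_func"
proof -
  note LA = Om.LC.Dom_in[simplified] Om.LC.Cod_in[simplified]
  note [simp] = free_func_sel LA
  note [simp del] = TipSet_sum
  have "is_functor Omega2_frac C free_func"
    using category_Omega2_frac category_axioms
    by (intro functorI) (auto simp: Hom_iff F_Comp F_Ident)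
  moreover have "Omap free_func \<in> extensional (Obj Omega2_frac)" "Amap free_func \<in> extensional (Arr Omega2_frac)"
    "Mmap free_func \<in> extensional (Obj Omega2_frac \<times> Obj Omega2_frac)"
    by (simp_all add: free_func_def)
  moreover have "Mmap free_func (b, d) \<cdot> (Amap free_func f \<otimes> Amap free_func g)
      = Amap free_func (f \<otimes>\<^bsub>Omega2_frac\<^esub> g) \<cdot> Mmap free_func (a, c)"
    if "f \<in> Hom Omega2_frac a b" "g \<in> Hom Omega2_frac c d" for a b c d f g
    using that by (auto simp: Hom_iff F_TenA pw_add)
  ultimately show ?thesis
    unfolding is_braided_functor_def
    by (auto simp: Hom_iff nt_sum pw_add iso_Ident F_Assoc F_unit F_braid)
qed

end

section \<open>Comparison with an arbitrary braided functor\<close>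

locale tree_braided_functor = strict_braided C
  for C :: "('o, 'a, 'z) brcat_scheme" (structure) +
  fixes G :: "(tree, (tree, tree_arrow) fraction, 'o, 'a) mfunc"
  assumes G: "is_braided_functor Omega2_frac C G"
begin

abbreviation "Go \<equiv> Omap G"
abbreviation "Ga \<equiv> Amap G"
abbreviation "M2 S T \<equiv> Mmap G (S, T)"
abbreviation "U0 \<equiv> Umap G"

lemma G_functor: "is_functor Omega2_frac C G"
  using G by (simp add: is_braided_functor_def)

lemma G_functor_L: "is_functor \<L> C \<lparr>Omap = Go, Amap = Ga\<rparr>"
  using functor_simps[OF G_functor] category_axioms
  by (intro functorI) (auto simp: Hom_iff Om.category_L)

lemmas G_simps [simp] = functor_simps(1-4)[OF G_functor, simplified]
lemmas G_Comp = functor_simps(6)[OF G_functor, simplified]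

lemma G_Ident [simp]: "pruned_tree T \<Longrightarrow> Ga (Om.frac T T []) = I (Go T)"
  using functor_simps(5)[OF G_functor, of T] by simp

lemma G_id: "pruned_tree T \<Longrightarrow> Ga (lt T T (\<lambda>x. x)) = I (Go T)"
  by (simp add: lt_id)

lemma G_iso: "isomorphism \<L> X \<Longrightarrow> isomorphism C (Ga X)"
  using functor_iso[OF G_functor] by (simp add: Omega2_frac_cat)

lemma M2_simps [simp]:
  assumes "pruned_tree S" "pruned_tree T"
  shows "M2 S T \<in> Arr C" "Dom C (M2 S T) = Go S \<odot> Go T" "Cod C (M2 S T) = Go (tree_sum S T)"
    and M2_iso: "isomorphism C (M2 S T)"
  using G assms unfolding is_braided_functor_def Hom_iff by simp_all

lemma U0_simps [simp]: "U0 \<in> Arr C" "Dom C U0 = \<one>" "Cod C U0 = Go empty_tree"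
  and U0_iso: "isomorphism C U0"
  using G unfolding is_braided_functor_def Hom_iff by simp_all

lemma M2_nat:
  assumes "X \<in> Arr \<L>" "Y \<in> Arr \<L>"
  shows "M2 (Target X) (Target Y) \<cdot> (Ga X \<otimes> Ga Y) = Ga (TenA \<L> X Y) \<cdot> M2 (Source X) (Source Y)"
proof -
  have "X \<in> Hom Omega2_frac (Source X) (Target X)" "Y \<in> Hom Omega2_frac (Source Y) (Target Y)"
    using assms by (simp_all add: Hom_iff)
  then show ?thesis using G unfolding is_braided_functor_def Omega2_frac_sel by blast
qed

lemma M2_assoc: "pruned_tree a \<Longrightarrow> pruned_tree b \<Longrightarrow> pruned_tree d \<Longrightarrow>
    Ga (Om.lf (Assoc Omega2 a b d)) \<cdot> M2 (tree_sum a b) d \<cdot> (M2 a b \<otimes> I (Go d)) = M2 a (tree_sum b d) \<cdot> (I (Go a) \<otimes> M2 b d)"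
  and M2_unit: "pruned_tree a \<Longrightarrow> Ga (Om.lf (Lunit Omega2 a)) \<cdot> M2 empty_tree a \<cdot> (U0 \<otimes> I (Go a)) = I (Go a)"
    "pruned_tree a \<Longrightarrow> Ga (Om.lf (Runit Omega2 a)) \<cdot> M2 a empty_tree \<cdot> (I (Go a) \<otimes> U0) = I (Go a)"
  and M2_braid: "pruned_tree a \<Longrightarrow> pruned_tree b \<Longrightarrow> Ga (tree_braid a b) \<cdot> M2 a b = M2 b a \<cdot> Braid C (Go a) (Go b)"
  using G unfolding is_braided_functor_def by simp_all

text \<open>Naturality of the structure maps pulls a tree morphism out of one tensor factor and
  merges it with the outer one. With \<open>M2_right\<close> and \<open>M2_reassoc\<close>, a
  composite is reduced to a single tip map followed by structure maps, so that equations can be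
  decided on tips.\<close>

lemma M2_left:
  assumes f: "tmor (tree_sum X Y) Z f" and g: "tmor X' X g" and Y: "pruned_tree Y"
    and u: "u \<in> Arr C" "Cod C u = Go X' \<odot> Go Y"
  shows "Ga (lt (tree_sum X Y) Z f) \<cdot> M2 X Y \<cdot> (Ga (lt X' X g) \<otimes> I (Go Y)) \<cdot> u
    = Ga (lt (tree_sum X' Y) Z (f \<circ> sum_map g (\<lambda>x. x))) \<cdot> M2 X' Y \<cdot> u"
proof -
  let ?f = "Ga (lt (tree_sum X Y) Z f)"
  let ?g = "Ga (lt (tree_sum X' Y) (tree_sum X Y) (sum_map g (\<lambda>x. x)))"
  note p = tmorD(1,2)[OF g] Y and i = tmor_id[OF Y]
  note gi = tmor_sum[OF g i]
  have "M2 X Y \<cdot> (Ga (lt X' X g) \<otimes> I (Go Y)) = ?g \<cdot> M2 X' Y"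
    using M2_nat[of "lt X' X g" "lt Y Y (\<lambda>x. x)"] lt_TenA[OF g i] g i p by (simp add: G_id)
  from push[OF this, of u]
  have "?f \<cdot> M2 X Y \<cdot> (Ga (lt X' X g) \<otimes> I (Go Y)) \<cdot> u
     = ?f \<cdot> ?g \<cdot> M2 X' Y \<cdot> u"
    using g p u gi by simp
  also have "\<dots> = (?f \<cdot> ?g) \<cdot> M2 X' Y \<cdot> u"
    using f g p u gi by simp
  also have "?f \<cdot> ?g
     = Ga (lt (tree_sum X' Y) Z (f \<circ> sum_map g (\<lambda>x. x)))"
    using G_Comp[of "lt (tree_sum X' Y) (tree_sum X Y) (sum_map g (\<lambda>x. x))" "lt (tree_sum X Y) Z f"] lt_Comp[OF gi f] gi f by simp
  finally show ?thesis .
qed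

lemma M2_right:
  assumes f: "tmor (tree_sum X Y) Z f" and g: "tmor Y' Y g" and X: "pruned_tree X"
    and u: "u \<in> Arr C" "Cod C u = Go X \<odot> Go Y'"
  shows "Ga (lt (tree_sum X Y) Z f) \<cdot> M2 X Y \<cdot> (I (Go X) \<otimes> Ga (lt Y' Y g)) \<cdot> u
    = Ga (lt (tree_sum X Y') Z (f \<circ> sum_map (\<lambda>x. x) g)) \<cdot> M2 X Y' \<cdot> u"
proof -
  let ?f = "Ga (lt (tree_sum X Y) Z f)"
  let ?g = "Ga (lt (tree_sum X Y') (tree_sum X Y) (sum_map (\<lambda>x. x) g))"
  note p = tmorD(1,2)[OF g] X and i = tmor_id[OF X]
  note gi = tmor_sum[OF i g]
  have "M2 X Y \<cdot> (I (Go X) \<otimes> Ga (lt Y' Y g)) = ?g \<cdot> M2 X Y'"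
    using M2_nat[of "lt X X (\<lambda>x. x)" "lt Y' Y g"] lt_TenA[OF i g] g i p by (simp add: G_id)
  from push[OF this, of u]
  have "?f \<cdot> M2 X Y \<cdot> (I (Go X) \<otimes> Ga (lt Y' Y g)) \<cdot> u
     = ?f \<cdot> ?g \<cdot> M2 X Y' \<cdot> u"
    using g p u gi by simp
  also have "\<dots> = (?f \<cdot> ?g) \<cdot> M2 X Y' \<cdot> u"
    using f g p u gi by simp
  also have "?f \<cdot> ?g
     = Ga (lt (tree_sum X Y') Z (f \<circ> sum_map (\<lambda>x. x) g))"
    using G_Comp[of "lt (tree_sum X Y') (tree_sum X Y) (sum_map (\<lambda>x. x) g)" "lt (tree_sum X Y) Z f"] lt_Comp[OF gi f] gi f by simp
  finally show ?thesis .
qed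

lemma M2_reassoc:
  assumes f: "tmor (tree_sum X (tree_sum Y W)) Z f" and p: "pruned_tree X" "pruned_tree Y" "pruned_tree W"
  shows "Ga (lt (tree_sum (tree_sum X Y) W) Z (f \<circ> sum_assoc)) \<cdot> M2 (tree_sum X Y) W \<cdot> (M2 X Y \<otimes> I (Go W))
    = Ga (lt (tree_sum X (tree_sum Y W)) Z f) \<cdot> M2 X (tree_sum Y W) \<cdot> (I (Go X) \<otimes> M2 Y W)"
proof -
  note a = tmor_assoc[OF p]
  have "Ga (lt (tree_sum (tree_sum X Y) W) Z (f \<circ> sum_assoc)) = Ga (lt (tree_sum X (tree_sum Y W)) Z f) \<cdot> Ga (Om.lf (Assoc Omega2 X Y W))"
    unfolding lf_Assoc[OF p] lt_Comp[OF a f, symmetric] using a f by (simp add: G_Comp)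
  then show ?thesis unfolding M2_assoc[OF p, symmetric] using f p a by (simp add: lf_Assoc)
qed

abbreviation "A \<equiv> Go S1"

definition \<mu> :: 'a where "\<mu> = Ga (lt (tree_sum S1 S1) S1 (\<lambda>_. 1)) \<cdot> M2 S1 S1"

definition \<iota> :: 'a where "\<iota> = Ga (lt empty_tree S1 (\<lambda>_. 1)) \<cdot> U0"

lemma tmor_const: "tmor (tree_sum S1 S1) S1 (\<lambda>_. 1)" "tmor empty_tree S1 (\<lambda>_. 1)"
  by (auto intro!: tmor_S1)

lemma image_S1_monoid: "image_monoid C S1_monoid G = \<lparr>Carr = A, Mult = \<mu>, Unt = \<iota>\<rparr>"
  by (simp add: image_monoid_def \<mu>_def \<iota>_def)

text \<open>The monoid laws are transported by merging the multiplications into constant maps to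
  \<open>S1\<close>; commutativity is that of the generator combined with compatibility of
  \<open>G\<close> with the braidings.\<close>

lemma commutative_image: "commutative_monoid_object C A \<mu> \<iota>"
proof
  note t = tmor_const and s = S1_simps(1)
  let ?D = "tree_sum S1 S1" and ?k = "\<lambda>_. 1 :: nat"
  let ?m = "Ga (lt ?D S1 ?k)"
  note [simp] = t t[unfolded One_nat_def]
  show "A \<in> Obj C" "\<mu> \<in> Arr C" "Dom C \<mu> = A \<odot> A" "Cod C \<mu> = A" "\<iota> \<in> Arr C" "Dom C \<iota> = \<one>" "Cod C \<iota> = A"
    by (simp_all add: \<mu>_def \<iota>_def)
  have t3: "tmor (tree_sum S1 ?D) S1 ?k" by (auto intro!: tmor_S1)
  have "\<mu> \<cdot> (\<mu> \<otimes> I A) = ?m \<cdot> M2 S1 S1 \<cdot> (?m \<otimes> I A) \<cdot> (M2 S1 S1 \<otimes> I A)"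
    by (simp add: \<mu>_def wr)
  also have "\<dots> = Ga (lt (tree_sum ?D S1) S1 (?k \<circ> sum_assoc)) \<cdot> M2 ?D S1 \<cdot> (M2 S1 S1 \<otimes> I A)"
    by (subst M2_left[OF t(1) t(1) s]) (simp_all add: comp_def)
  also have "\<dots> = Ga (lt (tree_sum S1 ?D) S1 ?k) \<cdot> M2 S1 ?D \<cdot> (I A \<otimes> M2 S1 S1)"
    by (rule M2_reassoc[OF t3 s s s])
  also have "\<dots> = ?m \<cdot> M2 S1 S1 \<cdot> (I A \<otimes> ?m) \<cdot> (I A \<otimes> M2 S1 S1)"
    by (subst M2_right[OF t(1) t(1) s]) (simp_all add: comp_def)
  also have "\<dots> = \<mu> \<cdot> (I A \<otimes> \<mu>)"
    by (simp add: \<mu>_def wl)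
  finally show "\<mu> \<cdot> (\<mu> \<otimes> I A) = \<mu> \<cdot> (I A \<otimes> \<mu>)" .
  have "\<mu> \<cdot> (\<iota> \<otimes> I A) = ?m \<cdot> M2 S1 S1 \<cdot> (Ga (lt empty_tree S1 ?k) \<otimes> I A) \<cdot> (U0 \<otimes> I A)"
    by (simp add: \<mu>_def \<iota>_def wr)
  also have "\<dots> = Ga (lt (tree_sum empty_tree S1) S1 ?k) \<cdot> M2 empty_tree S1 \<cdot> (U0 \<otimes> I A)"
    by (subst M2_left[OF t(1) t(2) s]) (simp_all add: comp_def)
  also have "lt (tree_sum empty_tree S1) S1 ?k = Om.lf (Lunit Omega2 S1)"
    unfolding tarr_Lunit(3)[OF s] by (rule lt_S1[symmetric]) auto
  finally show "\<mu> \<cdot> (\<iota> \<otimes> I A) = I A" using M2_unit(1)[OF s] by simp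
  have "\<mu> \<cdot> (I A \<otimes> \<iota>) = ?m \<cdot> M2 S1 S1 \<cdot> (I A \<otimes> Ga (lt empty_tree S1 ?k)) \<cdot> (I A \<otimes> U0)"
    by (simp add: \<mu>_def \<iota>_def wl)
  also have "\<dots> = Ga (lt (tree_sum S1 empty_tree) S1 ?k) \<cdot> M2 S1 empty_tree \<cdot> (I A \<otimes> U0)"
    by (subst M2_right[OF t(1) t(2) s]) (simp_all add: comp_def)
  also have "lt (tree_sum S1 empty_tree) S1 ?k = Om.lf (Runit Omega2 S1)"
    unfolding tarr_Lunit(4)[OF s] by (rule lt_S1[symmetric]) auto
  finally show "\<mu> \<cdot> (I A \<otimes> \<iota>) = I A" using M2_unit(2)[OF s] by simp
  have "lt ?D S1 ?k \<bullet> tree_braid S1 S1 = lt ?D S1 ?k"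
    using commutative_S1_monoid by (simp add: is_commutative_monoid_def)
  then have "?m \<cdot> Ga (tree_braid S1 S1) = ?m"
    by (simp flip: G_Comp)
  then have "(?m \<cdot> Ga (tree_braid S1 S1)) \<cdot> M2 S1 S1 = \<mu>" by (simp add: \<mu>_def)
  then show "\<mu> \<cdot> Braid C A A = \<mu>" using M2_braid[OF s s] by (simp add: \<mu>_def)
qed

sublocale CM: commutative_monoid_object C "Omap G S1" \<mu> \<iota>
  by (rule commutative_image)

section \<open>The image of a corolla as a slot object\<close>

definition ins :: "nat \<Rightarrow> nat \<Rightarrow> nat" where
  "ins y = cases_sum (\<lambda>x. x) (\<lambda>_. y)"

definition sl :: "nat \<Rightarrow> nat \<Rightarrow> 'a" where
  "sl n y = Ga (lt (tree_sum (Cn n) S1) (Cn n) (ins y)) \<cdot> M2 (Cn n) S1"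

definition e0 :: "nat \<Rightarrow> 'a" where
  "e0 n = Ga (lt empty_tree (Cn n) (\<lambda>x. x)) \<cdot> U0"

lemma tmor_ins: "y < n \<Longrightarrow> tmor (tree_sum (Cn n) S1) (Cn n) (ins y)"
  by (rule tmorI) (auto simp: ins_def)

lemma tmor_empty: "pruned_tree T \<Longrightarrow> tmor empty_tree T f"
  by (rule tmorI) auto

text \<open>Two successive insertions amount to one tip map \<open>pr\<close> out of
  \<open>tree_sum (Cn n) ?D\<close>, by \<open>two\<close>. The rules of a slot object then compare
  such tip maps: exchanging the added tips is the braiding, identifying them is the multiplication,
  and inserting the empty tree is a unitor.\<close>

lemma slot_object_Cn: "CM.slot_object (Go (Cn n)) n (sl n)"
proof -
  let ?E = "Go (Cn n)" and ?D = "tree_sum S1 S1"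
  define pr where "pr y z = cases_sum (\<lambda>x. x) (cases_sum (\<lambda>_. y) (\<lambda>_. z))" for y z :: nat
  have tpr: "tmor (tree_sum (Cn n) ?D) (Cn n) (pr y z)" if "y < n" "z < n" for y z
    by (rule tmorI) (use that in \<open>auto simp: pr_def\<close>)
  note s = S1_simps(1) Cn_simps(1)[of n]
  have sl: "sl n y \<in> Arr C" "Dom C (sl n y) = ?E \<odot> A" "Cod C (sl n y) = ?E" if "y < n" for y
    using tmor_ins[OF that] by (simp_all add: sl_def)
  have two: "sl n y \<cdot> (sl n z \<otimes> I A) = Ga (lt (tree_sum (Cn n) ?D) (Cn n) (pr z y)) \<cdot> M2 (Cn n) ?D \<cdot> (I ?E \<otimes> M2 S1 S1)"
    if y: "y < n" and z: "z < n" for y z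
  proof -
    have "sl n y \<cdot> (sl n z \<otimes> I A) = Ga (lt (tree_sum (Cn n) S1) (Cn n) (ins y)) \<cdot> M2 (Cn n) S1
        \<cdot> (Ga (lt (tree_sum (Cn n) S1) (Cn n) (ins z)) \<otimes> I A) \<cdot> (M2 (Cn n) S1 \<otimes> I A)"
      using tmor_ins[OF y] tmor_ins[OF z] by (simp add: sl_def wr)
    also have "\<dots> = Ga (lt (tree_sum (tree_sum (Cn n) S1) S1) (Cn n) (ins y \<circ> sum_map (ins z) (\<lambda>x. x))) \<cdot> M2 (tree_sum (Cn n) S1) S1 \<cdot> (M2 (Cn n) S1 \<otimes> I A)"
      by (rule M2_left[OF tmor_ins[OF y] tmor_ins[OF z] s(1)]) simp_all
    also have "lt (tree_sum (tree_sum (Cn n) S1) S1) (Cn n) (ins y \<circ> sum_map (ins z) (\<lambda>x. x)) = lt (tree_sum (tree_sum (Cn n) S1) S1) (Cn n) (pr z y \<circ> sum_assoc)"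
      by (rule lt_cong) (auto simp: ins_def pr_def)
    also have "Ga (lt (tree_sum (tree_sum (Cn n) S1) S1) (Cn n) (pr z y \<circ> sum_assoc)) \<cdot> M2 (tree_sum (Cn n) S1) S1 \<cdot> (M2 (Cn n) S1 \<otimes> I A)
        = Ga (lt (tree_sum (Cn n) ?D) (Cn n) (pr z y)) \<cdot> M2 (Cn n) ?D \<cdot> (I ?E \<otimes> M2 S1 S1)"
      by (rule M2_reassoc[OF tpr[OF z y] s(2,1,1)])
    finally show ?thesis .
  qed
  have R1: "sl n y \<cdot> (sl n z \<otimes> I A) = sl n z \<cdot> (sl n y \<otimes> I A) \<cdot> (I ?E \<otimes> Braid C A A)"
    if yz: "y \<le> z" and zn: "z < n" for y z
  proof -
    have yn: "y < n" using yz zn by simp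
    let ?b = "tree_braid S1 S1"
    have d: "finite_linear_order (ordered_sum (Tips S1) (Tips S1))"
      by (intro flo_ordered_sum prunedD(1)) simp_all
    \<comment> \<open>To absorb the braiding, both added tips are placed in one fibre, in their
      given order. Then \<open>y \<le> z\<close> is what makes \<open>pr y z\<close> a morphism;
      this is the origin of the inequality in the commutation rule.\<close>
    have "tmor (tree_sum (Cn n) (corolla (ordered_sum (Tips S1) (Tips S1)))) (Cn n) (pr y z)"
      by (rule tmorI) (use d yz zn yn in \<open>auto simp: pr_def\<close>)
    then have "lt (tree_sum (Cn n) ?D) (Cn n) (pr y z) \<bullet> Om.LT (Cn n) ?b = lt (tree_sum (Cn n) ?D) (Cn n) (pr y z \<circ> sum_map (\<lambda>x. x) sum_swap)"
      by (rule tree_braid_absorb_left[OF s(1,1,2)])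
    also have "\<dots> = lt (tree_sum (Cn n) ?D) (Cn n) (pr z y)"
      by (rule lt_cong) (auto simp: pr_def)
    finally have b: "Ga (lt (tree_sum (Cn n) ?D) (Cn n) (pr z y)) = Ga (lt (tree_sum (Cn n) ?D) (Cn n) (pr y z)) \<cdot> Ga (Om.LT (Cn n) ?b)"
      using tpr[OF yn zn] by (simp flip: G_Comp)
    have nat: "M2 (Cn n) ?D \<cdot> (I ?E \<otimes> Ga ?b) = Ga (Om.LT (Cn n) ?b) \<cdot> M2 (Cn n) ?D"
      using M2_nat[of "Om.frac (Cn n) (Cn n) []" ?b] by simp
    have "sl n z \<cdot> (sl n y \<otimes> I A) \<cdot> (I ?E \<otimes> Braid C A A) = (sl n z \<cdot> (sl n y \<otimes> I A)) \<cdot> (I ?E \<otimes> Braid C A A)"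
      using sl[OF zn] sl[OF yn] by simp
    also have "\<dots> = Ga (lt (tree_sum (Cn n) ?D) (Cn n) (pr y z)) \<cdot> M2 (Cn n) ?D \<cdot> (I ?E \<otimes> (M2 S1 S1 \<cdot> Braid C A A))"
      unfolding two[OF zn yn] using tpr[OF yn zn] by (simp add: wl)
    also have "\<dots> = Ga (lt (tree_sum (Cn n) ?D) (Cn n) (pr y z)) \<cdot> (M2 (Cn n) ?D \<cdot> (I ?E \<otimes> Ga ?b)) \<cdot> (I ?E \<otimes> M2 S1 S1)"
      unfolding M2_braid[OF s(1,1), symmetric] using tpr[OF yn zn] by (simp add: wl)
    also have "\<dots> = sl n y \<cdot> (sl n z \<otimes> I A)"
      unfolding two[OF yn zn] b nat using tpr[OF yn zn] by simp
    finally show ?thesis by simp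
  qed
  have R2: "sl n y \<cdot> (sl n y \<otimes> I A) = sl n y \<cdot> (I ?E \<otimes> \<mu>)" if y: "y < n" for y
  proof -
    have "sl n y \<cdot> (I ?E \<otimes> \<mu>) = Ga (lt (tree_sum (Cn n) S1) (Cn n) (ins y)) \<cdot> M2 (Cn n) S1
        \<cdot> (I ?E \<otimes> Ga (lt ?D S1 (\<lambda>_. 1))) \<cdot> (I ?E \<otimes> M2 S1 S1)"
      using tmor_ins[OF y] tmor_const by (simp add: sl_def \<mu>_def wl)
    also have "\<dots> = Ga (lt (tree_sum (Cn n) ?D) (Cn n) (ins y \<circ> sum_map (\<lambda>x. x) (\<lambda>_. 1))) \<cdot> M2 (Cn n) ?D \<cdot> (I ?E \<otimes> M2 S1 S1)"
      by (rule M2_right[OF tmor_ins[OF y] tmor_const(1) s(2)]) simp_all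
    also have "lt (tree_sum (Cn n) ?D) (Cn n) (ins y \<circ> sum_map (\<lambda>x. x) (\<lambda>_. 1)) = lt (tree_sum (Cn n) ?D) (Cn n) (pr y y)"
      by (rule lt_cong) (auto simp: ins_def pr_def)
    finally show ?thesis using two[OF y y] by simp
  qed
  have R3: "sl n y \<cdot> (I ?E \<otimes> \<iota>) = I ?E" if y: "y < n" for y
  proof -
    have "sl n y \<cdot> (I ?E \<otimes> \<iota>) = Ga (lt (tree_sum (Cn n) S1) (Cn n) (ins y)) \<cdot> M2 (Cn n) S1
        \<cdot> (I ?E \<otimes> Ga (lt empty_tree S1 (\<lambda>_. 1))) \<cdot> (I ?E \<otimes> U0)"
      using tmor_ins[OF y] tmor_const by (simp add: sl_def \<iota>_def wl)
    also have "\<dots> = Ga (lt (tree_sum (Cn n) empty_tree) (Cn n) (ins y \<circ> sum_map (\<lambda>x. x) (\<lambda>_. 1))) \<cdot> M2 (Cn n) empty_tree \<cdot> (I ?E \<otimes> U0)"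
      by (rule M2_right[OF tmor_ins[OF y] tmor_const(2) s(2)]) simp_all
    also have "lt (tree_sum (Cn n) empty_tree) (Cn n) (ins y \<circ> sum_map (\<lambda>x. x) (\<lambda>_. 1)) = Om.lf (Runit Omega2 (Cn n))"
      unfolding tarr_Lunit(4)[OF s(2)] by (rule lt_cong) (auto simp: ins_def)
    finally show ?thesis using M2_unit(2)[OF s(2)] by simp
  qed
  show ?thesis unfolding CM.slot_object_def using sl R1 R2 R3 by simp
qed

lemma e0_simps [simp]: "e0 n \<in> Arr C" "Dom C (e0 n) = \<one>" "Cod C (e0 n) = Go (Cn n)"
  using tmor_empty[of "Cn n"] by (simp_all add: e0_def)

section \<open>The comparison of powers with images of trees\<close>

primrec gam :: "nat \<Rightarrow> 'a" where
  "gam 0 = U0"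
| "gam (Suc n) = M2 (Pn n) S1 \<cdot> (gam n \<otimes> I A)"

lemma gam_simps [simp]: "gam n \<in> Arr C" "Dom C (gam n) = CM.pw n" "Cod C (gam n) = Go (Pn n)"
proof -
  have "gam n \<in> Arr C \<and> Dom C (gam n) = CM.pw n \<and> Cod C (gam n) = Go (Pn n)"
    by (induction n) auto
  then show "gam n \<in> Arr C" "Dom C (gam n) = CM.pw n" "Cod C (gam n) = Go (Pn n)" by auto
qed

lemma gam_iso: "isomorphism C (gam n)"
  by (induction n) (auto simp: U0_iso M2_iso iso_TenA iso_Ident intro!: iso_Comp)

text \<open>Both sides obey the same recursion: the last tip of \<open>Pn (Suc m)\<close> is a
  summand \<open>S1\<close>, and mapping it to \<open>g (inr 1)\<close> is insertion into that
  slot.\<close>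

lemma gam_Phi:
  assumes "tmor (Pn m) (Cn n) g"
  shows "Ga (lt (Pn m) (Cn n) g) \<cdot> gam m = CM.Phi (sl n) (e0 n) (map g (tips (Pn m)))"
  using assms
proof (induction m arbitrary: g)
  case 0
  have "lt empty_tree (Cn n) g = lt empty_tree (Cn n) (\<lambda>x. x)" by (rule lt_cong) auto
  then show ?case by (simp add: e0_def)
next
  case (Suc m)
  let ?g = "\<lambda>x. g (inl x)" and ?y = "g (inr 1)"
  have g: "tmor (Pn m) (Cn n) ?g"
    by (rule tmor_Pn) (use tmorD(3)[OF Suc.prems] in auto)
  have y: "?y < n" using tmorD(3)[OF Suc.prems, of "inr 1"] by simp
  have t: "tips (Pn (Suc m)) = map inl (tips (Pn m)) @ [inr 1]" by (simp add: tips_sum)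
  have "CM.Phi (sl n) (e0 n) (map g (tips (Pn (Suc m)))) = sl n ?y \<cdot> (CM.Phi (sl n) (e0 n) (map ?g (tips (Pn m))) \<otimes> I A)"
    unfolding t by (simp add: comp_def)
  also have "\<dots> = Ga (lt (tree_sum (Cn n) S1) (Cn n) (ins ?y)) \<cdot> M2 (Cn n) S1 \<cdot> (Ga (lt (Pn m) (Cn n) ?g) \<otimes> I A) \<cdot> (gam m \<otimes> I A)"
    unfolding Suc.IH[OF g, symmetric] using g tmor_ins[OF y] by (simp add: sl_def wr)
  also have "\<dots> = Ga (lt (tree_sum (Pn m) S1) (Cn n) (ins ?y \<circ> sum_map ?g (\<lambda>x. x))) \<cdot> M2 (Pn m) S1 \<cdot> (gam m \<otimes> I A)"
    by (rule M2_left[OF tmor_ins[OF y] g S1_simps(1)]) simp_all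
  also have "lt (tree_sum (Pn m) S1) (Cn n) (ins ?y \<circ> sum_map ?g (\<lambda>x. x)) = lt (Pn (Suc m)) (Cn n) g"
    unfolding Pn.simps by (rule lt_cong) (auto simp: ins_def)
  finally show ?case by simp
qed

text \<open>The linear tree is where structure maps of \<open>G\<close> identify the image with a
  power of \<open>A\<close>; the tip bijection \<open>pt T\<close> carries this over to
  \<open>T\<close>.\<close>

definition theta :: "tree \<Rightarrow> 'a" where
  "theta T = Ga (lt (Pn (nt T)) T (pt T)) \<cdot> gam (nt T)"

lemma theta_simps [simp]:
  assumes "pruned_tree T"
  shows "theta T \<in> Arr C" "Dom C (theta T) = CM.pw (nt T)" "Cod C (theta T) = Go T"
  using tmor_pt[OF assms] by (simp_all add: theta_def)

lemma theta_iso: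
  assumes "pruned_tree T" shows "isomorphism C (theta T)"
  unfolding theta_def using tmor_pt[OF assms] lt_iso[OF tmor_pt[OF assms] bij_pt[OF assms]]
  by (intro iso_Comp gam_iso G_iso) simp_all

lemma theta_Cn:
  assumes g: "tmor T (Cn n) g"
  shows "Ga (lt T (Cn n) g) \<cdot> theta T = CM.Phi (sl n) (e0 n) (map g (tips T))"
proof -
  note T = tmorD(1)[OF g]
  note p = tmor_pt[OF T]
  have "Ga (lt T (Cn n) g) \<cdot> theta T = Ga (lt (Pn (nt T)) (Cn n) (g \<circ> pt T)) \<cdot> gam (nt T)"
    unfolding theta_def lt_Comp[OF p g, symmetric] using p g by (simp add: G_Comp)
  also have "\<dots> = CM.Phi (sl n) (e0 n) (map (g \<circ> pt T) (tips (Pn (nt T))))"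
    by (rule gam_Phi[OF tarr_Comp(1)[OF p g]])
  also have "map (g \<circ> pt T) (tips (Pn (nt T))) = map g (tips T)"
    using map_pt[OF T] by (metis map_map)
  finally show ?thesis .
qed

text \<open>After composition with the invertible image of the map to \<open>Cn ?n\<close> given by
  positions, \<open>theta T\<close> is \<open>Phi\<close> on the list \<open>[0..<?n]\<close>. This
  list is increasing, so the hypothesis of \<open>Phi_functorial\<close> is immediate, and both
  sides become \<open>Phi\<close> on the positions of the images under \<open>f\<close>.\<close>

lemma theta_nat_lt:
  assumes f: "tmor S T f"
  shows "theta T \<cdot> CM.F (lt S T f) = Ga (lt S T f) \<cdot> theta S"
proof -
  note p = tmorD(1,2)[OF f]
  let ?n = "nt T"
  let ?k = "lt T (Cn ?n) (pos T)"
  note k = tmor_Cn[OF p(2)]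
  have ki: "isomorphism C (Ga ?k)"
    by (rule G_iso[OF lt_iso[OF k]]) (use pos_bij[OF p(2)] in simp)
  let ?xs = "map (\<lambda>x. pos T (f x)) (tips S)"
  have xs: "set ?xs \<subseteq> {..<?n}" using tmorD(3)[OF f] pos_less[OF p(2)] by (auto simp: set_tips p)
  have "Ga ?k \<cdot> theta T \<cdot> CM.F (lt S T f) = (Ga ?k \<cdot> theta T) \<cdot> CM.F (lt S T f)"
    using k f p by simp
  also have "\<dots> = CM.Phi (sl ?n) (e0 ?n) [0..<?n] \<cdot> CM.Phin (length [0..<?n]) ?xs"
    unfolding theta_Cn[OF k] CM.F_lt[OF f] by (simp add: pos_tips p)
  also have "\<dots> = CM.Phi (sl ?n) (e0 ?n) (map (\<lambda>x. [0..<?n] ! x) ?xs)"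
  proof (rule CM.Phi_functorial[OF slot_object_Cn])
    fix i j z assume "i < j" "j < length ?xs" and z: "?xs ! j < z" "z \<le> ?xs ! i"
    then have "?xs ! i \<in> set ?xs" by (intro nth_mem) simp
    then have "?xs ! i < ?n" using xs by (meson lessThan_iff subsetD)
    then show "[0..<?n] ! (?xs ! j) \<le> [0..<?n] ! z" using z by simp
  qed (use xs in auto)
  also have "map (\<lambda>x. [0..<?n] ! x) ?xs = map (pos T \<circ> f) (tips S)"
    using tmorD(3)[OF f] pos_less[OF p(2)] by (simp add: set_tips p)
  also have "CM.Phi (sl ?n) (e0 ?n) (map (pos T \<circ> f) (tips S)) = Ga (lt S (Cn ?n) (pos T \<circ> f)) \<cdot> theta S"
    by (rule theta_Cn[OF tarr_Comp(1)[OF f k], symmetric])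
  also have "\<dots> = Ga ?k \<cdot> Ga (lt S T f) \<cdot> theta S"
    unfolding lt_Comp[OF f k, symmetric] using f k p by (simp add: G_Comp)
  finally have e: "Ga ?k \<cdot> theta T \<cdot> CM.F (lt S T f) = Ga ?k \<cdot> Ga (lt S T f) \<cdot> theta S" .
  show ?thesis by (rule iso_cancel_left[OF ki _ _ _ _ e]) (use f k p in simp_all)
qed

lemma theta_nat:
  assumes X: "X \<in> Arr \<L>"
  shows "theta (Target X) \<cdot> CM.F X = Ga X \<cdot> theta (Source X)"
proof -
  have E: "is_functor \<L> C \<lparr>Omap = \<lambda>T. CM.pw (nt T), Amap = CM.F\<rparr>"
    using category_axioms by (intro functorI) (auto simp: Hom_iff Om.category_L CM.F_Comp CM.F_Ident)
  show ?thesis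
  proof (rule Om.natural_L[OF E G_functor_L _ _ X])
    fix h assume "h \<in> Arr Omega2"
    then obtain S T f where "h = tarr S T f" "tmor S T f" using Arr_tarr by blast
    then show "theta (Cod Omega2 h) \<cdot> CM.F (Om.lf h) = Ga (Om.lf h) \<cdot> theta (Dom Omega2 h)"
      using theta_nat_lt by simp
  qed (simp add: Hom_iff)
qed

text \<open>\<open>Pn (m + n)\<close> is bracketed to the left and differs from the sum of the two
  linear trees; \<open>pt\<close> supplies the rebracketing. The induction on \<open>n\<close> is
  the coherence of the structure maps with unitor and associator.\<close>

lemma gam_add:
  "Ga (lt (Pn (m + n)) (tree_sum (Pn m) (Pn n)) (pt (tree_sum (Pn m) (Pn n)))) \<cdot> gam (m + n)
    = M2 (Pn m) (Pn n) \<cdot> (gam m \<otimes> gam n)"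
proof (induction n)
  case 0
  let ?S = "tree_sum (Pn m) empty_tree"
  let ?r = "Ga (lt ?S (Pn m) (cases_sum id id))" and ?p = "Ga (lt (Pn m) ?S (pt ?S))"
  have S: "pruned_tree ?S" and n: "nt ?S = m" by (simp_all add: nt_sum del: TipSet_sum)
  have t: "tmor (Pn m) ?S (pt ?S)" using tmor_pt[OF S] n by simp
  note r = tarr_Lunit(2,4)[OF pruned_Pn[of m]]
  \<comment> \<open>Both maps preserve positions, so the right unitor undoes the rebracketing; the
    two sides of the claim are compared after this invertible unitor.\<close>
  have "x \<in> TipSet (Pn m) \<Longrightarrow> cases_sum id id (pt ?S x) = x" for x
    using pt_unique[OF S, of x "inl x"] n pos_sum(1)[of "Pn m" empty_tree x] by simp
  then have "lt ?S (Pn m) (cases_sum id id) \<bullet> lt (Pn m) ?S (pt ?S) = lt (Pn m) (Pn m) (\<lambda>x. x)"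
    by (rule lt_Comp_eq[OF t r(1)])
  then have 1: "?r \<cdot> ?p = I (Go (Pn m))"
    using t r(1) by (simp add: G_id flip: G_Comp)
  have "?r \<cdot> ?p \<cdot> gam m = gam m"
    using push[OF 1, of "gam m"] t r(1) by simp
  moreover have "?r \<cdot> M2 (Pn m) empty_tree \<cdot> (gam m \<otimes> U0) = gam m"
  proof -
    have "gam m \<otimes> U0 = (I (Go (Pn m)) \<otimes> U0) \<cdot> gam m"
      using interchange[of "gam m" "I (Go (Pn m))" "I \<one>" U0] by simp
    then have "?r \<cdot> M2 (Pn m) empty_tree \<cdot> (gam m \<otimes> U0)
       = (?r \<cdot> M2 (Pn m) empty_tree \<cdot> (I (Go (Pn m)) \<otimes> U0)) \<cdot> gam m"
      using r(1) by simp
    also have "\<dots> = gam m" using M2_unit(2)[OF pruned_Pn[of m]] unfolding r(2) by simp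
    finally show ?thesis .
  qed
  ultimately have e: "?r \<cdot> ?p \<cdot> gam m
     = ?r \<cdot> M2 (Pn m) empty_tree \<cdot> (gam m \<otimes> U0)" by simp
  have i: "isomorphism C (?r)"
    by (rule G_iso[OF lt_iso[OF r(1)]]) (auto simp: bij_betw_def inj_on_def image_image)
  have "?p \<cdot> gam m = M2 (Pn m) empty_tree \<cdot> (gam m \<otimes> U0)"
    by (rule iso_cancel_left[OF i _ _ _ _ e]) (use t r(1) in simp_all)
  then show ?case by simp
next
  case (Suc n)
  let ?S = "tree_sum (Pn m) (Pn n)" and ?S' = "tree_sum (Pn m) (Pn (Suc n))" and ?T = "tree_sum (tree_sum (Pn m) (Pn n)) S1"
  let ?p = "lt (Pn (m + n)) ?S (pt ?S)" and ?p' = "lt (Pn (Suc (m + n))) ?S' (pt ?S')" let ?t = "TenA \<L> ?p (lt S1 S1 (\<lambda>x. x))"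
  have S: "pruned_tree ?S" "pruned_tree ?S'" and N: "nt ?S = m + n" "nt ?S' = Suc (m + n)"
    by (simp_all add: nt_sum del: TipSet_sum)
  have t: "tmor (Pn (m + n)) ?S (pt ?S)" "tmor (Pn (Suc (m + n))) ?S' (pt ?S')"
    using tmor_pt[OF S(1)] tmor_pt[OF S(2)] unfolding N by simp_all
  note i = tmor_id[OF S1_simps(1)] and ti = tmor_sum[OF t(1) tmor_id[OF S1_simps(1)]]
  note a = tmor_assoc[OF pruned_Pn[of m] pruned_Pn[of n] S1_simps(1)]
  \<comment> \<open>The rebracketing for \<open>Suc n\<close> is the one for \<open>n\<close>,
    extended by the last tip and followed by the associator; it is recognised by its effect on
    positions.\<close>
  have pe: "sum_assoc (sum_map (pt ?S) (\<lambda>x. x) x) = pt ?S' x" if x: "x \<in> TipSet (Pn (Suc (m + n)))" for x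
  proof (rule pt_unique[OF S(2), symmetric])
    show "x \<in> TipSet (Pn (nt ?S'))" using x unfolding N .
    have x': "x \<in> TipSet (tree_sum (Pn (m + n)) S1)" using x by simp
    have "sum_map (pt ?S) (\<lambda>x. x) x \<in> TipSet ?T" using tmorD(3)[OF ti x'] .
    from tmorD(3)[OF a this]
    show "sum_assoc (sum_map (pt ?S) (\<lambda>x. x) x) \<in> TipSet ?S'" by simp
    show "pos ?S' (sum_assoc (sum_map (pt ?S) (\<lambda>x. x) x)) = pos (Pn (nt ?S')) x"
    proof (cases "x \<in> inl ` TipSet (Pn (m + n))")
      case True
      then obtain y where y: "x = inl y" "y \<in> TipSet (Pn (m + n))" by auto
      have py: "pt ?S y \<in> TipSet ?S" "pos ?S (pt ?S y) = pos (Pn (m + n)) y"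
        using pt_simps[OF S(1), of y] y unfolding N by simp_all
      from py(1) consider u where "pt ?S y = inl u" "u \<in> TipSet (Pn m)" | u where "pt ?S y = inr u" "u \<in> TipSet (Pn n)" by auto
      then have "pos ?S' (sum_assoc (inl (pt ?S y))) = pos ?S (pt ?S y)"
        by cases (simp_all add: pos_sum)
      then show ?thesis unfolding N using y py by (simp add: pos_sum)
    next
      case False
      then have "x = inr 1" using x' by simp
      then show ?thesis unfolding N by (simp add: pos_sum nt_sum del: TipSet_sum add: TipSet_sum[of "Pn n" S1])
    qed
  qed
  have l: "Ga ?p' = Ga (Om.lf (Assoc Omega2 (Pn m) (Pn n) S1)) \<cdot> Ga ?t"
  proof -
    have "lt ?T ?S' sum_assoc \<bullet> lt (tree_sum (Pn (m + n)) S1) ?T (sum_map (pt ?S) (\<lambda>x. x)) = ?p'"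
      unfolding Pn.simps by (rule lt_Comp_eq[OF ti a]) (use pe in simp)
    then show ?thesis
      unfolding lf_Assoc[OF pruned_Pn pruned_Pn S1_simps(1)] lt_TenA[OF t(1) i] using ti a by (simp flip: G_Comp)
  qed
  have nat: "Ga ?t \<cdot> M2 (Pn (m + n)) S1
     = M2 ?S S1 \<cdot> (Ga ?p \<otimes> I A)"
    using M2_nat[of "?p" "lt S1 S1 (\<lambda>x. x)"] t i by (simp add: G_id)
  let ?a = "Ga (Om.lf (Assoc Omega2 (Pn m) (Pn n) S1))"
  have [simp]: "Om.lf (Assoc Omega2 (Pn m) (Pn n) S1) \<in> Arr \<L>"
    "Source (Om.lf (Assoc Omega2 (Pn m) (Pn n) S1)) = ?T" "Target (Om.lf (Assoc Omega2 (Pn m) (Pn n) S1)) = ?S'"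
    unfolding lf_Assoc[OF pruned_Pn pruned_Pn S1_simps(1)] using a by simp_all
  note [simp] = Om.L_TenA_Arr[OF lt_simps(1)[OF t(1)] lt_simps(1)[OF i]]
  have "Ga ?p' \<cdot> gam (Suc (m + n))
     = ?a \<cdot> (Ga ?t \<cdot> M2 (Pn (m + n)) S1) \<cdot> (gam (m + n) \<otimes> I A)"
    unfolding l using t i by simp
  also have "\<dots> = ?a \<cdot> M2 ?S S1 \<cdot> ((Ga ?p \<cdot> gam (m + n)) \<otimes> I A)"
    unfolding nat using t by (simp add: wr)
  also have "\<dots> = (?a \<cdot> M2 ?S S1 \<cdot> (M2 (Pn m) (Pn n) \<otimes> I A)) \<cdot> (gam m \<otimes> gam n \<otimes> I A)"
    unfolding Suc.IH by (simp add: wr)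
  also have "\<dots> = M2 (Pn m) (Pn (Suc n)) \<cdot> (I (Go (Pn m)) \<otimes> M2 (Pn n) S1) \<cdot> (gam m \<otimes> gam n \<otimes> I A)"
    unfolding M2_assoc[OF pruned_Pn pruned_Pn S1_simps(1)] by simp
  also have "(I (Go (Pn m)) \<otimes> M2 (Pn n) S1) \<cdot> (gam m \<otimes> gam n \<otimes> I A) = gam m \<otimes> gam (Suc n)"
    using interchange[of "gam m" "I (Go (Pn m))" "gam n \<otimes> I A" "M2 (Pn n) S1"] by simp
  finally show ?case by (simp del: gam.simps Pn.simps)
qed

text \<open>The tip bijection for the sum is the rebracketing of linear trees followed by the sum of
  both bijections, so \<open>gam_add\<close> and naturality of \<open>M2\<close> give the
  claim.\<close>

lemma theta_sum:
  assumes S: "pruned_tree S" and T: "pruned_tree T"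
  shows "theta (tree_sum S T) = M2 S T \<cdot> (theta S \<otimes> theta T)"
proof -
  let ?m = "nt S" and ?n = "nt T"
  let ?P = "tree_sum (Pn ?m) (Pn ?n)"
  let ?s = "lt (Pn ?m) S (pt S)"
  let ?t = "lt (Pn ?n) T (pt T)"
  let ?p = "lt (Pn (?m + ?n)) ?P (pt ?P)"
  have P: "pruned_tree ?P" "nt ?P = ?m + ?n" by (simp_all add: nt_sum del: TipSet_sum)
  have N: "nt (tree_sum S T) = ?m + ?n" by (rule nt_sum[OF S T])
  note t = tmor_pt[OF S] tmor_pt[OF T]
  note st = tmor_sum[OF t]
  have tP: "tmor (Pn (?m + ?n)) ?P (pt ?P)" using tmor_pt[OF P(1)] unfolding P(2) .
  have pe: "sum_map (pt S) (pt T) (pt ?P x) = pt (tree_sum S T) x" if x: "x \<in> TipSet (Pn (?m + ?n))" for x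
  proof (rule pt_unique[symmetric])
    show "pruned_tree (tree_sum S T)" using S T by simp
    show "x \<in> TipSet (Pn (nt (tree_sum S T)))" using x unfolding N .
    have y: "pt ?P x \<in> TipSet ?P" "pos ?P (pt ?P x) = pos (Pn (?m + ?n)) x"
      using pt_simps[OF P(1), of x] x unfolding P(2) by simp_all
    show "sum_map (pt S) (pt T) (pt ?P x) \<in> TipSet (tree_sum S T)" using tmorD(3)[OF st y(1)] .
    from y(1) consider u where "pt ?P x = inl u" "u \<in> TipSet (Pn ?m)" | u where "pt ?P x = inr u" "u \<in> TipSet (Pn ?n)" by auto
    then have "pos (tree_sum S T) (sum_map (pt S) (pt T) (pt ?P x)) = pos ?P (pt ?P x)"
      by cases (simp_all add: pos_sum S T pt_simps)
    then show "pos (tree_sum S T) (sum_map (pt S) (pt T) (pt ?P x)) = pos (Pn (nt (tree_sum S T))) x"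
      unfolding y(2) N .
  qed
  have "lt ?P (tree_sum S T) (sum_map (pt S) (pt T)) \<bullet> ?p = lt (Pn (?m + ?n)) (tree_sum S T) (pt (tree_sum S T))"
    by (rule lt_Comp_eq[OF tP st]) (use pe in simp)
  then have l: "Ga (lt (Pn (?m + ?n)) (tree_sum S T) (pt (tree_sum S T))) = Ga (TenA \<L> (?s) (?t)) \<cdot> Ga (?p)"
    unfolding lt_TenA[OF t] using tP st by (simp flip: G_Comp)
  have nat: "Ga (TenA \<L> (?s) (?t)) \<cdot> M2 (Pn ?m) (Pn ?n)
     = M2 S T \<cdot> (Ga (?s) \<otimes> Ga (?t))"
    using M2_nat[of "?s" "?t"] t by simp
  have "theta (tree_sum S T) = Ga (TenA \<L> (?s) (?t)) \<cdot> (Ga (?p) \<cdot> gam (?m + ?n))"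
    unfolding theta_def N l using t tP by simp
  also have "\<dots> = (Ga (TenA \<L> (?s) (?t)) \<cdot> M2 (Pn ?m) (Pn ?n)) \<cdot> (gam ?m \<otimes> gam ?n)"
    unfolding gam_add using t by simp
  also have "\<dots> = M2 S T \<cdot> (theta S \<otimes> theta T)"
    unfolding nat theta_def using t S T by (simp add: interchange)
  finally show ?thesis .
qed

lemma theta_empty: "theta empty_tree = U0"
proof -
  have "lt empty_tree empty_tree (pt empty_tree) = lt empty_tree empty_tree (\<lambda>x. x)"
    by (rule lt_cong) auto
  then show ?thesis by (simp add: theta_def G_id)
qed

lemma theta_monoidal: "is_monoidal_natural Omega2_frac C CM.free_func G (\<lambda>T\<in>Obj Omega2_frac. theta T)"
proof -
  note LA = Om.LC.Dom_in[simplified] Om.LC.Cod_in[simplified]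
  have "is_natural Omega2_frac C CM.free_func G (\<lambda>T\<in>Obj Omega2_frac. theta T)"
    unfolding is_natural_def using theta_nat LA by (auto simp: Hom_iff CM.free_func_sel)
  then show ?thesis
    unfolding is_monoidal_natural_def
    by (auto simp: CM.free_func_sel theta_sum theta_empty CM.pw_add)
qed

end

section \<open>The equivalence\<close>

context strict_braided
begin

lemma commutative_monoidD:
  "is_commutative_monoid C M \<Longrightarrow> commutative_monoid_object C (Carr M) (Mult M) (Unt M)"
  by unfold_locales (auto simp: is_commutative_monoid_def Hom_iff)

lemma (in commutative_monoid_object) commutative_monoidI:
  "is_commutative_monoid C \<lparr>Carr = A, Mult = \<mu>, Unt = \<iota>\<rparr>"
  by (simp add: is_commutative_monoid_def Hom_iff mu_assoc mu_left mu_right mu_comm)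

lemma tree_braided_functorI: "is_braided_functor Omega2_frac C G \<Longrightarrow> tree_braided_functor C G"
  by (simp add: tree_braided_functor_def tree_braided_functor_axioms_def strict_braided_axioms)

section \<open>The two categories and the evaluation functor\<close>

abbreviation "MC \<equiv> commutative_monoid_category C"
abbreviation "FC \<equiv> braided_functor_category Omega2_frac C"

lemma MC_sel [simp]: "Obj MC = {A. is_commutative_monoid C A}" "Dom MC = Source" "Cod MC = Target"
  "Ident MC A = \<lparr>Source = A, Target = A, Body = I (Carr A)\<rparr>"
  "Comp MC k h = \<lparr>Source = Source h, Target = Target k, Body = Body k \<cdot> Body h\<rparr>"
  "Arr MC = {h. is_commutative_monoid C (Source h) \<and> is_commutative_monoid C (Target h) \<and>
                is_monoid_hom C (Source h) (Target h) (Body h)}"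
  by (simp_all add: commutative_monoid_category_def)

lemma FC_sel [simp]: "Obj FC = {F. is_braided_functor Omega2_frac C F}" "Dom FC = Source" "Cod FC = Target"
  "Ident FC F = \<lparr>Source = F, Target = F, Body = (\<lambda>a\<in>Obj Omega2_frac. I (Omap F a))\<rparr>"
  "Comp FC \<psi> \<theta> = \<lparr>Source = Source \<theta>, Target = Target \<psi>,
                      Body = (\<lambda>a\<in>Obj Omega2_frac. Body \<psi> a \<cdot> Body \<theta> a)\<rparr>"
  "Arr FC = {\<theta>. is_braided_functor Omega2_frac C (Source \<theta>) \<and> is_braided_functor Omega2_frac C (Target \<theta>) \<and>
                 is_monoidal_natural Omega2_frac C (Source \<theta>) (Target \<theta>) (Body \<theta>)}"
  by (simp_all add: braided_functor_category_def)

lemma monoid_homD: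
  assumes "is_monoid_hom C M N h"
  shows "h \<in> Arr C" "Dom C h = Carr M" "Cod C h = Carr N" "h \<cdot> Mult M = Mult N \<cdot> (h \<otimes> h)" "h \<cdot> Unt M = Unt N"
  using assms by (auto simp: is_monoid_hom_def Hom_iff)

lemma category_MC: "category MC"
proof
  fix f g h a b d e
  show "f \<in> Arr MC \<Longrightarrow> Dom MC f \<in> Obj MC" "f \<in> Arr MC \<Longrightarrow> Cod MC f \<in> Obj MC" by simp_all
  show "Ident MC a \<in> Hom MC a a" if "a \<in> Obj MC"
  proof -
    interpret A: commutative_monoid_object C "Carr a" "Mult a" "Unt a" using that commutative_monoidD by simp
    show ?thesis using that by (simp add: Hom_iff is_monoid_hom_def)
  qed
  assume f: "f \<in> Hom MC a b"
  then have fA: "f \<in> Arr MC" "Source f = a" "Target f = b" by (auto simp: Hom_iff)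
  interpret A: commutative_monoid_object C "Carr a" "Mult a" "Unt a" using fA commutative_monoidD by auto
  interpret B: commutative_monoid_object C "Carr b" "Mult b" "Unt b" using fA commutative_monoidD by auto
  have fh: "is_monoid_hom C a b (Body f)" using fA by auto
  note F = monoid_homD[OF fh]
  show "Ident MC b \<cdot>\<^bsub>MC\<^esub> f = f" "f \<cdot>\<^bsub>MC\<^esub> Ident MC a = f"
    using fA F by simp_all
  assume g: "g \<in> Hom MC b d"
  then have gA: "g \<in> Arr MC" "Source g = b" "Target g = d" by (auto simp: Hom_iff)
  interpret D: commutative_monoid_object C "Carr d" "Mult d" "Unt d" using gA commutative_monoidD by auto
  have gh: "is_monoid_hom C b d (Body g)" using gA by auto
  note G = monoid_homD[OF gh]
  have "Body g \<cdot> Body f \<cdot> Mult a = (Body g \<cdot> Mult b) \<cdot> (Body f \<otimes> Body f)" using F G(1-3) by simp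
  also have "\<dots> = (Mult d \<cdot> (Body g \<otimes> Body g)) \<cdot> (Body f \<otimes> Body f)" by (simp only: G(4))
  also have "\<dots> = Mult d \<cdot> ((Body g \<cdot> Body f) \<otimes> (Body g \<cdot> Body f))" using F(1-3) G(1-3) by (simp add: interchange)
  finally have "is_monoid_hom C a d (Body g \<cdot> Body f)"
    using F(1-3,5) G(1-3,5) by (simp add: is_monoid_hom_def Hom_iff)
  then show "g \<cdot>\<^bsub>MC\<^esub> f \<in> Hom MC a d" using fA gA by (simp add: Hom_iff)
  assume h: "h \<in> Hom MC d e"
  then have hA: "Source h = d" "Target h = e" "is_monoid_hom C d e (Body h)" by (auto simp: Hom_iff)
  note H = monoid_homD[OF hA(3)]
  show "(h \<cdot>\<^bsub>MC\<^esub> g) \<cdot>\<^bsub>MC\<^esub> f = h \<cdot>\<^bsub>MC\<^esub> (g \<cdot>\<^bsub>MC\<^esub> f)"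
    using F G H fA gA hA by simp
qed

lemma monoidal_naturalD:
  assumes "is_monoidal_natural Omega2_frac C F G \<theta>"
  shows "pruned_tree T \<Longrightarrow> \<theta> T \<in> Arr C" "pruned_tree T \<Longrightarrow> Dom C (\<theta> T) = Omap F T" "pruned_tree T \<Longrightarrow> Cod C (\<theta> T) = Omap G T"
    and "X \<in> Arr \<L> \<Longrightarrow> \<theta> (Target X) \<cdot> Amap F X = Amap G X \<cdot> \<theta> (Source X)"
    and "\<theta> \<in> extensional (Obj Omega2_frac)"
    and "pruned_tree S \<Longrightarrow> pruned_tree T \<Longrightarrow> \<theta> (tree_sum S T) \<cdot> Mmap F (S, T) = Mmap G (S, T) \<cdot> (\<theta> S \<otimes> \<theta> T)"
    and "\<theta> empty_tree \<cdot> Umap F = Umap G"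
proof -
  have n: "is_natural Omega2_frac C F G \<theta>" using assms by (simp add: is_monoidal_natural_def)
  then have t: "pruned_tree T \<Longrightarrow> \<theta> T \<in> Hom C (Omap F T) (Omap G T)" for T by (simp add: is_natural_def)
  then show "pruned_tree T \<Longrightarrow> \<theta> T \<in> Arr C" "pruned_tree T \<Longrightarrow> Dom C (\<theta> T) = Omap F T" "pruned_tree T \<Longrightarrow> Cod C (\<theta> T) = Omap G T"
    by (auto simp: Hom_iff)
  assume "X \<in> Arr \<L>"
  then have "X \<in> Hom Omega2_frac (Source X) (Target X)" by (simp add: Hom_iff)
  then show "\<theta> (Target X) \<cdot> Amap F X = Amap G X \<cdot> \<theta> (Source X)" using n unfolding is_natural_def by blast
qed (use assms in \<open>simp_all add: is_monoidal_natural_def\<close>)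

lemma monoidal_naturalI:
  assumes "\<And>T. pruned_tree T \<Longrightarrow> \<theta> T \<in> Hom C (Omap F T) (Omap G T)"
    and "\<And>X. X \<in> Arr \<L> \<Longrightarrow> \<theta> (Target X) \<cdot> Amap F X = Amap G X \<cdot> \<theta> (Source X)"
    and "\<theta> \<in> extensional (Obj Omega2_frac)"
    and "\<And>S T. pruned_tree S \<Longrightarrow> pruned_tree T \<Longrightarrow> \<theta> (tree_sum S T) \<cdot> Mmap F (S, T) = Mmap G (S, T) \<cdot> (\<theta> S \<otimes> \<theta> T)"
    and "\<theta> empty_tree \<cdot> Umap F = Umap G"
  shows "is_monoidal_natural Omega2_frac C F G \<theta>"
  unfolding is_monoidal_natural_def is_natural_def using assms by (auto simp: Hom_iff)

lemma pruned_ends: "X \<in> Arr \<L> \<Longrightarrow> pruned_tree (Source X)" "X \<in> Arr \<L> \<Longrightarrow> pruned_tree (Target X)"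
  using Om.LC.Dom_in Om.LC.Cod_in by auto

lemma monoidal_natural_Ident:
  assumes "is_braided_functor Omega2_frac C F"
  shows "is_monoidal_natural Omega2_frac C F F (\<lambda>a\<in>Obj Omega2_frac. I (Omap F a))"
proof -
  interpret F: tree_braided_functor C F by (rule tree_braided_functorI[OF assms])
  show ?thesis
    by (rule monoidal_naturalI) (auto simp: Hom_iff pruned_ends)
qed

lemma monoidal_natural_Comp:
  assumes F: "is_braided_functor Omega2_frac C F" and G: "is_braided_functor Omega2_frac C G"
    and H: "is_braided_functor Omega2_frac C H"
    and t: "is_monoidal_natural Omega2_frac C F G \<theta>" and p: "is_monoidal_natural Omega2_frac C G H \<psi>"
  shows "is_monoidal_natural Omega2_frac C F H (\<lambda>a\<in>Obj Omega2_frac. \<psi> a \<cdot> \<theta> a)"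
proof -
  interpret F: tree_braided_functor C F by (rule tree_braided_functorI[OF F])
  interpret G: tree_braided_functor C G by (rule tree_braided_functorI[OF G])
  interpret H: tree_braided_functor C H by (rule tree_braided_functorI[OF H])
  note T = monoidal_naturalD[OF t] and P = monoidal_naturalD[OF p]
  note [simp] = T(1-3) P(1-3) pruned_ends
  show ?thesis
  proof (rule monoidal_naturalI)
    fix X assume X: "X \<in> Arr \<L>"
    have "\<psi> (Target X) \<cdot> \<theta> (Target X) \<cdot> Amap F X = (\<psi> (Target X) \<cdot> Amap G X) \<cdot> \<theta> (Source X)"
      unfolding T(4)[OF X] using X by simp
    then show "(\<lambda>a\<in>Obj Omega2_frac. \<psi> a \<cdot> \<theta> a) (Target X) \<cdot> Amap F X = Amap H X \<cdot> (\<lambda>a\<in>Obj Omega2_frac. \<psi> a \<cdot> \<theta> a) (Source X)"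
      unfolding P(4)[OF X] using X by simp
  next
    fix S U assume SU: "pruned_tree S" "pruned_tree U"
    have "\<psi> (tree_sum S U) \<cdot> \<theta> (tree_sum S U) \<cdot> Mmap F (S, U) = (\<psi> (tree_sum S U) \<cdot> Mmap G (S, U)) \<cdot> (\<theta> S \<otimes> \<theta> U)"
      unfolding T(6)[OF SU] using SU by simp
    then show "(\<lambda>a\<in>Obj Omega2_frac. \<psi> a \<cdot> \<theta> a) (tree_sum S U) \<cdot> Mmap F (S, U)
        = Mmap H (S, U) \<cdot> ((\<lambda>a\<in>Obj Omega2_frac. \<psi> a \<cdot> \<theta> a) S \<otimes> (\<lambda>a\<in>Obj Omega2_frac. \<psi> a \<cdot> \<theta> a) U)"
      unfolding P(6)[OF SU] using SU by (simp add: interchange)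
  qed (auto simp: Hom_iff T(7) P(7))
qed

lemma category_FC: "category FC"
proof
  fix f g h a b d e
  show "f \<in> Arr FC \<Longrightarrow> Dom FC f \<in> Obj FC" "f \<in> Arr FC \<Longrightarrow> Cod FC f \<in> Obj FC" by simp_all
  show "a \<in> Obj FC \<Longrightarrow> Ident FC a \<in> Hom FC a a"
    using monoidal_natural_Ident by (simp add: Hom_iff)
  have E: "(\<lambda>a\<in>Obj Omega2_frac. \<theta> a) = \<theta>" if "\<theta> \<in> extensional (Obj Omega2_frac)" for \<theta> :: "tree \<Rightarrow> 'a"
    using extensional_restrict[OF that] .
  assume "f \<in> Hom FC a b"
  then have f: "Source f = a" "Target f = b" "is_braided_functor Omega2_frac C a" "is_braided_functor Omega2_frac C b"
    "is_monoidal_natural Omega2_frac C a b (Body f)" by (auto simp: Hom_iff)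
  note F = monoidal_naturalD[OF f(5)]
  \<comment> \<open>The identity laws rest on extensionality: a composite is restricted to the
    objects, and an extensional transformation is equal to its restriction.\<close>
  have "(\<lambda>T\<in>Obj Omega2_frac. I (Omap b T) \<cdot> Body f T) = Body f" "(\<lambda>T\<in>Obj Omega2_frac. Body f T \<cdot> I (Omap a T)) = Body f"
    using F(1-3) by (subst (2) E[OF F(5), symmetric], intro restrict_ext, simp)+
  moreover have "restrict (Omap b) {t. pruned_tree t} = Omap b" "restrict (Omap a) {t. pruned_tree t} = Omap a"
    using f(3,4) by (simp_all add: is_braided_functor_def extensional_restrict)
  ultimately show "Ident FC b \<cdot>\<^bsub>FC\<^esub> f = f" "f \<cdot>\<^bsub>FC\<^esub> Ident FC a = f"
    using f by (simp_all cong: restrict_cong)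
  assume "g \<in> Hom FC b d"
  then have g: "Source g = b" "Target g = d" "is_braided_functor Omega2_frac C d"
    "is_monoidal_natural Omega2_frac C b d (Body g)" by (auto simp: Hom_iff)
  note G = monoidal_naturalD[OF g(4)]
  show "g \<cdot>\<^bsub>FC\<^esub> f \<in> Hom FC a d"
    using monoidal_natural_Comp[OF f(3,4) g(3) f(5) g(4)] f g by (simp add: Hom_iff)
  assume "h \<in> Hom FC d e"
  then have h: "Source h = d" "Target h = e" "is_monoidal_natural Omega2_frac C d e (Body h)" by (auto simp: Hom_iff)
  note H = monoidal_naturalD[OF h(3)]
  show "(h \<cdot>\<^bsub>FC\<^esub> g) \<cdot>\<^bsub>FC\<^esub> f = h \<cdot>\<^bsub>FC\<^esub> (g \<cdot>\<^bsub>FC\<^esub> f)"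
    using f g h F(1-3) G(1-3) H(1-3) by (auto intro!: restrict_ext)
qed

text \<open>The inverses of the components satisfy the inverted squares, so they form a monoidal
  transformation again; restriction makes it extensional.\<close>

lemma iso_FC:
  assumes F: "is_braided_functor Omega2_frac C F" and G: "is_braided_functor Omega2_frac C G"
    and t: "is_monoidal_natural Omega2_frac C F G \<theta>" and i: "\<And>T. pruned_tree T \<Longrightarrow> isomorphism C (\<theta> T)"
  defines "\<phi> \<equiv> \<lambda>T\<in>Obj Omega2_frac. inv_arr C (\<theta> T)"
  shows "inverse_arrows FC \<lparr>Source = F, Target = G, Body = \<theta>\<rparr> \<lparr>Source = G, Target = F, Body = \<phi>\<rparr>"
proof -
  interpret F: tree_braided_functor C F by (rule tree_braided_functorI[OF F])
  interpret G: tree_braided_functor C G by (rule tree_braided_functorI[OF G])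
  note T = monoidal_naturalD[OF t]
  note [simp] = T(1-3) pruned_ends i
  have p: "is_monoidal_natural Omega2_frac C G F \<phi>"
  proof (rule monoidal_naturalI)
    fix X assume X: "X \<in> Arr \<L>"
    have "Amap F X \<cdot> inv_arr C (\<theta> (Source X)) = inv_arr C (\<theta> (Target X)) \<cdot> (\<theta> (Target X) \<cdot> Amap F X) \<cdot> inv_arr C (\<theta> (Source X))"
      using X by simp
    also have "\<dots> = inv_arr C (\<theta> (Target X)) \<cdot> Amap G X" unfolding T(4)[OF X] using X by simp
    finally show "\<phi> (Target X) \<cdot> Amap G X = Amap F X \<cdot> \<phi> (Source X)" using X by (simp add: \<phi>_def)
  next
    fix S U assume SU: "pruned_tree S" "pruned_tree U"
    have "Mmap F (S, U) \<cdot> (inv_arr C (\<theta> S) \<otimes> inv_arr C (\<theta> U))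
       = inv_arr C (\<theta> (tree_sum S U)) \<cdot> (\<theta> (tree_sum S U) \<cdot> Mmap F (S, U)) \<cdot> (inv_arr C (\<theta> S) \<otimes> inv_arr C (\<theta> U))"
      using SU by simp
    also have "\<dots> = inv_arr C (\<theta> (tree_sum S U)) \<cdot> Mmap G (S, U)"
      unfolding T(6)[OF SU] using SU by (simp add: interchange)
    finally show "\<phi> (tree_sum S U) \<cdot> Mmap G (S, U) = Mmap F (S, U) \<cdot> (\<phi> S \<otimes> \<phi> U)"
      using SU by (simp add: \<phi>_def)
  next
    show "\<phi> empty_tree \<cdot> Umap G = Umap F" unfolding T(7)[symmetric] by (simp add: \<phi>_def)
  qed (auto simp: \<phi>_def Hom_iff)
  then show ?thesis
    using F G t unfolding inverse_arrows_def Hom_iff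
    by (auto simp: \<phi>_def intro!: restrict_ext)
qed

text \<open>The component at \<open>S1\<close> is a homomorphism because the transformation is
  natural at the multiplication and the unit of \<open>S1\<close> and compatible with the structure
  maps.\<close>

lemma evaluation_functor: "is_functor FC MC (evaluation C S1_monoid)"
proof (rule functorI)
  show "category FC" "category MC" by (rule category_FC category_MC)+
  show ob: "Omap (evaluation C S1_monoid) F \<in> Obj MC" if "F \<in> Obj FC" for F
  proof -
    interpret F: tree_braided_functor C F by (rule tree_braided_functorI) (use that in simp)
    show ?thesis using F.CM.commutative_monoidI by (simp add: evaluation_def F.image_S1_monoid)
  qed
  fix \<theta> assume "\<theta> \<in> Arr FC"
  then have t: "is_braided_functor Omega2_frac C (Source \<theta>)" "is_braided_functor Omega2_frac C (Target \<theta>)"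
    "is_monoidal_natural Omega2_frac C (Source \<theta>) (Target \<theta>) (Body \<theta>)" by auto
  interpret F: tree_braided_functor C "Source \<theta>" by (rule tree_braided_functorI[OF t(1)])
  interpret G: tree_braided_functor C "Target \<theta>" by (rule tree_braided_functorI[OF t(2)])
  note T = monoidal_naturalD[OF t(3)]
  let ?h = "Body \<theta> S1"
  note k = F.tmor_const
  have n: "?h \<cdot> Amap (Source \<theta>) (lt (tree_sum S1 S1) S1 (\<lambda>_. 1)) = Amap (Target \<theta>) (lt (tree_sum S1 S1) S1 (\<lambda>_. 1)) \<cdot> Body \<theta> (tree_sum S1 S1)"
    "?h \<cdot> Amap (Source \<theta>) (lt empty_tree S1 (\<lambda>_. 1)) = Amap (Target \<theta>) (lt empty_tree S1 (\<lambda>_. 1)) \<cdot> Body \<theta> empty_tree"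
    using T(4)[OF lt_simps(1)[OF k(1)]] T(4)[OF lt_simps(1)[OF k(2)]] k by simp_all
  note [simp] = T(1-3) k k[unfolded One_nat_def]
  have "?h \<cdot> F.\<mu> = (?h \<cdot> Amap (Source \<theta>) (lt (tree_sum S1 S1) S1 (\<lambda>_. 1))) \<cdot> Mmap (Source \<theta>) (S1, S1)"
    by (simp add: F.\<mu>_def)
  also have "\<dots> = Amap (Target \<theta>) (lt (tree_sum S1 S1) S1 (\<lambda>_. 1)) \<cdot> (Body \<theta> (tree_sum S1 S1) \<cdot> Mmap (Source \<theta>) (S1, S1))"
    unfolding n by simp
  also have "\<dots> = G.\<mu> \<cdot> (?h \<otimes> ?h)" unfolding T(6)[OF S1_simps(1,1)] by (simp add: G.\<mu>_def)
  finally have m: "?h \<cdot> F.\<mu> = G.\<mu> \<cdot> (?h \<otimes> ?h)" .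
  have "?h \<cdot> F.\<iota> = (?h \<cdot> Amap (Source \<theta>) (lt empty_tree S1 (\<lambda>_. 1))) \<cdot> Umap (Source \<theta>)"
    by (simp add: F.\<iota>_def)
  also have "\<dots> = Amap (Target \<theta>) (lt empty_tree S1 (\<lambda>_. 1)) \<cdot> (Body \<theta> empty_tree \<cdot> Umap (Source \<theta>))"
    unfolding n by simp
  also have "\<dots> = G.\<iota>" unfolding T(7) by (simp add: G.\<iota>_def)
  finally have u: "?h \<cdot> F.\<iota> = G.\<iota>" .
  show "Amap (evaluation C S1_monoid) \<theta> \<in> Hom MC (Omap (evaluation C S1_monoid) (Dom FC \<theta>)) (Omap (evaluation C S1_monoid) (Cod FC \<theta>))"
    using F.CM.commutative_monoidI G.CM.commutative_monoidI m u
    by (simp add: evaluation_def Hom_iff is_monoid_hom_def F.image_S1_monoid G.image_S1_monoid)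
qed (auto simp: evaluation_def image_monoid_def)

primrec hpow :: "'a \<Rightarrow> nat \<Rightarrow> 'a" where
  "hpow h 0 = I \<one>"
| "hpow h (Suc n) = hpow h n \<otimes> h"

end

section \<open>Functoriality in the commutative monoid\<close>

locale commutative_monoid_hom =
  X: commutative_monoid_object C A \<mu> \<iota> + Y: commutative_monoid_object C A' \<mu>' \<iota>'
  for C :: "('o, 'a, 'z) brcat_scheme" (structure) and A \<mu> \<iota> A' \<mu>' \<iota>' +
  fixes h :: 'a
  assumes h_in [simp]: "h \<in> Arr C" "Dom C h = A" "Cod C h = A'"
    and h_mult: "h \<cdot> \<mu> = \<mu>' \<cdot> (h \<otimes> h)" and h_unit: "h \<cdot> \<iota> = \<iota>'"
begin

abbreviation "hp \<equiv> X.hpow h"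

lemma hp_simps [simp]: "hp n \<in> Arr C" "Dom C (hp n) = X.pw n" "Cod C (hp n) = Y.pw n"
proof -
  have "hp n \<in> Arr C \<and> Dom C (hp n) = X.pw n \<and> Cod C (hp n) = Y.pw n" by (induction n) auto
  then show "hp n \<in> Arr C" "Dom C (hp n) = X.pw n" "Cod C (hp n) = Y.pw n" by auto
qed

lemma hp_add: "hp (m + n) = hp m \<otimes> hp n"
  by (induction n) auto

lemma hp_eps: "hp n \<cdot> X.eps n = Y.eps n"
  by (induction n) (auto simp: X.interchange h_unit)

text \<open>Powers of \<open>h\<close> pass the crossings by naturality of the braiding, and the
  final multiplication because \<open>h\<close> preserves it.\<close>

lemma hp_slot: "y < n \<Longrightarrow> hp n \<cdot> X.slot n y = Y.slot n y \<cdot> (hp n \<otimes> h)"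
proof (induction n)
  case (Suc n)
  show ?case
  proof (cases "y < n")
    case True
    have "hp (Suc n) \<cdot> X.slot (Suc n) y = ((hp n \<otimes> h) \<cdot> (X.slot n y \<otimes> X.I A)) \<cdot> (X.I (X.pw n) \<otimes> X.c)"
      using True by simp
    also have "(hp n \<otimes> h) \<cdot> (X.slot n y \<otimes> X.I A) = (Y.slot n y \<cdot> (hp n \<otimes> h)) \<otimes> h"
      using True Suc by (simp add: X.interchange)
    also have "\<dots> = (Y.slot n y \<otimes> X.I A') \<cdot> (hp n \<otimes> h \<otimes> h)"
      using True X.interchange[of "hp n \<otimes> h" "Y.slot n y" h "X.I A'"] by simp
    also have "((Y.slot n y \<otimes> X.I A') \<cdot> (hp n \<otimes> h \<otimes> h)) \<cdot> (X.I (X.pw n) \<otimes> X.c)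
       = (Y.slot n y \<otimes> X.I A') \<cdot> (hp n \<otimes> ((h \<otimes> h) \<cdot> X.c))"
      using True X.interchange[of "X.I (X.pw n)" "hp n" X.c "h \<otimes> h"] by simp
    also have "(h \<otimes> h) \<cdot> X.c = Y.c \<cdot> (h \<otimes> h)"
      using X.Braid_natural[of h h] by simp
    also have "(Y.slot n y \<otimes> X.I A') \<cdot> (hp n \<otimes> (Y.c \<cdot> (h \<otimes> h))) = (Y.slot n y \<otimes> X.I A') \<cdot> (X.I (Y.pw n) \<otimes> Y.c) \<cdot> (hp n \<otimes> h \<otimes> h)"
      using True X.interchange[of "hp n" "X.I (Y.pw n)" "h \<otimes> h" Y.c] by simp
    finally show ?thesis using True by simp
  next
    case False
    then show ?thesis using Suc.prems X.interchange[of "X.I (X.pw n)" "hp n" \<mu> h] X.interchange[of "hp n" "X.I (Y.pw n)" "h \<otimes> h" \<mu>']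
      by (simp add: h_mult)
  qed
qed simp

lemma hp_Phin: "set xs \<subseteq> {..<n} \<Longrightarrow> hp n \<cdot> X.Phin n xs = Y.Phin n xs \<cdot> hp (length xs)"
proof (induction xs rule: rev_induct)
  case Nil then show ?case by (simp add: hp_eps)
next
  case (snoc y xs)
  then have y: "y < n" and xs: "set xs \<subseteq> {..<n}" by auto
  have "hp n \<cdot> X.Phin n (xs @ [y]) = (hp n \<cdot> X.slot n y) \<cdot> (X.Phin n xs \<otimes> X.I A)"
    using y xs by simp
  also have "\<dots> = Y.slot n y \<cdot> ((hp n \<cdot> X.Phin n xs) \<otimes> h)"
    unfolding hp_slot[OF y] using y xs by (simp add: X.interchange)
  also have "\<dots> = Y.slot n y \<cdot> (Y.Phin n xs \<otimes> X.I A') \<cdot> (hp (length xs) \<otimes> h)"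
    unfolding snoc.IH[OF xs] using xs y by (simp add: X.interchange)
  finally show ?case using y xs by simp
qed

lemma hp_nat:
  assumes V: "V \<in> Arr \<L>" shows "hp (nt (Target V)) \<cdot> X.F V = Y.F V \<cdot> hp (nt (Source V))"
proof -
  have E: "is_functor \<L> C \<lparr>Omap = \<lambda>T. X.pw (nt T), Amap = X.F\<rparr>" "is_functor \<L> C \<lparr>Omap = \<lambda>T. Y.pw (nt T), Amap = Y.F\<rparr>"
    using X.category_axioms
    by (intro functorI; auto simp: Hom_iff Om.category_L X.F_Comp X.F_Ident Y.F_Comp Y.F_Ident)+
  show ?thesis
  proof (rule Om.natural_L[OF E _ _ V])
    fix k assume "k \<in> Arr Omega2"
    then obtain S T f where k: "k = tarr S T f" "tmor S T f" using Arr_tarr by blast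
    have "set (map (\<lambda>x. pos T (f x)) (tips S)) \<subseteq> {..<nt T}"
      using tmorD[OF k(2)] pos_less by (auto simp: set_tips)
    from hp_Phin[OF this] show "hp (nt (Cod Omega2 k)) \<cdot> X.F (Om.lf k) = Y.F (Om.lf k) \<cdot> hp (nt (Dom Omega2 k))"
      using k by (simp add: X.F_lt Y.F_lt)
  qed (simp add: Hom_iff)
qed

lemma hp_monoidal:
  "is_monoidal_natural Omega2_frac C X.free_func Y.free_func (\<lambda>T\<in>Obj Omega2_frac. hp (nt T))"
  by (rule X.monoidal_naturalI)
     (auto simp: Hom_iff X.free_func_sel Y.free_func_sel X.pruned_ends hp_nat nt_sum hp_add X.pw_add Y.pw_add simp del: TipSet_sum)

end

context strict_braided
begin

lemma commutative_monoid_homI: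
  assumes "is_commutative_monoid C M" "is_commutative_monoid C N" "is_monoid_hom C M N h"
  shows "commutative_monoid_hom C (Carr M) (Mult M) (Unt M) (Carr N) (Mult N) (Unt N) h"
  using commutative_monoidD[OF assms(1)] commutative_monoidD[OF assms(2)] monoid_homD[OF assms(3)]
  by (simp add: commutative_monoid_hom_def commutative_monoid_hom_axioms_def)

section \<open>The quasi-inverse of evaluation\<close>

definition free :: "('o, 'a) monoid_data \<Rightarrow> (tree, (tree, tree_arrow) fraction, 'o, 'a) mfunc" where
  "free M = commutative_monoid_object.free_func C (Carr M) (Mult M) (Unt M)"

lemma free_braided: "is_commutative_monoid C M \<Longrightarrow> is_braided_functor Omega2_frac C (free M)"
  unfolding free_def by (rule commutative_monoid_object.free_func_braided[OF commutative_monoidD])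

definition free_functor ::
  "(('o, 'a) monoid_data, (('o, 'a) monoid_data, 'a) arrow,
    (tree, (tree, tree_arrow) fraction, 'o, 'a) mfunc,
    ((tree, (tree, tree_arrow) fraction, 'o, 'a) mfunc, tree \<Rightarrow> 'a) arrow) func" where
  "free_functor = \<lparr>Omap = free,
     Amap = (\<lambda>h. \<lparr>Source = free (Source h), Target = free (Target h),
                  Body = (\<lambda>T\<in>Obj Omega2_frac. hpow (Body h) (nt T))\<rparr>)\<rparr>"


lemma free_functor: "is_functor MC FC free_functor"
proof (rule functorI)
  show "category MC" "category FC" by (rule category_MC category_FC)+
  show "Omap free_functor M \<in> Obj FC" if "M \<in> Obj MC" for M
    using that free_braided by (simp add: free_functor_def)
  show "Amap free_functor h \<in> Hom FC (Omap free_functor (Dom MC h)) (Omap free_functor (Cod MC h))" if "h \<in> Arr MC" for h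
  proof -
    have h: "is_commutative_monoid C (Source h)" "is_commutative_monoid C (Target h)" "is_monoid_hom C (Source h) (Target h) (Body h)"
      using that by auto
    show ?thesis using commutative_monoid_hom.hp_monoidal[OF commutative_monoid_homI[OF h]] free_braided h
      by (simp add: free_functor_def Hom_iff free_def)
  qed
  show "Amap free_functor (Ident MC M) = Ident FC (Omap free_functor M)" if "M \<in> Obj MC" for M
  proof -
    interpret A: commutative_monoid_object C "Carr M" "Mult M" "Unt M" using that commutative_monoidD by simp
    have "hpow (I (Carr M)) n = I (A.pw n)" for n by (induction n) auto
    then show ?thesis by (auto simp: free_functor_def free_def A.free_func_sel intro!: restrict_ext)
  qed
  fix f g assume "f \<in> Arr MC" "g \<in> Arr MC" "Dom MC g = Cod MC f"
  then have f: "is_commutative_monoid C (Source f)" "is_commutative_monoid C (Target f)" "is_monoid_hom C (Source f) (Target f) (Body f)"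
    and g: "is_commutative_monoid C (Target f)" "is_commutative_monoid C (Target g)" "is_monoid_hom C (Target f) (Target g) (Body g)"
    and fg: "Source g = Target f" by auto
  interpret f: commutative_monoid_hom C "Carr (Source f)" "Mult (Source f)" "Unt (Source f)" "Carr (Target f)" "Mult (Target f)" "Unt (Target f)" "Body f"
    by (rule commutative_monoid_homI[OF f])
  interpret g: commutative_monoid_hom C "Carr (Target f)" "Mult (Target f)" "Unt (Target f)" "Carr (Target g)" "Mult (Target g)" "Unt (Target g)" "Body g"
    by (rule commutative_monoid_homI[OF g])
  have "hpow (Body g \<cdot> Body f) n = hpow (Body g) n \<cdot> hpow (Body f) n" for n
    by (induction n) (auto simp: interchange)
  then show "Amap free_functor (g \<cdot>\<^bsub>MC\<^esub> f) = Amap free_functor g \<cdot>\<^bsub>FC\<^esub> Amap free_functor f"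
    by (auto simp: free_functor_def intro!: restrict_ext)
qed

text \<open>By strictness \<open>pw 1\<close> is the carrier itself. The multiplication of
  \<open>S1\<close> has the list \<open>[0, 0]\<close>, which yields \<open>Mult M\<close> after the
  first factor meets the unit, and the unit has the empty list, which yields \<open>Unt M\<close>.
  The monoid is thus recovered as an equal, not just isomorphic, object.\<close>

lemma evaluation_free:
  assumes "is_commutative_monoid C M" shows "image_monoid C S1_monoid (free M) = M"
proof -
  interpret A: commutative_monoid_object C "Carr M" "Mult M" "Unt M" using assms commutative_monoidD by simp
  have t: "tmor (tree_sum S1 S1) S1 (\<lambda>_. 1)" "tmor empty_tree S1 (\<lambda>_. 1)"
    by (auto intro!: tmor_S1)
  have "pos S1 1 < nt S1" by (rule pos_less) simp_all
  then have p: "pos S1 1 = 0" by simp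
  have "A.F (lt (tree_sum S1 S1) S1 (\<lambda>_. 1)) = A.Phin 1 ([0] @ [0])"
    unfolding A.F_lt[OF t(1)] using p by (simp add: tips_sum)
  also have "\<dots> = Mult M"
    using A.Phin_id[of 1] unfolding A.Phin_snoc by simp
  finally have m: "A.F (lt (tree_sum S1 S1) S1 (\<lambda>_. 1)) = Mult M" .
  have u: "A.F (lt empty_tree S1 (\<lambda>_. 1)) = Unt M"
    unfolding A.F_lt[OF t(2)] by simp
  show ?thesis
    using m u t by (simp add: image_monoid_def free_def A.free_func_sel)
qed

theorem evaluation_equivalence: "is_equivalence FC MC (evaluation C S1_monoid)"
proof -
  let ?E = "evaluation C S1_monoid"
  \<comment> \<open>The comparison \<open>theta\<close> runs from the free functor to
    \<open>F\<close>, so the unit of the equivalence is made of its inverses.\<close>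
  define \<eta> where "\<eta> F = \<lparr>Source = F, Target = free (image_monoid C S1_monoid F),
     Body = (\<lambda>T\<in>Obj Omega2_frac. inv_arr C (tree_braided_functor.theta C F T))\<rparr>" for F
  have frim: "free (image_monoid C S1_monoid F) = commutative_monoid_object.free_func C (Omap F S1) (tree_braided_functor.\<mu> C F) (tree_braided_functor.\<iota> C F)"
    if "is_braided_functor Omega2_frac C F" for F
    using tree_braided_functor.image_S1_monoid[OF tree_braided_functorI[OF that]] by (simp add: free_def)
  have iso: "inverse_arrows FC \<lparr>Source = free (image_monoid C S1_monoid F), Target = F,
      Body = (\<lambda>T\<in>Obj Omega2_frac. tree_braided_functor.theta C F T)\<rparr> (\<eta> F)"
    if F: "is_braided_functor Omega2_frac C F" for F
  proof -
    interpret F: tree_braided_functor C F by (rule tree_braided_functorI[OF F])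
    have "(\<lambda>T\<in>Obj Omega2_frac. inv_arr C ((\<lambda>T\<in>Obj Omega2_frac. F.theta T) T)) = (\<lambda>T\<in>Obj Omega2_frac. inv_arr C (F.theta T))"
      by (rule restrict_ext) simp
    then show ?thesis unfolding \<eta>_def frim[OF F]
      using iso_FC[OF F.CM.free_func_braided F F.theta_monoidal] F.theta_iso by simp
  qed
  have FCc: "category FC" by (rule category_FC)
  have i\<eta>: "isomorphism FC (\<eta> F)" if "is_braided_functor Omega2_frac C F" for F
    using category.inverse_arrows_sym[OF FCc iso[OF that]] unfolding isomorphism_def by blast
  have A\<eta>: "\<eta> F \<in> Arr FC" if "is_braided_functor Omega2_frac C F" for F
    using category.iso_arr[OF FCc i\<eta>[OF that]] .
  have nat: "\<eta> G \<cdot>\<^bsub>FC\<^esub> \<alpha> = Amap (comp_func free_functor ?E) \<alpha> \<cdot>\<^bsub>FC\<^esub> \<eta> F" if "\<alpha> \<in> Hom FC F G" for F G \<alpha>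
  proof -
    have a: "Source \<alpha> = F" "Target \<alpha> = G" "is_braided_functor Omega2_frac C F" "is_braided_functor Omega2_frac C G"
      "is_monoidal_natural Omega2_frac C F G (Body \<alpha>)" using that by (auto simp: Hom_iff)
    interpret F: tree_braided_functor C F by (rule tree_braided_functorI[OF a(3)])
    interpret G: tree_braided_functor C G by (rule tree_braided_functorI[OF a(4)])
    note N = monoidal_naturalD[OF a(5)]
    let ?h = "Body \<alpha> S1"
    note [simp] = N(1-3)
    have hp: "hpow ?h n \<in> Arr C" "Dom C (hpow ?h n) = F.CM.pw n" "Cod C (hpow ?h n) = G.CM.pw n" for n
      by (induction n) auto
    \<comment> \<open>On powers of \<open>S1\<close> a monoidal transformation is determined by its
      component at \<open>S1\<close>; induction along the structure maps identifies it with
      \<open>hpow ?h n\<close>.\<close>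
    have gam: "Body \<alpha> (Pn n) \<cdot> F.gam n = G.gam n \<cdot> hpow ?h n" for n
    proof (induction n)
      case 0 then show ?case using N(7) by simp
    next
      case (Suc n)
      have "Body \<alpha> (Pn (Suc n)) \<cdot> F.gam (Suc n) = (Body \<alpha> (tree_sum (Pn n) S1) \<cdot> Mmap F (Pn n, S1)) \<cdot> (F.gam n \<otimes> I (Omap F S1))"
        by simp
      also have "\<dots> = Mmap G (Pn n, S1) \<cdot> ((Body \<alpha> (Pn n) \<cdot> F.gam n) \<otimes> ?h)"
        unfolding N(6)[OF pruned_Pn S1_simps(1)] by (simp add: interchange)
      also have "\<dots> = G.gam (Suc n) \<cdot> hpow ?h (Suc n)"
        unfolding Suc using hp[of n] by (simp add: interchange)
      finally show ?case .
    qed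
    \<comment> \<open>Naturality at \<open>pt T\<close> carries the identification from linear trees
      to all trees.\<close>
    have th: "Body \<alpha> T \<cdot> F.theta T = G.theta T \<cdot> hpow ?h (nt T)" if T: "pruned_tree T" for T
    proof -
      let ?p = "lt (Pn (nt T)) T (pt T)"
      note t = tmor_pt[OF T]
      have "Body \<alpha> T \<cdot> F.theta T = (Body \<alpha> T \<cdot> Amap F ?p) \<cdot> F.gam (nt T)"
        unfolding F.theta_def using t T by simp
      also have "\<dots> = Amap G ?p \<cdot> (Body \<alpha> (Pn (nt T)) \<cdot> F.gam (nt T))"
        using N(4)[OF lt_simps(1)[OF t]] t T by simp
      also have "\<dots> = G.theta T \<cdot> hpow ?h (nt T)"
        unfolding gam G.theta_def using t T hp by simp
      finally show ?thesis .
    qed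
    have "inv_arr C (G.theta T) \<cdot> Body \<alpha> T = hpow ?h (nt T) \<cdot> inv_arr C (F.theta T)" if T: "pruned_tree T" for T
    proof -
      note [simp] = F.theta_iso[OF T] G.theta_iso[OF T] hp T
      have "hpow ?h (nt T) \<cdot> inv_arr C (F.theta T) = inv_arr C (G.theta T) \<cdot> (G.theta T \<cdot> hpow ?h (nt T)) \<cdot> inv_arr C (F.theta T)"
        by simp
      also have "\<dots> = inv_arr C (G.theta T) \<cdot> Body \<alpha> T"
        unfolding th[OF T, symmetric] by simp
      finally show ?thesis by simp
    qed
    then show ?thesis
      using a by (auto simp: \<eta>_def comp_func_def free_functor_def evaluation_def intro!: restrict_ext)
  qed
  have "is_natural_iso FC FC id_func (comp_func free_functor ?E) \<eta>"
    unfolding is_natural_iso_def is_natural_def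
  proof (intro conjI ballI allI)
    fix F assume "F \<in> Obj FC"
    then have F: "is_braided_functor Omega2_frac C F" by simp
    show "isomorphism FC (\<eta> F)" by (rule i\<eta>[OF F])
    show "\<eta> F \<in> Hom FC (Omap id_func F) (Omap (comp_func free_functor ?E) F)"
      using A\<eta>[OF F] by (simp add: Hom_iff \<eta>_def id_func_def comp_func_def free_functor_def evaluation_def del: FC_sel(6))
  next
    fix F G \<alpha> assume "\<alpha> \<in> Hom FC F G"
    then show "\<eta> G \<cdot>\<^bsub>FC\<^esub> Amap id_func \<alpha> = Amap (comp_func free_functor ?E) \<alpha> \<cdot>\<^bsub>FC\<^esub> \<eta> F"
      using nat by (simp add: id_func_def del: FC_sel)
  qed
  moreover have "is_natural_iso MC MC (comp_func ?E free_functor) id_func (Ident MC)"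
    unfolding is_natural_iso_def is_natural_def
  proof (intro conjI ballI allI)
    interpret MC: category MC by (rule category_MC)
    fix M assume M: "M \<in> Obj MC"
    show "isomorphism MC (Ident MC M)" by (rule MC.iso_Ident[OF M])
    have "Omap (comp_func ?E free_functor) M = M" using M evaluation_free by (simp add: comp_func_def free_functor_def evaluation_def)
    then show "Ident MC M \<in> Hom MC (Omap (comp_func ?E free_functor) M) (Omap id_func M)"
      using MC.Ident_in[OF M] by (simp add: id_func_def del: MC_sel)
  next
    interpret MC: category MC by (rule category_MC)
    fix M N h assume h: "h \<in> Hom MC M N"
    then have hA: "Source h = M" "Target h = N" "is_commutative_monoid C M" "is_commutative_monoid C N" "is_monoid_hom C M N (Body h)"
      by (auto simp: Hom_iff)
    \<comment> \<open>\<open>S1\<close> has one tip, so the component at \<open>S1\<close> of the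
      induced transformation is \<open>h\<close> again. With \<open>evaluation_free\<close> this
      makes the composite on monoids the identity, and identities serve as counit.\<close>
    have "hpow (Body h) 1 = Body h" using monoid_homD[OF hA(5)] by simp
    then have "Amap (comp_func ?E free_functor) h = h"
      using hA evaluation_free by (simp add: comp_func_def free_functor_def evaluation_def)
    then show "Ident MC N \<cdot>\<^bsub>MC\<^esub> Amap (comp_func ?E free_functor) h = Amap id_func h \<cdot>\<^bsub>MC\<^esub> Ident MC M"
      using MC.Ident_left[OF h] MC.Ident_right[OF h] by (simp add: id_func_def del: MC_sel)
  qed
  ultimately show ?thesis
    unfolding is_equivalence_def using evaluation_functor free_functor by blast
qed

end

theorem theorem5p0p14:
  shows "braided_monoidal_category Omega2_frac \<and>
    is_commutative_monoid Omega2_frac S1_monoid \<and>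
    (\<forall>C :: ('o, 'a) brcat. braided_monoidal_category C \<and> strict_monoidal_category C \<longrightarrow>
       is_equivalence (braided_functor_category Omega2_frac C) (commutative_monoid_category C)
         (evaluation C S1_monoid))"
proof (intro conjI allI impI)
  show "braided_monoidal_category Omega2_frac" by (rule braided_Omega2_frac)
  show "is_commutative_monoid Omega2_frac S1_monoid" by (rule commutative_S1_monoid)
  fix C :: "('o, 'a) brcat"
  assume "braided_monoidal_category C \<and> strict_monoidal_category C"
  then have "strict_braided C" by (simp add: strict_braided_def)
  then show "is_equivalence (braided_functor_category Omega2_frac C) (commutative_monoid_category C) (evaluation C S1_monoid)"
    by (rule strict_braided.evaluation_equivalence)
qed

end
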